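(* Let $\omega>0$, suppose $V\in L^1((0,\omega);dx)$ (complex-valued), let $\theta\in[0,2\pi)$, and $z\in\mathbb{C}\setminus\operatorname{spec}(H^{(0)}_\theta)$. Then, with $K_\theta(z)$ and the Floquet discriminant $\Delta(z)$ as defined in the context, $K_\theta(z)$ is a trace class operator in $L^2((0,\omega);dx)$ and $$\det(I-K_\theta(z))=\frac{\Delta(z)-\cos(\theta)}{\cos(z^{1/2}\omega)-\cos(\theta)}.$$
   Context: $H^{(0)}_\theta$ is the self-adjoint operator $H^{(0)}_\theta f=-f''$ in $L^2((0,\omega);dx)$ with domain $\{g\in L^2((0,\omega);dx): g,g'\in AC([0,\omega]),\ g(\omega)=e^{i\theta}g(0),\ g'(\omega)=e^{i\theta}g'(0),\ g''\in L^2((0,\omega);dx)\}$; $\operatorname{spec}$ denotes the spectrum. Let $G^{(0)}_\theta(z,x,x')$ be the integral kernel (Green's function) of $(H^{(0)}_\theta-z)^{-1}$; for $z\neq0$ it equals $$\frac{i}{2z^{1/2}}\bigg[e^{iz^{1/2}|x-x'|}+\frac{e^{iz^{1/2}(x-x')}}{e^{i\theta}e^{-iz^{1/2}\omega}-1}+\frac{e^{-iz^{1/2}(x-x')}}{e^{-i\theta}e^{-iz^{1/2}\omega}-1}\bigg].$$ Factor $V=uv$ with $v(x)=|V(x)|^{1/2}$, $u(x)=|V(x)|^{1/2}\exp(i\arg(V(x)))$. Then $K_\theta(z)=-\overline{u(H^{(0)}_\theta-z)^{-1}v}$ (closure), i.e., the integral operator in $L^2((0,\omega);dx)$ with kernel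 $-u(x)G^{(0)}_\theta(z,x,x')v(x')$. $\det(I-K_\theta(z))$ is the Fredholm determinant. Let $c(z,\cdot)$, $s(z,\cdot)$ be the solutions of $-\psi''+V\psi=z\psi$ on $[0,\omega]$ with $c(z,0)=1=s'(z,0)$, $c'(z,0)=0=s(z,0)$. The Floquet discriminant is $\Delta(z)=[c(z,\omega)+s'(z,\omega)]/2$. *)

theory Defs
  imports "HOL-Analysis.Analysis"
begin

section \<open>Operators in $L^2$\<close>

text \<open>
  Elements of $L^2(M)$ are represented by functions, and equality is equality almost everywhere.
  An operator, possibly unbounded, is represented by its graph, a set of pairs of square integrable
  functions.  Accordingly the composition ``first \<open>A\<close>, then \<open>B\<close>'' is the relation composition
  \<open>A O B\<close>, and the inverse is the converse relation.
\<close>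

type_synonym 'a graph = "(('a \<Rightarrow> complex) \<times> ('a \<Rightarrow> complex)) set"

definition L2 :: "'a measure \<Rightarrow> ('a \<Rightarrow> complex) set" where
  "L2 M = {f. f \<in> borel_measurable M \<and> integrable M (\<lambda>x. (cmod (f x))\<^sup>2)}"

definition l2_inner :: "'a measure \<Rightarrow> ('a \<Rightarrow> complex) \<Rightarrow> ('a \<Rightarrow> complex) \<Rightarrow> complex" where
  "l2_inner M f g = (LINT x|M. cnj (f x) * g x)"

definition l2_norm :: "'a measure \<Rightarrow> ('a \<Rightarrow> complex) \<Rightarrow> real" where
  "l2_norm M f = sqrt (LINT x|M. (cmod (f x))\<^sup>2)"

definition orthonormal_basis :: "'a measure \<Rightarrow> ('a \<Rightarrow> complex) set \<Rightarrow> bool" where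
  "orthonormal_basis M E \<longleftrightarrow>
     E \<subseteq> L2 M \<and>
     (\<forall>e\<in>E. \<forall>e'\<in>E. l2_inner M e e' = (if e = e' then 1 else 0)) \<and>
     (\<forall>f\<in>L2 M. (\<forall>e\<in>E. l2_inner M e f = 0) \<longrightarrow> (AE x in M. f x = 0))"

text \<open>
  Bounded linear operators defined on all of $L^2(M)$.  The last condition makes the
  operator single-valued up to null sets; the second one says that the graph does not
  depend on the choice of representatives.
\<close>

definition bounded_operator :: "'a measure \<Rightarrow> 'a graph \<Rightarrow> bool" where
  "bounded_operator M A \<longleftrightarrow>
     A \<subseteq> L2 M \<times> L2 M \<and>
     (\<forall>f g f' g'. (f, g) \<in> A \<and> f' \<in> L2 M \<and> g' \<in> L2 M \<and>
        (AE x in M. f' x = f x) \<and> (AE x in M. g' x = g x) \<longrightarrow> (f', g') \<in> A) \<and>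
     (\<forall>f\<in>L2 M. \<exists>g. (f, g) \<in> A) \<and>
     (\<forall>f g f' g'. (f, g) \<in> A \<and> (f', g') \<in> A \<longrightarrow> (\<lambda>x. f x + f' x, \<lambda>x. g x + g' x) \<in> A) \<and>
     (\<forall>c f g. (f, g) \<in> A \<longrightarrow> (\<lambda>x. c * f x, \<lambda>x. c * g x) \<in> A) \<and>
     (\<exists>C. \<forall>(f, g)\<in>A. l2_norm M g \<le> C * l2_norm M f)"

definition mult_operator :: "'a measure \<Rightarrow> ('a \<Rightarrow> complex) \<Rightarrow> 'a graph" where
  "mult_operator M w = {(f, g). f \<in> L2 M \<and> g \<in> L2 M \<and> (AE x in M. g x = w x * f x)}"

definition minus_operator :: "'a graph \<Rightarrow> 'a graph" where
  "minus_operator A = {(f, \<lambda>x. - g x) | f g. (f, g) \<in> A}"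

definition shift_operator :: "'a graph \<Rightarrow> complex \<Rightarrow> 'a graph" where
  "shift_operator A z = {(f, \<lambda>x. g x - z * f x) | f g. (f, g) \<in> A}"

definition resolvent :: "'a graph \<Rightarrow> complex \<Rightarrow> 'a graph" where
  "resolvent A z = (shift_operator A z)\<inverse>"

definition spectrum :: "'a measure \<Rightarrow> 'a graph \<Rightarrow> complex set" where
  "spectrum M A = {z. \<not> bounded_operator M (resolvent A z)}"

definition operator_closure :: "'a measure \<Rightarrow> 'a graph \<Rightarrow> 'a graph" where
  "operator_closure M A =
     {(f, g). f \<in> L2 M \<and> g \<in> L2 M \<and>
        (\<forall>\<epsilon>>0. \<exists>(f', g')\<in>A. l2_norm M (\<lambda>x. f x - f' x) < \<epsilon> \<and> l2_norm M (\<lambda>x. g x - g' x) < \<epsilon>)}"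

definition adjoint_operator :: "'a measure \<Rightarrow> 'a graph \<Rightarrow> 'a graph" where
  "adjoint_operator M A =
     {(f, g). f \<in> L2 M \<and> g \<in> L2 M \<and> (\<forall>(h, k)\<in>A. l2_inner M k f = l2_inner M h g)}"

definition positive_operator :: "'a measure \<Rightarrow> 'a graph \<Rightarrow> bool" where
  "positive_operator M A \<longleftrightarrow> bounded_operator M A \<and> (\<forall>(f, g)\<in>A. l2_inner M f g \<in> \<real>\<^sub>\<ge>\<^sub>0)"

text \<open>$P = |T|$, the positive square root of $T^*T$.\<close>

definition is_operator_abs :: "'a measure \<Rightarrow> 'a graph \<Rightarrow> 'a graph \<Rightarrow> bool" where
  "is_operator_abs M T P \<longleftrightarrow> positive_operator M P \<and> P O P = T O adjoint_operator M T"

text \<open>The matrix element $\langle e, A f\rangle$, for \<open>f\<close> in the domain of \<open>A\<close>.\<close>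

definition matrix_element ::
    "'a measure \<Rightarrow> 'a graph \<Rightarrow> ('a \<Rightarrow> complex) \<Rightarrow> ('a \<Rightarrow> complex) \<Rightarrow> complex" where
  "matrix_element M A e f = l2_inner M e (SOME g. (f, g) \<in> A)"

text \<open>Trace class: $\mathrm{tr}\,|T| = \sum_e \langle e, |T| e\rangle < \infty$.\<close>

definition trace_class :: "'a measure \<Rightarrow> 'a graph \<Rightarrow> bool" where
  "trace_class M T \<longleftrightarrow>
     bounded_operator M T \<and>
     (\<exists>P. is_operator_abs M T P \<and>
        (\<exists>E. orthonormal_basis M E \<and> (\<lambda>e. matrix_element M P e e) summable_on E))"

text \<open>
  For a trace class operator \<open>T\<close>,
  $\det(I - T) = \sum_{k} (-1)^k\, \mathrm{tr}\, \Lambda^k(T)$, where $\Lambda^k(T)$ is the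
  \<open>k\<close>-th antisymmetric tensor power.  If \<open>E\<close> is an orthonormal basis, then the vectors
  $e_1 \wedge \dots \wedge e_k$, one for each \<open>k\<close>-element subset $S = \{e_1,\dots,e_k\}$ of \<open>E\<close>, form
  an orthonormal basis of the \<open>k\<close>-th antisymmetric tensor power of the space, and
  $\langle e_1 \wedge \dots \wedge e_k, \Lambda^k(T)\,(e_1 \wedge \dots \wedge e_k)\rangle
     = \det\,(\langle e_i, T e_j\rangle)_{i,j}$.
\<close>

definition wedge_matrix_element :: "'a measure \<Rightarrow> 'a graph \<Rightarrow> ('a \<Rightarrow> complex) set \<Rightarrow> complex" where
  "wedge_matrix_element M T S =
     (\<Sum>p | p permutes S. of_int (sign p) * (\<Prod>e\<in>S. matrix_element M T e (p e)))"

definition wedge_trace :: "'a measure \<Rightarrow> 'a graph \<Rightarrow> ('a \<Rightarrow> complex) set \<Rightarrow> nat \<Rightarrow> complex \<Rightarrow> bool" where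
  "wedge_trace M T E k t \<longleftrightarrow>
     (wedge_matrix_element M T has_sum t) {S. S \<subseteq> E \<and> finite S \<and> card S = k}"

text \<open>$\det(I - T)$; the value is required to be the same for all orthonormal bases.\<close>

definition fredholm_det_id_minus :: "'a measure \<Rightarrow> 'a graph \<Rightarrow> complex" where
  "fredholm_det_id_minus M T =
     (THE d. \<forall>E. orthonormal_basis M E \<longrightarrow>
        (\<exists>t. (\<forall>k. wedge_trace M T E k (t k)) \<and> (\<lambda>k. (-1) ^ k * t k) sums d))"


section \<open>Schroedinger operators on a bounded interval\<close>

definition AC :: "real \<Rightarrow> real \<Rightarrow> (real \<Rightarrow> complex) \<Rightarrow> bool" where
  "AC a b f \<longleftrightarrow>
     (\<forall>\<epsilon>>0. \<exists>\<delta>>0. \<forall>n l r.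
        (\<forall>i<n. a \<le> l i \<and> l i \<le> r i \<and> r i \<le> b) \<and>
        disjoint_family_on (\<lambda>i. {l i<..<r i}) {..<n::nat} \<and>
        (\<Sum>i<n. r i - l i) < \<delta>
        \<longrightarrow> (\<Sum>i<n. cmod (f (r i) - f (l i))) < \<epsilon>)"

abbreviation interval_measure :: "real \<Rightarrow> real measure" where
  "interval_measure \<omega> \<equiv> lebesgue_on {0<..<\<omega>}"

text \<open>
  \<open>g\<close> and its derivative \<open>g1\<close> are absolutely continuous on \<open>[0,\<omega>]\<close>, and \<open>g''\<close>, which exists
  almost everywhere, is \<open>g2\<close>.
\<close>

definition AC_derivs ::
    "real \<Rightarrow> (real \<Rightarrow> complex) \<Rightarrow> (real \<Rightarrow> complex) \<Rightarrow> (real \<Rightarrow> complex) \<Rightarrow> bool" where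
  "AC_derivs \<omega> g g1 g2 \<longleftrightarrow>
     AC 0 \<omega> g \<and> AC 0 \<omega> g1 \<and>
     (\<forall>x\<in>{0..\<omega>}. (g has_vector_derivative g1 x) (at x within {0..\<omega>})) \<and>
     (AE x in interval_measure \<omega>. (g1 has_vector_derivative g2 x) (at x))"

text \<open>\<open>g\<close> is the absolutely continuous representative of \<open>f\<close>, and \<open>h = -f''\<close>.\<close>

definition H0 :: "real \<Rightarrow> real \<Rightarrow> real graph" where
  "H0 \<omega> \<theta> =
     {(f, h). f \<in> L2 (interval_measure \<omega>) \<and> h \<in> L2 (interval_measure \<omega>) \<and>
        (\<exists>g g1. (AE x in interval_measure \<omega>. f x = g x) \<and>
           AC_derivs \<omega> g g1 (\<lambda>x. - h x) \<and>
           g \<omega> = exp (\<i> * of_real \<theta>) * g 0 \<and>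
           g1 \<omega> = exp (\<i> * of_real \<theta>) * g1 0)}"

definition factor_v :: "(real \<Rightarrow> complex) \<Rightarrow> real \<Rightarrow> complex" where
  "factor_v V x = of_real (sqrt (cmod (V x)))"

definition factor_u :: "(real \<Rightarrow> complex) \<Rightarrow> real \<Rightarrow> complex" where
  "factor_u V x = of_real (sqrt (cmod (V x))) * exp (\<i> * of_real (Arg (V x)))"

text \<open>The closure of $-u\,(H^{(0)}_\theta - z)^{-1} v$, each product having its maximal domain.\<close>

definition K :: "real \<Rightarrow> (real \<Rightarrow> complex) \<Rightarrow> real \<Rightarrow> complex \<Rightarrow> real graph" where
  "K \<omega> V \<theta> z =
     operator_closure (interval_measure \<omega>)
       (minus_operator
         (mult_operator (interval_measure \<omega>) (factor_v V) O
          resolvent (H0 \<omega> \<theta>) z O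
          mult_operator (interval_measure \<omega>) (factor_u V)))"

definition schroedinger_solution ::
    "real \<Rightarrow> (real \<Rightarrow> complex) \<Rightarrow> complex \<Rightarrow> (real \<Rightarrow> complex) \<Rightarrow> (real \<Rightarrow> complex) \<Rightarrow> bool" where
  "schroedinger_solution \<omega> V z \<psi> \<psi>1 \<longleftrightarrow> AC_derivs \<omega> \<psi> \<psi>1 (\<lambda>x. (V x - z) * \<psi> x)"

text \<open>
  The solutions \<open>c\<close> and \<open>s\<close> are determined only on \<open>[0,\<omega>]\<close>; this determines the value below.
\<close>

definition floquet_discriminant :: "real \<Rightarrow> (real \<Rightarrow> complex) \<Rightarrow> complex \<Rightarrow> complex" where
  "floquet_discriminant \<omega> V z =
     (THE d. \<exists>c c1 s s1.
        schroedinger_solution \<omega> V z c c1 \<and> c 0 = 1 \<and> c1 0 = 0 \<and>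
        schroedinger_solution \<omega> V z s s1 \<and> s 0 = 0 \<and> s1 0 = 1 \<and>
        d = (c \<omega> + s1 \<omega>) / 2)"

end

theory Submission
  imports Defs "Jordan_Normal_Form.Determinant"
begin

text \<open>
  The resolvent of the free operator is an integral operator with Lipschitz kernel \<open>green\<close>, so freezing
  the first argument of the kernel at the left endpoints of a grid of mesh \<open>\<omega> / 4 ^ n\<close> and telescoping over
  \<open>n\<close> expands \<open>K\<close> into a nuclear series of rank one operators.  For such a series the trace class property
  follows from the spectral theorem for \<open>T\<^sup>* T\<close>, and the Fredholm determinant equals
  the limit of determinants of finite matrices by an infinite Cauchy--Binet formula.  The grid
  matrices are a rank two perturbation of a triangular matrix; hence their determinants reduce to
  \<open>2 \<times> 2\<close> determinants formed with the Euler scheme for the Schroedinger equation in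
  variation of parameters form.  The scheme converges to the monodromy data, whose trace is twice the
  Floquet discriminant.
\<close>

section \<open>Absolutely continuous functions\<close>

text \<open>As \<open>V\<close> is only integrable, \<open>u\<close> and \<open>v\<close> are only
  square integrable, \<open>v * f\<close> is only integrable, and the Green's function has a kink on
  the diagonal. What is left is its Lipschitz bound. On level \<open>n\<close> it yields functionals
  of norm O(4^-n), while Cauchy-Schwarz over the 4^n cells costs a factor 2^n; the level contributes
  O(2^-n) and the expansion is nuclear. The determinant must have one value for all orthonormal
  bases. The expansion factors the operator as \<open>A B\<close> through its index set; passing to
  \<open>B A\<close>, with entries <b_i, a_j>, removes the basis. After telescoping, a partial sum
  is an operator with two finite expansions, and equality of the operators alone transfers the
  determinant to the shorter one, a matrix of size 4^n. The condition on \<open>z\<close> is used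
  through \<open>D \<noteq> 0\<close>, where \<open>D\<close> is the characteristic determinant of
  the free monodromy matrix; \<open>D\<close> is also the normalisation of the Green's function and,
  up to the factor -2 \<open>mult\<close>, the denominator of the final formula.\<close>

lemma AC_finite_family:
  assumes "AC a b f" "\<epsilon> > 0"
  obtains \<delta> where "\<delta> > 0"
    "\<And>(I :: 'i set) l r. \<lbrakk>finite I; \<And>i. i \<in> I \<Longrightarrow> a \<le> l i \<and> l i \<le> r i \<and> r i \<le> b;
       disjoint_family_on (\<lambda>i. {l i<..<r i}) I; (\<Sum>i\<in>I. r i - l i) < \<delta>\<rbrakk>
      \<Longrightarrow> (\<Sum>i\<in>I. cmod (f (r i) - f (l i))) < \<epsilon>"
proof -
  obtain \<delta> where \<delta>: "\<delta> > 0"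
    "\<And>n l r. (\<forall>i<n. a \<le> l i \<and> l i \<le> r i \<and> r i \<le> b) \<and>
        disjoint_family_on (\<lambda>i. {l i<..<r i}) {..<n::nat} \<and>
        (\<Sum>i<n. r i - l i) < \<delta>
        \<Longrightarrow> (\<Sum>i<n. cmod (f (r i) - f (l i))) < \<epsilon>"
    using assms unfolding AC_def by meson
  show ?thesis
  proof (rule that[OF \<delta>(1)])
    fix I :: "'i set" and l r
    assume I: "finite I" "\<And>i. i \<in> I \<Longrightarrow> a \<le> l i \<and> l i \<le> r i \<and> r i \<le> b"
      "disjoint_family_on (\<lambda>i. {l i<..<r i}) I" "(\<Sum>i\<in>I. r i - l i) < \<delta>"
    obtain h where h: "bij_betw h {..<card I} I"
      using ex_bij_betw_nat_finite[OF I(1)] atLeast0LessThan by metis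
    have hI: "h i \<in> I" if "i < card I" for i using h that by (auto simp: bij_betw_def)
    have "(\<Sum>i<card I. cmod (f (r (h i)) - f (l (h i)))) < \<epsilon>"
    proof (rule \<delta>(2), intro conjI)
      show "\<forall>i<card I. a \<le> l (h i) \<and> l (h i) \<le> r (h i) \<and> r (h i) \<le> b" using hI I(2) by blast
      show "disjoint_family_on (\<lambda>i. {l (h i)<..<r (h i)}) {..<card I}"
        using I(3) h unfolding disjoint_family_on_def bij_betw_def inj_on_def by blast
      show "(\<Sum>i<card I. r (h i) - l (h i)) < \<delta>"
        using I(4) sum.reindex_bij_betw[OF h, of "\<lambda>i. r i - l i"] by simp
    qed
    then show "(\<Sum>i\<in>I. cmod (f (r i) - f (l i))) < \<epsilon>"
      using sum.reindex_bij_betw[OF h, of "\<lambda>i. cmod (f (r i) - f (l i))"] by simp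
  qed
qed

lemma AC_lipschitz:
  assumes "\<And>x y. \<lbrakk>x \<in> {a..b}; y \<in> {a..b}\<rbrakk> \<Longrightarrow> cmod (f x - f y) \<le> L * \<bar>x - y\<bar>"
  shows "AC a b f"
  unfolding AC_def
proof (intro allI impI)
  fix \<epsilon> :: real assume "\<epsilon> > 0"
  define L' where "L' = \<bar>L\<bar> + 1"
  have L': "L' > 0" "\<And>x y. \<lbrakk>x \<in> {a..b}; y \<in> {a..b}\<rbrakk> \<Longrightarrow> cmod (f x - f y) \<le> L' * \<bar>x - y\<bar>"
    using assms unfolding L'_def
    by (auto intro!: order.trans[OF assms] mult_right_mono)
  show "\<exists>\<delta>>0. \<forall>n l r. (\<forall>i<n. a \<le> l i \<and> l i \<le> r i \<and> r i \<le> b) \<and>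
        disjoint_family_on (\<lambda>i. {l i<..<r i}) {..<n::nat} \<and>
        (\<Sum>i<n. r i - l i) < \<delta> \<longrightarrow> (\<Sum>i<n. cmod (f (r i) - f (l i))) < \<epsilon>"
  proof (intro exI[of _ "\<epsilon> / L'"] conjI allI impI)
    show "\<epsilon> / L' > 0" using \<open>\<epsilon> > 0\<close> L' by simp
    fix n :: nat and l r :: "nat \<Rightarrow> real"
    assume A: "(\<forall>i<n. a \<le> l i \<and> l i \<le> r i \<and> r i \<le> b) \<and>
        disjoint_family_on (\<lambda>i. {l i<..<r i}) {..<n} \<and> (\<Sum>i<n. r i - l i) < \<epsilon> / L'"
    have "(\<Sum>i<n. cmod (f (r i) - f (l i))) \<le> (\<Sum>i<n. L' * (r i - l i))"
    proof (rule sum_mono)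
      fix i assume "i \<in> {..<n}"
      with A have "a \<le> l i \<and> l i \<le> r i \<and> r i \<le> b" by blast
      with L'(2)[of "r i" "l i"] show "cmod (f (r i) - f (l i)) \<le> L' * (r i - l i)" by auto
    qed
    also have "\<dots> = L' * (\<Sum>i<n. r i - l i)" by (simp add: sum_distrib_left)
    also have "\<dots> < \<epsilon>" using A L'(1) by (simp add: field_simps)
    finally show "(\<Sum>i<n. cmod (f (r i) - f (l i))) < \<epsilon>" .
  qed
qed

lemma AC_const: "AC a b (\<lambda>x. c)"
  by (rule AC_lipschitz[where L = 0]) simp

lemma AC_subinterval: "AC a b f \<Longrightarrow> a \<le> c \<Longrightarrow> d \<le> b \<Longrightarrow> AC c d f"
  unfolding AC_def by (meson order.trans)

text \<open>A single interval is a disjoint family indexed by \<open>unit\<close>, which turns the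
  definition into uniform continuity.\<close>

lemma AC_continuous_on:
  assumes "AC a b f"
  shows "continuous_on {a..b} f"
proof (clarsimp simp: continuous_on_iff)
  fix x \<epsilon> :: real assume x: "a \<le> x" "x \<le> b" "\<epsilon> > 0"
  obtain \<delta> where \<delta>: "\<delta> > 0"
    "\<And>(I :: unit set) l r. \<lbrakk>finite I; \<And>i. i \<in> I \<Longrightarrow> a \<le> l i \<and> l i \<le> r i \<and> r i \<le> b;
       disjoint_family_on (\<lambda>i. {l i<..<r i}) I; (\<Sum>i\<in>I. r i - l i) < \<delta>\<rbrakk>
      \<Longrightarrow> (\<Sum>i\<in>I. cmod (f (r i) - f (l i))) < \<epsilon>"
    using AC_finite_family[OF assms x(3), where ?'i = unit] by blast
  have "cmod (f y' - f x') < \<epsilon>" if "x' \<in> {a..b}" "y' \<in> {a..b}" "x' \<le> y'" "y' - x' < \<delta>" for x' y'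
    using \<delta>(2)[of "{()}" "\<lambda>_. x'" "\<lambda>_. y'"] that by (simp add: disjoint_family_on_def)
  then have "dist (f y) (f x) < \<epsilon>" if "y \<in> {a..b}" "dist y x < \<delta>" for y
    using that x \<delta>(1) unfolding dist_norm real_norm_def
    by (metis abs_diff_less_iff abs_less_iff atLeastAtMost_iff linorder_le_cases minus_diff_eq norm_minus_commute)
  with \<delta>(1) show "\<exists>d>0. \<forall>x'\<in>{a..b}. dist x' x < d \<longrightarrow> dist (f x') (f x) < \<epsilon>" by blast
qed

lemma AC_bounded:
  assumes "AC a b f"
  obtains B where "B > 0" "\<And>x. x \<in> {a..b} \<Longrightarrow> cmod (f x) \<le> B"
proof -
  have "bounded (f ` {a..b})"
    by (intro compact_imp_bounded compact_continuous_image AC_continuous_on assms) simp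
  then show ?thesis using that unfolding bounded_pos by blast
qed

lemma AC_add:
  assumes f: "AC a b f" and g: "AC a b g"
  shows "AC a b (\<lambda>x. f x + g x)"
  unfolding AC_def
proof (intro allI impI)
  fix \<epsilon> :: real assume "\<epsilon> > 0"
  then have e2: "\<epsilon> / 2 > 0" by simp
  obtain d1 where d1: "d1 > 0"
    "\<And>n l r. (\<forall>i<n. a \<le> l i \<and> l i \<le> r i \<and> r i \<le> b) \<and>
        disjoint_family_on (\<lambda>i. {l i<..<r i}) {..<n::nat} \<and> (\<Sum>i<n. r i - l i) < d1
        \<Longrightarrow> (\<Sum>i<n. cmod (f (r i) - f (l i))) < \<epsilon> / 2"
    using f e2 unfolding AC_def by meson
  obtain d2 where d2: "d2 > 0"
    "\<And>n l r. (\<forall>i<n. a \<le> l i \<and> l i \<le> r i \<and> r i \<le> b) \<and>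
        disjoint_family_on (\<lambda>i. {l i<..<r i}) {..<n::nat} \<and> (\<Sum>i<n. r i - l i) < d2
        \<Longrightarrow> (\<Sum>i<n. cmod (g (r i) - g (l i))) < \<epsilon> / 2"
    using g e2 unfolding AC_def by meson
  show "\<exists>\<delta>>0. \<forall>n l r. (\<forall>i<n. a \<le> l i \<and> l i \<le> r i \<and> r i \<le> b) \<and>
        disjoint_family_on (\<lambda>i. {l i<..<r i}) {..<n::nat} \<and> (\<Sum>i<n. r i - l i) < \<delta> \<longrightarrow>
        (\<Sum>i<n. cmod (f (r i) + g (r i) - (f (l i) + g (l i)))) < \<epsilon>"
  proof (intro exI[of _ "min d1 d2"] conjI allI impI)
    show "min d1 d2 > 0" using d1 d2 by simp
    fix n :: nat and l r :: "nat \<Rightarrow> real"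
    assume A: "(\<forall>i<n. a \<le> l i \<and> l i \<le> r i \<and> r i \<le> b) \<and>
        disjoint_family_on (\<lambda>i. {l i<..<r i}) {..<n} \<and> (\<Sum>i<n. r i - l i) < min d1 d2"
    have "(\<Sum>i<n. cmod (f (r i) + g (r i) - (f (l i) + g (l i))))
        \<le> (\<Sum>i<n. cmod (f (r i) - f (l i)) + cmod (g (r i) - g (l i)))"
      by (intro sum_mono) (metis add_diff_add norm_triangle_ineq)
    also have "\<dots> < \<epsilon> / 2 + \<epsilon> / 2"
      unfolding sum.distrib using A by (intro add_strict_mono d1(2) d2(2)) auto
    finally show "(\<Sum>i<n. cmod (f (r i) + g (r i) - (f (l i) + g (l i)))) < \<epsilon>" by simp
  qed
qed

lemma AC_mult:
  assumes f: "AC a b f" and g: "AC a b g"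
  shows "AC a b (\<lambda>x. f x * g x)"
  unfolding AC_def
proof (intro allI impI)
  fix \<epsilon> :: real assume "\<epsilon> > 0"
  obtain F where F: "F > 0" "\<And>x. x \<in> {a..b} \<Longrightarrow> cmod (f x) \<le> F"
    using AC_bounded[OF f] by blast
  obtain G where G: "G > 0" "\<And>x. x \<in> {a..b} \<Longrightarrow> cmod (g x) \<le> G"
    using AC_bounded[OF g] by blast
  \<comment> \<open>Each increment of the product splits into an increment of \<open>f\<close>
    weighted by at most \<open>G\<close> and an increment of \<open>g\<close> weighted by at most
    \<open>F\<close>.\<close>
  have e2: "\<epsilon> / (2 * G) > 0" "\<epsilon> / (2 * F) > 0" using \<open>\<epsilon> > 0\<close> F(1) G(1) by auto
  obtain d1 where d1: "d1 > 0"
    "\<And>n l r. (\<forall>i<n. a \<le> l i \<and> l i \<le> r i \<and> r i \<le> b) \<and>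
        disjoint_family_on (\<lambda>i. {l i<..<r i}) {..<n::nat} \<and> (\<Sum>i<n. r i - l i) < d1
        \<Longrightarrow> (\<Sum>i<n. cmod (f (r i) - f (l i))) < \<epsilon> / (2 * G)"
    using f e2 unfolding AC_def by meson
  obtain d2 where d2: "d2 > 0"
    "\<And>n l r. (\<forall>i<n. a \<le> l i \<and> l i \<le> r i \<and> r i \<le> b) \<and>
        disjoint_family_on (\<lambda>i. {l i<..<r i}) {..<n::nat} \<and> (\<Sum>i<n. r i - l i) < d2
        \<Longrightarrow> (\<Sum>i<n. cmod (g (r i) - g (l i))) < \<epsilon> / (2 * F)"
    using g e2 unfolding AC_def by meson
  show "\<exists>\<delta>>0. \<forall>n l r. (\<forall>i<n. a \<le> l i \<and> l i \<le> r i \<and> r i \<le> b) \<and>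
        disjoint_family_on (\<lambda>i. {l i<..<r i}) {..<n::nat} \<and> (\<Sum>i<n. r i - l i) < \<delta> \<longrightarrow>
        (\<Sum>i<n. cmod (f (r i) * g (r i) - f (l i) * g (l i))) < \<epsilon>"
  proof (intro exI[of _ "min d1 d2"] conjI allI impI)
    show "min d1 d2 > 0" using d1 d2 by simp
    fix n :: nat and l r :: "nat \<Rightarrow> real"
    assume A: "(\<forall>i<n. a \<le> l i \<and> l i \<le> r i \<and> r i \<le> b) \<and>
        disjoint_family_on (\<lambda>i. {l i<..<r i}) {..<n} \<and> (\<Sum>i<n. r i - l i) < min d1 d2"
    have "(\<Sum>i<n. cmod (f (r i) * g (r i) - f (l i) * g (l i)))
        \<le> (\<Sum>i<n. G * cmod (f (r i) - f (l i)) + F * cmod (g (r i) - g (l i)))"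
    proof (intro sum_mono)
      fix i assume "i \<in> {..<n}"
      with A have i: "r i \<in> {a..b}" "l i \<in> {a..b}" by force+
      have "f (r i) * g (r i) - f (l i) * g (l i) = (f (r i) - f (l i)) * g (r i) + f (l i) * (g (r i) - g (l i))"
        by (simp add: algebra_simps)
      also have "cmod \<dots> \<le> cmod (f (r i) - f (l i)) * cmod (g (r i)) + cmod (f (l i)) * cmod (g (r i) - g (l i))"
        by (metis norm_mult norm_triangle_ineq)
      also have "\<dots> \<le> cmod (f (r i) - f (l i)) * G + F * cmod (g (r i) - g (l i))"
        by (intro add_mono mult_left_mono mult_right_mono F G i) auto
      finally show "cmod (f (r i) * g (r i) - f (l i) * g (l i))
          \<le> G * cmod (f (r i) - f (l i)) + F * cmod (g (r i) - g (l i))" by (simp add: mult.commute)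
    qed
    also have "\<dots> = G * (\<Sum>i<n. cmod (f (r i) - f (l i))) + F * (\<Sum>i<n. cmod (g (r i) - g (l i)))"
      by (simp add: sum.distrib sum_distrib_left)
    also have "\<dots> < G * (\<epsilon> / (2 * G)) + F * (\<epsilon> / (2 * F))"
      using A F(1) G(1) by (intro add_strict_mono mult_strict_left_mono d1(2) d2(2)) auto
    also have "\<dots> = \<epsilon>" using F(1) G(1) by simp
    finally show "(\<Sum>i<n. cmod (f (r i) * g (r i) - f (l i) * g (l i))) < \<epsilon>" .
  qed
qed

lemma AC_cmult: "AC a b f \<Longrightarrow> AC a b (\<lambda>x. c * f x)"
  by (intro AC_mult AC_const)

lemma AC_diff: "AC a b f \<Longrightarrow> AC a b g \<Longrightarrow> AC a b (\<lambda>x. f x - g x)"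
  using AC_add[OF _ AC_cmult[where c = "-1"]] by simp

lemma AC_cong:
  assumes "AC a b f" "\<And>x. x \<in> {a..b} \<Longrightarrow> f x = g x"
  shows "AC a b g"
  unfolding AC_def
proof (intro allI impI)
  fix \<epsilon> :: real assume "\<epsilon> > 0"
  then obtain d where d: "d > 0"
    "\<And>n l r. (\<forall>i<n. a \<le> l i \<and> l i \<le> r i \<and> r i \<le> b) \<and>
        disjoint_family_on (\<lambda>i. {l i<..<r i}) {..<n::nat} \<and> (\<Sum>i<n. r i - l i) < d
        \<Longrightarrow> (\<Sum>i<n. cmod (f (r i) - f (l i))) < \<epsilon>"
    using assms unfolding AC_def by meson
  show "\<exists>\<delta>>0. \<forall>n l r. (\<forall>i<n. a \<le> l i \<and> l i \<le> r i \<and> r i \<le> b) \<and>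
        disjoint_family_on (\<lambda>i. {l i<..<r i}) {..<n::nat} \<and> (\<Sum>i<n. r i - l i) < \<delta> \<longrightarrow>
        (\<Sum>i<n. cmod (g (r i) - g (l i))) < \<epsilon>"
  proof (intro exI[of _ d] conjI allI impI d(1))
    fix n :: nat and l r :: "nat \<Rightarrow> real"
    assume A: "(\<forall>i<n. a \<le> l i \<and> l i \<le> r i \<and> r i \<le> b) \<and>
        disjoint_family_on (\<lambda>i. {l i<..<r i}) {..<n} \<and> (\<Sum>i<n. r i - l i) < d"
    have "(\<Sum>i<n. cmod (g (r i) - g (l i))) = (\<Sum>i<n. cmod (f (r i) - f (l i)))"
    proof (rule sum.cong)
      fix i assume "i \<in> {..<n}"
      with A have "r i \<in> {a..b}" "l i \<in> {a..b}" by force+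
      then show "cmod (g (r i) - g (l i)) = cmod (f (r i) - f (l i))" using assms(2) by simp
    qed simp
    also have "\<dots> < \<epsilon>" using A by (intro d(2)) auto
    finally show "(\<Sum>i<n. cmod (g (r i) - g (l i))) < \<epsilon>" .
  qed
qed

text \<open>By Cousin's lemma: tags in the exceptional null set contribute little by absolute continuity,
  the other tags contribute little because the derivative vanishes there.\<close>

lemma AC_deriv_zero_eq:
  assumes F: "AC a b F" and ab: "a \<le> b"
    and D: "AE x in lebesgue_on {a<..<b}. (F has_vector_derivative 0) (at x)"
  shows "F b = F a"
proof -
  have "cmod (F b - F a) \<le> e" if e0: "e > 0" for e :: real
  proof -
    \<comment> \<open>As a bound for difference quotients this adds up to at most e/2 over a total
      length b - a; the summand 1 keeps the denominator positive when a = b.\<close>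
    define \<epsilon> where "\<epsilon> = e / (2 * (b - a + 1))"
    have \<epsilon>: "\<epsilon> > 0" using that ab by (simp add: \<epsilon>_def)
    obtain \<delta> where \<delta>: "\<delta> > 0"
      "\<And>(I :: (real \<times> real set) set) l r. \<lbrakk>finite I; \<And>i. i \<in> I \<Longrightarrow> a \<le> l i \<and> l i \<le> r i \<and> r i \<le> b;
       disjoint_family_on (\<lambda>i. {l i<..<r i}) I; (\<Sum>i\<in>I. r i - l i) < \<delta>\<rbrakk>
      \<Longrightarrow> (\<Sum>i\<in>I. cmod (F (r i) - F (l i))) < e / 2"
      using AC_finite_family[OF F half_gt_zero[OF e0], where ?'i = "real \<times> real set"] by blast
    have "AE x in lebesgue. x \<in> {a<..<b} \<longrightarrow> (F has_vector_derivative 0) (at x)"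
      using D by (subst (asm) AE_restrict_space_iff) auto
    then obtain N0 where N0: "N0 \<in> null_sets lebesgue"
      "{x. \<not> (x \<in> {a<..<b} \<longrightarrow> (F has_vector_derivative 0) (at x))} \<subseteq> N0"
      unfolding eventually_ae_filter by auto
    \<comment> \<open>The endpoints join the exceptional set because the derivative is known in the
      open interval only.\<close>
    define N where "N = N0 \<union> {a, b}"
    have N: "N \<in> null_sets lebesgue"
    proof -
      have "negligible N0" using N0(1) by (simp add: negligible_iff_null_sets)
      then have "negligible N" unfolding N_def by (rule negligible_Un[OF _ negligible_finite]) auto
      then show ?thesis by (simp add: negligible_iff_null_sets)
    qed
    have D': "(F has_vector_derivative 0) (at x)" if "x \<in> {a..b}" "x \<notin> N" for x
    proof -
      have "x \<in> {a<..<b}" "x \<notin> N0" using that by (auto simp: N_def)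
      then show ?thesis using N0(2) by blast
    qed
    \<comment> \<open>An open neighbourhood of the null set whose measure is below the threshold
      from absolute continuity; it serves as the gauge at exceptional tags.\<close>
    obtain U where U: "open U" "N \<subseteq> U" "(U - N) \<in> lmeasurable" "emeasure lebesgue (U - N) < ennreal \<delta>"
      using sets_lebesgue_outer_open[OF null_setsD2[OF N] \<delta>(1)] by blast
    have mU: "emeasure lebesgue U < ennreal \<delta>"
    proof -
      have "emeasure lebesgue U \<le> emeasure lebesgue ((U - N) \<union> N)"
        using U N by (intro emeasure_mono) auto
      also have "\<dots> = emeasure lebesgue (U - N)" using U N by (intro emeasure_Un_null_set) auto
      finally show ?thesis using U(4) by simp
    qed
    have "\<exists>d>0. \<forall>y. \<bar>y - x\<bar> < d \<longrightarrow> cmod (F y - F x) \<le> \<epsilon> * \<bar>y - x\<bar>" if "x \<in> {a..b}" "x \<notin> N" for x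
    proof -
      have "\<exists>d>0. \<forall>y. norm (y - x) < d \<longrightarrow> norm (F y - F x - (y - x) *\<^sub>R 0) \<le> \<epsilon> * norm (y - x)"
        using D'[OF that] \<epsilon> unfolding has_vector_derivative_def has_derivative_at_alt by blast
      then show ?thesis by simp
    qed
    then have "\<forall>x\<in>{a..b} - N. \<exists>d>0. \<forall>y. \<bar>y - x\<bar> < d \<longrightarrow> cmod (F y - F x) \<le> \<epsilon> * \<bar>y - x\<bar>" by blast
    then obtain d where "\<forall>x\<in>{a..b} - N. d x > 0 \<and> (\<forall>y. \<bar>y - x\<bar> < d x \<longrightarrow> cmod (F y - F x) \<le> \<epsilon> * \<bar>y - x\<bar>)"
      unfolding bchoice_iff by blast
    then have d: "\<And>x. x \<in> {a..b} \<Longrightarrow> x \<notin> N \<Longrightarrow> d x > 0 \<and> (\<forall>y. \<bar>y - x\<bar> < d x \<longrightarrow> cmod (F y - F x) \<le> \<epsilon> * \<bar>y - x\<bar>)"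
      by blast
    \<comment> \<open>The last branch only makes the gauge total: tags never lie outside [a,b]
      unless they belong to \<open>N\<close>.\<close>
    define \<gamma> where "\<gamma> x = (if x \<in> N then U else if x \<in> {a..b} then ball x (d x) else ball x 1)" for x
    have "open (\<gamma> x) \<and> x \<in> \<gamma> x" for x
      using U(1,2) d[of x] by (cases "x \<in> N"; cases "x \<in> {a..b}") (simp_all add: \<gamma>_def subset_iff)
    then have "gauge \<gamma>" unfolding gauge_def by auto
    then obtain p where p: "p tagged_division_of {a..b}" "\<gamma> fine p"
      by (rule fine_division_exists_real)
    note pD = tagged_division_ofD[OF p(1)]
    have seg: "a \<le> Inf K \<and> Inf K \<le> x \<and> x \<le> Sup K \<and> Sup K \<le> b \<and> K = {Inf K..Sup K}" if xK: "(x, K) \<in> p" for x K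
    proof -
      obtain c d where K: "K = {c..d}" using pD(4)[OF xK] unfolding box_real by blast
      have "x \<in> K" "K \<subseteq> {a..b}" using pD(2)[OF xK] pD(3)[OF xK] .
      then show ?thesis using K by auto
    qed
    have disj: "disjoint_family_on (\<lambda>i. {Inf (snd i)<..<Sup (snd i)}) p"
      unfolding disjoint_family_on_def
    proof (intro ballI impI)
      fix i j assume ij: "i \<in> p" "j \<in> p" "i \<noteq> j"
      obtain x K x' K' where xK: "i = (x, K)" "j = (x', K')" by (metis surj_pair)
      have "interior K = {Inf K<..<Sup K}" "interior K' = {Inf K'<..<Sup K'}"
        using seg[of x K] seg[of x' K'] ij(1,2) interior_atLeastAtMost_real unfolding xK by metis+
      then show "{Inf (snd i)<..<Sup (snd i)} \<inter> {Inf (snd j)<..<Sup (snd j)} = {}"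
        using pD(5)[of x K x' K'] ij unfolding xK by simp
    qed
    define p1 where "p1 = {i \<in> p. fst i \<in> N}"
    define p2 where "p2 = {i \<in> p. fst i \<notin> N}"
    have p12: "p = p1 \<union> p2" "p1 \<inter> p2 = {}" "finite p1" "finite p2" "p1 \<subseteq> p" "p2 \<subseteq> p"
      using pD(1) unfolding p1_def p2_def by auto
    have seg1: "Inf (snd i) \<le> Sup (snd i)" if "i \<in> p1" for i
      using seg[of "fst i" "snd i"] that p12(5) by auto
    have "F b - F a = (\<Sum>(x,K)\<in>p. F (Sup K) - F (Inf K))"
      by (rule additive_tagged_division_1[OF ab p(1), symmetric])
    also have "cmod \<dots> \<le> (\<Sum>i\<in>p. cmod (F (Sup (snd i)) - F (Inf (snd i))))"
      by (rule order.trans[OF norm_sum]) (simp add: case_prod_beta)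
    also have "\<dots> = (\<Sum>i\<in>p1. cmod (F (Sup (snd i)) - F (Inf (snd i)))) + (\<Sum>i\<in>p2. cmod (F (Sup (snd i)) - F (Inf (snd i))))"
      unfolding p12(1) by (rule sum.union_disjoint[OF p12(3,4,2)])
    also have "\<dots> \<le> e / 2 + e / 2"
    proof (rule add_mono)
      \<comment> \<open>By fineness the intervals with exceptional tags lie in \<open>U\<close>, and
        they are disjoint, so their total length is at most the measure of \<open>U\<close>.\<close>
      have "(\<Sum>i\<in>p1. Sup (snd i) - Inf (snd i)) < \<delta>"
      proof -
        have "ennreal (\<Sum>i\<in>p1. Sup (snd i) - Inf (snd i)) = (\<Sum>i\<in>p1. emeasure lebesgue {Inf (snd i)<..<Sup (snd i)})"
          using seg1 by (subst sum_ennreal[symmetric]) auto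
        also have "\<dots> = emeasure lebesgue (\<Union>i\<in>p1. {Inf (snd i)<..<Sup (snd i)})"
          using disj p12 by (intro sum_emeasure) (auto simp: disjoint_family_on_def)
        also have "\<dots> \<le> emeasure lebesgue U"
        proof (rule emeasure_mono)
          show "U \<in> sets lebesgue" using U(1) by auto
          show "(\<Union>i\<in>p1. {Inf (snd i)<..<Sup (snd i)}) \<subseteq> U"
          proof safe
            fix t x K assume *: "(x, K) \<in> p1" "t \<in> {Inf (snd (x, K))<..<Sup (snd (x, K))}"
            then have "K \<subseteq> U" using fineD[OF p(2), of x K] by (simp add: p1_def \<gamma>_def)
            moreover have "t \<in> K" using seg[of x K] *(2) subsetD[OF p12(5) *(1)] by (metis atLeastAtMost_iff greaterThanLessThan_iff less_imp_le snd_conv)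
            ultimately show "t \<in> U" by blast
          qed
        qed
        also have "\<dots> < ennreal \<delta>" by (rule mU)
        finally show ?thesis
          using \<delta>(1) by (subst (asm) ennreal_less_iff) (use seg1 in \<open>auto intro!: sum_nonneg\<close>)
      qed
      moreover have "disjoint_family_on (\<lambda>i. {Inf (snd i)<..<Sup (snd i)}) p1"
        using disj p12(5) by (rule disjoint_family_on_mono[rotated])
      moreover have "a \<le> Inf (snd i) \<and> Inf (snd i) \<le> Sup (snd i) \<and> Sup (snd i) \<le> b" if "i \<in> p1" for i
        using seg[of "fst i" "snd i"] that p12(5) by auto
      ultimately show "(\<Sum>i\<in>p1. cmod (F (Sup (snd i)) - F (Inf (snd i)))) \<le> e / 2"
        using \<delta>(2)[of p1 "\<lambda>i. Inf (snd i)" "\<lambda>i. Sup (snd i)"] p12(3) by (simp add: less_imp_le)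
      have "(\<Sum>i\<in>p2. cmod (F (Sup (snd i)) - F (Inf (snd i)))) \<le> (\<Sum>i\<in>p2. \<epsilon> * (Sup (snd i) - Inf (snd i)))"
      proof (rule sum_mono)
        fix i assume i: "i \<in> p2"
        obtain x K where xK: "i = (x, K)" by (cases i)
        have xp: "(x, K) \<in> p" "x \<notin> N" using i xK unfolding p2_def by auto
        note s = seg[OF xp(1)]
        have x: "x \<in> {a..b}" using s by auto
        have "K \<subseteq> ball x (d x)" using fineD[OF p(2) xp(1)] xp(2) x by (simp add: \<gamma>_def)
        moreover have "Sup K \<in> K" "Inf K \<in> K"
          using s atLeastAtMost_iff[of "Sup K" "Inf K" "Sup K"] atLeastAtMost_iff[of "Inf K" "Inf K" "Sup K"] by simp_all
        ultimately have "\<bar>Sup K - x\<bar> < d x" "\<bar>Inf K - x\<bar> < d x" by (auto simp: dist_real_def abs_minus_commute)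
        then have *: "cmod (F (Sup K) - F x) \<le> \<epsilon> * \<bar>Sup K - x\<bar>" "cmod (F (Inf K) - F x) \<le> \<epsilon> * \<bar>Inf K - x\<bar>"
          using d[OF x xp(2)] by blast+
        have "cmod (F (Sup K) - F (Inf K)) \<le> cmod (F (Sup K) - F x) + cmod (F (Inf K) - F x)"
          using norm_triangle_ineq4[of "F (Sup K) - F x" "F (Inf K) - F x"] by simp
        also have "\<dots> \<le> \<epsilon> * (Sup K - x) + \<epsilon> * (x - Inf K)" using * s by simp
        also have "\<dots> = \<epsilon> * (Sup K - Inf K)" by (simp add: algebra_simps)
        finally show "cmod (F (Sup (snd i)) - F (Inf (snd i))) \<le> \<epsilon> * (Sup (snd i) - Inf (snd i))"
          by (simp add: xK)
      qed
      also have "\<dots> \<le> (\<Sum>i\<in>p. \<epsilon> * (Sup (snd i) - Inf (snd i)))"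
      proof (rule sum_mono2[OF pD(1) p12(6)])
        fix i assume "i \<in> p - p2"
        then show "0 \<le> \<epsilon> * (Sup (snd i) - Inf (snd i))" using seg[of "fst i" "snd i"] \<epsilon> by auto
      qed
      also have "\<dots> = \<epsilon> * (\<Sum>(x,K)\<in>p. Sup K - Inf K)" by (simp add: sum_distrib_left case_prod_beta)
      also have "\<dots> = \<epsilon> * (b - a)" by (subst additive_tagged_division_1[OF ab p(1)]) simp
      also have "\<dots> \<le> e / 2"
      proof -
        have "e * (b - a) \<le> e * (b - a + 1)" using that by (simp add: algebra_simps)
        then show ?thesis using ab unfolding \<epsilon>_def by (simp add: field_simps)
      qed
      finally show "(\<Sum>i\<in>p2. cmod (F (Sup (snd i)) - F (Inf (snd i)))) \<le> e / 2" .
    qed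
    finally show ?thesis by simp
  qed
  then have "cmod (F b - F a) \<le> 0" by (meson dense not_le)
  then show ?thesis by simp
qed

section \<open>Absolute continuity of the integral and Lebesgue differentiation\<close>

text \<open>Truncation at a height \<open>n\<close> splits |h| into a part bounded by
  \<open>n\<close>, which contributes at most \<open>n\<close> times the total length, and an excess
  \<open>k\<close> whose whole integral is below \<epsilon>/2 by dominated convergence.\<close>

lemma integral_small_on_small_sets:
  fixes h :: "real \<Rightarrow> complex"
  assumes h: "h absolutely_integrable_on {a..b}" and "\<epsilon> > 0"
  obtains \<delta> where "\<delta> > 0"
    "\<And>(I :: 'i set) l r. \<lbrakk>finite I; \<And>i. i \<in> I \<Longrightarrow> a \<le> l i \<and> l i \<le> r i \<and> r i \<le> b;
       disjoint_family_on (\<lambda>i. {l i<..<r i}) I; (\<Sum>i\<in>I. r i - l i) < \<delta>\<rbrakk>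
      \<Longrightarrow> (\<Sum>i\<in>I. integral {l i..r i} (\<lambda>x. cmod (h x))) < \<epsilon>"
proof -
  define H where "H x = indicator {a..b} x * cmod (h x)" for x
  have H: "integrable lebesgue H"
    using absolutely_integrable_norm[OF h] unfolding H_def set_integrable_def by (simp add: o_def)
  have Hn: "H x \<ge> 0" for x by (simp add: H_def)
  have "(\<lambda>n. LINT x|lebesgue. H x - min (H x) (real n)) \<longlonglongrightarrow> (LINT x|(lebesgue::real measure). 0)"
  proof (rule integral_dominated_convergence[where w = H])
    show "AE x in lebesgue. (\<lambda>n. H x - min (H x) (real n)) \<longlonglongrightarrow> 0"
    proof (rule AE_I2)
      fix x
      obtain N where "H x \<le> real N" using real_arch_simple by blast
      then have "eventually (\<lambda>n. H x - min (H x) (real n) = 0) sequentially"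
        unfolding eventually_sequentially by (intro exI[of _ N]) auto
      then show "(\<lambda>n. H x - min (H x) (real n)) \<longlonglongrightarrow> 0" by (rule tendsto_eventually)
    qed
    show "AE x in lebesgue. norm (H x - min (H x) (real n)) \<le> H x" for n
      using Hn by (intro AE_I2) (auto simp: min_def)
  qed (use H in auto)
  then have "eventually (\<lambda>n. (LINT x|lebesgue. H x - min (H x) (real n)) < \<epsilon> / 2) sequentially"
    using \<open>\<epsilon> > 0\<close> by (intro order_tendstoD(2)) auto
  then obtain n where n: "(LINT x|lebesgue. H x - min (H x) (real n)) < \<epsilon> / 2"
    by (auto simp: eventually_sequentially)
  define k where "k x = H x - min (H x) (real n)" for x
  have km[measurable]: "k \<in> borel_measurable lebesgue" unfolding k_def using H by auto
  have k: "integrable lebesgue k"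
    by (rule Bochner_Integration.integrable_bound[OF H]) (use Hn km in \<open>auto simp: k_def min_def\<close>)
  have kn: "k x \<ge> 0" for x by (simp add: k_def)
  show ?thesis
  proof (rule that)
    \<comment> \<open>The truncation height may be 0, hence \<open>real n + 1\<close>.\<close>
    show "\<epsilon> / (2 * (real n + 1)) > 0" using \<open>\<epsilon> > 0\<close> by simp
    fix I :: "'i set" and l r
    assume I: "finite I" "\<And>i. i \<in> I \<Longrightarrow> a \<le> l i \<and> l i \<le> r i \<and> r i \<le> b"
       "disjoint_family_on (\<lambda>i. {l i<..<r i}) I" "(\<Sum>i\<in>I. r i - l i) < \<epsilon> / (2 * (real n + 1))"
    have ki: "integrable lebesgue (\<lambda>x. indicator {l i<..<r i} x * k x)" for i
      using k by (intro integrable_mult_indicator[where 'b=real, simplified]) auto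
    have one: "integral {l i..r i} (\<lambda>x. cmod (h x)) \<le> real n * (r i - l i) + (LINT x|lebesgue. indicator {l i<..<r i} x * k x)"
      if i: "i \<in> I" for i
    proof -
      have "(\<lambda>x. cmod (h x)) absolutely_integrable_on {l i<..<r i}"
        using I(2)[OF i] by (intro set_integrable_subset[OF absolutely_integrable_norm[OF h, unfolded o_def]]) auto
      then have "integral {l i<..<r i} (\<lambda>x. cmod (h x)) = (LINT x|lebesgue. indicator {l i<..<r i} x * cmod (h x))"
        by (subst set_lebesgue_integral_eq_integral(2)[symmetric]) (auto simp: set_lebesgue_integral_def)
      then have "integral {l i..r i} (\<lambda>x. cmod (h x)) = (LINT x|lebesgue. indicator {l i<..<r i} x * cmod (h x))"
        by (simp add: integral_open_interval_real)
      also have "\<dots> = (LINT x|lebesgue. indicator {l i<..<r i} x * H x)"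
        using I(2)[OF i] by (intro Bochner_Integration.integral_cong) (auto simp: H_def indicator_def)
      also have "\<dots> \<le> (LINT x|lebesgue. real n * indicator {l i<..<r i} x + indicator {l i<..<r i} x * k x)"
      proof (rule integral_mono)
        show "integrable lebesgue (\<lambda>x. indicator {l i<..<r i} x * H x)"
          using H by (intro integrable_mult_indicator[where 'b=real, simplified]) auto
        show "integrable lebesgue (\<lambda>x. real n * indicator {l i<..<r i} x + indicator {l i<..<r i} x * k x)"
          using ki I(2)[OF i] by (intro Bochner_Integration.integrable_add integrable_mult_right integrable_real_indicator) auto
      qed (auto simp: k_def indicator_def)
      also have "\<dots> = real n * (r i - l i) + (LINT x|lebesgue. indicator {l i<..<r i} x * k x)"
        using ki I(2)[OF i] by (subst Bochner_Integration.integral_add) (auto intro!: integrable_mult_right integrable_real_indicator)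
      finally show ?thesis .
    qed
    have "(\<Sum>i\<in>I. integral {l i..r i} (\<lambda>x. cmod (h x)))
        \<le> (\<Sum>i\<in>I. real n * (r i - l i)) + (\<Sum>i\<in>I. LINT x|lebesgue. indicator {l i<..<r i} x * k x)"
      unfolding sum.distrib[symmetric] by (intro sum_mono one)
    also have "(\<Sum>i\<in>I. LINT x|lebesgue. indicator {l i<..<r i} x * k x)
        = (LINT x|lebesgue. (\<Sum>i\<in>I. indicator {l i<..<r i} x * k x))"
      using ki by (simp add: Bochner_Integration.integral_sum)
    also have "\<dots> \<le> (LINT x|lebesgue. k x)"
    proof (rule integral_mono)
      fix x
      have "(\<Sum>i\<in>I. indicator {l i<..<r i} x * k x) = indicator (\<Union>i\<in>I. {l i<..<r i}) x * k x"
        using I(1,3) by (simp add: sum_distrib_right[symmetric] indicator_UN_disjoint)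
      also have "\<dots> \<le> k x" using kn by (simp add: indicator_def)
      finally show "(\<Sum>i\<in>I. indicator {l i<..<r i} x * k x) \<le> k x" .
    qed (use k ki in auto)
    also have "(\<Sum>i\<in>I. real n * (r i - l i)) + (LINT x|lebesgue. k x) < \<epsilon> / 2 + \<epsilon> / 2"
    proof (rule add_le_less_mono)
      have "(\<Sum>i\<in>I. real n * (r i - l i)) = real n * (\<Sum>i\<in>I. r i - l i)" by (simp add: sum_distrib_left)
      also have "\<dots> \<le> real n * (\<epsilon> / (2 * (real n + 1)))" using I(4) by (intro mult_left_mono) auto
      also have "\<dots> \<le> \<epsilon> / 2" using \<open>\<epsilon> > 0\<close> by (simp add: field_simps)
      finally show "(\<Sum>i\<in>I. real n * (r i - l i)) \<le> \<epsilon> / 2" .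
    qed (use n in \<open>simp add: k_def\<close>)
    finally show "(\<Sum>i\<in>I. integral {l i..r i} (\<lambda>x. cmod (h x))) < \<epsilon>" by simp
  qed
qed

lemma integral_diff_subinterval:
  fixes h :: "real \<Rightarrow> complex"
  assumes "h integrable_on {a..b}" "a \<le> x" "x \<le> y" "y \<le> b"
  shows "integral {a..y} h - integral {a..x} h = integral {x..y} h"
proof -
  have "h integrable_on {a..y}" using assms by (auto intro: integrable_on_subinterval)
  from Henstock_Kurzweil_Integration.integral_combine[OF assms(2,3) this] show ?thesis by (simp add: algebra_simps)
qed

lemma AC_integral:
  fixes h :: "real \<Rightarrow> complex"
  assumes h: "h absolutely_integrable_on {a..b}"
  shows "AC a b (\<lambda>x. integral {a..x} h)"
  unfolding AC_def
proof (intro allI impI)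
  fix \<epsilon> :: real assume "\<epsilon> > 0"
  obtain \<delta> where d: "\<delta> > 0"
    "\<And>(I :: nat set) l r. \<lbrakk>finite I; \<And>i. i \<in> I \<Longrightarrow> a \<le> l i \<and> l i \<le> r i \<and> r i \<le> b;
       disjoint_family_on (\<lambda>i. {l i<..<r i}) I; (\<Sum>i\<in>I. r i - l i) < \<delta>\<rbrakk>
      \<Longrightarrow> (\<Sum>i\<in>I. integral {l i..r i} (\<lambda>x. cmod (h x))) < \<epsilon>"
    using integral_small_on_small_sets[OF h \<open>\<epsilon> > 0\<close>, where ?'i = nat] by blast
  show "\<exists>\<delta>>0. \<forall>n l r. (\<forall>i<n. a \<le> l i \<and> l i \<le> r i \<and> r i \<le> b) \<and>
        disjoint_family_on (\<lambda>i. {l i<..<r i}) {..<n::nat} \<and> (\<Sum>i<n. r i - l i) < \<delta> \<longrightarrow>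
        (\<Sum>i<n. cmod (integral {a..r i} h - integral {a..l i} h)) < \<epsilon>"
  proof (intro exI[of _ \<delta>] conjI d(1) allI impI)
    fix n :: nat and l r :: "nat \<Rightarrow> real"
    assume A: "(\<forall>i<n. a \<le> l i \<and> l i \<le> r i \<and> r i \<le> b) \<and>
        disjoint_family_on (\<lambda>i. {l i<..<r i}) {..<n} \<and> (\<Sum>i<n. r i - l i) < \<delta>"
    have "(\<Sum>i<n. cmod (integral {a..r i} h - integral {a..l i} h)) \<le> (\<Sum>i<n. integral {l i..r i} (\<lambda>x. cmod (h x)))"
    proof (rule sum_mono)
      fix i assume "i \<in> {..<n}"
      with A have i: "a \<le> l i" "l i \<le> r i" "r i \<le> b" by auto
      have hi: "h absolutely_integrable_on {l i..r i}"
        using i by (intro set_integrable_subset[OF h]) auto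
      have "integral {a..r i} h - integral {a..l i} h = integral {l i..r i} h"
        using i h by (intro integral_diff_subinterval[of h a b]) (auto simp: absolutely_integrable_on_def)
      also have "cmod \<dots> \<le> integral {l i..r i} (\<lambda>x. cmod (h x))"
        using hi by (intro integral_norm_bound_integral) (auto simp: absolutely_integrable_on_def)
      finally show "cmod (integral {a..r i} h - integral {a..l i} h) \<le> integral {l i..r i} (\<lambda>x. cmod (h x))" .
    qed
    also have "\<dots> < \<epsilon>" using A by (intro d(2)) auto
    finally show "(\<Sum>i<n. cmod (integral {a..r i} h - integral {a..l i} h)) < \<epsilon>" .
  qed
qed

text \<open>The Henstock lemma bounds the total length of any finite disjoint family of intervals on which the
  difference quotient is off by at least \<open>e\<close>; the Vitali covering lemma extracts such a family.\<close>

lemma negligible_bad_difference_quotient: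
  fixes h :: "real \<Rightarrow> complex"
  assumes h: "h integrable_on {a..b}" and e: "e > 0"
  shows "negligible {x \<in> {a<..<b}. \<forall>d>0. \<exists>y\<in>{a..b}. y \<noteq> x \<and> \<bar>y - x\<bar> < d \<and>
     cmod (integral {a..y} h - integral {a..x} h - (y - x) *\<^sub>R h x) > e * \<bar>y - x\<bar>}" (is "negligible ?B")
  unfolding negligible_outer_le
proof (intro allI impI)
  fix \<eta> :: real assume "\<eta> > 0"
  define F where "F x = integral {a..x} h" for x
  \<comment> \<open>The 5 is the enlargement factor of the Vitali covering; \<open>e\<close>
    converts errors of the integral into lengths.\<close>
  have \<eta>e: "\<eta> * e / 5 > 0" using \<open>\<eta> > 0\<close> e by simp
  obtain \<gamma> where \<gamma>: "gauge \<gamma>"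
    "\<And>p. \<lbrakk>p tagged_partial_division_of (cbox a b); \<gamma> fine p\<rbrakk> \<Longrightarrow>
      (\<Sum>(x,k)\<in>p. norm (measure lborel k *\<^sub>R h x - integral k h)) < \<eta> * e / 5"
    using Henstock_lemma[OF h[folded box_real(2)] \<eta>e] by blast
  \<comment> \<open>The interval between the bad point and its witness, in whichever order they lie;
    the bad point, the first component, becomes the tag.\<close>
  define seg where "seg i = {min (fst i) (snd i)..max (fst i) (snd i)}" for i :: "real \<times> real"
  \<comment> \<open>The bound 1 on the lengths supplies the uniform radius bound of the covering
    lemma.\<close>
  define J where "J = {(x, y). x \<in> {a<..<b} \<and> y \<in> {a..b} \<and> y \<noteq> x \<and> \<bar>y - x\<bar> < 1 \<and> seg (x, y) \<subseteq> \<gamma> x \<and>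
     cmod (F y - F x - (y - x) *\<^sub>R h x) > e * \<bar>y - x\<bar>}"
  define c where "c i = (fst i + snd i) / 2" for i :: "real \<times> real"
  define \<rho> where "\<rho> i = \<bar>fst i - snd i\<bar> / 2" for i :: "real \<times> real"
  have segc: "seg i = cball (c i) (\<rho> i)" for i
    unfolding seg_def c_def \<rho>_def cball_eq_atLeastAtMost by (auto simp: min_def max_def field_simps)
  have cov: "?B \<subseteq> (\<Union>i\<in>J. cball (c i) (\<rho> i))"
  proof
    fix x assume x: "x \<in> ?B"
    obtain d where d: "d > 0" "ball x d \<subseteq> \<gamma> x"
      using \<gamma>(1) unfolding gauge_def by (meson openE)
    then have "min d 1 > 0" by simp
    with x obtain y where y: "y \<in> {a..b}" "y \<noteq> x" "\<bar>y - x\<bar> < min d 1" "cmod (F y - F x - (y - x) *\<^sub>R h x) > e * \<bar>y - x\<bar>"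
      unfolding F_def by blast
    have "seg (x, y) \<subseteq> ball x d" using y by (auto simp: seg_def dist_real_def)
    then have "(x, y) \<in> J" using y d x unfolding J_def by auto
    moreover have "x \<in> seg (x, y)" by (simp add: seg_def)
    ultimately show "x \<in> (\<Union>i\<in>J. cball (c i) (\<rho> i))" unfolding segc by blast
  qed
  have "\<And>i. i \<in> J \<Longrightarrow> 0 < \<rho> i \<and> \<rho> i \<le> 1" unfolding J_def \<rho>_def by auto
  from Vitali_covering_lemma_cballs[OF cov this]
  obtain C where C: "countable C" "C \<subseteq> J"
     "pairwise (\<lambda>i j. disjnt (cball (c i) (\<rho> i)) (cball (c j) (\<rho> j))) C"
     "?B \<subseteq> (\<Union>i\<in>C. cball (c i) (5 * \<rho> i))" by blast
  have fin: "measure lebesgue (\<Union>i\<in>C'. cball (c i) (5 * \<rho> i)) \<le> \<eta>" if C': "C' \<subseteq> C" "finite C'" for C'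
  proof -
    define p where "p = (\<lambda>i. (fst i, seg i)) ` C'"
    have dj: "seg i \<inter> seg j = {}" if "i \<in> C'" "j \<in> C'" "i \<noteq> j" for i j
      using C(3) that C'(1) unfolding pairwise_def segc disjnt_def by blast
    have inj: "inj_on (\<lambda>i. (fst i, seg i)) C'"
    proof (rule inj_onI)
      fix i j assume ij: "i \<in> C'" "j \<in> C'" "(fst i, seg i) = (fst j, seg j)"
      have "fst i \<in> seg i" by (simp add: seg_def)
      with ij have "seg i \<inter> seg j \<noteq> {}" by auto
      with dj ij show "i = j" by blast
    qed
    have sub: "seg i \<subseteq> cbox a b" if "i \<in> C'" for i
      using that C'(1) C(2) unfolding J_def seg_def by auto
    have "p tagged_partial_division_of cbox a b"
      unfolding tagged_partial_division_of_def
    proof (intro conjI allI impI)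
      show "finite p" using C'(2) by (simp add: p_def)
      fix x K assume "(x, K) \<in> p"
      then obtain i where i: "i \<in> C'" "x = fst i" "K = seg i" by (auto simp: p_def)
      show "x \<in> K" using i by (simp add: seg_def)
      show "K \<subseteq> cbox a b" using sub i by simp
      show "\<exists>a b. K = cbox a b" using i by (auto simp: seg_def)
    next
      fix x1 K1 x2 K2 assume "(x1, K1) \<in> p \<and> (x2, K2) \<in> p \<and> (x1, K1) \<noteq> (x2, K2)"
      then obtain i j where "i \<in> C'" "j \<in> C'" "i \<noteq> j" "K1 = seg i" "K2 = seg j" unfolding p_def by auto
      then have "K1 \<inter> K2 = {}" using dj by simp
      then show "interior K1 \<inter> interior K2 = {}" using interior_subset by blast
    qed
    moreover have "\<gamma> fine p"
      unfolding fine_def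
    proof safe
      fix x K t assume "(x, K) \<in> p" "t \<in> K"
      then obtain i where i: "i \<in> J" "x = fst i" "t \<in> seg i" using C'(1) C(2) unfolding p_def by auto
      then show "t \<in> \<gamma> x" unfolding J_def by auto
    qed
    ultimately have "(\<Sum>(x,k)\<in>p. norm (measure lborel k *\<^sub>R h x - integral k h)) < \<eta> * e / 5" by (rule \<gamma>(2))
    then have s: "(\<Sum>i\<in>C'. norm (measure lborel (seg i) *\<^sub>R h (fst i) - integral (seg i) h)) < \<eta> * e / 5"
      unfolding p_def by (subst (asm) sum.reindex[OF inj]) (simp add: o_def)
    have "(\<Sum>i\<in>C'. e * (2 * \<rho> i)) \<le> (\<Sum>i\<in>C'. norm (measure lborel (seg i) *\<^sub>R h (fst i) - integral (seg i) h))"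
    proof (rule sum_mono)
      fix i assume "i \<in> C'"
      then have iJ: "i \<in> J" using C' C by blast
      obtain x y where xy: "i = (x, y)" by (cases i)
      have bnd: "a < x" "x < b" "a \<le> y" "y \<le> b" "cmod (F y - F x - (y - x) *\<^sub>R h x) > e * \<bar>y - x\<bar>"
        using iJ unfolding J_def xy by auto
      \<comment> \<open>The Henstock error on the segment is, up to sign, the defect of the
        difference quotient; the sign depends on the order of \<open>x\<close> and
        \<open>y\<close>.\<close>
      have "norm (measure lborel (seg i) *\<^sub>R h (fst i) - integral (seg i) h) = cmod (F y - F x - (y - x) *\<^sub>R h x)"
      proof (cases "x \<le> y")
        case True
        have "integral {x..y} h = F y - F x" unfolding F_def
          using bnd True by (intro integral_diff_subinterval[OF h, symmetric]) auto
        then show ?thesis using True by (simp add: xy seg_def norm_minus_commute)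
      next
        case False
        have "integral {y..x} h = F x - F y" unfolding F_def
          using bnd False by (intro integral_diff_subinterval[OF h, symmetric]) auto
        then have "measure lborel (seg i) *\<^sub>R h (fst i) - integral (seg i) h = F y - F x - (y - x) *\<^sub>R h x"
          using False by (simp add: xy seg_def scaleR_diff_left)
        then show ?thesis by simp
      qed
      then show "e * (2 * \<rho> i) \<le> norm (measure lborel (seg i) *\<^sub>R h (fst i) - integral (seg i) h)"
        using bnd(5) by (simp add: xy \<rho>_def abs_minus_commute)
    qed
    with s have s2: "(\<Sum>i\<in>C'. e * (2 * \<rho> i)) < \<eta> * e / 5" by simp
    have "measure lebesgue (\<Union>i\<in>C'. cball (c i) (5 * \<rho> i)) \<le> (\<Sum>i\<in>C'. measure lebesgue (cball (c i) (5 * \<rho> i)))"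
      using C'(2) by (intro measure_UNION_le) auto
    also have "\<dots> = (\<Sum>i\<in>C'. 5 * (2 * \<rho> i))"
    proof (rule sum.cong)
      fix i
      have "\<rho> i \<ge> 0" by (simp add: \<rho>_def)
      then show "measure lebesgue (cball (c i) (5 * \<rho> i)) = 5 * (2 * \<rho> i)"
        by (simp add: cball_eq_atLeastAtMost)
    qed simp
    also have "\<dots> = (5 / e) * (\<Sum>i\<in>C'. e * (2 * \<rho> i))"
      using e by (simp add: sum_distrib_left)
    also have "\<dots> \<le> (5 / e) * (\<eta> * e / 5)" using s2 e by (intro mult_left_mono) auto
    also have "\<dots> = \<eta>" using e by simp
    finally show ?thesis .
  qed
  show "\<exists>T. ?B \<subseteq> T \<and> T \<in> lmeasurable \<and> measure lebesgue T \<le> \<eta>"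
  proof (intro exI conjI)
    show "?B \<subseteq> (\<Union>i\<in>C. cball (c i) (5 * \<rho> i))" by (rule C(4))
    show "(\<Union>i\<in>C. cball (c i) (5 * \<rho> i)) \<in> lmeasurable"
      by (rule fmeasurable_UN_bound[OF C(1) _ fin]) auto
    show "measure lebesgue (\<Union>i\<in>C. cball (c i) (5 * \<rho> i)) \<le> \<eta>"
      by (rule measure_UN_bound[OF C(1) _ fin]) auto
  qed
qed

text \<open>Differentiability fails at an interior point only if the quotient is off by more than
  some 1/(n+1) arbitrarily close to it; each of these countably many exceptional sets is
  negligible.\<close>

lemma AE_deriv_integral:
  fixes h :: "real \<Rightarrow> complex"
  assumes h: "h integrable_on {a..b}"
  shows "AE x in lebesgue_on {a<..<b}. ((\<lambda>x. integral {a..x} h) has_vector_derivative h x) (at x)"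
proof -
  define B where "B n = {x \<in> {a<..<b}. \<forall>d>0. \<exists>y\<in>{a..b}. y \<noteq> x \<and> \<bar>y - x\<bar> < d \<and>
     cmod (integral {a..y} h - integral {a..x} h - (y - x) *\<^sub>R h x) > inverse (real (Suc n)) * \<bar>y - x\<bar>}" for n
  have "negligible (\<Union>n. B n)"
    unfolding B_def by (intro negligible_Union_nat negligible_bad_difference_quotient h) auto
  then have N: "(\<Union>n. B n) \<in> null_sets lebesgue" by (simp add: negligible_iff_null_sets)
  have D: "((\<lambda>x. integral {a..x} h) has_vector_derivative h x) (at x)" if x: "x \<in> {a<..<b}" "x \<notin> (\<Union>n. B n)" for x
    unfolding has_vector_derivative_def has_derivative_at_alt
  proof (intro conjI bounded_linear_scaleR_left allI impI)
    fix e :: real assume "e > 0"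
    then obtain n where n: "inverse (real (Suc n)) < e" using reals_Archimedean by blast
    have "x \<notin> B n" using x by blast
    then have "\<exists>d>0. \<forall>y\<in>{a..b}. y \<noteq> x \<and> \<bar>y - x\<bar> < d \<longrightarrow>
       \<not> cmod (integral {a..y} h - integral {a..x} h - (y - x) *\<^sub>R h x) > inverse (real (Suc n)) * \<bar>y - x\<bar>"
      using x(1) unfolding B_def by blast
    then obtain d where d: "d > 0" "\<And>y. y \<in> {a..b} \<Longrightarrow> y \<noteq> x \<Longrightarrow> \<bar>y - x\<bar> < d \<Longrightarrow>
       cmod (integral {a..y} h - integral {a..x} h - (y - x) *\<^sub>R h x) \<le> inverse (real (Suc n)) * \<bar>y - x\<bar>"
      unfolding not_less by blast
    \<comment> \<open>The two extra bounds keep \<open>y\<close> inside [a,b], where the difference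
      quotient is controlled.\<close>
    define d' where "d' = min d (min (x - a) (b - x))"
    have "d' > 0" using d(1) x(1) by (auto simp: d'_def)
    moreover have "cmod (integral {a..y} h - integral {a..x} h - (y - x) *\<^sub>R h x) \<le> e * norm (y - x)"
      if "norm (y - x) < d'" for y
    proof (cases "y = x")
      case False
      have "y \<in> {a..b}" "\<bar>y - x\<bar> < d" using that unfolding d'_def by auto
      from d(2)[OF this(1) False this(2)] have "cmod (integral {a..y} h - integral {a..x} h - (y - x) *\<^sub>R h x)
         \<le> inverse (real (Suc n)) * \<bar>y - x\<bar>" .
      also have "\<dots> \<le> e * \<bar>y - x\<bar>" using n by (intro mult_right_mono) auto
      finally show ?thesis by simp
    qed simp
    ultimately show "\<exists>d>0. \<forall>y. norm (y - x) < d \<longrightarrow>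
        norm (integral {a..y} h - integral {a..x} h - (y - x) *\<^sub>R h x) \<le> e * norm (y - x)" by blast
  qed
  have "AE x in lebesgue. x \<in> {a<..<b} \<longrightarrow> ((\<lambda>x. integral {a..x} h) has_vector_derivative h x) (at x)"
    by (rule AE_I'[OF N]) (use D in blast)
  then show ?thesis by (subst AE_restrict_space_iff) auto
qed

section \<open>Fundamental theorem of calculus for absolutely continuous functions\<close>

lemma AC_C1:
  assumes "\<And>x. x \<in> {a..b} \<Longrightarrow> (f has_vector_derivative f' x) (at x within {a..b})"
    and "continuous_on {a..b} f'"
  shows "AC a b f"
proof -
  have "bounded (f' ` {a..b})" by (intro compact_imp_bounded compact_continuous_image assms(2)) simp
  then obtain B where B: "\<And>x. x \<in> {a..b} \<Longrightarrow> cmod (f' x) \<le> B" unfolding bounded_iff by blast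
  show ?thesis
  proof (rule AC_lipschitz)
    fix x y assume "x \<in> {a..b}" "y \<in> {a..b}"
    then have "norm (f x - f y) \<le> B * norm (x - y)"
    proof (intro differentiable_bound[where S = "{a..b}" and f' = "\<lambda>x t. t *\<^sub>R f' x"])
      fix u assume u: "u \<in> {a..b}"
      show "onorm (\<lambda>t. t *\<^sub>R f' u) \<le> B"
        using B[OF u] by (intro onorm_le) (simp add: mult.commute[of B] mult_left_mono)
    qed (use assms(1) in \<open>auto simp: has_vector_derivative_def\<close>)
    then show "cmod (f x - f y) \<le> B * \<bar>x - y\<bar>" by simp
  qed
qed

text \<open>The difference of \<open>F\<close> and the integral of \<open>f\<close> is absolutely
  continuous with derivative 0 almost everywhere, hence constant.\<close>

lemma AC_eq_integral:
  assumes F: "AC a b F" and f: "f absolutely_integrable_on {a..b}"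
    and D: "AE x in lebesgue_on {a<..<b}. (F has_vector_derivative f x) (at x)"
    and x: "x \<in> {a..b}"
  shows "F x = F a + integral {a..x} f"
proof -
  define G where "G x = F x - integral {a..x} f" for x
  have fi: "f integrable_on {a..b}" using f by (rule set_lebesgue_integral_eq_integral(1))
  have "AC a b G" unfolding G_def by (intro AC_diff F AC_integral f)
  then have AG: "AC a x G" by (rule AC_subinterval) (use x in auto)
  have "AE t in lebesgue_on {a<..<b}. (G has_vector_derivative 0) (at t)"
    using D AE_deriv_integral[OF fi]
  proof eventually_elim
    case (elim t)
    from has_vector_derivative_diff[OF elim] show ?case unfolding G_def by simp
  qed
  then have "AE t in lebesgue. t \<in> {a<..<b} \<longrightarrow> (G has_vector_derivative 0) (at t)"
    by (subst (asm) AE_restrict_space_iff) auto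
  then have "AE t in lebesgue. t \<in> {a<..<x} \<longrightarrow> (G has_vector_derivative 0) (at t)"
    by eventually_elim (use x in auto)
  then have "AE t in lebesgue_on {a<..<x}. (G has_vector_derivative 0) (at t)"
    by (subst AE_restrict_space_iff) auto
  from AC_deriv_zero_eq[OF AG _ this] x have "G x = G a" by simp
  then show ?thesis by (simp add: G_def algebra_simps)
qed

text \<open>\<open>AC_derivs\<close> asks for the first derivative at every point of the closed
  interval, one-sided at its ends. A continuous derivative known almost everywhere gives this, since
  \<open>F\<close> is then the integral of a continuous function.\<close>

lemma AC_continuous_deriv:
  assumes F: "AC a b F" and f: "continuous_on {a..b} f"
    and D: "AE x in lebesgue_on {a<..<b}. (F has_vector_derivative f x) (at x)"
    and x: "x \<in> {a..b}"
  shows "(F has_vector_derivative f x) (at x within {a..b})"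
proof -
  have "f absolutely_integrable_on {a..b}"
    using f absolutely_integrable_continuous[of a b f] by (simp add: box_real)
  then have E: "F t = F a + integral {a..t} f" if "t \<in> {a..b}" for t
    using AC_eq_integral[OF F _ D that] by blast
  have "((\<lambda>t. F a + integral {a..t} f) has_vector_derivative f x) (at x within {a..b})"
    using has_vector_derivative_add[OF has_vector_derivative_const integral_has_vector_derivative[OF f x]] by simp
  then show ?thesis
    by (rule has_vector_derivative_transform[OF x E, rotated])
qed

section \<open>The free equation\<close>

definition free_cos :: "complex \<Rightarrow> real \<Rightarrow> complex" where
  "free_cos z x = cos (csqrt z * of_real x)"

text \<open>The removable singularity at \<open>z = 0\<close> is filled by its limit, so that
  \<open>free_cos\<close> and \<open>free_sin\<close> are a fundamental system with unit initial
  data for every \<open>z\<close>, including the point where formulas with the square root in a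
  denominator break down.\<close>

definition free_sin :: "complex \<Rightarrow> real \<Rightarrow> complex" where
  "free_sin z x = (if z = 0 then of_real x else sin (csqrt z * of_real x) / csqrt z)"

lemma free_cos_0 [simp]: "free_cos z 0 = 1" and free_sin_0 [simp]: "free_sin z 0 = 0"
  by (simp_all add: free_cos_def free_sin_def)

lemma csqrt_times_csqrt: "csqrt z * (csqrt z * w) = z * w"
  by (metis mult.assoc power2_csqrt power2_eq_square)

lemma free_cos_deriv: "(free_cos z has_vector_derivative - (z * free_sin z x)) (at x within S)"
proof -
  have "(free_cos z has_vector_derivative - (csqrt z * sin (csqrt z * of_real x))) (at x within S)"
    unfolding free_cos_def[abs_def]
    by (rule has_vector_derivative_real_field) (auto intro!: derivative_eq_intros)
  moreover have "csqrt z * sin (csqrt z * of_real x) = z * free_sin z x"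
    by (simp add: free_sin_def field_simps csqrt_times_csqrt)
  ultimately show ?thesis by simp
qed

lemma free_sin_deriv: "(free_sin z has_vector_derivative free_cos z x) (at x within S)"
proof (cases "z = 0")
  case True
  then show ?thesis unfolding free_sin_def[abs_def] free_cos_def
    by (auto intro!: has_vector_derivative_real_field derivative_eq_intros)
next
  case False
  then show ?thesis unfolding free_sin_def[abs_def] free_cos_def
    by (auto intro!: has_vector_derivative_real_field derivative_eq_intros)
qed

lemma continuous_on_free_cos [continuous_intros]: "continuous_on S (free_cos z)"
  and continuous_on_free_sin [continuous_intros]: "continuous_on S (free_sin z)"
  by (auto intro!: continuous_at_imp_continuous_on has_vector_derivative_continuous free_cos_deriv free_sin_deriv)

lemma AC_free_cos: "AC a b (free_cos z)"
  by (rule AC_C1[OF free_cos_deriv]) (intro continuous_intros)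

lemma AC_free_sin: "AC a b (free_sin z)"
  by (rule AC_C1[OF free_sin_deriv]) (intro continuous_intros)

text \<open>The left-hand side is the Wronskian c s' - c' s, because s' = c and c' = -z s.\<close>

lemma free_wronskian: "free_cos z x * free_cos z x + z * free_sin z x * free_sin z x = 1"
proof (cases "z = 0")
  case False
  have "csqrt z * csqrt z = z" by (metis power2_csqrt power2_eq_square)
  then have "z * free_sin z x * free_sin z x = sin (csqrt z * of_real x) * sin (csqrt z * of_real x)"
    using False by (simp add: free_sin_def field_simps)
  then show ?thesis unfolding free_cos_def by (metis sin_cos_squared_add3)
qed (simp add: free_cos_def free_sin_def)

text \<open>Separation of variables in the convolution kernel: this is why the triangular part of
  the Green's function has rank two.\<close>

lemma free_sin_diff: "free_sin z (x - t) = free_sin z x * free_cos z t - free_cos z x * free_sin z t"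
  by (simp add: free_sin_def free_cos_def sin_diff right_diff_distrib diff_divide_distrib)

section \<open>Variation of parameters\<close>

lemma absolutely_integrable_continuous_mult:
  fixes h :: "real \<Rightarrow> complex"
  assumes q: "continuous_on {a..b} q" and h: "h absolutely_integrable_on {a..b}"
  shows "(\<lambda>x. q x * h x) absolutely_integrable_on {a..b}"
  by (rule absolutely_integrable_bounded_measurable_product[where h = "(*)"])
     (use q h in \<open>auto simp: bilinear_conv_bounded_bilinear intro!: bounded_bilinear_mult continuous_imp_measurable_on_sets_lebesgue compact_imp_bounded compact_continuous_image\<close>)

lemma absolutely_integrable_on_initial:
  fixes a b x :: real
  shows "h absolutely_integrable_on {a..b} \<Longrightarrow> x \<in> {a..b} \<Longrightarrow> h absolutely_integrable_on {a..x}"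
  by (rule set_integrable_subset) auto

text \<open>The coefficients are chosen with A' = s h and B' = -c h almost everywhere. Then c A' + s
  B' = 0 and c' A' + s' B' = -h by the free Wronskian, so \<open>g\<close> solves g'' = -z g -
  h.\<close>

lemma variation_of_parameters:
  fixes h :: "real \<Rightarrow> complex" and \<omega> :: real and \<alpha> \<beta> z :: complex
  assumes h: "h absolutely_integrable_on {0..\<omega>}"
  defines "A \<equiv> \<lambda>x. \<alpha> + integral {0..x} (\<lambda>t. free_sin z t * h t)"
    and "B \<equiv> \<lambda>x. \<beta> - integral {0..x} (\<lambda>t. free_cos z t * h t)"
  defines "g \<equiv> \<lambda>x. free_cos z x * A x + free_sin z x * B x"
    and "g1 \<equiv> \<lambda>x. - (z * free_sin z x) * A x + free_cos z x * B x"
  shows "AC_derivs \<omega> g g1 (\<lambda>x. - z * g x - h x)"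
proof -
  have sh: "(\<lambda>t. free_sin z t * h t) absolutely_integrable_on {0..\<omega>}"
    and ch: "(\<lambda>t. free_cos z t * h t) absolutely_integrable_on {0..\<omega>}"
    by (intro absolutely_integrable_continuous_mult h continuous_intros)+
  have AA: "AC 0 \<omega> A" "AC 0 \<omega> B"
    unfolding A_def B_def by (intro AC_add AC_diff AC_const AC_integral sh ch)+
  have ACg: "AC 0 \<omega> g" unfolding g_def by (intro AC_add AC_mult AC_free_cos AC_free_sin AA)
  have ACg1: "AC 0 \<omega> g1"
    unfolding g1_def minus_mult_left by (intro AC_add AC_mult AC_cmult[where c = "- z"] AC_free_cos AC_free_sin AA)
  have D: "AE x in interval_measure \<omega>. (g has_vector_derivative g1 x) (at x) \<and>
      (g1 has_vector_derivative (- z * g x - h x)) (at x)"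
    using AE_deriv_integral[OF set_lebesgue_integral_eq_integral(1)[OF sh]]
      AE_deriv_integral[OF set_lebesgue_integral_eq_integral(1)[OF ch]]
  proof eventually_elim
    case (elim x)
    have dA: "(A has_vector_derivative free_sin z x * h x) (at x)"
      unfolding A_def using has_vector_derivative_add[OF has_vector_derivative_const elim(1)] by simp
    have dB: "(B has_vector_derivative - (free_cos z x * h x)) (at x)"
      unfolding B_def using has_vector_derivative_diff[OF has_vector_derivative_const elim(2)] by simp
    note mult = has_vector_derivative_mult
    have "(g has_vector_derivative free_cos z x * (free_sin z x * h x) + - (z * free_sin z x) * A x
        + (free_sin z x * - (free_cos z x * h x) + free_cos z x * B x)) (at x)"
      unfolding g_def by (intro has_vector_derivative_add mult free_cos_deriv free_sin_deriv dA dB)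
    then have 1: "(g has_vector_derivative g1 x) (at x)"
      by (simp add: g1_def algebra_simps)
    have "(g1 has_vector_derivative - (z * free_sin z x) * (free_sin z x * h x) + - (z * free_cos z x) * A x
        + (free_cos z x * - (free_cos z x * h x) + - (z * free_sin z x) * B x)) (at x)"
      unfolding g1_def
      by (intro has_vector_derivative_add mult free_cos_deriv dA dB has_vector_derivative_minus
          has_vector_derivative_mult_right free_sin_deriv)
    moreover have "- (z * free_sin z x) * (free_sin z x * h x) + - (z * free_cos z x) * A x
        + (free_cos z x * - (free_cos z x * h x) + - (z * free_sin z x) * B x)
        = - z * g x - (free_cos z x * free_cos z x + z * free_sin z x * free_sin z x) * h x"
      by (simp add: g_def algebra_simps)
    ultimately have 2: "(g1 has_vector_derivative (- z * g x - h x)) (at x)"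
      by (simp add: free_wronskian)
    from 1 2 show ?case ..
  qed
  \<comment> \<open>The almost everywhere statement for \<open>g\<close> improves to every point
    because \<open>g1\<close> is continuous; for \<open>g1\<close> it stays almost
    everywhere.\<close>
  have "(g has_vector_derivative g1 x) (at x within {0..\<omega>})" if "x \<in> {0..\<omega>}" for x
    by (rule AC_continuous_deriv[OF ACg AC_continuous_on[OF ACg1] _ that]) (use D in auto)
  then show ?thesis
    unfolding AC_derivs_def using ACg ACg1 D by auto
qed

section \<open>The Schroedinger equation with an integrable potential\<close>

text \<open>The primitive \<open>v\<close> of |V| has derivative |V| almost everywhere, so
  \<open>v^(n+1)/(n+1)\<close> is a primitive of the integrand. This produces the factorials in the
  Picard iteration, where \<open>V\<close> itself has no bound.\<close>

lemma integral_times_power_integral: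
  fixes V :: "real \<Rightarrow> complex" and x \<omega> :: real
  assumes V: "V absolutely_integrable_on {0..\<omega>}" and x: "x \<in> {0..\<omega>}"
  defines "v \<equiv> \<lambda>x. integral {0..x} (\<lambda>t. cmod (V t))"
  shows "((\<lambda>t. cmod (V t) * v t ^ n) has_integral v x ^ Suc n / real (Suc n)) {0..x}"
proof -
  \<comment> \<open>A complex-valued copy of \<open>v\<close>, since absolute continuity is defined
    for complex functions.\<close>
  define w where "w = (\<lambda>x. integral {0..x} (\<lambda>t. complex_of_real (cmod (V t))))"
  have Vc: "(\<lambda>t. complex_of_real (cmod (V t))) absolutely_integrable_on {0..\<omega>}"
    using absolutely_integrable_norm[OF V] absolutely_integrable_linear[OF _ bounded_linear_of_real]
    by (fastforce simp: o_def)
  have wv: "w t = of_real (v t)" if "t \<in> {0..\<omega>}" for t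
  proof -
    have "(\<lambda>t. cmod (V t)) integrable_on {0..t}"
      using absolutely_integrable_on_initial[OF absolutely_integrable_norm[OF V] that]
      by (auto simp: o_def absolutely_integrable_on_def)
    from integral_linear[OF this bounded_linear_of_real] show ?thesis unfolding w_def v_def by (simp add: o_def)
  qed
  have ACw: "AC 0 \<omega> w" unfolding w_def by (rule AC_integral[OF Vc])
  have ACp: "AC 0 \<omega> (\<lambda>x. w x ^ m)" for m
    by (induction m) (auto intro: AC_const AC_mult ACw)
  have Vp: "(\<lambda>t. w t ^ n * complex_of_real (cmod (V t))) absolutely_integrable_on {0..\<omega>}"
    by (intro absolutely_integrable_continuous_mult Vc AC_continuous_on ACp)
  have "AE t in interval_measure \<omega>. ((\<lambda>x. w x ^ Suc n) has_vector_derivative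
      of_nat (Suc n) * (w t ^ n * complex_of_real (cmod (V t)))) (at t)"
    using AE_deriv_integral[OF set_lebesgue_integral_eq_integral(1)[OF Vc]]
  proof eventually_elim
    case (elim t)
    then have "(w has_vector_derivative complex_of_real (cmod (V t))) (at t)" by (simp add: w_def)
    moreover have "((\<lambda>y. y ^ Suc n) has_field_derivative of_nat (Suc n) * w t ^ n) (at (w t) within range w)"
      by (rule derivative_eq_intros refl | simp)+
    ultimately have "((\<lambda>y. y ^ Suc n) \<circ> w has_vector_derivative complex_of_real (cmod (V t)) * (of_nat (Suc n) * w t ^ n)) (at t)"
      by (rule field_vector_diff_chain_within)
    then show ?case by (simp add: o_def mult_ac del: of_nat_Suc power_Suc)
  qed
  from AC_eq_integral[OF ACp absolutely_integrable_continuous_mult[OF continuous_on_const Vp] this x]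
  have "w x ^ Suc n = integral {0..x} (\<lambda>t. of_nat (Suc n) * (w t ^ n * complex_of_real (cmod (V t))))"
    by (simp add: w_def)
  also have "\<dots> = of_nat (Suc n) * integral {0..x} (\<lambda>t. w t ^ n * complex_of_real (cmod (V t)))"
    by simp
  finally have "integral {0..x} (\<lambda>t. w t ^ n * complex_of_real (cmod (V t))) = w x ^ Suc n / of_nat (Suc n)"
    by (simp add: field_simps del: of_nat_Suc)
  moreover have "(\<lambda>t. w t ^ n * complex_of_real (cmod (V t))) integrable_on {0..x}"
    using absolutely_integrable_on_initial[OF Vp x] by (simp add: absolutely_integrable_on_def)
  ultimately have "((\<lambda>t. w t ^ n * complex_of_real (cmod (V t))) has_integral w x ^ Suc n / of_nat (Suc n)) {0..x}"
    using integrable_integral by force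
  from has_integral_Re[OF this]
  have "((\<lambda>t. Re (w t ^ n * complex_of_real (cmod (V t)))) has_integral Re (w x ^ Suc n / of_nat (Suc n))) {0..x}" .
  moreover have "Re (w x ^ Suc n / of_nat (Suc n)) = v x ^ Suc n / real (Suc n)"
  proof -
    have "w x ^ Suc n / of_nat (Suc n) = complex_of_real (v x ^ Suc n / real (Suc n))"
      by (simp add: wv[OF x] del: of_nat_Suc power_Suc)
    then show ?thesis by (simp only: Re_complex_of_real)
  qed
  moreover have "Re (w t ^ n * complex_of_real (cmod (V t))) = cmod (V t) * v t ^ n" if "t \<in> {0..x}" for t
  proof -
    have "w t = of_real (v t)" using wv[of t] that x by auto
    then have "w t ^ n * complex_of_real (cmod (V t)) = of_real (cmod (V t) * v t ^ n)" by simp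
    then show ?thesis by (simp only: Re_complex_of_real)
  qed
  ultimately show ?thesis
    using has_integral_cong[of "{0..x}" "\<lambda>t. Re (w t ^ n * complex_of_real (cmod (V t)))" "\<lambda>t. cmod (V t) * v t ^ n"]
    by simp
qed

text \<open>Picard iteration with the Volterra operator \<Phi> of kernel
  \<open>free_sin z (x - t) * V t\<close>. The n-th iterate is at most B (C v(x))^n / n!, where
  \<open>v\<close> is the primitive of |V|, so the iterates sum uniformly although \<open>V\<close>
  may be unbounded.\<close>

lemma volterra_solution_exists:
  fixes V :: "real \<Rightarrow> complex"
  assumes V: "V absolutely_integrable_on {0..\<omega>}"
  obtains \<psi> where "continuous_on {0..\<omega>} \<psi>"
    "\<And>x. x \<in> {0..\<omega>} \<Longrightarrow> \<psi> x = free_cos z x * (\<alpha> - integral {0..x} (\<lambda>t. free_sin z t * (V t * \<psi> t)))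
        + free_sin z x * (\<beta> + integral {0..x} (\<lambda>t. free_cos z t * (V t * \<psi> t)))"
proof -
  define \<Phi> where "\<Phi> \<psi> x = free_sin z x * integral {0..x} (\<lambda>t. free_cos z t * (V t * \<psi> t))
      - free_cos z x * integral {0..x} (\<lambda>t. free_sin z t * (V t * \<psi> t))" for \<psi> x
  define y where "y = (\<lambda>x. free_cos z x * \<alpha> + free_sin z x * \<beta>)"
  define f where "f n = (\<Phi> ^^ n) y" for n
  define v where "v x = integral {0..x} (\<lambda>t. cmod (V t))" for x
  have ai: "(\<lambda>t. q t * (V t * \<psi> t)) absolutely_integrable_on {0..\<omega>}"
    if "continuous_on {0..\<omega>} q" "continuous_on {0..\<omega>} \<psi>" for q \<psi>
    using absolutely_integrable_continuous_mult[OF continuous_on_mult[OF that] V] by (simp add: mult_ac)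
  have ai': "(\<lambda>t. q t * (V t * \<psi> t)) integrable_on {0..x}"
    if "continuous_on {0..\<omega>} q" "continuous_on {0..\<omega>} \<psi>" "x \<in> {0..\<omega>}" for q \<psi> x
    using absolutely_integrable_on_initial[OF ai[OF that(1,2)] that(3)] by (simp add: absolutely_integrable_on_def)
  have cont\<Phi>: "continuous_on {0..\<omega>} (\<Phi> \<psi>)" if "continuous_on {0..\<omega>} \<psi>" for \<psi>
    unfolding \<Phi>_def using that
    by (intro continuous_intros AC_continuous_on[OF AC_integral] ai)
  have cf: "continuous_on {0..\<omega>} (f n)" for n
    unfolding f_def by (induction n) (auto intro!: cont\<Phi> continuous_intros simp: y_def)
  have \<Phi>eq: "\<Phi> \<psi> x = integral {0..x} (\<lambda>t. free_sin z (x - t) * (V t * \<psi> t))"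
    if "continuous_on {0..\<omega>} \<psi>" "x \<in> {0..\<omega>}" for \<psi> x
  proof -
    have i: "(\<lambda>t. free_cos z t * (V t * \<psi> t)) integrable_on {0..x}" "(\<lambda>t. free_sin z t * (V t * \<psi> t)) integrable_on {0..x}"
      by (intro ai' that continuous_intros)+
    have "integral {0..x} (\<lambda>t. free_sin z (x - t) * (V t * \<psi> t)) =
       integral {0..x} (\<lambda>t. free_sin z x * (free_cos z t * (V t * \<psi> t)) - free_cos z x * (free_sin z t * (V t * \<psi> t)))"
      by (simp add: free_sin_diff algebra_simps)
    also have "\<dots> = \<Phi> \<psi> x" unfolding \<Phi>_def using i
      by (subst Henstock_Kurzweil_Integration.integral_diff) (auto intro!: integrable_on_mult_right)
    finally show ?thesis by simp
  qed
  have "bounded (free_sin z ` {0..\<omega>})"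
    by (intro compact_imp_bounded compact_continuous_image continuous_intros) simp
  then obtain C where C: "C > 0" "\<And>x. x \<in> {0..\<omega>} \<Longrightarrow> cmod (free_sin z x) \<le> C" unfolding bounded_pos by blast
  have "bounded (y ` {0..\<omega>})" unfolding y_def
    by (intro compact_imp_bounded compact_continuous_image continuous_intros) simp
  then obtain B where B: "B > 0" "\<And>x. x \<in> {0..\<omega>} \<Longrightarrow> cmod (y x) \<le> B" unfolding bounded_pos by blast
  have bnd: "cmod (f n x) \<le> B * (C * v x) ^ n / fact n" if "x \<in> {0..\<omega>}" for n x
    using that
  proof (induction n arbitrary: x)
    case 0 then show ?case using B by (simp add: f_def)
  next
    case (Suc n)
    have "cmod (f (Suc n) x) = cmod (integral {0..x} (\<lambda>t. free_sin z (x - t) * (V t * f n t)))"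
      using \<Phi>eq[OF cf Suc.prems] by (simp add: f_def)
    also have "\<dots> \<le> integral {0..x} (\<lambda>t. B * C ^ Suc n / fact n * (cmod (V t) * v t ^ n))"
    proof (rule integral_norm_bound_integral)
      have "(\<lambda>t. free_sin z x * (free_cos z t * (V t * f n t)) - free_cos z x * (free_sin z t * (V t * f n t))) integrable_on {0..x}"
        by (intro integrable_diff integrable_on_mult_right ai' cf Suc.prems continuous_intros)
      then show "(\<lambda>t. free_sin z (x - t) * (V t * f n t)) integrable_on {0..x}"
        by (simp add: free_sin_diff algebra_simps)
      show "(\<lambda>t. B * C ^ Suc n / fact n * (cmod (V t) * v t ^ n)) integrable_on {0..x}"
        using integral_times_power_integral[OF V Suc.prems, of n] unfolding v_def
        by (intro integrable_on_mult_right) blast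
      fix t assume t: "t \<in> {0..x}"
      then have t': "t \<in> {0..\<omega>}" "x - t \<in> {0..\<omega>}" using Suc.prems by auto
      have "cmod (free_sin z (x - t) * (V t * f n t)) = cmod (free_sin z (x - t)) * cmod (V t) * cmod (f n t)"
        by (simp add: norm_mult)
      also have "\<dots> \<le> C * cmod (V t) * (B * (C * v t) ^ n / fact n)"
        using C(1) by (intro mult_mono C(2)[OF t'(2)] Suc.IH[OF t'(1)] mult_nonneg_nonneg) auto
      also have "\<dots> = B * C ^ Suc n / fact n * (cmod (V t) * v t ^ n)"
        by (simp add: power_mult_distrib field_simps)
      finally show "cmod (free_sin z (x - t) * (V t * f n t)) \<le> B * C ^ Suc n / fact n * (cmod (V t) * v t ^ n)" .
    qed
    also have "\<dots> = B * C ^ Suc n / fact n * (v x ^ Suc n / real (Suc n))"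
      using integral_times_power_integral[OF V Suc.prems, of n] unfolding v_def
      by (simp only: integral_mult_right integral_unique)
    also have "\<dots> = B * (C * v x) ^ Suc n / fact (Suc n)"
      by (simp add: power_mult_distrib field_simps)
    finally show ?case .
  qed
  have Vn: "(\<lambda>t. cmod (V t)) integrable_on {0..x}" if "x \<in> {0..\<omega>}" for x
    using absolutely_integrable_on_initial[OF V that] by (simp add: absolutely_integrable_on_def)
  have v0: "0 \<le> v x" for x 
    by (cases "(\<lambda>t. cmod (V t)) integrable_on {0..x}") (auto simp: v_def not_integrable_integral intro: integral_nonneg)
  have vmono: "v x \<le> v \<omega>" if "x \<in> {0..\<omega>}" for x
    unfolding v_def using that Vn[of \<omega>] Vn[of x] by (intro integral_subset_le) auto
  \<comment> \<open>Terms of an exponential series, used as majorants in the Weierstrass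
    test.\<close>
  define M where "M n = B * (C * v \<omega>) ^ n / fact n" for n
  have M: "summable M"
    unfolding M_def using summable_mult[OF summable_exp[of "C * v \<omega>"], of B] by (simp add: field_simps)
  have fM: "cmod (f n x) \<le> M n" if "x \<in> {0..\<omega>}" for n x
  proof -
    have "B * (C * v x) ^ n / fact n \<le> M n"
      unfolding M_def using B C v0 vmono[OF that]
      by (intro divide_right_mono mult_left_mono power_mono) auto
    with bnd[OF that, of n] show ?thesis by simp
  qed
  define \<psi> where "\<psi> x = (\<Sum>n. f n x)" for x
  have unif: "uniform_limit {0..\<omega>} (\<lambda>n x. \<Sum>i<n. f i x) \<psi> sequentially"
    unfolding \<psi>_def by (rule Weierstrass_m_test[OF _ M]) (use fM in auto)
  have c\<psi>: "continuous_on {0..\<omega>} \<psi>"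
    by (rule uniform_limit_theorem[OF always_eventually unif]) (intro allI continuous_on_sum cf, simp)
  define S where "S n x = (\<Sum>i<n. f i x)" for n x
  have cS: "continuous_on {0..\<omega>} (S n)" for n unfolding S_def by (intro continuous_intros cf)
  have S\<psi>: "(\<lambda>n. S n x) \<longlonglongrightarrow> \<psi> x" if "x \<in> {0..\<omega>}" for x
    using tendsto_uniform_limitI[OF unif that] by (simp add: S_def)
  have SM: "cmod (S n x) \<le> suminf M" if "x \<in> {0..\<omega>}" for n x
  proof -
    have "cmod (S n x) \<le> (\<Sum>i<n. M i)" unfolding S_def by (intro sum_norm_le fM that)
    also have "\<dots> \<le> suminf M" by (rule sum_le_suminf[OF M]) (use B C v0 in \<open>auto simp: M_def\<close>)
    finally show ?thesis .
  qed
  have lim: "(\<lambda>n. integral {0..x} (\<lambda>t. q t * (V t * S n t))) \<longlonglongrightarrow> integral {0..x} (\<lambda>t. q t * (V t * \<psi> t))"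
    if q: "continuous_on {0..\<omega>} q" and x: "x \<in> {0..\<omega>}" for q x
  proof -
    have "bounded (q ` {0..\<omega>})" by (intro compact_imp_bounded compact_continuous_image q) simp
    then obtain Q where Q: "Q > 0" "\<And>x. x \<in> {0..\<omega>} \<Longrightarrow> cmod (q x) \<le> Q" unfolding bounded_pos by blast
    show ?thesis
    proof (rule dominated_convergence(2)[where h = "\<lambda>t. Q * suminf M * cmod (V t)"])
      show "(\<lambda>t. Q * suminf M * cmod (V t)) integrable_on {0..x}" by (intro integrable_on_mult_right Vn x)
      show "(\<lambda>t. q t * (V t * S n t)) integrable_on {0..x}" for n by (intro ai' q cS x)
      fix n t assume t: "t \<in> {0..x}"
      then have t': "t \<in> {0..\<omega>}" using x by auto
      have "norm (q t * (V t * S n t)) = cmod (q t) * cmod (S n t) * cmod (V t)" by (simp add: norm_mult)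
      also have "\<dots> \<le> Q * suminf M * cmod (V t)"
        using Q(1) by (intro mult_right_mono mult_mono Q(2) SM t') auto
      finally show "norm (q t * (V t * S n t)) \<le> Q * suminf M * cmod (V t)" .
    next
      fix t assume "t \<in> {0..x}"
      then have "t \<in> {0..\<omega>}" using x by auto
      then show "(\<lambda>n. q t * (V t * S n t)) \<longlonglongrightarrow> q t * (V t * \<psi> t)" by (intro tendsto_intros S\<psi>)
    qed
  qed
  \<comment> \<open>The partial sums satisfy the fixed point equation with a shift of index; letting
    \<open>n\<close> tend to infinity, with dominated convergence in the integrals, gives the
    equation for the sum.\<close>
  have \<Phi>S: "S (Suc n) x = y x + \<Phi> (S n) x" if x: "x \<in> {0..\<omega>}" for n x
  proof (induction n)
    case 0 then show ?case by (simp add: S_def \<Phi>_def f_def)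
  next
    case (Suc n)
    have add: "integral {0..x} (\<lambda>t. q t * (V t * S (Suc n) t)) = integral {0..x} (\<lambda>t. q t * (V t * S n t)) + integral {0..x} (\<lambda>t. q t * (V t * f n t))"
      if q: "continuous_on {0..\<omega>} q" for q
      using Henstock_Kurzweil_Integration.integral_add[OF ai'[OF q cS[of n] x] ai'[OF q cf[of n] x]]
      by (simp add: S_def distrib_left)
    have "\<Phi> (S (Suc n)) x = \<Phi> (S n) x + \<Phi> (f n) x"
      unfolding \<Phi>_def add[OF continuous_on_free_sin] add[OF continuous_on_free_cos] by (simp add: algebra_simps)
    moreover have "S (Suc (Suc n)) x = S (Suc n) x + f (Suc n) x" by (simp add: S_def)
    moreover have "f (Suc n) x = \<Phi> (f n) x" by (simp add: f_def)
    ultimately show ?case using Suc by simp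
  qed
  have "\<psi> x = y x + \<Phi> \<psi> x" if x: "x \<in> {0..\<omega>}" for x
  proof (rule LIMSEQ_unique)
    show "(\<lambda>n. S (Suc n) x) \<longlonglongrightarrow> \<psi> x" using S\<psi>[OF x] by (rule LIMSEQ_Suc)
    have "(\<lambda>n. y x + \<Phi> (S n) x) \<longlonglongrightarrow> y x + \<Phi> \<psi> x"
      unfolding \<Phi>_def by (intro tendsto_intros lim x continuous_intros)
    then show "(\<lambda>n. S (Suc n) x) \<longlonglongrightarrow> y x + \<Phi> \<psi> x" by (simp add: \<Phi>S[OF x])
  qed
  then show ?thesis
    by (intro that[OF c\<psi>]) (simp add: y_def \<Phi>_def algebra_simps)
qed

section \<open>Wronskians and the Floquet discriminant\<close>

lemma AE_interval_subinterval:
  fixes P :: "real \<Rightarrow> bool"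
  assumes "AE x in lebesgue_on {a<..<b}. P x" "y \<le> b"
  shows "AE x in lebesgue_on {a<..<y}. P x"
proof -
  have "AE x in lebesgue. x \<in> {a<..<b} \<longrightarrow> P x"
    using assms(1) by (subst (asm) AE_restrict_space_iff) auto
  then have "AE x in lebesgue. x \<in> {a<..<y} \<longrightarrow> P x"
    by eventually_elim (use assms(2) in auto)
  then show ?thesis by (subst AE_restrict_space_iff) auto
qed

text \<open>The two second derivatives carry the same factor V - z, so the derivative of the
  Wronskian cancels almost everywhere. The lemma serves for the unit determinant and for uniqueness
  of the solutions.\<close>

lemma schroedinger_wronskian_const:
  assumes f: "schroedinger_solution \<omega> V z f f1" and g: "schroedinger_solution \<omega> V z g g1"
    and x: "x \<in> {0..\<omega>}"
  shows "f x * g1 x - f1 x * g x = f 0 * g1 0 - f1 0 * g 0"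
proof -
  define W where "W x = f x * g1 x - f1 x * g x" for x
  have AC: "AC 0 \<omega> f" "AC 0 \<omega> f1" "AC 0 \<omega> g" "AC 0 \<omega> g1"
    using f g unfolding schroedinger_solution_def AC_derivs_def by auto
  have ACW: "AC 0 \<omega> W" unfolding W_def by (intro AC_diff AC_mult AC)
  have d: "(h has_vector_derivative h1 t) (at t)" if "schroedinger_solution \<omega> V z h h1" "t \<in> {0<..<\<omega>}" for h h1 t
  proof -
    have "(h has_vector_derivative h1 t) (at t within {0..\<omega>})"
      using that unfolding schroedinger_solution_def AC_derivs_def by auto
    moreover have "at t within {0..\<omega>} = at t" using that(2) by (intro at_within_interior) auto
    ultimately show ?thesis by simp
  qed
  have "AE t in interval_measure \<omega>. t \<in> {0<..<\<omega>}"
    using AE_space[of "interval_measure \<omega>"] by simp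
  moreover have "AE t in interval_measure \<omega>. (f1 has_vector_derivative (V t - z) * f t) (at t)"
    "AE t in interval_measure \<omega>. (g1 has_vector_derivative (V t - z) * g t) (at t)"
    using f g unfolding schroedinger_solution_def AC_derivs_def by auto
  ultimately have "AE t in interval_measure \<omega>. (W has_vector_derivative 0) (at t)"
  proof eventually_elim
    case (elim t)
    have "(W has_vector_derivative (f t * ((V t - z) * g t) + f1 t * g1 t) - (f1 t * g1 t + ((V t - z) * f t) * g t)) (at t)"
      unfolding W_def by (intro has_vector_derivative_diff has_vector_derivative_mult d[OF f] d[OF g] elim)
    then show ?case by (simp add: algebra_simps)
  qed
  then have "AE t in lebesgue_on {0<..<x}. (W has_vector_derivative 0) (at t)"
    by (rule AE_interval_subinterval) (use x in auto)
  then have "W x = W 0"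
    using AC_deriv_zero_eq[OF AC_subinterval[OF ACW order.refl]] x by simp
  then show ?thesis by (simp add: W_def)
qed

text \<open>(C1, C2) and (S1, S2) are the coordinates of the two solutions in the free fundamental
  system. Their matrix at \<omega> has determinant 1, and the discriminant is half the trace of the
  free monodromy matrix times it. These coordinates are what the grid recursion
  approximates.\<close>

lemma floquet_discriminant_eq:
  assumes \<omega>: "\<omega> > 0" and V: "V absolutely_integrable_on {0..\<omega>}"
  obtains c s C1 C2 S1 S2 where
    "continuous_on {0..\<omega>} c" "continuous_on {0..\<omega>} s"
    "\<And>x. C1 x = 1 - integral {0..x} (\<lambda>t. free_sin z t * (V t * c t))"
    "\<And>x. C2 x = integral {0..x} (\<lambda>t. free_cos z t * (V t * c t))"
    "\<And>x. S1 x = - integral {0..x} (\<lambda>t. free_sin z t * (V t * s t))"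
    "\<And>x. S2 x = 1 + integral {0..x} (\<lambda>t. free_cos z t * (V t * s t))"
    "\<And>x. x \<in> {0..\<omega>} \<Longrightarrow> c x = free_cos z x * C1 x + free_sin z x * C2 x"
    "\<And>x. x \<in> {0..\<omega>} \<Longrightarrow> s x = free_cos z x * S1 x + free_sin z x * S2 x"
    "C1 \<omega> * S2 \<omega> - S1 \<omega> * C2 \<omega> = 1"
    "floquet_discriminant \<omega> V z = (free_cos z \<omega> * C1 \<omega> + free_sin z \<omega> * C2 \<omega>
        - z * free_sin z \<omega> * S1 \<omega> + free_cos z \<omega> * S2 \<omega>) / 2"
proof -
  obtain c where c: "continuous_on {0..\<omega>} c"
    "\<And>x. x \<in> {0..\<omega>} \<Longrightarrow> c x = free_cos z x * (1 - integral {0..x} (\<lambda>t. free_sin z t * (V t * c t)))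
        + free_sin z x * (0 + integral {0..x} (\<lambda>t. free_cos z t * (V t * c t)))"
    using volterra_solution_exists[OF V] by blast
  obtain s where s: "continuous_on {0..\<omega>} s"
    "\<And>x. x \<in> {0..\<omega>} \<Longrightarrow> s x = free_cos z x * (0 - integral {0..x} (\<lambda>t. free_sin z t * (V t * s t)))
        + free_sin z x * (1 + integral {0..x} (\<lambda>t. free_cos z t * (V t * s t)))"
    using volterra_solution_exists[OF V] by blast
  define C1 where "C1 x = 1 - integral {0..x} (\<lambda>t. free_sin z t * (V t * c t))" for x
  define C2 where "C2 x = integral {0..x} (\<lambda>t. free_cos z t * (V t * c t))" for x
  define S1 where "S1 x = - integral {0..x} (\<lambda>t. free_sin z t * (V t * s t))" for x
  define S2 where "S2 x = 1 + integral {0..x} (\<lambda>t. free_cos z t * (V t * s t))" for x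
  have ceq: "c x = free_cos z x * C1 x + free_sin z x * C2 x" if "x \<in> {0..\<omega>}" for x
    using c(2)[OF that] by (simp add: C1_def C2_def)
  have seq: "s x = free_cos z x * S1 x + free_sin z x * S2 x" if "x \<in> {0..\<omega>}" for x
    using s(2)[OF that] by (simp add: S1_def S2_def)
  have sol: "schroedinger_solution \<omega> V z \<psi> \<psi>1"
    if \<psi>: "continuous_on {0..\<omega>} \<psi>"
      "\<And>x. x \<in> {0..\<omega>} \<Longrightarrow> \<psi> x = free_cos z x * (\<alpha> - integral {0..x} (\<lambda>t. free_sin z t * (V t * \<psi> t)))
        + free_sin z x * (\<beta> + integral {0..x} (\<lambda>t. free_cos z t * (V t * \<psi> t)))"
      and \<psi>1: "\<And>x. \<psi>1 x = - (z * free_sin z x) * (\<alpha> - integral {0..x} (\<lambda>t. free_sin z t * (V t * \<psi> t)))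
        + free_cos z x * (\<beta> + integral {0..x} (\<lambda>t. free_cos z t * (V t * \<psi> t)))" for \<psi> \<psi>1 \<alpha> \<beta>
  proof -
    define g where "g x = free_cos z x * (\<alpha> - integral {0..x} (\<lambda>t. free_sin z t * (V t * \<psi> t)))
        + free_sin z x * (\<beta> + integral {0..x} (\<lambda>t. free_cos z t * (V t * \<psi> t)))" for x
    \<comment> \<open>A solution of the integral equation is the variation of parameters formula for
      the inhomogeneity h = -V \<psi>.\<close>
    have "(\<lambda>t. (- \<psi> t) * V t) absolutely_integrable_on {0..\<omega>}"
      by (intro absolutely_integrable_continuous_mult V continuous_intros \<psi>(1))
    from variation_of_parameters[OF this, of z \<alpha> \<beta>]
    have *: "AC_derivs \<omega> g \<psi>1 (\<lambda>x. - z * g x - (- \<psi> x) * V x)"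
      unfolding g_def[abs_def] \<psi>1[abs_def] by (simp add: mult_ac)
    have g: "\<psi> x = g x" if "x \<in> {0..\<omega>}" for x using \<psi>(2)[OF that] by (simp add: g_def)
    show ?thesis unfolding schroedinger_solution_def AC_derivs_def
    proof (intro conjI ballI)
      show "AC 0 \<omega> \<psi>" using * g unfolding AC_derivs_def by (metis AC_cong)
      show "AC 0 \<omega> \<psi>1" using * unfolding AC_derivs_def by simp
      fix x assume x: "x \<in> {0..\<omega>}"
      with * have "(g has_vector_derivative \<psi>1 x) (at x within {0..\<omega>})" unfolding AC_derivs_def by simp
      then show "(\<psi> has_vector_derivative \<psi>1 x) (at x within {0..\<omega>})"
        by (rule has_vector_derivative_transform[OF x, rotated]) (use g in auto)
    next
      have "AE x in interval_measure \<omega>. (\<psi>1 has_vector_derivative (- z * g x - (- \<psi> x) * V x)) (at x)"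
        using * unfolding AC_derivs_def by simp
      moreover have "AE t in interval_measure \<omega>. t \<in> {0<..<\<omega>}"
        using AE_space[of "interval_measure \<omega>"] by simp
      ultimately show "AE x in interval_measure \<omega>. (\<psi>1 has_vector_derivative ((V x - z) * \<psi> x)) (at x)"
        by eventually_elim (simp add: g[symmetric] algebra_simps)
    qed
  qed
  define c1 where "c1 x = - (z * free_sin z x) * C1 x + free_cos z x * C2 x" for x
  define s1 where "s1 x = - (z * free_sin z x) * S1 x + free_cos z x * S2 x" for x
  have csol: "schroedinger_solution \<omega> V z c c1"
    by (rule sol[OF c]) (simp_all add: c1_def C1_def C2_def)
  have ssol: "schroedinger_solution \<omega> V z s s1"
    by (rule sol[OF s]) (simp_all add: s1_def S1_def S2_def)
  have init: "c 0 = 1" "c1 0 = 0" "s 0 = 0" "s1 0 = 1"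
    using \<omega> by (simp_all add: ceq seq c1_def s1_def C1_def C2_def S1_def S2_def)
  have \<omega>in: "\<omega> \<in> {0..\<omega>}" using \<omega> by simp
  have W: "c \<omega> * s1 \<omega> - c1 \<omega> * s \<omega> = 1"
    using schroedinger_wronskian_const[OF csol ssol \<omega>in] init by simp
  \<comment> \<open>The Wronskians with \<open>c\<close> and \<open>s\<close> are determined by the
    initial data, and Cramer's rule recovers the data at \<omega> from them. This uniqueness makes
    the description in \<open>floquet_discriminant\<close> definite.\<close>
  have uniq: "\<psi> \<omega> = \<psi> 0 * c \<omega> + \<psi>1 0 * s \<omega> \<and> \<psi>1 \<omega> = \<psi> 0 * c1 \<omega> + \<psi>1 0 * s1 \<omega>"
    if "schroedinger_solution \<omega> V z \<psi> \<psi>1" for \<psi> \<psi>1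
  proof -
    have 1: "\<psi> \<omega> * c1 \<omega> - \<psi>1 \<omega> * c \<omega> = - \<psi>1 0"
      using schroedinger_wronskian_const[OF that csol \<omega>in] init by simp
    have 2: "\<psi> \<omega> * s1 \<omega> - \<psi>1 \<omega> * s \<omega> = \<psi> 0"
      using schroedinger_wronskian_const[OF that ssol \<omega>in] init by simp
    have "\<psi> \<omega> * (c \<omega> * s1 \<omega> - c1 \<omega> * s \<omega>) = (\<psi> \<omega> * s1 \<omega> - \<psi>1 \<omega> * s \<omega>) * c \<omega> - (\<psi> \<omega> * c1 \<omega> - \<psi>1 \<omega> * c \<omega>) * s \<omega>"
      by (simp add: algebra_simps)
    moreover have "\<psi>1 \<omega> * (c \<omega> * s1 \<omega> - c1 \<omega> * s \<omega>) = (\<psi> \<omega> * s1 \<omega> - \<psi>1 \<omega> * s \<omega>) * c1 \<omega> - (\<psi> \<omega> * c1 \<omega> - \<psi>1 \<omega> * c \<omega>) * s1 \<omega>"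
      by (simp add: algebra_simps)
    ultimately show ?thesis unfolding 1 2 W by simp
  qed
  have "floquet_discriminant \<omega> V z = (c \<omega> + s1 \<omega>) / 2"
    unfolding floquet_discriminant_def
  proof (rule the_equality)
    show "\<exists>c' c1' s' s1'. schroedinger_solution \<omega> V z c' c1' \<and> c' 0 = 1 \<and> c1' 0 = 0 \<and>
        schroedinger_solution \<omega> V z s' s1' \<and> s' 0 = 0 \<and> s1' 0 = 1 \<and> (c \<omega> + s1 \<omega>) / 2 = (c' \<omega> + s1' \<omega>) / 2"
      using csol ssol init by blast
    fix d assume "\<exists>c' c1' s' s1'. schroedinger_solution \<omega> V z c' c1' \<and> c' 0 = 1 \<and> c1' 0 = 0 \<and>
        schroedinger_solution \<omega> V z s' s1' \<and> s' 0 = 0 \<and> s1' 0 = 1 \<and> d = (c' \<omega> + s1' \<omega>) / 2"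
    then obtain c' c1' s' s1' where "schroedinger_solution \<omega> V z c' c1'" "c' 0 = 1" "c1' 0 = 0"
        "schroedinger_solution \<omega> V z s' s1'" "s' 0 = 0" "s1' 0 = 1" "d = (c' \<omega> + s1' \<omega>) / 2" by blast
    then show "d = (c \<omega> + s1 \<omega>) / 2" using uniq[of c' c1'] uniq[of s' s1'] by simp
  qed
  then have fd: "floquet_discriminant \<omega> V z = (free_cos z \<omega> * C1 \<omega> + free_sin z \<omega> * C2 \<omega>
        - z * free_sin z \<omega> * S1 \<omega> + free_cos z \<omega> * S2 \<omega>) / 2"
    by (simp add: ceq[OF \<omega>in] s1_def)
  \<comment> \<open>The Wronskian of the perturbed solutions is the free Wronskian times the
    determinant of the coordinates.\<close>
  have "c \<omega> * s1 \<omega> - c1 \<omega> * s \<omega>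
      = (free_cos z \<omega> * free_cos z \<omega> + z * free_sin z \<omega> * free_sin z \<omega>) * (C1 \<omega> * S2 \<omega> - S1 \<omega> * C2 \<omega>)"
    by (simp add: ceq[OF \<omega>in] seq[OF \<omega>in] s1_def c1_def algebra_simps)
  then have det: "C1 \<omega> * S2 \<omega> - S1 \<omega> * C2 \<omega> = 1"
    using W by (simp add: free_wronskian)
  show ?thesis
    by (rule that[OF c(1) s(1) C1_def C2_def S1_def S2_def ceq seq det fd])
qed

section \<open>Geometry of $L^2$\<close>

lemma of_real_cmod_power2: "(complex_of_real (cmod w))\<^sup>2 = w * cnj w"
  using complex_norm_square[of w] by simp

lemma has_sum_metric:
  fixes f :: "'a \<Rightarrow> 'b :: {comm_monoid_add, metric_space}"
  shows "(f has_sum s) A \<longleftrightarrow> (\<forall>e>0. \<exists>X. finite X \<and> X \<subseteq> A \<and>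
    (\<forall>Y. finite Y \<and> X \<subseteq> Y \<and> Y \<subseteq> A \<longrightarrow> dist (sum f Y) s < e))"
  unfolding has_sum_def tendsto_iff eventually_finite_subsets_at_top ..

lemma L2D: "f \<in> L2 M \<Longrightarrow> f \<in> borel_measurable M" "f \<in> L2 M \<Longrightarrow> integrable M (\<lambda>x. (cmod (f x))\<^sup>2)"
  by (simp_all add: L2_def)

lemma L2I_bound:
  assumes "f \<in> borel_measurable M" "integrable M g" "AE x in M. (cmod (f x))\<^sup>2 \<le> g x"
  shows "f \<in> L2 M"
proof -
  have "integrable M (\<lambda>x. (cmod (f x))\<^sup>2)"
  proof (rule Bochner_Integration.integrable_bound[OF assms(2)])
    show "AE x in M. norm ((cmod (f x))\<^sup>2) \<le> norm (g x)"
      using assms(3) by eventually_elim auto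
  qed (use assms(1) in measurable)
  with assms(1) show ?thesis by (simp add: L2_def)
qed

lemma L2_zero: "(\<lambda>x. 0) \<in> L2 M"
  by (simp add: L2_def)

lemma L2_add:
  assumes "f \<in> L2 M" "g \<in> L2 M"
  shows "(\<lambda>x. f x + g x) \<in> L2 M"
proof (rule L2I_bound)
  show "(\<lambda>x. f x + g x) \<in> borel_measurable M" using assms[THEN L2D(1)] by measurable
  show "integrable M (\<lambda>x. 2 * (cmod (f x))\<^sup>2 + 2 * (cmod (g x))\<^sup>2)" using assms[THEN L2D(2)] by simp
  have "(cmod (a + b))\<^sup>2 \<le> 2 * (cmod a)\<^sup>2 + 2 * (cmod b)\<^sup>2" for a b
  proof -
    have "(cmod (a + b))\<^sup>2 \<le> (cmod a + cmod b)\<^sup>2" by (intro power_mono norm_triangle_ineq) simp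
    also have "\<dots> \<le> 2 * (cmod a)\<^sup>2 + 2 * (cmod b)\<^sup>2"
      using zero_le_power2[of "cmod a - cmod b"] by (simp add: power2_eq_square algebra_simps)
    finally show ?thesis .
  qed
  then show "AE x in M. (cmod (f x + g x))\<^sup>2 \<le> 2 * (cmod (f x))\<^sup>2 + 2 * (cmod (g x))\<^sup>2" by simp
qed

lemma L2_cmult: "f \<in> L2 M \<Longrightarrow> (\<lambda>x. c * f x) \<in> L2 M"
  by (auto simp: L2_def norm_mult power_mult_distrib)

lemma L2_uminus: "f \<in> L2 M \<Longrightarrow> (\<lambda>x. - f x) \<in> L2 M"
  using L2_cmult[of f M "- 1"] by simp

lemma L2_diff: "f \<in> L2 M \<Longrightarrow> g \<in> L2 M \<Longrightarrow> (\<lambda>x. f x - g x) \<in> L2 M"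
  using L2_add[OF _ L2_uminus, of f M g] by simp

lemma L2_sum: "(\<And>i. i \<in> I \<Longrightarrow> f i \<in> L2 M) \<Longrightarrow> (\<lambda>x. \<Sum>i\<in>I. f i x) \<in> L2 M"
  by (induction I rule: infinite_finite_induct) (auto intro: L2_zero L2_add)

lemma L2_cnj: "f \<in> L2 M \<Longrightarrow> (\<lambda>x. cnj (f x)) \<in> L2 M"
proof -
  assume f: "f \<in> L2 M"
  have "cnj \<in> borel_measurable borel" by (intro borel_measurable_continuous_onI continuous_intros)
  then have "(\<lambda>x. cnj (f x)) \<in> borel_measurable M" using L2D(1)[OF f] by measurable
  then show ?thesis using L2D(2)[OF f] by (simp add: L2_def)
qed

lemma borel_measurable_cnj [measurable (raw)]:
  "f \<in> borel_measurable M \<Longrightarrow> (\<lambda>x. cnj (f x)) \<in> borel_measurable M"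
  by (rule measurable_compose[where N = borel]) (auto intro!: borel_measurable_continuous_onI continuous_intros)

lemma L2_integrable_norm_mult:
  assumes "f \<in> L2 M" "g \<in> L2 M"
  shows "integrable M (\<lambda>x. cmod (f x) * cmod (g x))"
proof (rule Bochner_Integration.integrable_bound[of _ "\<lambda>x. (cmod (f x))\<^sup>2 + (cmod (g x))\<^sup>2"])
  show "integrable M (\<lambda>x. (cmod (f x))\<^sup>2 + (cmod (g x))\<^sup>2)" using assms[THEN L2D(2)] by simp
  show "(\<lambda>x. cmod (f x) * cmod (g x)) \<in> borel_measurable M" using assms[THEN L2D(1)] by measurable
  have "a * b \<le> a\<^sup>2 + b\<^sup>2" for a b :: real
    using sum_squares_bound[of a b] zero_le_power2[of a] zero_le_power2[of b] by linarith
  then show "AE x in M. norm (cmod (f x) * cmod (g x)) \<le> norm ((cmod (f x))\<^sup>2 + (cmod (g x))\<^sup>2)"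
    by (intro AE_I2) (auto simp: abs_of_nonneg)
qed

lemma L2_integrable_mult:
  assumes "f \<in> L2 M" "g \<in> L2 M"
  shows "integrable M (\<lambda>x. f x * g x)"
  by (rule Bochner_Integration.integrable_bound[OF L2_integrable_norm_mult[OF assms]])
     (use assms[THEN L2D(1)] in \<open>auto simp: norm_mult\<close>)

lemma L2_integrable_inner:
  assumes "f \<in> L2 M" "g \<in> L2 M"
  shows "integrable M (\<lambda>x. cnj (f x) * g x)"
  by (rule L2_integrable_mult[OF L2_cnj[OF assms(1)] assms(2)])

lemma l2_inner_add_right:
  "h \<in> L2 M \<Longrightarrow> f \<in> L2 M \<Longrightarrow> g \<in> L2 M \<Longrightarrow> l2_inner M h (\<lambda>x. f x + g x) = l2_inner M h f + l2_inner M h g"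
  by (simp add: l2_inner_def distrib_left Bochner_Integration.integral_add L2_integrable_inner)

lemma l2_inner_diff_right:
  "h \<in> L2 M \<Longrightarrow> f \<in> L2 M \<Longrightarrow> g \<in> L2 M \<Longrightarrow> l2_inner M h (\<lambda>x. f x - g x) = l2_inner M h f - l2_inner M h g"
  by (simp add: l2_inner_def right_diff_distrib Bochner_Integration.integral_diff L2_integrable_inner)

lemma l2_inner_cmult_right: "l2_inner M h (\<lambda>x. c * f x) = c * l2_inner M h f"
  by (simp add: l2_inner_def mult.left_commute)

lemma l2_inner_zero_right [simp]: "l2_inner M h (\<lambda>x. 0) = 0"
  by (simp add: l2_inner_def)

lemma l2_inner_sum_right:
  assumes "h \<in> L2 M" "\<And>i. i \<in> I \<Longrightarrow> f i \<in> L2 M"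
  shows "l2_inner M h (\<lambda>x. \<Sum>i\<in>I. f i x) = (\<Sum>i\<in>I. l2_inner M h (f i))"
  using assms(2)
  by (induction I rule: infinite_finite_induct) (auto simp: l2_inner_add_right assms(1) L2_sum)

lemma l2_inner_commute: "l2_inner M f g = cnj (l2_inner M g f)"
proof -
  have "cnj (l2_inner M g f) = (LINT x|M. cnj (cnj (g x) * f x))"
    unfolding l2_inner_def by (rule Bochner_Integration.integral_cnj[symmetric])
  then show ?thesis by (simp add: l2_inner_def mult.commute)
qed

lemma l2_inner_diff_left:
  "h \<in> L2 M \<Longrightarrow> f \<in> L2 M \<Longrightarrow> g \<in> L2 M \<Longrightarrow> l2_inner M (\<lambda>x. f x - g x) h = l2_inner M f h - l2_inner M g h"
  using l2_inner_diff_right[of h M f g] by (metis complex_cnj_diff l2_inner_commute)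

lemma l2_inner_cmult_left: "l2_inner M (\<lambda>x. c * f x) h = cnj c * l2_inner M f h"
  using l2_inner_cmult_right[of M h c f] by (metis complex_cnj_mult l2_inner_commute)

lemma l2_inner_zero_left [simp]: "l2_inner M (\<lambda>x. 0) h = 0"
  by (simp add: l2_inner_def)

lemma l2_inner_sum_left:
  assumes "h \<in> L2 M" "\<And>i. i \<in> I \<Longrightarrow> f i \<in> L2 M"
  shows "l2_inner M (\<lambda>x. \<Sum>i\<in>I. f i x) h = (\<Sum>i\<in>I. l2_inner M (f i) h)"
  by (subst l2_inner_commute) (simp add: l2_inner_sum_right[OF assms] l2_inner_commute[symmetric])

lemma l2_norm_nonneg [simp]: "0 \<le> l2_norm M f"
  by (simp add: l2_norm_def)

lemma l2_norm_power2: "(l2_norm M f)\<^sup>2 = (LINT x|M. (cmod (f x))\<^sup>2)"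
  by (simp add: l2_norm_def)

lemma l2_inner_self: "l2_inner M f f = of_real ((l2_norm M f)\<^sup>2)"
  unfolding l2_norm_power2 l2_inner_def
  by (simp add: of_real_cmod_power2 mult.commute flip: integral_complex_of_real)

lemma l2_norm_zero [simp]: "l2_norm M (\<lambda>x. 0) = 0"
  by (simp add: l2_norm_def)

lemma l2_norm_eq_0_AE:
  assumes "f \<in> L2 M" "l2_norm M f = 0"
  shows "AE x in M. f x = 0"
proof -
  have "(LINT x|M. (cmod (f x))\<^sup>2) = 0" using assms(2) l2_norm_power2[of M f] by simp
  then have "AE x in M. (cmod (f x))\<^sup>2 = 0"
    using integral_nonneg_eq_0_iff_AE[OF L2D(2)[OF assms(1)]] by simp
  then show ?thesis by eventually_elim simp
qed

lemma l2_inner_cong_AE: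
  assumes "AE x in M. f x = f' x" "AE x in M. g x = g' x"
    "f \<in> L2 M" "f' \<in> L2 M" "g \<in> L2 M" "g' \<in> L2 M"
  shows "l2_inner M f g = l2_inner M f' g'"
  unfolding l2_inner_def
proof (rule integral_cong_AE)
  show "AE x in M. cnj (f x) * g x = cnj (f' x) * g' x" using assms(1,2) by eventually_elim simp
qed (use assms(3-6)[THEN L2D(1)] in measurable)

lemma l2_norm_cong_AE:
  assumes "AE x in M. f x = f' x" "f \<in> L2 M" "f' \<in> L2 M"
  shows "l2_norm M f = l2_norm M f'"
proof -
  have "complex_of_real ((l2_norm M f)\<^sup>2) = of_real ((l2_norm M f')\<^sup>2)"
    unfolding l2_inner_self[symmetric] by (rule l2_inner_cong_AE) (use assms in auto)
  then have "(l2_norm M f)\<^sup>2 = (l2_norm M f')\<^sup>2" by (simp only: of_real_eq_iff)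
  then show ?thesis by (simp add: power2_eq_iff_nonneg)
qed

lemma l2_norm_diff_power2:
  assumes "f \<in> L2 M" "g \<in> L2 M"
  shows "(l2_norm M (\<lambda>x. f x - g x))\<^sup>2 = (l2_norm M f)\<^sup>2 - 2 * Re (l2_inner M f g) + (l2_norm M g)\<^sup>2"
proof -
  have "complex_of_real ((l2_norm M (\<lambda>x. f x - g x))\<^sup>2)
      = l2_inner M f f - l2_inner M f g - (cnj (l2_inner M f g) - l2_inner M g g)"
    unfolding l2_inner_self[symmetric]
    by (subst l2_inner_diff_right) (use assms in \<open>auto intro: L2_diff simp: l2_inner_diff_left l2_inner_commute[of M g f]\<close>)
  then have "Re (complex_of_real ((l2_norm M (\<lambda>x. f x - g x))\<^sup>2))
      = Re (l2_inner M f f - l2_inner M f g - (cnj (l2_inner M f g) - l2_inner M g g))" by simp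
  then show ?thesis by (simp add: l2_inner_self)
qed

lemma l2_cauchy_schwarz:
  assumes f: "f \<in> L2 M" and g: "g \<in> L2 M"
  shows "cmod (l2_inner M f g) \<le> l2_norm M f * l2_norm M g"
proof (cases "l2_norm M g = 0")
  case True
  have "l2_inner M f g = l2_inner M f (\<lambda>x. 0)"
    by (rule l2_inner_cong_AE) (use l2_norm_eq_0_AE[OF g True] f g L2_zero in auto)
  then show ?thesis by simp
next
  case False
  define n where "n = (l2_norm M g)\<^sup>2"
  have n: "n > 0" using False by (simp add: n_def)
  \<comment> \<open>\<open>c * g\<close> is the orthogonal projection of \<open>f\<close> onto the
    line of \<open>g\<close>.\<close>
  define c where "c = l2_inner M g f / of_real n"
  have "0 \<le> (l2_norm M (\<lambda>x. f x - c * g x))\<^sup>2" by simp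
  also have "\<dots> = (l2_norm M f)\<^sup>2 - 2 * Re (l2_inner M f (\<lambda>x. c * g x)) + (l2_norm M (\<lambda>x. c * g x))\<^sup>2"
    by (rule l2_norm_diff_power2[OF f L2_cmult[OF g]])
  also have "l2_inner M f (\<lambda>x. c * g x) = of_real ((cmod (l2_inner M f g))\<^sup>2 / n)"
  proof -
    have "l2_inner M f (\<lambda>x. c * g x) = l2_inner M f g * cnj (l2_inner M f g) / of_real n"
      unfolding l2_inner_cmult_right by (simp add: c_def l2_inner_commute[of M g f] mult.commute)
    then show ?thesis by (simp add: of_real_cmod_power2)
  qed
  also have "(l2_norm M (\<lambda>x. c * g x))\<^sup>2 = (cmod (l2_inner M f g))\<^sup>2 / n"
  proof -
    have "(l2_norm M (\<lambda>x. c * g x))\<^sup>2 = (cmod c)\<^sup>2 * n"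
      by (simp add: l2_norm_power2 n_def norm_mult power_mult_distrib)
    also have "cmod c = cmod (l2_inner M f g) / n"
      using n l2_inner_commute[of M g f] by (simp add: c_def norm_divide)
    finally show ?thesis using n by (simp add: power_divide power2_eq_square)
  qed
  finally have "(cmod (l2_inner M f g))\<^sup>2 / n \<le> (l2_norm M f)\<^sup>2" by simp
  then have "(cmod (l2_inner M f g))\<^sup>2 \<le> (l2_norm M f)\<^sup>2 * n" using n by (simp add: field_simps)
  then have "(cmod (l2_inner M f g))\<^sup>2 \<le> (l2_norm M f * l2_norm M g)\<^sup>2" by (simp add: n_def power_mult_distrib)
  then show ?thesis by (rule power2_le_imp_le) simp
qed

lemma l2_norm_cmult: "l2_norm M (\<lambda>x. c * f x) = cmod c * l2_norm M f"
  by (simp add: l2_norm_def norm_mult power_mult_distrib real_sqrt_mult)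

lemma l2_norm_uminus: "l2_norm M (\<lambda>x. - f x) = l2_norm M f"
  by (simp add: l2_norm_def)

lemma l2_norm_minus_commute: "l2_norm M (\<lambda>x. f x - g x) = l2_norm M (\<lambda>x. g x - f x)"
  by (simp add: l2_norm_def norm_minus_commute)

lemma l2_norm_triangle_diff:
  assumes f: "f \<in> L2 M" and g: "g \<in> L2 M"
  shows "l2_norm M (\<lambda>x. f x - g x) \<le> l2_norm M f + l2_norm M g"
proof (rule power2_le_imp_le)
  have "- Re (l2_inner M f g) \<le> l2_norm M f * l2_norm M g"
    using l2_cauchy_schwarz[OF f g] abs_Re_le_cmod[of "l2_inner M f g"] by linarith
  then show "(l2_norm M (\<lambda>x. f x - g x))\<^sup>2 \<le> (l2_norm M f + l2_norm M g)\<^sup>2"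
    unfolding l2_norm_diff_power2[OF f g] by (simp add: power2_sum)
qed simp

lemma l2_norm_triangle:
  assumes "f \<in> L2 M" "g \<in> L2 M"
  shows "l2_norm M (\<lambda>x. f x + g x) \<le> l2_norm M f + l2_norm M g"
  using l2_norm_triangle_diff[OF assms(1) L2_uminus[OF assms(2)]] by (simp add: l2_norm_uminus)

lemma l2_dist_triangle:
  assumes "f \<in> L2 M" "g \<in> L2 M" "h \<in> L2 M"
  shows "l2_norm M (\<lambda>x. f x - h x) \<le> l2_norm M (\<lambda>x. f x - g x) + l2_norm M (\<lambda>x. g x - h x)"
  using l2_norm_triangle[OF L2_diff[OF assms(1,2)] L2_diff[OF assms(2,3)]] by simp

text \<open>Testing with h = f gives the bound after division by the norm; the second disjunct
  covers a null \<open>f\<close>, when \<open>C\<close> may be negative if the whole space is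
  trivial.\<close>

lemma l2_norm_le_by_inner:
  assumes f: "f \<in> L2 M" and C: "\<And>h. h \<in> L2 M \<Longrightarrow> cmod (l2_inner M h f) \<le> C * l2_norm M h"
  shows "l2_norm M f \<le> C \<or> l2_norm M f = 0"
proof -
  have "(l2_norm M f)\<^sup>2 = cmod (l2_inner M f f)" by (simp add: l2_inner_self norm_power)
  also have "\<dots> \<le> C * l2_norm M f" by (rule C[OF f])
  finally show ?thesis
    using l2_norm_nonneg[of M f] by (cases "l2_norm M f = 0") (auto simp: power2_eq_square)
qed

section \<open>Completeness and unordered sums\<close>

text \<open>On a finite measure a Cauchy sequence in the \<open>L2\<close> norm is Cauchy in the
  mean, so a subsequence converges almost everywhere; Fatou's lemma then carries the
  \<open>L2\<close> bounds over to the limit.\<close>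

lemma L2_complete:
  assumes fin: "finite_measure M" and s: "\<And>n. s n \<in> L2 M"
    and cauchy: "\<And>e. e > 0 \<Longrightarrow> \<exists>N. \<forall>i\<ge>N. \<forall>j\<ge>N. l2_norm M (\<lambda>x. s i x - s j x) < e"
  obtains f where "f \<in> L2 M" "(\<lambda>n. l2_norm M (\<lambda>x. s n x - f x)) \<longlonglongrightarrow> 0"
proof -
  interpret finite_measure M by (rule fin)
  note sm[measurable] = L2D(1)[OF s]
  have one: "(\<lambda>x. 1) \<in> L2 M" by (simp add: L2_def)
  have L1: "integrable M (s n)" for n
    using L2_integrable_mult[OF one s] by simp
  have L1C: "\<exists>N. \<forall>i\<ge>N. \<forall>j\<ge>N. LINT x|M. norm (s i x - s j x) < e" if "e > 0" for e
  proof -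
    define e' where "e' = e / (l2_norm M (\<lambda>x. 1) + 1)"
    have den: "l2_norm M (\<lambda>x. 1) + 1 > 0" using l2_norm_nonneg[of M "\<lambda>x. 1"] by linarith
    have "e' > 0" unfolding e'_def using that den by simp
    from cauchy[OF this] obtain N where N: "\<And>i j. i \<ge> N \<Longrightarrow> j \<ge> N \<Longrightarrow> l2_norm M (\<lambda>x. s i x - s j x) < e'" by blast
    show ?thesis
    proof (intro exI[of _ N] allI impI)
      fix i j assume ij: "i \<ge> N" "j \<ge> N"
      define d where "d x = complex_of_real (cmod (s i x - s j x))" for x
      have "(\<lambda>x. s i x - s j x) \<in> L2 M" by (intro L2_diff s)
      then have d: "d \<in> L2 M" "l2_norm M d = l2_norm M (\<lambda>x. s i x - s j x)"
        unfolding d_def[abs_def] by (auto simp: L2_def l2_norm_def)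
      have "l2_inner M (\<lambda>x. 1) d = of_real (LINT x|M. norm (s i x - s j x))"
        unfolding l2_inner_def d_def by simp
      then have "(LINT x|M. norm (s i x - s j x)) \<le> cmod (l2_inner M (\<lambda>x. 1) d)" by simp
      also have "\<dots> \<le> l2_norm M (\<lambda>x. 1) * l2_norm M d" by (rule l2_cauchy_schwarz[OF one d(1)])
      also have "\<dots> \<le> l2_norm M (\<lambda>x. 1) * e'" using N[OF ij] d(2) by (intro mult_left_mono) auto
      also have "\<dots> < (l2_norm M (\<lambda>x. 1) + 1) * e'" using \<open>e' > 0\<close> by (simp add: algebra_simps)
      also have "\<dots> = e" using den by (simp add: e'_def)
      finally show "(LINT x|M. norm (s i x - s j x)) < e" .
    qed
  qed
  obtain r where r: "strict_mono r" "AE x in M. Cauchy (\<lambda>i. s (r i) x)"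
    using cauchy_L1_AE_cauchy_subseq[OF L1 L1C] by blast
  define f where "f x = lim (\<lambda>i. s (r i) x)" for x
  have fm[measurable]: "f \<in> borel_measurable M" unfolding f_def[abs_def]
    by (rule borel_measurable_lim_metric) simp
  have lim: "AE x in M. (\<lambda>i. s (r i) x) \<longlonglongrightarrow> f x"
    using r(2) by eventually_elim (simp add: f_def Cauchy_convergent_iff convergent_LIMSEQ_iff)
  \<comment> \<open>Fatou along the subsequence: a bound on the distances from \<open>s m\<close> to
    late terms passes to the distance from the limit.\<close>
  have key: "(\<lambda>x. s m x - f x) \<in> L2 M \<and> l2_norm M (\<lambda>x. s m x - f x) \<le> e"
    if e: "e > 0" and N: "\<And>j. j \<ge> N \<Longrightarrow> l2_norm M (\<lambda>x. s m x - s j x) < e" for m N e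
  proof -
    have int: "integrable M (\<lambda>x. (cmod (s m x - s j x))\<^sup>2)" for j by (rule L2D(2)[OF L2_diff[OF s s]])
    have "(\<integral>\<^sup>+x. ennreal ((cmod (s m x - f x))\<^sup>2) \<partial>M) = (\<integral>\<^sup>+x. liminf (\<lambda>i. ennreal ((cmod (s m x - s (r i) x))\<^sup>2)) \<partial>M)"
    proof (rule nn_integral_cong_AE)
      show "AE x in M. ennreal ((cmod (s m x - f x))\<^sup>2) = liminf (\<lambda>i. ennreal ((cmod (s m x - s (r i) x))\<^sup>2))"
        using lim
      proof eventually_elim
        case (elim x)
        have "(\<lambda>i. ennreal ((cmod (s m x - s (r i) x))\<^sup>2)) \<longlonglongrightarrow> ennreal ((cmod (s m x - f x))\<^sup>2)"
          by (intro tendsto_ennrealI tendsto_intros elim)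
        from lim_imp_Liminf[OF sequentially_bot this] show ?case by simp
      qed
    qed
    also have "\<dots> \<le> liminf (\<lambda>i. \<integral>\<^sup>+x. ennreal ((cmod (s m x - s (r i) x))\<^sup>2) \<partial>M)"
      by (rule nn_integral_liminf) measurable
    also have "\<dots> \<le> ennreal (e\<^sup>2)"
    proof (rule Liminf_le)
      show "eventually (\<lambda>i. (\<integral>\<^sup>+x. ennreal ((cmod (s m x - s (r i) x))\<^sup>2) \<partial>M) \<le> ennreal (e\<^sup>2)) sequentially"
        using eventually_ge_at_top[of N]
      proof eventually_elim
        case (elim i)
        then have "r i \<ge> N" using seq_suble[OF r(1), of i] by simp
        from N[OF this] have "(l2_norm M (\<lambda>x. s m x - s (r i) x))\<^sup>2 \<le> e\<^sup>2"
          by (intro power_mono) auto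
        then show ?case
          by (subst nn_integral_eq_integral[OF int]) (auto simp: l2_norm_power2)
      qed
    qed simp
    finally have fin: "(\<integral>\<^sup>+x. ennreal ((cmod (s m x - f x))\<^sup>2) \<partial>M) \<le> ennreal (e\<^sup>2)" .
    then have "integrable M (\<lambda>x. (cmod (s m x - f x))\<^sup>2)"
      by (intro integrableI_nonneg) (auto intro: le_less_trans)
    then have L2: "(\<lambda>x. s m x - f x) \<in> L2 M" by (simp add: L2_def)
    have "ennreal ((l2_norm M (\<lambda>x. s m x - f x))\<^sup>2) \<le> ennreal (e\<^sup>2)"
      using fin unfolding l2_norm_power2 by (subst (asm) nn_integral_eq_integral[OF L2D(2)[OF L2]]) auto
    then have "(l2_norm M (\<lambda>x. s m x - f x))\<^sup>2 \<le> e\<^sup>2" by (simp add: ennreal_le_iff)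
    then have "l2_norm M (\<lambda>x. s m x - f x) \<le> e" by (rule power2_le_imp_le) (use e in simp)
    with L2 show ?thesis by simp
  qed
  obtain N1 where "\<And>i j. i \<ge> N1 \<Longrightarrow> j \<ge> N1 \<Longrightarrow> l2_norm M (\<lambda>x. s i x - s j x) < 1" using cauchy[of 1] by auto
  then have "(\<lambda>x. s N1 x - f x) \<in> L2 M" using key[of 1 N1 N1] by simp
  from L2_diff[OF s[of N1] this] have fL2: "f \<in> L2 M" by simp
  show ?thesis
  proof (rule that[OF fL2])
    show "(\<lambda>n. l2_norm M (\<lambda>x. s n x - f x)) \<longlonglongrightarrow> 0"
    proof (rule LIMSEQ_I)
      fix e :: real assume "e > 0"
      then obtain N where N: "\<And>i j. i \<ge> N \<Longrightarrow> j \<ge> N \<Longrightarrow> l2_norm M (\<lambda>x. s i x - s j x) < e / 2"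
        using cauchy[of "e / 2"] by auto
      show "\<exists>no. \<forall>n\<ge>no. norm (l2_norm M (\<lambda>x. s n x - f x) - 0) < e"
      proof (intro exI[of _ N] allI impI)
        fix n assume "n \<ge> N"
        then have "l2_norm M (\<lambda>x. s n x - f x) \<le> e / 2" using key[of "e / 2" N n] N \<open>e > 0\<close> by simp
        then show "norm (l2_norm M (\<lambda>x. s n x - f x) - 0) < e" using \<open>e > 0\<close> by simp
      qed
    qed
  qed
qed

lemma l2_inner_tendsto:
  assumes "h \<in> L2 M" "\<And>n. s n \<in> L2 M" "f \<in> L2 M" "(\<lambda>n. l2_norm M (\<lambda>x. s n x - f x)) \<longlonglongrightarrow> 0"
  shows "(\<lambda>n. l2_inner M h (s n)) \<longlonglongrightarrow> l2_inner M h f"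
proof -
  have "(\<lambda>n. l2_inner M h (s n) - l2_inner M h f) \<longlonglongrightarrow> 0"
  proof (rule Lim_null_comparison)
    show "eventually (\<lambda>n. norm (l2_inner M h (s n) - l2_inner M h f) \<le> l2_norm M h * l2_norm M (\<lambda>x. s n x - f x)) sequentially"
      using assms l2_cauchy_schwarz[OF assms(1) L2_diff[OF assms(2,3)]]
      by (auto simp: l2_inner_diff_right[symmetric])
    show "(\<lambda>n. l2_norm M h * l2_norm M (\<lambda>x. s n x - f x)) \<longlonglongrightarrow> 0"
      using tendsto_mult_left[OF assms(4), of "l2_norm M h"] by simp
  qed
  then show ?thesis by (rule LIM_zero_cancel)
qed

text \<open>An unordered Cauchy criterion: finite blocks disjoint from a large finite set are small
  in norm. A sum is built along an increasing sequence of finite sets, and the unordered statement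
  is drawn for inner products with fixed vectors.\<close>

lemma L2_family_converges:
  assumes fin: "finite_measure M" and g: "\<And>j. j \<in> A \<Longrightarrow> g j \<in> L2 M"
    and cauchy: "\<And>e. e > 0 \<Longrightarrow> \<exists>F. finite F \<and> F \<subseteq> A \<and>
      (\<forall>F'. finite F' \<and> F' \<subseteq> A - F \<longrightarrow> l2_norm M (\<lambda>x. \<Sum>j\<in>F'. g j x) < e)"
  obtains f where "f \<in> L2 M" "\<And>h. h \<in> L2 M \<Longrightarrow> ((\<lambda>j. l2_inner M h (g j)) has_sum l2_inner M h f) A"
proof -
  have "\<forall>n. \<exists>F. finite F \<and> F \<subseteq> A \<and>
      (\<forall>F'. finite F' \<and> F' \<subseteq> A - F \<longrightarrow> l2_norm M (\<lambda>x. \<Sum>j\<in>F'. g j x) < inverse (real (Suc n)))"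
    using cauchy by simp
  then obtain F where F: "\<And>n. finite (F n)" "\<And>n. F n \<subseteq> A"
    "\<And>n F'. finite F' \<Longrightarrow> F' \<subseteq> A - F n \<Longrightarrow> l2_norm M (\<lambda>x. \<Sum>j\<in>F'. g j x) < inverse (real (Suc n))"
    by metis
  \<comment> \<open>Unions make the chosen finite sets increasing without enlarging the
    tails.\<close>
  define G where "G n = (\<Union>m\<le>n. F m)" for n
  have G: "finite (G n)" "G n \<subseteq> A" "F n \<subseteq> G n" for n using F by (auto simp: G_def)
  have Gm: "G m \<subseteq> G n" if "m \<le> n" for m n using that by (force simp: G_def)
  have Gs: "l2_norm M (\<lambda>x. \<Sum>j\<in>F'. g j x) < inverse (real (Suc n))" if "finite F'" "F' \<subseteq> A - G n" for F' n
    using F(3)[of F' n] that G(3)[of n] by blast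
  define S where "S n x = (\<Sum>j\<in>G n. g j x)" for n x
  have S: "S n \<in> L2 M" for n unfolding S_def[abs_def] using G by (intro L2_sum g) auto
  have SG: "l2_norm M (\<lambda>x. (\<Sum>j\<in>F'. g j x) - S n x) < inverse (real (Suc n))"
    if "finite F'" "G n \<subseteq> F'" "F' \<subseteq> A" for F' n
  proof -
    have "(\<lambda>x. (\<Sum>j\<in>F'. g j x) - S n x) = (\<lambda>x. \<Sum>j\<in>F' - G n. g j x)"
      unfolding S_def using that by (simp add: sum_diff)
    then show ?thesis using Gs[of "F' - G n" n] that by auto
  qed
  have SC: "\<exists>N. \<forall>i\<ge>N. \<forall>j\<ge>N. l2_norm M (\<lambda>x. S i x - S j x) < e" if e0: "e > 0" for e
  proof -
    obtain N where N: "inverse (real (Suc N)) < e / 2" using reals_Archimedean[OF half_gt_zero[OF e0]] by blast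
    have 1: "l2_norm M (\<lambda>x. S i x - S N x) < e / 2" if "i \<ge> N" for i
      using SG[of "G i" N] G Gm[OF that] N unfolding S_def[symmetric] by force
    have 2: "l2_norm M (\<lambda>x. S i x - S j x) \<le> l2_norm M (\<lambda>x. S i x - S N x) + l2_norm M (\<lambda>x. S j x - S N x)" for i j
      using l2_dist_triangle[OF S[of i] S[of N] S[of j]] l2_norm_minus_commute[of M "S N" "S j"] by simp
    have "l2_norm M (\<lambda>x. S i x - S j x) < e" if "i \<ge> N" "j \<ge> N" for i j
      using 1[OF that(1)] 1[OF that(2)] 2[of i j] by linarith
    then show ?thesis by blast
  qed
  obtain f where f: "f \<in> L2 M" "(\<lambda>n. l2_norm M (\<lambda>x. S n x - f x)) \<longlonglongrightarrow> 0"
    by (rule L2_complete[OF fin S SC])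
  show ?thesis
  proof (rule that[OF f(1)])
    fix h assume h: "h \<in> L2 M"
    show "((\<lambda>j. l2_inner M h (g j)) has_sum l2_inner M h f) A"
      unfolding has_sum_metric
    proof (intro allI impI)
      fix e :: real assume "e > 0"
      define e' where "e' = e / (2 * (l2_norm M h + 1))"
      have den: "l2_norm M h + 1 > 0" using l2_norm_nonneg[of M h] by linarith
      have e': "e' > 0" using \<open>e > 0\<close> den by (simp add: e'_def)
      have "eventually (\<lambda>n. inverse (real (Suc n)) < e') sequentially"
        using LIMSEQ_inverse_real_of_nat e' by (rule order_tendstoD(2))
      moreover have "eventually (\<lambda>n. l2_norm M (\<lambda>x. S n x - f x) < e') sequentially"
        using f(2) e' by (rule order_tendstoD(2))
      ultimately have "eventually (\<lambda>n. inverse (real (Suc n)) < e' \<and> l2_norm M (\<lambda>x. S n x - f x) < e') sequentially"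
        by (rule eventually_conj)
      then obtain n where n: "inverse (real (Suc n)) < e'" "l2_norm M (\<lambda>x. S n x - f x) < e'"
        by (auto simp: eventually_sequentially)
      show "\<exists>X. finite X \<and> X \<subseteq> A \<and> (\<forall>Y. finite Y \<and> X \<subseteq> Y \<and> Y \<subseteq> A \<longrightarrow>
          dist (\<Sum>j\<in>Y. l2_inner M h (g j)) (l2_inner M h f) < e)"
      proof (intro exI[of _ "G n"] conjI G allI impI)
        fix Y assume Y: "finite Y \<and> G n \<subseteq> Y \<and> Y \<subseteq> A"
        have SY: "(\<lambda>x. \<Sum>j\<in>Y. g j x) \<in> L2 M" using Y by (intro L2_sum g) auto
        have "(\<Sum>j\<in>Y. l2_inner M h (g j)) - l2_inner M h f = l2_inner M h (\<lambda>x. (\<Sum>j\<in>Y. g j x) - f x)"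
          using Y by (subst l2_inner_diff_right[OF h SY f(1)], subst l2_inner_sum_right[OF h]) (auto intro: g)
        also have "cmod \<dots> \<le> l2_norm M h * l2_norm M (\<lambda>x. (\<Sum>j\<in>Y. g j x) - f x)"
          by (rule l2_cauchy_schwarz[OF h L2_diff[OF SY f(1)]])
        also have "\<dots> \<le> l2_norm M h * (e' + e')"
        proof (intro mult_left_mono)
          have "l2_norm M (\<lambda>x. (\<Sum>j\<in>Y. g j x) - f x) \<le> l2_norm M (\<lambda>x. (\<Sum>j\<in>Y. g j x) - S n x) + l2_norm M (\<lambda>x. S n x - f x)"
            by (rule l2_dist_triangle[OF SY S f(1)])
          then show "l2_norm M (\<lambda>x. (\<Sum>j\<in>Y. g j x) - f x) \<le> e' + e'" using SG[of Y n] Y n by linarith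
        qed simp
        also have "\<dots> < (l2_norm M h + 1) * (e' + e')" using e' by (simp add: algebra_simps)
        also have "\<dots> = 2 * (l2_norm M h + 1) * e'" by (simp add: algebra_simps)
        also have "\<dots> = e" using den by (simp add: e'_def)
        finally show "dist (\<Sum>j\<in>Y. l2_inner M h (g j)) (l2_inner M h f) < e" by (simp add: dist_norm)
      qed
    qed
  qed
qed

section \<open>Orthonormal systems: Bessel, Riesz-Fischer and Parseval\<close>

definition orthonormal :: "'a measure \<Rightarrow> ('a \<Rightarrow> complex) set \<Rightarrow> bool" where
  "orthonormal M E \<longleftrightarrow> E \<subseteq> L2 M \<and> (\<forall>e\<in>E. \<forall>e'\<in>E. l2_inner M e e' = (if e = e' then 1 else 0))"

lemma orthonormal_basis_orthonormal: "orthonormal_basis M E \<Longrightarrow> orthonormal M E"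
  by (simp add: orthonormal_basis_def orthonormal_def)

lemma orthonormal_norm: "orthonormal M E \<Longrightarrow> e \<in> E \<Longrightarrow> l2_norm M e = 1"
proof -
  assume "orthonormal M E" "e \<in> E"
  then have "l2_inner M e e = 1" by (simp add: orthonormal_def)
  then have "(l2_norm M e)\<^sup>2 = 1" unfolding l2_inner_self by (metis of_real_eq_1_iff)
  then show ?thesis using l2_norm_nonneg[of M e] by (simp add: power2_eq_1_iff)
qed

lemma orthonormal_inner_sum:
  assumes "orthonormal M E" "finite F" "F \<subseteq> E" "e \<in> E"
  shows "l2_inner M e (\<lambda>x. \<Sum>e'\<in>F. c e' * e' x) = (if e \<in> F then c e else 0)"
proof -
  have L: "e' \<in> L2 M" if "e' \<in> E" for e' using assms(1) that by (auto simp: orthonormal_def)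
  have "l2_inner M e (\<lambda>x. \<Sum>e'\<in>F. c e' * e' x) = (\<Sum>e'\<in>F. l2_inner M e (\<lambda>x. c e' * e' x))"
    by (rule l2_inner_sum_right) (use assms L in \<open>auto intro: L2_cmult\<close>)
  also have "\<dots> = (\<Sum>e'\<in>F. if e = e' then c e' else 0)"
    by (rule sum.cong) (use assms in \<open>auto simp: l2_inner_cmult_right orthonormal_def\<close>)
  also have "\<dots> = (if e \<in> F then c e else 0)" using assms(2) by simp
  finally show ?thesis .
qed

lemma orthonormal_norm_sum:
  assumes "orthonormal M E" "finite F" "F \<subseteq> E"
  shows "(l2_norm M (\<lambda>x. \<Sum>e\<in>F. c e * e x))\<^sup>2 = (\<Sum>e\<in>F. (cmod (c e))\<^sup>2)"
proof -
  have L: "e' \<in> L2 M" if "e' \<in> E" for e' using assms(1) that by (auto simp: orthonormal_def)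
  have S: "(\<lambda>x. \<Sum>e\<in>F. c e * e x) \<in> L2 M" by (intro L2_sum L2_cmult L) (use assms in auto)
  have "complex_of_real ((l2_norm M (\<lambda>x. \<Sum>e\<in>F. c e * e x))\<^sup>2)
      = (\<Sum>e\<in>F. l2_inner M (\<lambda>x. c e * e x) (\<lambda>x. \<Sum>e\<in>F. c e * e x))"
    unfolding l2_inner_self[symmetric]
    by (rule l2_inner_sum_left[OF S]) (use assms L in \<open>auto intro: L2_cmult\<close>)
  also have "\<dots> = (\<Sum>e\<in>F. cnj (c e) * c e)"
    by (rule sum.cong) (use assms in \<open>auto simp: l2_inner_cmult_left orthonormal_inner_sum[OF assms]\<close>)
  also have "\<dots> = of_real (\<Sum>e\<in>F. (cmod (c e))\<^sup>2)"
    by (simp add: of_real_cmod_power2 mult.commute)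
  finally show ?thesis by (simp only: of_real_eq_iff)
qed

lemma bessel:
  assumes E: "orthonormal M E" "finite F" "F \<subseteq> E" and f: "f \<in> L2 M"
  shows "(\<Sum>e\<in>F. (cmod (l2_inner M e f))\<^sup>2) \<le> (l2_norm M f)\<^sup>2"
proof -
  have L: "e' \<in> L2 M" if "e' \<in> E" for e' using E(1) that by (auto simp: orthonormal_def)
  define g where "g x = (\<Sum>e\<in>F. l2_inner M e f * e x)" for x
  have g: "g \<in> L2 M" unfolding g_def[abs_def] by (intro L2_sum L2_cmult L) (use E in auto)
  have "l2_inner M f g = (\<Sum>e\<in>F. l2_inner M f (\<lambda>x. l2_inner M e f * e x))"
    unfolding g_def by (rule l2_inner_sum_right[OF f]) (use E L in \<open>auto intro: L2_cmult\<close>)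
  also have "\<dots> = of_real (\<Sum>e\<in>F. (cmod (l2_inner M e f))\<^sup>2)"
    by (simp add: l2_inner_cmult_right of_real_cmod_power2 l2_inner_commute[of M f])
  finally have 1: "Re (l2_inner M f g) = (\<Sum>e\<in>F. (cmod (l2_inner M e f))\<^sup>2)" by (metis Re_complex_of_real)
  have "(l2_norm M g)\<^sup>2 = (\<Sum>e\<in>F. (cmod (l2_inner M e f))\<^sup>2)"
    unfolding g_def by (rule orthonormal_norm_sum[OF E])
  with 1 l2_norm_diff_power2[OF f g] zero_le_power2[of "l2_norm M (\<lambda>x. f x - g x)"] show ?thesis by linarith
qed

lemma bessel_summable:
  assumes "orthonormal M E" "f \<in> L2 M"
  shows "(\<lambda>e. (cmod (l2_inner M e f))\<^sup>2) summable_on E"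
    "infsum (\<lambda>e. (cmod (l2_inner M e f))\<^sup>2) E \<le> (l2_norm M f)\<^sup>2"
proof -
  show "(\<lambda>e. (cmod (l2_inner M e f))\<^sup>2) summable_on E"
    by (rule nonneg_bdd_above_summable_on) (auto intro!: bdd_aboveI2[where M = "(l2_norm M f)\<^sup>2"] bessel[OF assms(1) _ _ assms(2)])
  then show "infsum (\<lambda>e. (cmod (l2_inner M e f))\<^sup>2) E \<le> (l2_norm M f)\<^sup>2"
    by (rule infsum_le_finite_sums) (use bessel[OF assms(1) _ _ assms(2)] in auto)
qed

text \<open>By Pythagoras the squared norm of a finite block of the series is the corresponding
  block of the summable family |c e|^2, so the unordered Cauchy criterion applies.\<close>

lemma riesz_fischer:
  assumes fin: "finite_measure M" and E: "orthonormal M E"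
    and c: "(\<lambda>e. (cmod (c e))\<^sup>2) summable_on E"
  obtains f where "f \<in> L2 M" "\<And>e. e \<in> E \<Longrightarrow> l2_inner M e f = c e"
    "\<And>h. h \<in> L2 M \<Longrightarrow> ((\<lambda>e. l2_inner M h e * c e) has_sum l2_inner M h f) E"
proof -
  have L: "e \<in> L2 M" if "e \<in> E" for e using E that by (auto simp: orthonormal_def)
  have "\<exists>F. finite F \<and> F \<subseteq> E \<and> (\<forall>F'. finite F' \<and> F' \<subseteq> E - F \<longrightarrow> l2_norm M (\<lambda>x. \<Sum>e\<in>F'. c e * e x) < \<epsilon>)"
    if "\<epsilon> > 0" for \<epsilon>
  proof -
    have \<epsilon>2: "\<epsilon>\<^sup>2 / 2 > 0" using that by simp
    have "\<exists>X. finite X \<and> X \<subseteq> E \<and> (\<forall>Y. finite Y \<and> X \<subseteq> Y \<and> Y \<subseteq> E \<longrightarrow>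
        dist (\<Sum>e\<in>Y. (cmod (c e))\<^sup>2) (infsum (\<lambda>e. (cmod (c e))\<^sup>2) E) < \<epsilon>\<^sup>2 / 2)"
      using has_sum_infsum[OF c] \<epsilon>2 unfolding has_sum_metric by (elim allE impE)
    then obtain F where F: "finite F" "F \<subseteq> E"
      "\<And>Y. finite Y \<Longrightarrow> F \<subseteq> Y \<Longrightarrow> Y \<subseteq> E \<Longrightarrow>
          dist (\<Sum>e\<in>Y. (cmod (c e))\<^sup>2) (infsum (\<lambda>e. (cmod (c e))\<^sup>2) E) < \<epsilon>\<^sup>2 / 2"
      by (elim exE conjE) simp
    have "l2_norm M (\<lambda>x. \<Sum>e\<in>F'. c e * e x) < \<epsilon>" if F': "finite F'" "F' \<subseteq> E - F" for F'
    proof (rule power2_less_imp_less)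
      have "(\<Sum>e\<in>F'. (cmod (c e))\<^sup>2) = (\<Sum>e\<in>F \<union> F'. (cmod (c e))\<^sup>2) - (\<Sum>e\<in>F. (cmod (c e))\<^sup>2)"
        using F F' by (subst sum.union_disjoint) auto
      also have "\<dots> < \<epsilon>\<^sup>2" 
      proof -
        have "dist (\<Sum>e\<in>F. (cmod (c e))\<^sup>2) (infsum (\<lambda>e. (cmod (c e))\<^sup>2) E) < \<epsilon>\<^sup>2 / 2"
          by (rule F(3)) (use F in auto)
        moreover have "dist (\<Sum>e\<in>F \<union> F'. (cmod (c e))\<^sup>2) (infsum (\<lambda>e. (cmod (c e))\<^sup>2) E) < \<epsilon>\<^sup>2 / 2"
          by (rule F(3)) (use F F' in auto)
        ultimately show ?thesis unfolding dist_real_def by linarith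
      qed
      finally show "(l2_norm M (\<lambda>x. \<Sum>e\<in>F'. c e * e x))\<^sup>2 < \<epsilon>\<^sup>2"
        using F' by (subst orthonormal_norm_sum[OF E]) auto
    qed (use \<open>\<epsilon> > 0\<close> in simp)
    with F show ?thesis by blast
  qed
  then obtain f where f: "f \<in> L2 M" "\<And>h. h \<in> L2 M \<Longrightarrow> ((\<lambda>e. l2_inner M h (\<lambda>x. c e * e x)) has_sum l2_inner M h f) E"
    using L2_family_converges[OF fin L2_cmult[OF L], of E "\<lambda>e. e" c thesis] by blast
  have f2: "((\<lambda>e. l2_inner M h e * c e) has_sum l2_inner M h f) E" if "h \<in> L2 M" for h
    using f(2)[OF that] unfolding l2_inner_cmult_right by (simp add: mult.commute)
  show ?thesis
  proof (rule that[OF f(1) _ f2])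
    fix e assume e: "e \<in> E"
    have "((\<lambda>e'. l2_inner M e e' * c e') has_sum c e) E"
      by (rule has_sum_finite_neutralI[where B = "{e}"]) (use e E in \<open>auto simp: orthonormal_def\<close>)
    with f2[OF L[OF e]] show "l2_inner M e f = c e" by (rule has_sum_unique)
  qed
qed

text \<open>The vector built from the coefficients of \<open>g\<close> has the same coefficients as
  \<open>g\<close>; by completeness of the basis it equals \<open>g\<close> almost everywhere, and
  its inner products are sums by construction.\<close>

lemma parseval:
  assumes fin: "finite_measure M" and E: "orthonormal_basis M E" and f: "f \<in> L2 M" and g: "g \<in> L2 M"
  shows "((\<lambda>e. l2_inner M f e * l2_inner M e g) has_sum l2_inner M f g) E"
proof -
  note E' = orthonormal_basis_orthonormal[OF E]
  obtain g' where g': "g' \<in> L2 M" "\<And>e. e \<in> E \<Longrightarrow> l2_inner M e g' = l2_inner M e g"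
    "\<And>h. h \<in> L2 M \<Longrightarrow> ((\<lambda>e. l2_inner M h e * l2_inner M e g) has_sum l2_inner M h g') E"
    using riesz_fischer[OF fin E' bessel_summable(1)[OF E' g]] by blast
  have "\<forall>e\<in>E. l2_inner M e (\<lambda>x. g x - g' x) = 0"
    using g' g E' by (auto simp: l2_inner_diff_right orthonormal_def)
  then have "AE x in M. g x - g' x = 0"
    using E L2_diff[OF g g'(1)] unfolding orthonormal_basis_def by blast
  then have "AE x in M. g x = g' x" by eventually_elim simp
  then have "l2_inner M f g = l2_inner M f g'"
    by (intro l2_inner_cong_AE) (use f g g' in auto)
  with g'(3)[OF f] show ?thesis by simp
qed

lemma parseval_norm:
  assumes "finite_measure M" "orthonormal_basis M E" "f \<in> L2 M"
  shows "((\<lambda>e. (cmod (l2_inner M e f))\<^sup>2) has_sum (l2_norm M f)\<^sup>2) E"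
proof -
  have "((\<lambda>e. l2_inner M f e * l2_inner M e f) has_sum l2_inner M f f) E"
    by (rule parseval[OF assms assms(3)])
  then have "((\<lambda>e. complex_of_real ((cmod (l2_inner M e f))\<^sup>2)) has_sum complex_of_real ((l2_norm M f)\<^sup>2)) E"
    by (simp add: l2_inner_self of_real_cmod_power2 l2_inner_commute[of M f] mult.commute)
  then show ?thesis by (simp only: has_sum_of_real_iff)
qed

lemma orthonormal_basis_AE_eq:
  assumes E: "orthonormal_basis M E" and f: "f \<in> L2 M" "g \<in> L2 M"
    and eq: "\<And>e. e \<in> E \<Longrightarrow> l2_inner M e f = l2_inner M e g"
  shows "AE x in M. f x = g x"
proof -
  have "\<forall>e\<in>E. l2_inner M e (\<lambda>x. f x - g x) = 0"
    using f eq E by (auto simp: l2_inner_diff_right orthonormal_basis_def)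
  then have "AE x in M. f x - g x = 0"
    using E L2_diff[OF f] unfolding orthonormal_basis_def by blast
  then show ?thesis by eventually_elim simp
qed

section \<open>Infinite Cauchy--Binet\<close>

text \<open>The principal minor of the matrix \<open>F\<close> on the index set \<open>S\<close>, by
  the Leibniz formula, for index sets carrying no order.\<close>

definition perm_sum :: "('i \<Rightarrow> 'i \<Rightarrow> complex) \<Rightarrow> 'i set \<Rightarrow> complex" where
  "perm_sum F S = (\<Sum>p | p permutes S. of_int (sign p) * (\<Prod>i\<in>S. F i (p i)))"

lemma perm_sum_cong:
  assumes "\<And>i j. i \<in> S \<Longrightarrow> j \<in> S \<Longrightarrow> F i j = G i j"
  shows "perm_sum F S = perm_sum G S"
  unfolding perm_sum_def
proof (rule sum.cong)
  fix p assume "p \<in> {p. p permutes S}"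
  then have "F i (p i) = G i (p i)" if "i \<in> S" for i using that assms by (simp add: permutes_in_image)
  then show "of_int (sign p) * (\<Prod>i\<in>S. F i (p i)) = of_int (sign p) * (\<Prod>i\<in>S. G i (p i))" by simp
qed simp

lemma perm_sum_image:
  assumes "inj_on f S" "finite S"
  shows "perm_sum F (f ` S) = perm_sum (\<lambda>i j. F (f i) (f j)) S"
proof -
  have fb: "bij_betw f S (f ` S)" using assms(1) by (simp add: bij_betw_def)
  have inv: "bij_betw (inv_into S f) (f ` S) S" by (rule bij_betw_inv_into[OF fb])
  have bij: "bij_betw (map_permutation S f) {p. p permutes S} {p. p permutes f ` S}"
  proof (rule bij_betwI[where g = "map_permutation (f ` S) (inv_into S f)"])
    show "map_permutation S f \<in> {p. p permutes S} \<rightarrow> {p. p permutes f ` S}"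
      using map_permutation_permutes[OF fb] by auto
    show "map_permutation (f ` S) (inv_into S f) \<in> {p. p permutes f ` S} \<rightarrow> {p. p permutes S}"
      using map_permutation_permutes[OF inv] by auto
    fix p assume "p \<in> {p. p permutes S}"
    then show "map_permutation (f ` S) (inv_into S f) (map_permutation S f p) = p"
      using map_permutation_compose_inv[OF fb, of p "inv_into S f"] assms(1) by simp
  next
    fix p assume "p \<in> {p. p permutes f ` S}"
    then show "map_permutation S f (map_permutation (f ` S) (inv_into S f) p) = p"
      using map_permutation_compose_inv[OF inv, of p f] assms(1) by (auto simp: f_inv_into_f)
  qed
  have "perm_sum F (f ` S) = (\<Sum>p | p permutes S. of_int (sign (map_permutation S f p)) *
      (\<Prod>i\<in>f ` S. F i (map_permutation S f p i)))"
    unfolding perm_sum_def by (rule sum.reindex_bij_betw[OF bij, symmetric])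
  also have "\<dots> = perm_sum (\<lambda>i j. F (f i) (f j)) S"
    unfolding perm_sum_def
  proof (rule sum.cong)
    fix p assume p: "p \<in> {p. p permutes S}"
    have "(\<Prod>i\<in>f ` S. F i (map_permutation S f p i)) = (\<Prod>i\<in>S. F (f i) (f (p i)))"
      using assms by (simp add: prod.reindex map_permutation_apply)
    then show "of_int (sign (map_permutation S f p)) * (\<Prod>i\<in>f ` S. F i (map_permutation S f p i))
        = of_int (sign p) * (\<Prod>i\<in>S. F (f i) (f (p i)))"
      using p assms by (simp add: sign_map_permutation)
  qed simp
  finally show ?thesis .
qed

text \<open>A determinant with two equal columns: composing with the transposition of
  \<open>a\<close> and \<open>b\<close> leaves all entries unchanged and flips the sign, so the sum
  is its own negative.\<close>

lemma perm_sum_eq_0: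
  assumes I: "finite I" and ab: "a \<in> I" "b \<in> I" "a \<noteq> b" "e a = e b"
  shows "perm_sum (\<lambda>r s. F (e r) (e s)) I = 0"
proof -
  define \<tau> where "\<tau> = Transposition.transpose a b"
  have \<tau>: "\<tau> permutes I" "permutation \<tau>" "sign \<tau> = - 1" "e (\<tau> x) = e x" for x
    using ab by (auto simp: \<tau>_def permutes_swap_id permutation_swap_id sign_swap_id Transposition.transpose_def)
  have "perm_sum (\<lambda>r s. F (e r) (e s)) I
      = (\<Sum>p | p permutes I. of_int (sign (\<tau> \<circ> p)) * (\<Prod>i\<in>I. F (e i) (e ((\<tau> \<circ> p) i))))"
    unfolding perm_sum_def by (rule setum_permutations_compose_left[OF \<tau>(1)])
  also have "\<dots> = (\<Sum>p | p permutes I. - (of_int (sign p) * (\<Prod>i\<in>I. F (e i) (e (p i)))))"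
  proof (rule sum.cong)
    fix p assume "p \<in> {p. p permutes I}"
    then have "permutation p" using I by (auto simp: permutation_permutes)
    then have "sign (\<tau> \<circ> p) = - sign p" using \<tau>(2,3) by (simp add: sign_compose)
    then show "of_int (sign (\<tau> \<circ> p)) * (\<Prod>i\<in>I. F (e i) (e ((\<tau> \<circ> p) i)))
        = - (of_int (sign p) * (\<Prod>i\<in>I. F (e i) (e (p i))))" by (simp add: \<tau>(4))
  qed simp
  also have "\<dots> = - perm_sum (\<lambda>r s. F (e r) (e s)) I"
    by (simp add: perm_sum_def sum_negf)
  finally show ?thesis by simp
qed

text \<open>The bound \<beta> i * \<alpha> j is of rank one, so its product along a permutation is
  the same for all permutations.\<close>

lemma norm_perm_sum_le:
  assumes "finite S" and F: "\<And>i j. i \<in> S \<Longrightarrow> j \<in> S \<Longrightarrow> cmod (F i j) \<le> \<beta> i * \<alpha> j"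
  shows "cmod (perm_sum F S) \<le> fact (card S) * (\<Prod>i\<in>S. \<alpha> i * \<beta> i)"
proof -
  have "cmod (perm_sum F S) \<le> (\<Sum>p | p permutes S. \<Prod>i\<in>S. \<alpha> i * \<beta> i)"
    unfolding perm_sum_def
  proof (rule sum_norm_le)
    fix p assume "p \<in> {p. p permutes S}"
    then have p: "p permutes S" by simp
    have "cmod (of_int (sign p) * (\<Prod>i\<in>S. F i (p i))) = (\<Prod>i\<in>S. cmod (F i (p i)))"
      by (simp add: norm_mult prod_norm[symmetric] sign_def)
    also have "\<dots> \<le> (\<Prod>i\<in>S. \<beta> i * \<alpha> (p i))"
      using p F by (intro prod_mono) (auto simp: permutes_in_image)
    also have "\<dots> = (\<Prod>i\<in>S. \<beta> i) * (\<Prod>i\<in>S. \<alpha> (p i))" by (rule prod.distrib)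
    also have "(\<Prod>i\<in>S. \<alpha> (p i)) = (\<Prod>i\<in>S. \<alpha> i)" by (rule prod.permute[OF p, symmetric, unfolded o_def])
    finally show "cmod (of_int (sign p) * (\<Prod>i\<in>S. F i (p i))) \<le> (\<Prod>i\<in>S. \<alpha> i * \<beta> i)"
      by (simp add: prod.distrib mult.commute)
  qed
  also have "\<dots> = fact (card S) * (\<Prod>i\<in>S. \<alpha> i * \<beta> i)"
    using assms(1) by (simp add: card_permutations)
  finally show ?thesis .
qed

section \<open>Absolute summability over finite subsets and tuples\<close>

text \<open>In the multinomial expansion of the power the product over each k-element subset occurs
  \<open>k!\<close> times, and the other terms are nonnegative. The induction separates subsets
  containing the new element from the others.\<close>

lemma sum_subsets_card_le:
  fixes w :: "'i \<Rightarrow> real"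
  assumes "finite F" "\<And>i. i \<in> F \<Longrightarrow> 0 \<le> w i"
  shows "fact k * (\<Sum>U | U \<subseteq> F \<and> card U = k. \<Prod>i\<in>U. w i) \<le> (\<Sum>i\<in>F. w i) ^ k"
  using assms
proof (induction F arbitrary: k rule: finite_induct)
  case empty
  have "{U. U \<subseteq> ({} :: 'i set) \<and> card U = k} = (if k = 0 then {{}} else {})" by auto
  then show ?case by simp
next
  case (insert x F)
  define s where "s = (\<Sum>i\<in>F. w i)"
  have s0: "s \<ge> 0" unfolding s_def using insert.prems by (intro sum_nonneg) auto
  have w0: "w x \<ge> 0" using insert.prems by simp
  show ?case
  proof (cases k)
    case 0
    have "{U. U \<subseteq> insert x F \<and> card U = 0} = {{}}"
      using insert.hyps(1) by (auto simp: card_eq_0_iff dest: finite_subset)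
    then show ?thesis using 0 by simp
  next
    case (Suc m)
    have split: "{U. U \<subseteq> insert x F \<and> card U = k} = {U. U \<subseteq> F \<and> card U = k} \<union> insert x ` {U. U \<subseteq> F \<and> card U = m}"
      (is "?L = ?R")
    proof
      have "card (insert x U) = Suc (card U)" if "U \<subseteq> F" for U
        using that insert.hyps finite_subset[of U F] by (intro card_insert_disjoint) auto
      then show "?R \<subseteq> ?L" using Suc by auto
      show "?L \<subseteq> ?R"
      proof
        fix U assume U: "U \<in> ?L"
        show "U \<in> ?R"
        proof (cases "x \<in> U")
          case True
          have "finite U" using U insert.hyps(1) by (auto dest: finite_subset)
          then have "card (U - {x}) = m" using True U Suc by simp
          moreover have "U - {x} \<subseteq> F" "U = insert x (U - {x})" using U True by auto
          ultimately show ?thesis by blast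
        next
          case False
          then show ?thesis using U by auto
        qed
      qed
    qed
    have disj: "{U. U \<subseteq> F \<and> card U = k} \<inter> insert x ` {U. U \<subseteq> F \<and> card U = m} = {}"
      using insert.hyps(2) by auto
    have fin: "finite {U. U \<subseteq> F \<and> card U = n}" for n using insert.hyps(1) by simp
    have inj: "inj_on (insert x) {U. U \<subseteq> F \<and> card U = m}"
      using insert.hyps(2) unfolding inj_on_def by (metis (no_types, lifting) insert_ident mem_Collect_eq subsetD)
    have "(\<Sum>U | U \<subseteq> insert x F \<and> card U = k. \<Prod>i\<in>U. w i)
        = (\<Sum>U | U \<subseteq> F \<and> card U = k. \<Prod>i\<in>U. w i) + (\<Sum>U\<in>insert x ` {U. U \<subseteq> F \<and> card U = m}. \<Prod>i\<in>U. w i)"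
      unfolding split by (rule sum.union_disjoint) (use fin disj in auto)
    also have "(\<Sum>U\<in>insert x ` {U. U \<subseteq> F \<and> card U = m}. \<Prod>i\<in>U. w i) = (\<Sum>U | U \<subseteq> F \<and> card U = m. \<Prod>i\<in>insert x U. w i)"
      using sum.reindex[OF inj] by simp
    also have "\<dots> = w x * (\<Sum>U | U \<subseteq> F \<and> card U = m. \<Prod>i\<in>U. w i)"
      unfolding sum_distrib_left
    proof (rule sum.cong)
      fix U assume "U \<in> {U. U \<subseteq> F \<and> card U = m}"
      then have "finite U" "x \<notin> U" using insert.hyps by (auto dest: finite_subset)
      then show "(\<Prod>i\<in>insert x U. w i) = w x * (\<Prod>i\<in>U. w i)" by simp
    qed simp
    finally have "fact k * (\<Sum>U | U \<subseteq> insert x F \<and> card U = k. \<Prod>i\<in>U. w i)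
        = fact k * (\<Sum>U | U \<subseteq> F \<and> card U = k. \<Prod>i\<in>U. w i)
          + real k * w x * (fact m * (\<Sum>U | U \<subseteq> F \<and> card U = m. \<Prod>i\<in>U. w i))"
      using Suc by (simp add: algebra_simps)
    also have "\<dots> \<le> s ^ k + real k * w x * s ^ m"
      unfolding s_def using w0 insert.prems by (intro add_mono mult_left_mono insert.IH) auto
    also have "\<dots> \<le> (w x + s) ^ k"
    proof -
      \<comment> \<open>These are the first two terms of the binomial expansion of (w x + s)^k; the
        remaining ones are nonnegative.\<close>
      have "s ^ k + real k * w x * s ^ m = (\<Sum>j\<le>1. real (k choose j) * w x ^ j * s ^ (k - j))"
        using Suc by (simp add: lessThan_Suc_atMost[symmetric])
      also have "\<dots> \<le> (\<Sum>j\<le>k. real (k choose j) * w x ^ j * s ^ (k - j))"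
        using Suc s0 w0 by (intro sum_mono2) auto
      also have "\<dots> = (w x + s) ^ k" by (simp add: binomial_ring)
      finally show ?thesis .
    qed
    also have "w x + s = (\<Sum>i\<in>insert x F. w i)" using insert.hyps by (simp add: s_def)
    finally show ?thesis .
  qed
qed

text \<open>A binomial coefficient is at most a power of two. It splits the factorial of a subset
  between its part in a finite core and its part in the tail.\<close>

lemma fact_add_le: "(fact (a + b) :: real) \<le> 2 ^ (a + b) * (fact a * fact b)"
proof -
  have "real ((a + b) choose a) \<le> 2 ^ (a + b)"
    using binomial_le_pow2[of "a + b" a] by (metis of_nat_le_iff of_nat_numeral of_nat_power)
  moreover have "(fact (a + b) :: real) = real ((a + b) choose a) * (fact a * fact b)"
    using binomial_fact_lemma[of a "a + b"] by (metis add_diff_cancel_left' le_add1 mult.commute of_nat_fact of_nat_mult)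
  ultimately show ?thesis by (simp add: mult_right_mono)
qed

text \<open>All but finitely many of the weights sum to at most \<open>1/4\<close>, and for those
  \<open>2^b b!\<close> is beaten by the multinomial bound.\<close>

lemma fact_prod_summable:
  fixes w :: "'i \<Rightarrow> real"
  assumes w: "w summable_on J" and w0: "\<And>i. i \<in> J \<Longrightarrow> 0 \<le> w i"
  shows "(\<lambda>U. fact (card U) * (\<Prod>i\<in>U. w i)) summable_on {U. finite U \<and> U \<subseteq> J}"
proof -
  have "eventually (\<lambda>F. dist (sum w F) (infsum w J) < 1 / 4) (finite_subsets_at_top J)"
    using has_sum_infsum[OF w] unfolding has_sum_def by (rule tendstoD) simp
  then obtain J0 where J0: "finite J0" "J0 \<subseteq> J" "dist (sum w J0) (infsum w J) < 1 / 4"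
    unfolding eventually_finite_subsets_at_top by blast
  have tail: "sum w F \<le> 1 / 4" if F: "finite F" "F \<subseteq> J - J0" for F
  proof -
    have "sum w F + sum w J0 = sum w (F \<union> J0)" using F J0 by (subst sum.union_disjoint) auto
    also have "\<dots> \<le> infsum w J" by (rule finite_sum_le_infsum[OF w]) (use F J0 w0 in auto)
    finally show ?thesis using J0(3) unfolding dist_real_def by linarith
  qed
  \<comment> \<open>The power of two pays for splitting the factorial; in the tail 2^k * (1/4)^k
    leaves a geometric series with sum 2.\<close>
  define \<phi> where "\<phi> U = 2 ^ card U * fact (card U) * (\<Prod>i\<in>U. w i)" for U
  have \<phi>0: "\<phi> U \<ge> 0" if "U \<subseteq> J" for U unfolding \<phi>_def using that w0 by (intro mult_nonneg_nonneg prod_nonneg) auto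
  define C where "C = (\<Sum>U\<in>Pow J0. \<phi> U)"
  have C0: "C \<ge> 0" unfolding C_def using J0 by (intro sum_nonneg \<phi>0) auto
  have tailsum: "(\<Sum>U\<in>Pow F. \<phi> U) \<le> 2" if F: "finite F" "F \<subseteq> J - J0" for F
  proof -
    have "(\<Sum>U\<in>Pow F. \<phi> U) = (\<Sum>k\<le>card F. \<Sum>U | U \<in> Pow F \<and> card U = k. \<phi> U)"
      using F(1) by (intro sum.group[symmetric]) (auto intro: card_mono)
    also have "\<dots> = (\<Sum>k\<le>card F. 2 ^ k * (fact k * (\<Sum>U | U \<subseteq> F \<and> card U = k. \<Prod>i\<in>U. w i)))"
      by (intro sum.cong refl) (auto simp: \<phi>_def sum_distrib_left mult_ac)
    also have "\<dots> \<le> (\<Sum>k\<le>card F. 2 ^ k * (1 / 4) ^ k)"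
    proof (intro sum_mono mult_left_mono)
      fix k
      have "fact k * (\<Sum>U | U \<subseteq> F \<and> card U = k. \<Prod>i\<in>U. w i) \<le> (\<Sum>i\<in>F. w i) ^ k"
        by (rule sum_subsets_card_le) (use F w0 in auto)
      also have "\<dots> \<le> (1 / 4) ^ k" using tail[OF F] F w0 by (intro power_mono sum_nonneg) auto
      finally show "fact k * (\<Sum>U | U \<subseteq> F \<and> card U = k. \<Prod>i\<in>U. w i) \<le> (1 / 4) ^ k" .
    qed simp
    also have "\<dots> = (\<Sum>k\<le>card F. (1 / 2) ^ k)" by (simp flip: power_mult_distrib)
    also have "\<dots> \<le> (\<Sum>k. (1 / 2 :: real) ^ k)" by (rule sum_le_suminf) (auto simp: summable_geometric)
    also have "\<dots> = 2" by (simp add: suminf_geometric)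
    finally show ?thesis .
  qed
  have bound: "(\<Sum>U\<in>\<U>. fact (card U) * (\<Prod>i\<in>U. w i)) \<le> C * 2"
    if U: "\<U> \<subseteq> {U. finite U \<and> U \<subseteq> J}" "finite \<U>" for \<U>
  proof -
    define F where "F = \<Union>\<U> - J0"
    have F: "finite F" "F \<subseteq> J - J0" using U by (auto simp: F_def)
    have "(\<Sum>U\<in>\<U>. fact (card U) * (\<Prod>i\<in>U. w i)) \<le> (\<Sum>U\<in>\<U>. \<phi> (U \<inter> J0) * \<phi> (U - J0))"
    proof (rule sum_mono)
      fix X assume "X \<in> \<U>"
      then have X: "finite X" "X \<subseteq> J" using U by auto
      have c: "card X = card (X \<inter> J0) + card (X - J0)" using X(1)
        by (metis Diff_Int2 Diff_Int_distrib2 Int_Diff_Un Int_Diff_disjoint card_Un_disjoint finite_Diff finite_Int)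
      have p: "(\<Prod>i\<in>X. w i) = (\<Prod>i\<in>X \<inter> J0. w i) * (\<Prod>i\<in>X - J0. w i)"
        using X(1) by (metis Int_Diff_Un Int_Diff_disjoint finite_Diff finite_Int prod.union_disjoint)
      have "fact (card X) * (\<Prod>i\<in>X. w i) \<le> 2 ^ card X * (fact (card (X \<inter> J0)) * fact (card (X - J0))) * (\<Prod>i\<in>X. w i)"
        unfolding c by (intro mult_right_mono fact_add_le prod_nonneg) (use X w0 in auto)
      also have "\<dots> = \<phi> (X \<inter> J0) * \<phi> (X - J0)"
        unfolding \<phi>_def p c by (simp add: power_add mult_ac)
      finally show "fact (card X) * (\<Prod>i\<in>X. w i) \<le> \<phi> (X \<inter> J0) * \<phi> (X - J0)" .
    qed
    also have "\<dots> = (\<Sum>(U1, U2)\<in>(\<lambda>U. (U \<inter> J0, U - J0)) ` \<U>. \<phi> U1 * \<phi> U2)"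
    proof -
      have "inj_on (\<lambda>U. (U \<inter> J0, U - J0)) \<U>"
        by (rule inj_onI) (metis Int_Diff_Un prod.inject)
      then show ?thesis by (simp add: sum.reindex)
    qed
    also have "\<dots> \<le> (\<Sum>(U1, U2)\<in>Pow J0 \<times> Pow F. \<phi> U1 * \<phi> U2)"
    proof (rule sum_mono2)
      show "finite (Pow J0 \<times> Pow F)" using J0 F by simp
      show "(\<lambda>U. (U \<inter> J0, U - J0)) ` \<U> \<subseteq> Pow J0 \<times> Pow F" by (auto simp: F_def)
      fix b assume "b \<in> Pow J0 \<times> Pow F - (\<lambda>U. (U \<inter> J0, U - J0)) ` \<U>"
      then have "fst b \<subseteq> J0" "snd b \<subseteq> F" by (simp_all add: mem_Times_iff)
      then have "fst b \<subseteq> J" "snd b \<subseteq> J" using J0(2) F(2) by blast+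
      then show "0 \<le> (case b of (U1, U2) \<Rightarrow> \<phi> U1 * \<phi> U2)" using \<phi>0 by (simp add: case_prod_beta)
    qed
    also have "\<dots> = C * (\<Sum>U\<in>Pow F. \<phi> U)"
      unfolding C_def by (simp add: sum_product sum.cartesian_product)
    also have "\<dots> \<le> C * 2" by (intro mult_left_mono tailsum F C0)
    finally show ?thesis .
  qed
  show ?thesis
  proof (rule nonneg_bdd_above_summable_on)
    fix U assume "U \<in> {U. finite U \<and> U \<subseteq> J}"
    then show "0 \<le> fact (card U) * (\<Prod>i\<in>U. w i)" using w0 by (intro mult_nonneg_nonneg prod_nonneg) auto
  next
    show "bdd_above (sum (\<lambda>U. fact (card U) * (\<Prod>i\<in>U. w i)) ` {F. F \<subseteq> {U. finite U \<and> U \<subseteq> J} \<and> finite F})"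
      using bound by (intro bdd_aboveI2[where M = "C * 2"]) auto
  qed
qed

text \<open>A finite set of functions lies in the finite box of its coordinate projections, and over
  a box the sum of products factors.\<close>

lemma prod_PiE_abs_summable:
  fixes f :: "'a \<Rightarrow> 'b \<Rightarrow> complex"
  assumes A: "finite A" and f: "\<And>x. x \<in> A \<Longrightarrow> (\<lambda>y. cmod (f x y)) summable_on B x"
  shows "(\<lambda>g. cmod (\<Prod>x\<in>A. f x (g x))) summable_on PiE A B"
proof (rule nonneg_bdd_above_summable_on)
  show "bdd_above (sum (\<lambda>g. cmod (\<Prod>x\<in>A. f x (g x))) ` {F. F \<subseteq> PiE A B \<and> finite F})"
  proof (rule bdd_aboveI2[where M = "\<Prod>x\<in>A. infsum (\<lambda>y. cmod (f x y)) (B x)"])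
    fix P assume "P \<in> {F. F \<subseteq> PiE A B \<and> finite F}"
    then have P: "P \<subseteq> PiE A B" "finite P" by auto
    define B' where "B' x = (\<lambda>g. g x) ` P" for x
    have B': "finite (B' x)" "x \<in> A \<Longrightarrow> B' x \<subseteq> B x" for x using P by (auto simp: B'_def)
    have "(\<Sum>g\<in>P. cmod (\<Prod>x\<in>A. f x (g x))) \<le> (\<Sum>g\<in>PiE A B'. cmod (\<Prod>x\<in>A. f x (g x)))"
    proof (rule sum_mono2)
      show "finite (PiE A B')" using A B' by (intro finite_PiE) auto
      show "P \<subseteq> PiE A B'" using P by (auto simp: B'_def PiE_def)
    qed simp
    also have "\<dots> = (\<Sum>g\<in>PiE A B'. \<Prod>x\<in>A. cmod (f x (g x)))" by (simp add: prod_norm)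
    also have "\<dots> = (\<Prod>x\<in>A. \<Sum>y\<in>B' x. cmod (f x y))" using A B' by (subst prod_sum_PiE) auto
    also have "\<dots> \<le> (\<Prod>x\<in>A. infsum (\<lambda>y. cmod (f x y)) (B x))"
      by (intro prod_mono conjI sum_nonneg finite_sum_le_infsum) (use B' f in auto)
    finally show "(\<Sum>g\<in>P. cmod (\<Prod>x\<in>A. f x (g x))) \<le> (\<Prod>x\<in>A. infsum (\<lambda>y. cmod (f x y)) (B x))" .
  qed
qed simp

lemma infsum_cauchy_schwarz:
  fixes a b :: "'e \<Rightarrow> complex"
  assumes a: "(\<lambda>e. (cmod (a e))\<^sup>2) summable_on E" "infsum (\<lambda>e. (cmod (a e))\<^sup>2) E \<le> \<alpha>\<^sup>2"
    and b: "(\<lambda>e. (cmod (b e))\<^sup>2) summable_on E" "infsum (\<lambda>e. (cmod (b e))\<^sup>2) E \<le> \<beta>\<^sup>2"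
    and nn: "0 \<le> \<alpha>" "0 \<le> \<beta>"
  shows "(\<lambda>e. cmod (a e * b e)) summable_on E" "infsum (\<lambda>e. cmod (a e * b e)) E \<le> \<alpha> * \<beta>"
proof -
  show abs: "(\<lambda>e. cmod (a e * b e)) summable_on E"
    by (rule abs_summable_product) (use a b in \<open>auto simp: norm_mult power2_eq_square\<close>)
  show "infsum (\<lambda>e. cmod (a e * b e)) E \<le> \<alpha> * \<beta>"
  proof (rule infsum_le_finite_sums[OF abs])
    fix F assume F: "finite F" "F \<subseteq> E"
    have "(\<Sum>e\<in>F. cmod (a e * b e)) = (\<Sum>e\<in>F. \<bar>cmod (a e)\<bar> * \<bar>cmod (b e)\<bar>)" by (simp add: norm_mult)
    also have "\<dots> \<le> L2_set (\<lambda>e. cmod (a e)) F * L2_set (\<lambda>e. cmod (b e)) F" by (rule L2_set_mult_ineq)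
    also have "\<dots> \<le> \<alpha> * \<beta>"
    proof (intro mult_mono)
      have "(\<Sum>e\<in>F. (cmod (a e))\<^sup>2) \<le> \<alpha>\<^sup>2"
        using finite_sum_le_infsum[OF a(1) F(1,2)] a(2) by simp
      then show "L2_set (\<lambda>e. cmod (a e)) F \<le> \<alpha>" unfolding L2_set_def using nn by (simp add: real_le_lsqrt sum_nonneg)
      have "(\<Sum>e\<in>F. (cmod (b e))\<^sup>2) \<le> \<beta>\<^sup>2"
        using finite_sum_le_infsum[OF b(1) F(1,2)] b(2) by simp
      then show "L2_set (\<lambda>e. cmod (b e)) F \<le> \<beta>" unfolding L2_set_def using nn by (simp add: real_le_lsqrt sum_nonneg)
    qed (use nn in \<open>auto simp: L2_set_nonneg\<close>)
    finally show "(\<Sum>e\<in>F. cmod (a e * b e)) \<le> \<alpha> * \<beta>" .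
  qed
qed

lemma has_sum_finite_sum:
  fixes f :: "'p \<Rightarrow> 'x \<Rightarrow> complex"
  assumes "finite P" "\<And>p. p \<in> P \<Longrightarrow> (f p has_sum s p) A"
  shows "((\<lambda>x. \<Sum>p\<in>P. f p x) has_sum (\<Sum>p\<in>P. s p)) A"
  using assms by (induction P rule: finite_induct) (auto intro: has_sum_add)

section \<open>Sums over tuples and sums over subsets\<close>

definition subsets_of_card :: "'i set \<Rightarrow> nat \<Rightarrow> 'i set set" where
  "subsets_of_card X k = {S. S \<subseteq> X \<and> finite S \<and> card S = k}"

lemma card_bijections:
  assumes S: "finite S" "card S = k"
  shows "finite {t \<in> extensional {..<k}. bij_betw t {..<k} S}"
    "card {t \<in> extensional {..<k}. bij_betw t {..<k} S} = fact k"
proof -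
  obtain h where h: "bij_betw h {..<k} S"
    using ex_bij_betw_nat_finite[OF S(1)] S(2) atLeast0LessThan by metis
  have inv: "bij_betw (inv_into {..<k} h) S {..<k}" by (rule bij_betw_inv_into[OF h])
  have b: "bij_betw (\<lambda>p. restrict (h \<circ> p) {..<k}) {p. p permutes {..<k}} {t \<in> extensional {..<k}. bij_betw t {..<k} S}"
  proof (rule bij_betwI[where g = "\<lambda>t i. if i < k then inv_into {..<k} h (t i) else i"])
    show "(\<lambda>p. restrict (h \<circ> p) {..<k}) \<in> {p. p permutes {..<k}} \<rightarrow> {t \<in> extensional {..<k}. bij_betw t {..<k} S}"
    proof
      fix p assume "p \<in> {p. p permutes {..<k}}"
      then have "bij_betw (h \<circ> p) {..<k} S" using h by (auto intro: bij_betw_trans permutes_imp_bij)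
      then have "bij_betw (restrict (h \<circ> p) {..<k}) {..<k} S" by (subst bij_betw_restrict_eq)
      then show "restrict (h \<circ> p) {..<k} \<in> {t \<in> extensional {..<k}. bij_betw t {..<k} S}" by simp
    qed
    show "(\<lambda>t i. if i < k then inv_into {..<k} h (t i) else i) \<in> {t \<in> extensional {..<k}. bij_betw t {..<k} S} \<rightarrow> {p. p permutes {..<k}}"
    proof
      fix t assume "t \<in> {t \<in> extensional {..<k}. bij_betw t {..<k} S}"
      then have "bij_betw (inv_into {..<k} h \<circ> t) {..<k} {..<k}" using inv by (auto intro: bij_betw_trans)
      then have "bij_betw (\<lambda>i. if i < k then inv_into {..<k} h (t i) else i) {..<k} {..<k}"
        by (rule bij_betw_cong[THEN iffD1, rotated]) simp
      then show "(\<lambda>i. if i < k then inv_into {..<k} h (t i) else i) \<in> {p. p permutes {..<k}}"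
        by (intro CollectI bij_imp_permutes) simp_all
    qed
  next
    fix p assume "p \<in> {p. p permutes {..<k}}"
    then have p: "p permutes {..<k}" by simp
    show "(\<lambda>i. if i < k then inv_into {..<k} h (restrict (h \<circ> p) {..<k} i) else i) = p"
    proof
      fix i
      show "(if i < k then inv_into {..<k} h (restrict (h \<circ> p) {..<k} i) else i) = p i"
      proof (cases "i < k")
        case True
        then have "p i \<in> {..<k}" using permutes_in_image[OF p, of i] by simp
        then show ?thesis using True bij_betw_inv_into_left[OF h] by simp
      next
        case False
        then show ?thesis using permutes_not_in[OF p, of i] by simp
      qed
    qed
  next
    fix t assume "t \<in> {t \<in> extensional {..<k}. bij_betw t {..<k} S}"
    then have t: "t \<in> extensional {..<k}" "bij_betw t {..<k} S" by auto
    show "restrict (h \<circ> (\<lambda>i. if i < k then inv_into {..<k} h (t i) else i)) {..<k} = t"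
    proof
      fix i
      show "restrict (h \<circ> (\<lambda>i. if i < k then inv_into {..<k} h (t i) else i)) {..<k} i = t i"
      proof (cases "i < k")
        case True
        then have "t i \<in> S" using t(2) by (auto simp: bij_betw_def)
        then show ?thesis using True bij_betw_inv_into_right[OF h] by simp
      next
        case False
        then show ?thesis using t(1) by (simp add: extensional_def)
      qed
    qed
  qed
  show "finite {t \<in> extensional {..<k}. bij_betw t {..<k} S}"
    using bij_betw_finite[OF b] finite_permutations[of "{..<k}"] by simp
  show "card {t \<in> extensional {..<k}. bij_betw t {..<k} S} = fact k"
    using bij_betw_same_card[OF b] card_permutations[of "{..<k}" k] by simp
qed

text \<open>Tuples with a repetition have two equal columns and contribute 0; each k-element subset
  is the image of \<open>k!\<close> injective tuples with the same minor. Sums over tuples range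
  over product sets, so sums of products factor there.\<close>

lemma infsum_tuples_eq_subsets:
  fixes F :: "'i \<Rightarrow> 'i \<Rightarrow> complex"
  assumes sm: "(\<lambda>t. perm_sum (\<lambda>r s. F (t r) (t s)) {..<k}) summable_on (PiE {..<k} (\<lambda>_. X))"
  shows "(perm_sum F has_sum (infsum (\<lambda>t. perm_sum (\<lambda>r s. F (t r) (t s)) {..<k}) (PiE {..<k} (\<lambda>_. X)) / fact k))
    (subsets_of_card X k)"
proof -
  define \<phi> where "\<phi> t = perm_sum (\<lambda>r s. F (t r) (t s)) {..<k}" for t
  define Bij where "Bij S = {t \<in> extensional {..<k}. bij_betw t {..<k} S}" for S :: "'i set"
  define I where "I = {t \<in> PiE {..<k} (\<lambda>_. X). inj_on t {..<k}}"
  have "(\<phi> has_sum infsum \<phi> (PiE {..<k} (\<lambda>_. X))) (PiE {..<k} (\<lambda>_. X))"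
    using sm unfolding \<phi>_def[abs_def] by (rule has_sum_infsum)
  moreover have "(\<phi> has_sum y) (PiE {..<k} (\<lambda>_. X)) \<longleftrightarrow> (\<phi> has_sum y) I" for y
  proof (rule has_sum_cong_neutral)
    fix t assume "t \<in> PiE {..<k} (\<lambda>_. X) - I"
    then have "\<not> inj_on t {..<k}" by (auto simp: I_def)
    then obtain a b where "a \<in> {..<k}" "b \<in> {..<k}" "a \<noteq> b" "t a = t b" unfolding inj_on_def by blast
    then show "\<phi> t = 0" unfolding \<phi>_def using perm_sum_eq_0[of "{..<k}" a b t] by simp
  qed (auto simp: I_def)
  ultimately have "(\<phi> has_sum infsum \<phi> (PiE {..<k} (\<lambda>_. X))) I" by simp
  moreover have bij: "bij_betw snd (Sigma (subsets_of_card X k) Bij) I"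
  proof (rule bij_betwI[where g = "\<lambda>t. (t ` {..<k}, t)"])
    show "snd \<in> Sigma (subsets_of_card X k) Bij \<rightarrow> I"
    proof
      fix x assume "x \<in> Sigma (subsets_of_card X k) Bij"
      then obtain S t where x: "x = (S, t)" "S \<subseteq> X" "t \<in> extensional {..<k}" "inj_on t {..<k}" "t ` {..<k} = S"
        by (auto simp: Bij_def subsets_of_card_def bij_betw_def)
      then have "t \<in> {..<k} \<rightarrow> X" by blast
      then show "snd x \<in> I" using x by (simp add: I_def PiE_def)
    qed
    show "(\<lambda>t. (t ` {..<k}, t)) \<in> I \<rightarrow> Sigma (subsets_of_card X k) Bij"
      by (auto simp: I_def Bij_def subsets_of_card_def bij_betw_def PiE_def card_image)
    show "(snd x ` {..<k}, snd x) = x" if "x \<in> Sigma (subsets_of_card X k) Bij" for x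
      using that by (auto simp: Bij_def bij_betw_def)
  qed simp
  ultimately have "((\<lambda>x. \<phi> (snd x)) has_sum infsum \<phi> (PiE {..<k} (\<lambda>_. X))) (Sigma (subsets_of_card X k) Bij)"
    using has_sum_reindex_bij_betw[OF bij, of \<phi>] by simp
  moreover have "((\<lambda>t. \<phi> (snd (S, t))) has_sum (fact k * perm_sum F S)) (Bij S)" if S: "S \<in> subsets_of_card X k" for S
  proof (rule has_sum_finiteI)
    have S': "finite S" "card S = k" using S by (auto simp: subsets_of_card_def)
    show "finite (Bij S)" unfolding Bij_def by (rule card_bijections(1)[OF S'])
    have "\<phi> t = perm_sum F S" if "t \<in> Bij S" for t
      using that perm_sum_image[of t "{..<k}" F] by (auto simp: Bij_def \<phi>_def bij_betw_def)
    then have "(\<Sum>t\<in>Bij S. \<phi> t) = (\<Sum>t\<in>Bij S. perm_sum F S)" by (intro sum.cong) auto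
    also have "\<dots> = fact k * perm_sum F S"
      unfolding Bij_def using card_bijections(2)[OF S'] by simp
    finally show "fact k * perm_sum F S = (\<Sum>t\<in>Bij S. \<phi> (snd (S, t)))" by simp
  qed
  ultimately have "((\<lambda>S. fact k * perm_sum F S) has_sum infsum \<phi> (PiE {..<k} (\<lambda>_. X))) (subsets_of_card X k)"
    by (rule has_sum_SigmaD)
  from has_sum_cmult_right[OF this, of "1 / fact k"] show ?thesis
    by (simp add: \<phi>_def[abs_def])
qed

text \<open>The two products \<open>A B\<close> and \<open>B A\<close> have the same sums of principal minors.\<close>

locale nuclear_matrices =
  fixes E :: "'e set" and J :: "'j set" and A :: "'e \<Rightarrow> 'j \<Rightarrow> complex" and B :: "'j \<Rightarrow> 'e \<Rightarrow> complex"
    and \<alpha> \<beta> :: "'j \<Rightarrow> real"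
  assumes A: "j \<in> J \<Longrightarrow> (\<lambda>e. (cmod (A e j))\<^sup>2) summable_on E" "j \<in> J \<Longrightarrow> infsum (\<lambda>e. (cmod (A e j))\<^sup>2) E \<le> (\<alpha> j)\<^sup>2"
    and B: "j \<in> J \<Longrightarrow> (\<lambda>e. (cmod (B j e))\<^sup>2) summable_on E" "j \<in> J \<Longrightarrow> infsum (\<lambda>e. (cmod (B j e))\<^sup>2) E \<le> (\<beta> j)\<^sup>2"
    and nonneg: "0 \<le> \<alpha> j" "0 \<le> \<beta> j"
    and summable: "(\<lambda>j. \<alpha> j * \<beta> j) summable_on J"
begin

definition "AB e e' = infsum (\<lambda>j. A e j * B j e') J"
definition "BA i j = infsum (\<lambda>e. B i e * A e j) E"

lemma BA_abs: "i \<in> J \<Longrightarrow> j \<in> J \<Longrightarrow> (\<lambda>e. cmod (B i e * A e j)) summable_on E"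
  "i \<in> J \<Longrightarrow> j \<in> J \<Longrightarrow> infsum (\<lambda>e. cmod (B i e * A e j)) E \<le> \<beta> i * \<alpha> j"
  using infsum_cauchy_schwarz[OF B A nonneg(2,1)] by auto

lemma norm_BA: "i \<in> J \<Longrightarrow> j \<in> J \<Longrightarrow> cmod (BA i j) \<le> \<beta> i * \<alpha> j"
  unfolding BA_def using norm_infsum_bound[OF BA_abs(1)] BA_abs(2) by (meson order.trans)

lemma norm_entry:
  assumes "e \<in> E" "j \<in> J"
  shows "cmod (A e j) \<le> \<alpha> j" "cmod (B j e) \<le> \<beta> j"
proof -
  have "(cmod (A e j))\<^sup>2 \<le> (\<alpha> j)\<^sup>2"
    using finite_sum_le_infsum[OF A(1)[OF assms(2)], of "{e}"] A(2)[OF assms(2)] assms(1) by simp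
  then show "cmod (A e j) \<le> \<alpha> j" by (rule power2_le_imp_le) (rule nonneg)
  have "(cmod (B j e))\<^sup>2 \<le> (\<beta> j)\<^sup>2"
    using finite_sum_le_infsum[OF B(1)[OF assms(2)], of "{e}"] B(2)[OF assms(2)] assms(1) by simp
  then show "cmod (B j e) \<le> \<beta> j" by (rule power2_le_imp_le) (rule nonneg)
qed

lemma AB_abs:
  assumes "e \<in> E" "e' \<in> E"
  shows "(\<lambda>j. cmod (A e j * B j e')) summable_on J"
proof (rule Infinite_Sum.abs_summable_on_comparison_test'[OF summable])
  fix j assume "j \<in> J"
  then show "cmod (A e j * B j e') \<le> \<alpha> j * \<beta> j"
    unfolding norm_mult using norm_entry assms nonneg by (intro mult_mono) auto
qed

context
  fixes k :: nat
begin

abbreviation "EE \<equiv> PiE {..<k} (\<lambda>_. E)"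
abbreviation "JJ \<equiv> PiE {..<k} (\<lambda>_. J)"

text \<open>One summand of a minor of \<open>AB\<close>, for a fixed permutation, after expanding
  every entry. Summed over \<open>j\<close> it gives a product of entries of \<open>AB\<close>,
  summed over \<open>e\<close> one of entries of \<open>BA\<close>.\<close>

definition "prod_term \<sigma> j e = (\<Prod>r<k. A (e r) (j r) * B (j r) (e (\<sigma> r)))"

text \<open>Reindexing the factors of \<open>B\<close> by the inverse permutation collects
  everything that depends on \<open>e r\<close> into the single factor number \<open>r\<close>, so
  the sum over \<open>e\<close> factors.\<close>

lemma prod_term_eq:
  assumes "\<sigma> permutes {..<k}"
  shows "prod_term \<sigma> j e = (\<Prod>r<k. B (j (inv_into UNIV \<sigma> r)) (e r) * A (e r) (j r))"
proof -
  have "(\<Prod>r<k. B (j r) (e (\<sigma> r))) = (\<Prod>r<k. B (j (inv_into UNIV \<sigma> r)) (e (\<sigma> (inv_into UNIV \<sigma> r))))"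
    using prod.permute[OF permutes_inv[OF assms], of "\<lambda>r. B (j r) (e (\<sigma> r))"] by (simp add: o_def)
  also have "\<dots> = (\<Prod>r<k. B (j (inv_into UNIV \<sigma> r)) (e r))" using permutes_inverses[OF assms] by simp
  finally show ?thesis unfolding prod_term_def by (simp add: prod.distrib mult.commute)
qed

text \<open>The double family is absolutely summable: by Cauchy-Schwarz the inner sum over
  \<open>e\<close> is at most the product of the weights \<alpha> \<beta>, whatever the permutation,
  and such products are summable over tuples.\<close>

lemma term_sums:
  assumes \<sigma>: "\<sigma> permutes {..<k}"
  shows "(\<lambda>(j, e). prod_term \<sigma> j e) summable_on (JJ \<times> EE)"
    "j \<in> JJ \<Longrightarrow> infsum (prod_term \<sigma> j) EE = (\<Prod>r<k. BA (j (inv_into UNIV \<sigma> r)) (j r))"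
    "e \<in> EE \<Longrightarrow> infsum (\<lambda>j. prod_term \<sigma> j e) JJ = (\<Prod>r<k. AB (e r) (e (\<sigma> r)))"
proof -
  have i: "inv_into UNIV \<sigma> r \<in> {..<k} \<longleftrightarrow> r \<in> {..<k}" for r using permutes_in_image[OF permutes_inv[OF \<sigma>]] .
  have ab: "(\<lambda>e. cmod (B (j (inv_into UNIV \<sigma> r)) e * A e (j r))) summable_on E"
    if "j \<in> JJ" "r \<in> {..<k}" for j r
  proof (rule BA_abs(1))
    show "j (inv_into UNIV \<sigma> r) \<in> J" "j r \<in> J" using that i[of r] by (auto simp: PiE_def Pi_def)
  qed
  show "infsum (prod_term \<sigma> j) EE = (\<Prod>r<k. BA (j (inv_into UNIV \<sigma> r)) (j r))" if j: "j \<in> JJ" for j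
    unfolding BA_def prod_term_eq[OF \<sigma>, abs_def]
    by (rule infsum_prod_PiE_abs) (use ab[OF j] in auto)
  show "infsum (\<lambda>j. prod_term \<sigma> j e) JJ = (\<Prod>r<k. AB (e r) (e (\<sigma> r)))" if e: "e \<in> EE" for e
    unfolding AB_def prod_term_def[abs_def]
  proof (rule infsum_prod_PiE_abs)
    fix r assume r: "r \<in> {..<k}"
    then have "\<sigma> r \<in> {..<k}" using permutes_in_image[OF \<sigma>] by blast
    then show "(\<lambda>j. cmod (A (e r) j * B j (e (\<sigma> r)))) summable_on J"
      using e r by (intro AB_abs) (auto simp: PiE_def Pi_def)
  qed simp
  have "(\<lambda>x. cmod (case x of (j, e) \<Rightarrow> prod_term \<sigma> j e)) summable_on (Sigma JJ (\<lambda>_. EE))"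
  proof (subst Infinite_Sum.abs_summable_on_Sigma_iff, intro conjI ballI)
    fix j assume j: "j \<in> JJ"
    show "(\<lambda>e. cmod (case (j, e) of (j, e) \<Rightarrow> prod_term \<sigma> j e)) summable_on EE"
      unfolding case_prod_conv prod_term_eq[OF \<sigma>]
      by (rule prod_PiE_abs_summable) (use ab[OF j] in auto)
  next
    have "(\<lambda>j. cmod (\<Prod>r<k. complex_of_real (\<alpha> (j r) * \<beta> (j r)))) summable_on JJ"
      by (rule prod_PiE_abs_summable) (use summable nonneg in \<open>auto simp: norm_mult\<close>)
    then have sw: "(\<lambda>j. \<Prod>r<k. \<alpha> (j r) * \<beta> (j r)) summable_on JJ"
      using nonneg by (simp add: prod_norm[symmetric] norm_mult)
    show "(\<lambda>j. norm (infsum (\<lambda>e. cmod (case (j, e) of (j, e) \<Rightarrow> prod_term \<sigma> j e)) EE)) summable_on JJ"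
    proof (rule Infinite_Sum.abs_summable_on_comparison_test'[OF sw])
      fix j assume j: "j \<in> JJ"
      have "infsum (\<lambda>e. cmod (prod_term \<sigma> j e)) EE = infsum (\<lambda>e. \<Prod>r<k. cmod (B (j (inv_into UNIV \<sigma> r)) (e r) * A (e r) (j r))) EE"
        unfolding prod_term_eq[OF \<sigma>] by (simp add: prod_norm)
      also have "\<dots> = (\<Prod>r<k. infsum (\<lambda>e. cmod (B (j (inv_into UNIV \<sigma> r)) e * A e (j r))) E)"
        by (rule infsum_prod_PiE_abs) (use ab[OF j] in auto)
      also have "\<dots> \<le> (\<Prod>r<k. \<beta> (j (inv_into UNIV \<sigma> r)) * \<alpha> (j r))"
      proof (intro prod_mono conjI infsum_nonneg)
        fix r assume r: "r \<in> {..<k}"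
        then have "j (inv_into UNIV \<sigma> r) \<in> J" "j r \<in> J" using j i[of r] by (auto simp: PiE_def Pi_def)
        then show "infsum (\<lambda>e. cmod (B (j (inv_into UNIV \<sigma> r)) e * A e (j r))) E \<le> \<beta> (j (inv_into UNIV \<sigma> r)) * \<alpha> (j r)"
          by (rule BA_abs(2))
      qed simp
      also have "\<dots> = (\<Prod>r<k. \<alpha> (j r) * \<beta> (j r))"
        using prod.permute[OF permutes_inv[OF \<sigma>], of "\<lambda>r. \<beta> (j r)"] by (simp add: prod.distrib o_def mult.commute)
      finally have "infsum (\<lambda>e. cmod (prod_term \<sigma> j e)) EE \<le> (\<Prod>r<k. \<alpha> (j r) * \<beta> (j r))" .
      then show "norm (infsum (\<lambda>e. cmod (case (j, e) of (j, e) \<Rightarrow> prod_term \<sigma> j e)) EE) \<le> (\<Prod>r<k. \<alpha> (j r) * \<beta> (j r))"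
        by (simp add: infsum_nonneg)
    qed
  qed
  then show "(\<lambda>(j, e). prod_term \<sigma> j e) summable_on (JJ \<times> EE)"
    by (rule abs_summable_summable)
qed

text \<open>Fubini for each permutation separately. Reindexing turns the inverse permutation on the
  \<open>BA\<close> side back into the permutation itself, so the signs agree term by term.\<close>

lemma cauchy_binet_tuples:
  "(\<lambda>e. perm_sum (\<lambda>r s. AB (e r) (e s)) {..<k}) summable_on EE"
  "(\<lambda>j. perm_sum (\<lambda>r s. BA (j r) (j s)) {..<k}) summable_on JJ"
  "infsum (\<lambda>e. perm_sum (\<lambda>r s. AB (e r) (e s)) {..<k}) EE = infsum (\<lambda>j. perm_sum (\<lambda>r s. BA (j r) (j s)) {..<k}) JJ"
proof -
  define P where "P = {p. p permutes {..<k}}"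
  have finP: "finite P" unfolding P_def by (rule finite_permutations) simp
  have inv: "(\<Prod>r<k. BA (j (inv_into UNIV \<sigma> r)) (j r)) = (\<Prod>r<k. BA (j r) (j (\<sigma> r)))" if "\<sigma> \<in> P" for \<sigma> j
  proof -
    have \<sigma>: "\<sigma> permutes {..<k}" using that by (simp add: P_def)
    have "(\<Prod>r<k. BA (j (inv_into UNIV \<sigma> r)) (j r)) = (\<Prod>r<k. BA (j (inv_into UNIV \<sigma> (\<sigma> r))) (j (\<sigma> r)))"
      using prod.permute[OF \<sigma>, of "\<lambda>r. BA (j (inv_into UNIV \<sigma> r)) (j r)"] by (simp add: o_def)
    then show ?thesis using permutes_inverses[OF \<sigma>] by simp
  qed
  have sJ: "(\<lambda>j. \<Prod>r<k. BA (j r) (j (\<sigma> r))) summable_on JJ"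
    and sE: "(\<lambda>e. \<Prod>r<k. AB (e r) (e (\<sigma> r))) summable_on EE"
    and eq: "infsum (\<lambda>e. \<Prod>r<k. AB (e r) (e (\<sigma> r))) EE = infsum (\<lambda>j. \<Prod>r<k. BA (j r) (j (\<sigma> r))) JJ"
    if \<sigma>P: "\<sigma> \<in> P" for \<sigma>
  proof -
    have \<sigma>: "\<sigma> permutes {..<k}" using \<sigma>P by (simp add: P_def)
    note t = term_sums[OF \<sigma>]
    have "(\<lambda>j. infsum (\<lambda>e. (\<lambda>(j, e). prod_term \<sigma> j e) (j, e)) EE) summable_on JJ"
      by (rule summable_on_Sigma_banach) (use t(1) in simp)
    then show "(\<lambda>j. \<Prod>r<k. BA (j r) (j (\<sigma> r))) summable_on JJ"
      by (rule summable_on_cong[THEN iffD1, rotated]) (use t(2) inv[OF \<sigma>P] in simp)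
    have "(\<lambda>(e, j). prod_term \<sigma> j e) summable_on (EE \<times> JJ)"
      using t(1) summable_on_swap[of "\<lambda>(j, e). prod_term \<sigma> j e" JJ EE] by (simp add: case_prod_beta')
    then have "(\<lambda>e. infsum (\<lambda>j. (\<lambda>(e, j). prod_term \<sigma> j e) (e, j)) JJ) summable_on EE"
      by (intro summable_on_Sigma_banach) simp
    then show "(\<lambda>e. \<Prod>r<k. AB (e r) (e (\<sigma> r))) summable_on EE"
      by (rule summable_on_cong[THEN iffD1, rotated]) (use t(3) in simp)
    have "infsum (\<lambda>e. \<Prod>r<k. AB (e r) (e (\<sigma> r))) EE = infsum (\<lambda>e. infsum (\<lambda>j. prod_term \<sigma> j e) JJ) EE"
      by (rule infsum_cong) (use t(3) in simp)
    also have "\<dots> = infsum (\<lambda>j. infsum (\<lambda>e. prod_term \<sigma> j e) EE) JJ"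
      by (rule infsum_swap_banach[symmetric]) (rule t(1))
    also have "\<dots> = infsum (\<lambda>j. \<Prod>r<k. BA (j r) (j (\<sigma> r))) JJ"
      by (rule infsum_cong) (use t(2) inv[OF \<sigma>P] in simp)
    finally show "infsum (\<lambda>e. \<Prod>r<k. AB (e r) (e (\<sigma> r))) EE = infsum (\<lambda>j. \<Prod>r<k. BA (j r) (j (\<sigma> r))) JJ" .
  qed
  have hs: "((\<lambda>e. perm_sum (\<lambda>r s. F (e r) (e s)) {..<k}) has_sum
       (\<Sum>p\<in>P. of_int (sign p) * infsum (\<lambda>e. \<Prod>r<k. F (e r) (e (p r))) Z)) Z"
    if "\<And>p. p \<in> P \<Longrightarrow> (\<lambda>e. \<Prod>r<k. F (e r) (e (p r))) summable_on Z"
    for F :: "'z \<Rightarrow> 'z \<Rightarrow> complex" and Z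
    unfolding perm_sum_def P_def[symmetric]
    by (intro has_sum_finite_sum has_sum_cmult_right has_sum_infsum that finP)
  have hE: "((\<lambda>e. perm_sum (\<lambda>r s. AB (e r) (e s)) {..<k}) has_sum
       (\<Sum>p\<in>P. of_int (sign p) * infsum (\<lambda>e. \<Prod>r<k. AB (e r) (e (p r))) EE)) EE"
    by (rule hs) (rule sE)
  have hJ: "((\<lambda>e. perm_sum (\<lambda>r s. BA (e r) (e s)) {..<k}) has_sum
       (\<Sum>p\<in>P. of_int (sign p) * infsum (\<lambda>e. \<Prod>r<k. BA (e r) (e (p r))) JJ)) JJ"
    by (rule hs) (rule sJ)
  show "(\<lambda>e. perm_sum (\<lambda>r s. AB (e r) (e s)) {..<k}) summable_on EE"
    using hE by (rule has_sum_imp_summable)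
  show "(\<lambda>j. perm_sum (\<lambda>r s. BA (j r) (j s)) {..<k}) summable_on JJ"
    using hJ by (rule has_sum_imp_summable)
  show "infsum (\<lambda>e. perm_sum (\<lambda>r s. AB (e r) (e s)) {..<k}) EE = infsum (\<lambda>j. perm_sum (\<lambda>r s. BA (j r) (j s)) {..<k}) JJ"
    unfolding infsumI[OF hE] infsumI[OF hJ] by (intro sum.cong refl arg_cong2[where f = "(*)"] eq)
qed

lemma cauchy_binet: "(perm_sum AB has_sum infsum (perm_sum BA) (subsets_of_card J k)) (subsets_of_card E k)"
proof -
  have "infsum (perm_sum BA) (subsets_of_card J k)
      = infsum (\<lambda>j. perm_sum (\<lambda>r s. BA (j r) (j s)) {..<k}) JJ / fact k"
    by (rule infsumI[OF infsum_tuples_eq_subsets[OF cauchy_binet_tuples(2)]])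
  then show ?thesis
    using infsum_tuples_eq_subsets[OF cauchy_binet_tuples(1)] unfolding cauchy_binet_tuples(3) by simp
qed

end

text \<open>The trivial bound on minors is \<open>k!\<close> times a product of weights, which is
  summable over all finite subsets of all sizes together.\<close>

lemma perm_sum_BA_summable: "(\<lambda>U. cmod (perm_sum BA U)) summable_on {U. finite U \<and> U \<subseteq> J}"
proof (rule Infinite_Sum.abs_summable_on_comparison_test'[where g = "\<lambda>U. fact (card U) * (\<Prod>i\<in>U. \<alpha> i * \<beta> i)"])
  show "(\<lambda>U. fact (card U) * (\<Prod>i\<in>U. \<alpha> i * \<beta> i)) summable_on {U. finite U \<and> U \<subseteq> J}"
    by (rule fact_prod_summable[OF summable]) (use nonneg in simp)
  fix U assume "U \<in> {U. finite U \<and> U \<subseteq> J}"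
  then show "cmod (perm_sum BA U) \<le> fact (card U) * (\<Prod>i\<in>U. \<alpha> i * \<beta> i)"
    by (intro norm_perm_sum_le norm_BA) auto
qed

text \<open>Grouping one absolutely convergent sum by cardinality gives the series over
  \<open>k\<close>. The ungrouped sum is kept because it can be exhausted by power sets of finite
  index sets.\<close>

lemma fredholm_sum:
  "((\<lambda>U. (-1) ^ card U * perm_sum BA U) has_sum infsum (\<lambda>U. (-1) ^ card U * perm_sum BA U) {U. finite U \<and> U \<subseteq> J})
     {U. finite U \<and> U \<subseteq> J}"
  "(\<lambda>k. (-1) ^ k * infsum (perm_sum BA) (subsets_of_card J k)) sums
     infsum (\<lambda>U. (-1) ^ card U * perm_sum BA U) {U. finite U \<and> U \<subseteq> J}"
proof -
  have s: "(\<lambda>U. (-1) ^ card U * perm_sum BA U) summable_on {U. finite U \<and> U \<subseteq> J}"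
    by (rule abs_summable_summable) (use perm_sum_BA_summable in \<open>simp add: norm_mult norm_power\<close>)
  show 1: "((\<lambda>U. (-1) ^ card U * perm_sum BA U) has_sum infsum (\<lambda>U. (-1) ^ card U * perm_sum BA U) {U. finite U \<and> U \<subseteq> J})
     {U. finite U \<and> U \<subseteq> J}"
    using s by (rule has_sum_infsum)
  have bij: "bij_betw snd (Sigma (UNIV :: nat set) (subsets_of_card J)) {U. finite U \<and> U \<subseteq> J}"
    by (rule bij_betwI[where g = "\<lambda>U. (card U, U)"]) (auto simp: subsets_of_card_def)
  have "((\<lambda>x. (-1) ^ card (snd x) * perm_sum BA (snd x)) has_sum
      infsum (\<lambda>U. (-1) ^ card U * perm_sum BA U) {U. finite U \<and> U \<subseteq> J}) (Sigma (UNIV :: nat set) (subsets_of_card J))"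
    using 1 has_sum_reindex_bij_betw[OF bij, of "\<lambda>U. (-1) ^ card U * perm_sum BA U"] by simp
  then have "((\<lambda>k. (-1) ^ k * infsum (perm_sum BA) (subsets_of_card J k)) has_sum
      infsum (\<lambda>U. (-1) ^ card U * perm_sum BA U) {U. finite U \<and> U \<subseteq> J}) UNIV"
  proof (rule has_sum_SigmaD)
    fix k :: nat
    have "perm_sum BA summable_on subsets_of_card J k"
      by (rule summable_on_subset_banach[OF abs_summable_summable[OF perm_sum_BA_summable]])
         (auto simp: subsets_of_card_def)
    from has_sum_cmult_right[OF has_sum_infsum[OF this], of "(-1) ^ k"]
    have "((\<lambda>U. (-1) ^ k * perm_sum BA U) has_sum (-1) ^ k * infsum (perm_sum BA) (subsets_of_card J k)) (subsets_of_card J k)" .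
    then show "((\<lambda>U. (-1) ^ card (snd (k, U)) * perm_sum BA (snd (k, U))) has_sum
        (-1) ^ k * infsum (perm_sum BA) (subsets_of_card J k)) (subsets_of_card J k)"
      by (rule has_sum_cong[THEN iffD1, rotated]) (auto simp: subsets_of_card_def)
  qed
  then show "(\<lambda>k. (-1) ^ k * infsum (perm_sum BA) (subsets_of_card J k)) sums
     infsum (\<lambda>U. (-1) ^ card U * perm_sum BA U) {U. finite U \<and> U \<subseteq> J}"
    by (rule has_sum_imp_sums)
qed

end

section \<open>Nuclear operators\<close>

lemma summable_tail_small:
  fixes w :: "'i \<Rightarrow> real"
  assumes w: "w summable_on A" "\<And>i. i \<in> A \<Longrightarrow> 0 \<le> w i" and e: "e > 0"
  obtains F where "finite F" "F \<subseteq> A" "\<And>F'. finite F' \<Longrightarrow> F' \<subseteq> A - F \<Longrightarrow> sum w F' < e"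
proof -
  have "eventually (\<lambda>F. dist (sum w F) (infsum w A) < e) (finite_subsets_at_top A)"
    using has_sum_infsum[OF w(1)] unfolding has_sum_def by (rule tendstoD) (rule e)
  then obtain F where F: "finite F" "F \<subseteq> A" "dist (sum w F) (infsum w A) < e"
    unfolding eventually_finite_subsets_at_top by blast
  show ?thesis
  proof (rule that[OF F(1,2)])
    fix F' assume F': "finite F'" "F' \<subseteq> A - F"
    have "sum w F' + sum w F = sum w (F' \<union> F)" using F F' by (subst sum.union_disjoint) auto
    also have "\<dots> \<le> infsum w A" by (rule finite_sum_le_infsum[OF w(1)]) (use F F' w in auto)
    finally show "sum w F' < e" using F(3) unfolding dist_real_def by linarith
  qed
qed

lemma l2_norm_sum_le:
  "(\<And>i. i \<in> I \<Longrightarrow> f i \<in> L2 M) \<Longrightarrow> l2_norm M (\<lambda>x. \<Sum>i\<in>I. f i x) \<le> (\<Sum>i\<in>I. l2_norm M (f i))"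
proof (induction I rule: infinite_finite_induct)
  case (insert i I)
  have "l2_norm M (\<lambda>x. f i x + (\<Sum>i\<in>I. f i x)) \<le> l2_norm M (f i) + l2_norm M (\<lambda>x. \<Sum>i\<in>I. f i x)"
    by (rule l2_norm_triangle) (use insert in \<open>auto intro: L2_sum\<close>)
  then show ?case using insert by fastforce
qed auto

lemma l2_AE_eqI:
  assumes "f \<in> L2 M" "g \<in> L2 M" "\<And>h. h \<in> L2 M \<Longrightarrow> l2_inner M h f = l2_inner M h g"
  shows "AE x in M. f x = g x"
proof -
  have d: "(\<lambda>x. f x - g x) \<in> L2 M" by (rule L2_diff[OF assms(1,2)])
  have "complex_of_real ((l2_norm M (\<lambda>x. f x - g x))\<^sup>2) = 0"
    unfolding l2_inner_self[symmetric] by (subst l2_inner_diff_right[OF d assms(1,2)]) (simp add: assms(3)[OF d])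
  then have "l2_norm M (\<lambda>x. f x - g x) = 0" by simp
  from l2_norm_eq_0_AE[OF d this] show ?thesis by eventually_elim simp
qed

text \<open>The operator sending \<open>f\<close> to the sum of <b j, f> a j. A countable index type
  makes the product topology on coefficient families first countable, as \<open>ap_compact\<close>
  needs for sequential compactness.\<close>

locale nuclear_operator =
  fixes M :: "'a measure" and a b :: "'j :: countable \<Rightarrow> 'a \<Rightarrow> complex"
  assumes fin: "finite_measure M" and a: "a j \<in> L2 M" and b: "b j \<in> L2 M"
    and summable: "(\<lambda>j. l2_norm M (a j) * l2_norm M (b j)) summable_on UNIV"
begin

text \<open>The series is imposed weakly, against every \<open>h\<close>; the relation is then
  single-valued up to null sets and closed under changes on null sets.\<close>

definition graph :: "('a \<Rightarrow> complex) rel" where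
  "graph = {(f, g). f \<in> L2 M \<and> g \<in> L2 M \<and>
     (\<forall>h\<in>L2 M. ((\<lambda>j. l2_inner M h (a j) * l2_inner M (b j) f) has_sum l2_inner M h g) UNIV)}"

text \<open>A chosen representative of the image; \<open>ap\<close> is linear only up to null sets,
  so identities for it are stated for inner products, norms or almost everywhere.\<close>

definition ap :: "('a \<Rightarrow> complex) \<Rightarrow> 'a \<Rightarrow> complex" where
  "ap f = (SOME g. (f, g) \<in> graph)"

text \<open>The nuclear weight of this expansion; it bounds the operator norm in
  \<open>norm_ap\<close> and the trace norm in \<open>sum_sv_le\<close>.\<close>

definition W :: real where "W = infsum (\<lambda>j. l2_norm M (a j) * l2_norm M (b j)) UNIV"

lemma W_nonneg: "0 \<le> W" unfolding W_def by (intro infsum_nonneg) simp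

lemma ap_graph: assumes f: "f \<in> L2 M" shows "(f, ap f) \<in> graph"
proof -
  have "\<exists>F. finite F \<and> F \<subseteq> UNIV \<and> (\<forall>F'. finite F' \<and> F' \<subseteq> UNIV - F \<longrightarrow>
      l2_norm M (\<lambda>x. \<Sum>j\<in>F'. l2_inner M (b j) f * a j x) < e)" if "e > 0" for e
  proof -
    define e' where "e' = e / (l2_norm M f + 1)"
    have den: "l2_norm M f + 1 > 0" using l2_norm_nonneg[of M f] by linarith
    have e'0: "e' > 0" using that den by (simp add: e'_def)
    obtain F where F: "finite F" "\<And>F'. finite F' \<Longrightarrow> F' \<subseteq> UNIV - F \<Longrightarrow> (\<Sum>j\<in>F'. l2_norm M (a j) * l2_norm M (b j)) < e'"
      using summable_tail_small[OF summable _ e'0] by auto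
    have "l2_norm M (\<lambda>x. \<Sum>j\<in>F'. l2_inner M (b j) f * a j x) < e" if F': "finite F'" "F' \<subseteq> UNIV - F" for F'
    proof -
      have "l2_norm M (\<lambda>x. \<Sum>j\<in>F'. l2_inner M (b j) f * a j x) \<le> (\<Sum>j\<in>F'. l2_norm M (\<lambda>x. l2_inner M (b j) f * a j x))"
        by (rule l2_norm_sum_le) (intro L2_cmult a)
      also have "\<dots> \<le> (\<Sum>j\<in>F'. l2_norm M f * (l2_norm M (a j) * l2_norm M (b j)))"
      proof (rule sum_mono)
        fix j
        have "cmod (l2_inner M (b j) f) * l2_norm M (a j) \<le> (l2_norm M (b j) * l2_norm M f) * l2_norm M (a j)"
          by (intro mult_right_mono l2_cauchy_schwarz b f) simp
        then show "l2_norm M (\<lambda>x. l2_inner M (b j) f * a j x) \<le> l2_norm M f * (l2_norm M (a j) * l2_norm M (b j))"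
          unfolding l2_norm_cmult by (simp add: mult_ac)
      qed
      also have "\<dots> = l2_norm M f * (\<Sum>j\<in>F'. l2_norm M (a j) * l2_norm M (b j))" by (simp add: sum_distrib_left)
      also have "\<dots> \<le> l2_norm M f * e'" using F(2)[OF F'] by (intro mult_left_mono) auto
      also have "\<dots> < (l2_norm M f + 1) * e'" using e'0 by (simp add: algebra_simps)
      also have "\<dots> = e" using den by (simp add: e'_def)
      finally show ?thesis .
    qed
    with F(1) show ?thesis by blast
  qed
  then obtain g where g: "g \<in> L2 M"
    "\<And>h. h \<in> L2 M \<Longrightarrow> ((\<lambda>j. l2_inner M h (\<lambda>x. l2_inner M (b j) f * a j x)) has_sum l2_inner M h g) UNIV"
    using L2_family_converges[OF fin, of UNIV "\<lambda>j x. l2_inner M (b j) f * a j x" thesis] L2_cmult[OF a] by blast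
  have "(f, g) \<in> graph"
    using f g unfolding graph_def l2_inner_cmult_right by (auto simp: mult.commute)
  then show ?thesis unfolding ap_def by (rule someI[of "\<lambda>g. (f, g) \<in> graph"])
qed

lemma ap_L2: "f \<in> L2 M \<Longrightarrow> ap f \<in> L2 M"
  using ap_graph by (auto simp: graph_def)

lemma inner_ap:
  "f \<in> L2 M \<Longrightarrow> h \<in> L2 M \<Longrightarrow> ((\<lambda>j. l2_inner M h (a j) * l2_inner M (b j) f) has_sum l2_inner M h (ap f)) UNIV"
  using ap_graph by (auto simp: graph_def)

lemma graph_AE: assumes "(f, g) \<in> graph" shows "AE x in M. g x = ap f x"
proof (rule l2_AE_eqI)
  show "g \<in> L2 M" "ap f \<in> L2 M" using assms ap_L2 by (auto simp: graph_def)
  fix h assume "h \<in> L2 M"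
  then show "l2_inner M h g = l2_inner M h (ap f)"
    using assms inner_ap[of f h] unfolding graph_def by (auto dest: has_sum_unique)
qed

text \<open>Keeps the individual coefficients of \<open>f\<close> in the bound, so that the
  compactness argument can treat a finite set of indices and its complement differently.\<close>

lemma norm_ap_le:
  assumes f: "f \<in> L2 M"
  shows "(\<lambda>j. l2_norm M (a j) * cmod (l2_inner M (b j) f)) summable_on UNIV"
    "l2_norm M (ap f) \<le> infsum (\<lambda>j. l2_norm M (a j) * cmod (l2_inner M (b j) f)) UNIV"
proof -
  have le: "l2_norm M (a j) * cmod (l2_inner M (b j) f) \<le> l2_norm M f * (l2_norm M (a j) * l2_norm M (b j))" for j
    using mult_left_mono[OF l2_cauchy_schwarz[OF b f, of j], of "l2_norm M (a j)"] by (simp add: mult_ac)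
  have sm: "(\<lambda>j. norm (l2_norm M (a j) * cmod (l2_inner M (b j) f))) summable_on UNIV"
    by (rule Infinite_Sum.abs_summable_on_comparison_test'[OF summable_on_cmult_right[OF summable, of "l2_norm M f"]])
       (use le in simp)
  then show s: "(\<lambda>j. l2_norm M (a j) * cmod (l2_inner M (b j) f)) summable_on UNIV" by simp
  have "cmod (l2_inner M h (ap f)) \<le> infsum (\<lambda>j. l2_norm M (a j) * cmod (l2_inner M (b j) f)) UNIV * l2_norm M h"
    if h: "h \<in> L2 M" for h
  proof -
    have t: "cmod (l2_inner M h (a j) * l2_inner M (b j) f) \<le> l2_norm M h * (l2_norm M (a j) * cmod (l2_inner M (b j) f))" for j
      using mult_right_mono[OF l2_cauchy_schwarz[OF h a, of j], of "cmod (l2_inner M (b j) f)"] by (simp add: norm_mult mult_ac)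
    have ts: "(\<lambda>j. cmod (l2_inner M h (a j) * l2_inner M (b j) f)) summable_on UNIV"
      by (rule Infinite_Sum.abs_summable_on_comparison_test'[OF summable_on_cmult_right[OF s, of "l2_norm M h"]]) (rule t)
    have "cmod (l2_inner M h (ap f)) = cmod (infsum (\<lambda>j. l2_inner M h (a j) * l2_inner M (b j) f) UNIV)"
      using infsumI[OF inner_ap[OF f h]] by simp
    also have "\<dots> \<le> infsum (\<lambda>j. cmod (l2_inner M h (a j) * l2_inner M (b j) f)) UNIV" by (rule norm_infsum_bound[OF ts])
    also have "\<dots> \<le> infsum (\<lambda>j. l2_norm M h * (l2_norm M (a j) * cmod (l2_inner M (b j) f))) UNIV"
      by (rule infsum_mono[OF ts summable_on_cmult_right[OF s]]) (rule t)
    also have "\<dots> = infsum (\<lambda>j. l2_norm M (a j) * cmod (l2_inner M (b j) f)) UNIV * l2_norm M h"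
      by (simp add: infsum_cmult_right' mult.commute)
    finally show ?thesis .
  qed
  then have "l2_norm M (ap f) \<le> infsum (\<lambda>j. l2_norm M (a j) * cmod (l2_inner M (b j) f)) UNIV \<or> l2_norm M (ap f) = 0"
    by (rule l2_norm_le_by_inner[OF ap_L2[OF f]])
  moreover have "0 \<le> infsum (\<lambda>j. l2_norm M (a j) * cmod (l2_inner M (b j) f)) UNIV" by (intro infsum_nonneg) simp
  ultimately show "l2_norm M (ap f) \<le> infsum (\<lambda>j. l2_norm M (a j) * cmod (l2_inner M (b j) f)) UNIV" by linarith
qed

lemma norm_ap: assumes f: "f \<in> L2 M" shows "l2_norm M (ap f) \<le> W * l2_norm M f"
proof -
  have "infsum (\<lambda>j. l2_norm M (a j) * cmod (l2_inner M (b j) f)) UNIV \<le> infsum (\<lambda>j. l2_norm M (a j) * l2_norm M (b j) * l2_norm M f) UNIV"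
  proof (rule infsum_mono[OF norm_ap_le(1)[OF f] summable_on_cmult_left[OF summable]])
    fix j
    show "l2_norm M (a j) * cmod (l2_inner M (b j) f) \<le> l2_norm M (a j) * l2_norm M (b j) * l2_norm M f"
      using mult_left_mono[OF l2_cauchy_schwarz[OF b f, of j], of "l2_norm M (a j)"] by (simp add: mult_ac)
  qed
  also have "\<dots> = W * l2_norm M f" unfolding W_def by (rule infsum_cmult_left')
  finally show ?thesis using norm_ap_le(2)[OF f] by linarith
qed

lemma inner_ap_diff:
  assumes "f \<in> L2 M" "g \<in> L2 M" "h \<in> L2 M"
  shows "l2_inner M h (ap (\<lambda>x. f x - g x)) = l2_inner M h (\<lambda>x. ap f x - ap g x)"
proof -
  have "((\<lambda>j. l2_inner M h (a j) * l2_inner M (b j) f + - (l2_inner M h (a j) * l2_inner M (b j) g)) has_sum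
      (l2_inner M h (ap f) + - l2_inner M h (ap g))) UNIV"
    by (intro has_sum_add has_sum_uminusI inner_ap assms)
  then have "((\<lambda>j. l2_inner M h (a j) * l2_inner M (b j) (\<lambda>x. f x - g x)) has_sum
      l2_inner M h (\<lambda>x. ap f x - ap g x)) UNIV"
    using assms b ap_L2 by (simp add: l2_inner_diff_right algebra_simps)
  with inner_ap[OF L2_diff[OF assms(1,2)] assms(3)] show ?thesis by (rule has_sum_unique)
qed

lemma norm_ap_diff:
  assumes "f \<in> L2 M" "g \<in> L2 M"
  shows "l2_norm M (\<lambda>x. ap f x - ap g x) = l2_norm M (ap (\<lambda>x. f x - g x))"
proof (rule l2_norm_cong_AE)
  show "AE x in M. ap f x - ap g x = ap (\<lambda>x. f x - g x) x"
    by (rule l2_AE_eqI) (use assms inner_ap_diff in \<open>auto intro: L2_diff ap_L2\<close>)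
qed (use assms in \<open>auto intro: L2_diff ap_L2\<close>)

lemma norm_ap_cmult:
  assumes f: "f \<in> L2 M"
  shows "l2_norm M (ap (\<lambda>x. c * f x)) = cmod c * l2_norm M (ap f)"
proof -
  have "l2_norm M (ap (\<lambda>x. c * f x)) = l2_norm M (\<lambda>x. c * ap f x)"
  proof (rule l2_norm_cong_AE)
    show "AE x in M. ap (\<lambda>x. c * f x) x = c * ap f x"
    proof (rule l2_AE_eqI)
      fix h assume h: "h \<in> L2 M"
      have "((\<lambda>j. l2_inner M h (a j) * l2_inner M (b j) (\<lambda>x. c * f x)) has_sum l2_inner M h (\<lambda>x. c * ap f x)) UNIV"
        using has_sum_cmult_right[OF inner_ap[OF f h], of c] by (simp add: l2_inner_cmult_right mult_ac)
      with inner_ap[OF L2_cmult[OF f] h] show "l2_inner M h (ap (\<lambda>x. c * f x)) = l2_inner M h (\<lambda>x. c * ap f x)"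
        by (rule has_sum_unique)
    qed (use f in \<open>auto intro: L2_cmult ap_L2\<close>)
  qed (use f in \<open>auto intro: L2_cmult ap_L2\<close>)
  then show ?thesis by (simp add: l2_norm_cmult)
qed

lemma bounded_operator_graph: "bounded_operator M graph"
  unfolding bounded_operator_def
proof (intro conjI allI impI ballI)
  show "graph \<subseteq> L2 M \<times> L2 M" by (auto simp: graph_def)
  show "\<exists>g. (f, g) \<in> graph" if "f \<in> L2 M" for f using ap_graph[OF that] by blast
  fix f g f' g'
  assume "(f, g) \<in> graph \<and> f' \<in> L2 M \<and> g' \<in> L2 M \<and> (AE x in M. f' x = f x) \<and> (AE x in M. g' x = g x)"
  then have *: "(f, g) \<in> graph" "f \<in> L2 M" "g \<in> L2 M" "f' \<in> L2 M" "g' \<in> L2 M" "AE x in M. f' x = f x" "AE x in M. g' x = g x"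
    by (auto simp: graph_def)
  have "l2_inner M h f' = l2_inner M h f" "l2_inner M h g' = l2_inner M h g" if "h \<in> L2 M" for h
    using * that by (auto intro!: l2_inner_cong_AE)
  with * b show "(f', g') \<in> graph" unfolding graph_def by auto
next
  fix f g f' g' assume *: "(f, g) \<in> graph \<and> (f', g') \<in> graph"
  then have L: "f \<in> L2 M" "g \<in> L2 M" "f' \<in> L2 M" "g' \<in> L2 M" by (auto simp: graph_def)
  have "((\<lambda>j. l2_inner M h (a j) * l2_inner M (b j) (\<lambda>x. f x + f' x)) has_sum l2_inner M h (\<lambda>x. g x + g' x)) UNIV"
    if h: "h \<in> L2 M" for h
  proof -
    have "((\<lambda>j. l2_inner M h (a j) * l2_inner M (b j) f + l2_inner M h (a j) * l2_inner M (b j) f') has_sum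
        (l2_inner M h g + l2_inner M h g')) UNIV"
      by (rule has_sum_add) (use * h in \<open>auto simp: graph_def\<close>)
    then show ?thesis using L h b by (simp add: l2_inner_add_right distrib_left)
  qed
  then show "(\<lambda>x. f x + f' x, \<lambda>x. g x + g' x) \<in> graph"
    unfolding graph_def using L by (auto intro: L2_add)
next
  fix c f g assume *: "(f, g) \<in> graph"
  have "((\<lambda>j. l2_inner M h (a j) * l2_inner M (b j) (\<lambda>x. c * f x)) has_sum l2_inner M h (\<lambda>x. c * g x)) UNIV"
    if h: "h \<in> L2 M" for h
  proof -
    have "((\<lambda>j. l2_inner M h (a j) * l2_inner M (b j) f) has_sum l2_inner M h g) UNIV"
      using * h by (auto simp: graph_def)
    from has_sum_cmult_right[OF this, of c] show ?thesis by (simp add: l2_inner_cmult_right mult_ac)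
  qed
  then show "(\<lambda>x. c * f x, \<lambda>x. c * g x) \<in> graph"
    using * unfolding graph_def by (auto intro: L2_cmult)
next
  have "l2_norm M g \<le> W * l2_norm M f" if "(f, g) \<in> graph" for f g
  proof -
    have "f \<in> L2 M" "g \<in> L2 M" using that by (auto simp: graph_def)
    then show ?thesis using norm_ap[of f] l2_norm_cong_AE[OF graph_AE[OF that]] ap_L2 by simp
  qed
  then show "\<exists>C. \<forall>(f, g)\<in>graph. l2_norm M g \<le> C * l2_norm M f" by blast
qed

text \<open>The coefficients of a bounded sequence lie in a product of closed discs, which is
  compact, so they converge coordinatewise along a subsequence. The tails of the weights are
  uniformly small, hence the images form a Cauchy sequence.\<close>

lemma ap_compact:
  assumes s: "\<And>n. s n \<in> L2 M" "\<And>n. l2_norm M (s n) \<le> 1"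
  shows "\<exists>r :: nat \<Rightarrow> nat. strict_mono r \<and>
    (\<forall>e>0. \<exists>N. \<forall>i\<ge>N. \<forall>k\<ge>N. l2_norm M (\<lambda>x. ap (s (r i)) x - ap (s (r k)) x) < e)"
proof -
  define X where "X n = (\<lambda>j. l2_inner M (b j) (s n))" for n
  define Q where "Q = PiE UNIV (\<lambda>j. cball (0 :: complex) (l2_norm M (b j)))"
  have Xle: "cmod (X n j) \<le> l2_norm M (b j)" for n j
  proof -
    have "cmod (X n j) \<le> l2_norm M (b j) * l2_norm M (s n)" unfolding X_def by (rule l2_cauchy_schwarz[OF b s(1)])
    also have "\<dots> \<le> l2_norm M (b j) * 1" by (intro mult_left_mono s(2)) simp
    finally show ?thesis by simp
  qed
  then have XQ: "X n \<in> Q" for n by (auto simp: Q_def)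
  have "compactin (product_topology (\<lambda>_. euclidean) UNIV) Q"
    unfolding Q_def by (subst compactin_PiE) auto
  then have "compact Q" by (simp add: euclidean_product_topology)
  then have "seq_compact Q" by (rule compact_imp_seq_compact)
  then obtain l r where r: "strict_mono r" "(X \<circ> r) \<longlonglongrightarrow> l"
    using XQ unfolding seq_compact_def by metis
  have lim: "(\<lambda>i. X (r i) j) \<longlonglongrightarrow> l j" for j
  proof -
    have "isCont (\<lambda>f :: 'j \<Rightarrow> complex. f j) l"
      by (rule continuous_on_interior[OF continuous_on_product_coordinates]) simp
    from isCont_tendsto_compose[OF this r(2)] show ?thesis by (simp add: o_def)
  qed
  have "\<exists>N. \<forall>i\<ge>N. \<forall>k\<ge>N. l2_norm M (\<lambda>x. ap (s (r i)) x - ap (s (r k)) x) < e" if e: "e > 0" for e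
  proof -
    \<comment> \<open>Two eighths for the finitely many chosen indices and two for the tail make
      e/2, which leaves room for a strict inequality.\<close>
    have e8: "e / 8 > 0" using e by simp
    obtain F where F: "finite F" "\<And>F'. finite F' \<Longrightarrow> F' \<subseteq> UNIV - F \<Longrightarrow> (\<Sum>j\<in>F'. l2_norm M (a j) * l2_norm M (b j)) < e / 8"
      using summable_tail_small[OF summable _ e8] by auto
    have "(\<lambda>i. \<Sum>j\<in>F. l2_norm M (a j) * cmod (X (r i) j - l j)) \<longlonglongrightarrow> (\<Sum>j\<in>F. l2_norm M (a j) * cmod (l j - l j))"
      by (intro tendsto_intros lim)
    then have "eventually (\<lambda>i. (\<Sum>j\<in>F. l2_norm M (a j) * cmod (X (r i) j - l j)) < e / 8) sequentially"
      by (rule order_tendstoD(2)) (use e in simp)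
    then obtain N where N: "\<And>i. i \<ge> N \<Longrightarrow> (\<Sum>j\<in>F. l2_norm M (a j) * cmod (X (r i) j - l j)) < e / 8"
      by (auto simp: eventually_sequentially)
    show ?thesis
    proof (intro exI[of _ N] allI impI)
      fix i k assume ik: "i \<ge> N" "k \<ge> N"
      define d where "d = (\<lambda>x. s (r i) x - s (r k) x)"
      have d: "d \<in> L2 M" unfolding d_def by (intro L2_diff s)
      have dX: "l2_inner M (b j) d = X (r i) j - X (r k) j" for j
        unfolding d_def X_def by (rule l2_inner_diff_right[OF b s(1) s(1)])
      have "l2_norm M (\<lambda>x. ap (s (r i)) x - ap (s (r k)) x) \<le> infsum (\<lambda>j. l2_norm M (a j) * cmod (l2_inner M (b j) d)) UNIV"
        using norm_ap_diff[OF s(1) s(1), of "r i" "r k"] norm_ap_le(2)[OF d] by (simp add: d_def)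
      also have "\<dots> \<le> e / 2"
      proof (rule infsum_le_finite_sums[OF norm_ap_le(1)[OF d]])
        fix G :: "'j set" assume G: "finite G"
        have "(\<Sum>j\<in>G. l2_norm M (a j) * cmod (l2_inner M (b j) d))
            = (\<Sum>j\<in>G \<inter> F. l2_norm M (a j) * cmod (l2_inner M (b j) d)) + (\<Sum>j\<in>G - F. l2_norm M (a j) * cmod (l2_inner M (b j) d))"
          using G by (subst sum.union_disjoint[symmetric]) (auto simp: Int_Diff_Un)
        also have "\<dots> \<le> (e / 8 + e / 8) + 2 * (e / 8)"
        proof (rule add_mono)
          have "(\<Sum>j\<in>G \<inter> F. l2_norm M (a j) * cmod (l2_inner M (b j) d)) \<le> (\<Sum>j\<in>F. l2_norm M (a j) * cmod (l2_inner M (b j) d))"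
            using F(1) by (intro sum_mono2) auto
          also have "\<dots> \<le> (\<Sum>j\<in>F. l2_norm M (a j) * cmod (X (r i) j - l j) + l2_norm M (a j) * cmod (X (r k) j - l j))"
          proof (rule sum_mono)
            fix j
            have "cmod (l2_inner M (b j) d) \<le> cmod (X (r i) j - l j) + cmod (X (r k) j - l j)"
              unfolding dX using norm_triangle_ineq4[of "X (r i) j - l j" "X (r k) j - l j"] by simp
            then have "l2_norm M (a j) * cmod (l2_inner M (b j) d) \<le> l2_norm M (a j) * (cmod (X (r i) j - l j) + cmod (X (r k) j - l j))"
              by (rule mult_left_mono) simp
            then show "l2_norm M (a j) * cmod (l2_inner M (b j) d)
                \<le> l2_norm M (a j) * cmod (X (r i) j - l j) + l2_norm M (a j) * cmod (X (r k) j - l j)"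
              by (simp add: distrib_left)
          qed
          also have "\<dots> \<le> e / 8 + e / 8" using N[OF ik(1)] N[OF ik(2)] by (simp add: sum.distrib)
          finally show "(\<Sum>j\<in>G \<inter> F. l2_norm M (a j) * cmod (l2_inner M (b j) d)) \<le> e / 8 + e / 8" .
          have "(\<Sum>j\<in>G - F. l2_norm M (a j) * cmod (l2_inner M (b j) d)) \<le> (\<Sum>j\<in>G - F. 2 * (l2_norm M (a j) * l2_norm M (b j)))"
          proof (rule sum_mono)
            fix j
            have "cmod (l2_inner M (b j) d) \<le> l2_norm M (b j) + l2_norm M (b j)"
              unfolding dX using norm_triangle_ineq4[of "X (r i) j" "X (r k) j"] Xle[of "r i" j] Xle[of "r k" j] by linarith
            then have "l2_norm M (a j) * cmod (l2_inner M (b j) d) \<le> l2_norm M (a j) * (l2_norm M (b j) + l2_norm M (b j))"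
              by (rule mult_left_mono) simp
            then show "l2_norm M (a j) * cmod (l2_inner M (b j) d) \<le> 2 * (l2_norm M (a j) * l2_norm M (b j))" by simp
          qed
          also have "\<dots> \<le> 2 * (e / 8)" unfolding sum_distrib_left[symmetric]
            using F(2)[of "G - F"] G by (intro mult_left_mono less_imp_le) auto
          finally show "(\<Sum>j\<in>G - F. l2_norm M (a j) * cmod (l2_inner M (b j) d)) \<le> 2 * (e / 8)" .
        qed
        finally show "(\<Sum>j\<in>G. l2_norm M (a j) * cmod (l2_inner M (b j) d)) \<le> e / 2" by simp
      qed
      also have "\<dots> < e" using e by simp
      finally show "l2_norm M (\<lambda>x. ap (s (r i)) x - ap (s (r k)) x) < e" .
    qed
  qed
  with r(1) show ?thesis by blast
qed

text \<open>Exchanging \<open>a\<close> and \<open>b\<close> gives the adjoint operator.\<close>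

lemma transpose: "nuclear_operator M b a"
  by (intro nuclear_operator.intro fin a b) (use summable in \<open>simp add: mult.commute\<close>)

interpretation adj: nuclear_operator M b a by (rule transpose)

lemma adj_inner:
  assumes "f \<in> L2 M" "g \<in> L2 M"
  shows "l2_inner M (ap f) g = l2_inner M f (adj.ap g)"
proof -
  have "((\<lambda>j. cnj (l2_inner M g (a j) * l2_inner M (b j) f)) has_sum cnj (l2_inner M g (ap f))) UNIV"
    using inner_ap[OF assms] by (subst has_sum_cnj_iff)
  then have "((\<lambda>j. l2_inner M f (b j) * l2_inner M (a j) g) has_sum l2_inner M (ap f) g) UNIV"
    by (simp add: l2_inner_commute[symmetric] mult.commute)
  from has_sum_unique[OF this adj.inner_ap[OF assms(2,1)]] show ?thesis .
qed

section \<open>Eigenvectors of the product of the adjoint with the operator\<close>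

text \<open>Weak form of the eigenvector equation for \<open>T* T\<close>, where \<open>T\<close> is
  the operator. Putting f = e shows that \<mu> is real and nonnegative for a non-null
  \<open>e\<close>.\<close>

definition eigen :: "('a \<Rightarrow> complex) \<Rightarrow> bool" where
  "eigen e \<longleftrightarrow> (\<exists>\<mu>. \<forall>f\<in>L2 M. l2_inner M (ap e) (ap f) = \<mu> * l2_inner M e f)"

text \<open>A maximising sequence for the norm of \<open>ap\<close> on the unit sphere of the complement converges along a
  subsequence, since \<open>ap\<close> is compact, and its limit is an eigenvector.\<close>

lemma exists_eigen:
  assumes E: "E \<subseteq> L2 M" "\<And>e. e \<in> E \<Longrightarrow> eigen e"
    and f0: "f0 \<in> L2 M" "\<And>e. e \<in> E \<Longrightarrow> l2_inner M e f0 = 0" "l2_norm M f0 \<noteq> 0"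
  obtains f where "f \<in> L2 M" "l2_norm M f = 1" "eigen f" "\<And>e. e \<in> E \<Longrightarrow> l2_inner M e f = 0"
proof -
  define N where "N = {f \<in> L2 M. \<forall>e\<in>E. l2_inner M e f = 0}"
  define U where "U = {f \<in> N. l2_norm M f = 1}"
  have norm1: "(\<lambda>x. of_real (inverse (l2_norm M f)) * f x) \<in> U" if "f \<in> N" "l2_norm M f \<noteq> 0" for f
    using that by (auto simp: U_def N_def l2_inner_cmult_right l2_norm_cmult norm_inverse intro: L2_cmult)
  have UN: "U \<noteq> {}" using norm1[of f0] f0 by (auto simp: N_def)
  define m where "m = (SUP f\<in>U. l2_norm M (ap f))"
  have bdd: "bdd_above ((\<lambda>f. l2_norm M (ap f)) ` U)"
    using norm_ap by (intro bdd_aboveI2[where M = W]) (fastforce simp: U_def N_def)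
  have mU: "l2_norm M (ap f) \<le> m" if "f \<in> U" for f
    unfolding m_def by (rule cSUP_upper[OF that bdd])
  have m0: "m \<ge> 0" using UN mU l2_norm_nonneg order.trans by blast
  have mN: "l2_norm M (ap f) \<le> m * l2_norm M f" if f: "f \<in> N" for f
  proof (cases "l2_norm M f = 0")
    case True
    then show ?thesis using norm_ap[of f] f m0 by (simp add: N_def)
  next
    case False
    have fL: "f \<in> L2 M" using f by (simp add: N_def)
    have "cmod (of_real (inverse (l2_norm M f))) * l2_norm M (ap f) \<le> m"
      using mU[OF norm1[OF f False]] unfolding norm_ap_cmult[OF fL] .
    then have "l2_norm M (ap f) / l2_norm M f \<le> m" by (simp add: norm_inverse divide_inverse mult.commute)
    then show ?thesis using False l2_norm_nonneg[of M f] by (simp add: pos_divide_le_eq)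
  qed
  show ?thesis
  proof (cases "m = 0")
    case True
    \<comment> \<open>If the supremum is 0, the image of any unit vector of the complement is null,
      and that vector is an eigenvector for 0.\<close>
    obtain f where f: "f \<in> U" using UN by blast
    then have fL: "f \<in> L2 M" by (simp add: U_def N_def)
    have "l2_norm M (ap f) = 0" using mU[OF f] True l2_norm_nonneg[of M "ap f"] by linarith
    then have "l2_inner M (ap f) (ap g) = 0" if "g \<in> L2 M" for g
      using l2_cauchy_schwarz[OF ap_L2[OF fL] ap_L2[OF that]] by simp
    then have "eigen f" unfolding eigen_def by (intro exI[of _ 0]) auto
    then show ?thesis using that[of f] f by (auto simp: U_def N_def)
  next
    case False
    then have mpos: "m > 0" using m0 by simp
    have "\<exists>f\<in>U. l2_norm M (ap f) > m - inverse (real (Suc n))" for n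
    proof -
      have "m - inverse (real (Suc n)) < m" by simp
      then show ?thesis unfolding m_def using less_cSUP_iff[OF UN bdd] by blast
    qed
    then obtain s0 where s0: "\<And>n. s0 n \<in> U" "\<And>n. l2_norm M (ap (s0 n)) > m - inverse (real (Suc n))" by metis
    have s0L: "s0 n \<in> L2 M" "l2_norm M (s0 n) = 1" "s0 n \<in> N" for n using s0(1)[of n] by (auto simp: U_def N_def)
    obtain r :: "nat \<Rightarrow> nat" where r: "strict_mono r"
      "\<forall>e>0. \<exists>N. \<forall>i\<ge>N. \<forall>k\<ge>N. l2_norm M (\<lambda>x. ap (s0 (r i)) x - ap (s0 (r k)) x) < e"
      using ap_compact[of s0, OF s0L(1) eq_refl[OF s0L(2)]] by (elim exE conjE)
    define s where "s i = s0 (r i)" for i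
    have s: "s i \<in> L2 M" "l2_norm M (s i) = 1" "s i \<in> N" "s i \<in> U" for i using s0L s0(1) by (auto simp: s_def)
    have "(\<lambda>n. l2_norm M (ap (s0 n))) \<longlonglongrightarrow> m"
    proof (rule tendsto_sandwich[of "\<lambda>n. m - inverse (real (Suc n))" _ _ "\<lambda>_. m"])
      show "(\<lambda>n. m - inverse (real (Suc n))) \<longlonglongrightarrow> m"
        using tendsto_diff[OF tendsto_const LIMSEQ_inverse_real_of_nat, of m] by simp
    qed (use s0 mU in \<open>auto intro!: always_eventually less_imp_le\<close>)
    then have slim: "(\<lambda>i. l2_norm M (ap (s i))) \<longlonglongrightarrow> m"
      unfolding s_def using LIMSEQ_subseq_LIMSEQ[OF _ r(1)] by (simp add: o_def)
    define S where "S f = adj.ap (ap f)" for f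
    have SL: "S f \<in> L2 M" if "f \<in> L2 M" for f unfolding S_def by (intro adj.ap_L2 ap_L2 that)
    have Sin: "l2_inner M g (S f) = l2_inner M (ap g) (ap f)" if "f \<in> L2 M" "g \<in> L2 M" for f g
      unfolding S_def using adj_inner[OF that(2) ap_L2[OF that(1)]] by simp
    \<comment> \<open>The complement of a set of eigenvectors is invariant under S = T* T, so the
      supremum \<open>m\<close> also controls the operator at \<open>S f\<close>.\<close>
    have SN: "S f \<in> N" if f: "f \<in> N" for f
    proof -
      have "l2_inner M e (S f) = 0" if e: "e \<in> E" for e
      proof -
        obtain \<mu> where "\<forall>f\<in>L2 M. l2_inner M (ap e) (ap f) = \<mu> * l2_inner M e f" using E(2)[OF e] by (auto simp: eigen_def)
        then show ?thesis using Sin[of f e] f e E(1) by (auto simp: N_def)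
      qed
      then show ?thesis using f SL by (auto simp: N_def)
    qed
    have Snorm: "l2_norm M (S f) \<le> m * l2_norm M (ap f)" if f: "f \<in> N" for f
    proof -
      have fL: "f \<in> L2 M" using f by (simp add: N_def)
      have "complex_of_real ((l2_norm M (S f))\<^sup>2) = l2_inner M (ap (S f)) (ap f)"
        unfolding l2_inner_self[symmetric] by (rule Sin[OF fL SL[OF fL]])
      then have "(l2_norm M (S f))\<^sup>2 = cmod (l2_inner M (ap (S f)) (ap f))"
        by (metis abs_of_nonneg norm_of_real zero_le_power2)
      also have "\<dots> \<le> l2_norm M (ap (S f)) * l2_norm M (ap f)"
        by (rule l2_cauchy_schwarz[OF ap_L2[OF SL[OF fL]] ap_L2[OF fL]])
      also have "\<dots> \<le> (m * l2_norm M (S f)) * l2_norm M (ap f)"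
        by (intro mult_right_mono mN SN f) simp
      finally have "l2_norm M (S f) * l2_norm M (S f) \<le> (m * l2_norm M (ap f)) * l2_norm M (S f)"
        by (simp add: power2_eq_square mult_ac)
      then show ?thesis
        using l2_norm_nonneg[of M "S f"] m0 by (cases "l2_norm M (S f) = 0") auto
    qed
    \<comment> \<open>The defect in the eigenvector equation for m^2. Expanding the square bounds
      its square by m^2 (m^2 - |T s_i|^2), which tends to 0 along the maximising sequence.\<close>
    define D where "D i = l2_norm M (\<lambda>x. S (s i) x - of_real (m\<^sup>2) * s i x)" for i
    have D0: "D i \<ge> 0" for i by (simp add: D_def)
    have D2: "(D i)\<^sup>2 \<le> m\<^sup>2 * (m\<^sup>2 - (l2_norm M (ap (s i)))\<^sup>2)" for i
    proof -
      have "(D i)\<^sup>2 = (l2_norm M (S (s i)))\<^sup>2 - 2 * Re (l2_inner M (S (s i)) (\<lambda>x. of_real (m\<^sup>2) * s i x))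
          + (l2_norm M (\<lambda>x. of_real (m\<^sup>2) * s i x))\<^sup>2"
        unfolding D_def by (rule l2_norm_diff_power2[OF SL[OF s(1)] L2_cmult[OF s(1)]])
      also have "l2_inner M (S (s i)) (\<lambda>x. of_real (m\<^sup>2) * s i x) = of_real (m\<^sup>2 * (l2_norm M (ap (s i)))\<^sup>2)"
      proof -
        have "l2_inner M (S (s i)) (s i) = cnj (l2_inner M (ap (s i)) (ap (s i)))"
          by (subst l2_inner_commute) (simp add: Sin s)
        then show ?thesis by (simp add: l2_inner_cmult_right l2_inner_self)
      qed
      also have "(l2_norm M (\<lambda>x. of_real (m\<^sup>2) * s i x))\<^sup>2 = m\<^sup>2 * m\<^sup>2"
        unfolding l2_norm_cmult s(2) by (simp add: norm_mult power2_eq_square)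
      also have "(l2_norm M (S (s i)))\<^sup>2 \<le> (m * l2_norm M (ap (s i)))\<^sup>2"
        by (intro power_mono Snorm s) simp
      finally show ?thesis by (simp add: algebra_simps power_mult_distrib)
    qed
    have "(\<lambda>i. (D i)\<^sup>2) \<longlonglongrightarrow> 0"
    proof (rule tendsto_sandwich[of "\<lambda>_. 0" _ _ "\<lambda>i. m\<^sup>2 * (m\<^sup>2 - (l2_norm M (ap (s i)))\<^sup>2)"])
      have "(\<lambda>i. m\<^sup>2 * (m\<^sup>2 - (l2_norm M (ap (s i)))\<^sup>2)) \<longlonglongrightarrow> m\<^sup>2 * (m\<^sup>2 - m\<^sup>2)" by (intro tendsto_intros slim)
      then show "(\<lambda>i. m\<^sup>2 * (m\<^sup>2 - (l2_norm M (ap (s i)))\<^sup>2)) \<longlonglongrightarrow> 0" by simp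
    qed (use D2 in auto)
    then have "(\<lambda>i. sqrt ((D i)\<^sup>2)) \<longlonglongrightarrow> sqrt 0" by (rule tendsto_real_sqrt)
    then have Dlim: "D \<longlonglongrightarrow> 0" using D0 by simp
    \<comment> \<open>Since m^2 s_i is close to S s_i and the images T s_i are Cauchy, the vectors
      s_i are Cauchy themselves; this is where m > 0 matters.\<close>
    have diff: "m\<^sup>2 * l2_norm M (\<lambda>x. s i x - s k x) \<le> D i + adj.W * l2_norm M (\<lambda>x. ap (s i) x - ap (s k) x) + D k" for i k
    proof -
      have L: "S (s i) \<in> L2 M" "S (s k) \<in> L2 M" "(\<lambda>x. of_real (m\<^sup>2) * s i x) \<in> L2 M" "(\<lambda>x. of_real (m\<^sup>2) * s k x) \<in> L2 M"
        using s SL by (auto intro: L2_cmult)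
      have "m\<^sup>2 * l2_norm M (\<lambda>x. s i x - s k x) = l2_norm M (\<lambda>x. of_real (m\<^sup>2) * (s i x - s k x))"
        unfolding l2_norm_cmult by (simp add: norm_power)
      also have "\<dots> = l2_norm M (\<lambda>x. of_real (m\<^sup>2) * s i x - of_real (m\<^sup>2) * s k x)"
        by (simp add: right_diff_distrib)
      also have "\<dots> \<le> l2_norm M (\<lambda>x. of_real (m\<^sup>2) * s i x - S (s i) x) + l2_norm M (\<lambda>x. S (s i) x - of_real (m\<^sup>2) * s k x)"
        by (rule l2_dist_triangle[OF L(3,1,4)])
      also have "l2_norm M (\<lambda>x. S (s i) x - of_real (m\<^sup>2) * s k x) \<le> l2_norm M (\<lambda>x. S (s i) x - S (s k) x) + D k"
        unfolding D_def by (rule l2_dist_triangle[OF L(1,2,4)])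
      also have "l2_norm M (\<lambda>x. S (s i) x - S (s k) x) \<le> adj.W * l2_norm M (\<lambda>x. ap (s i) x - ap (s k) x)"
        unfolding S_def adj.norm_ap_diff[OF ap_L2[OF s(1)] ap_L2[OF s(1)]]
        by (rule adj.norm_ap[OF L2_diff[OF ap_L2[OF s(1)] ap_L2[OF s(1)]]])
      finally show ?thesis by (simp add: D_def l2_norm_minus_commute[of M _ "S (s i)"])
    qed
    have cauchy: "\<exists>N. \<forall>i\<ge>N. \<forall>k\<ge>N. l2_norm M (\<lambda>x. s i x - s k x) < e" if e: "e > 0" for e
    proof -
      define e1 where "e1 = m\<^sup>2 * e / 4"
      have e1: "e1 > 0" using e mpos by (simp add: e1_def)
      obtain N1 where N1: "\<And>i. i \<ge> N1 \<Longrightarrow> D i < e1"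
        using order_tendstoD(2)[OF Dlim e1] by (auto simp: eventually_sequentially)
      define e2 where "e2 = e1 / (adj.W + 1)"
      have W1: "adj.W + 1 > 0" using adj.W_nonneg by linarith
      have e2: "e2 > 0" using e1 W1 by (simp add: e2_def)
      obtain N2 where N2: "\<And>i k. i \<ge> N2 \<Longrightarrow> k \<ge> N2 \<Longrightarrow> l2_norm M (\<lambda>x. ap (s i) x - ap (s k) x) < e2"
        using r(2)[rule_format, OF e2] unfolding s_def by blast
      have "l2_norm M (\<lambda>x. s i x - s k x) < e" if ik: "i \<ge> max N1 N2" "k \<ge> max N1 N2" for i k
      proof -
        have "adj.W * l2_norm M (\<lambda>x. ap (s i) x - ap (s k) x) \<le> adj.W * e2"
          using ik adj.W_nonneg by (intro mult_left_mono[OF less_imp_le[OF N2]]) auto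
        also have "\<dots> \<le> (adj.W + 1) * e2" using e2 by (intro mult_right_mono) auto
        also have "\<dots> = e1" using W1 by (simp add: e2_def)
        finally have "m\<^sup>2 * l2_norm M (\<lambda>x. s i x - s k x) < m\<^sup>2 * e"
          using diff[of i k] N1[of i] N1[of k] ik e1 unfolding e1_def by simp
        then show ?thesis using mpos by simp
      qed
      then show ?thesis by blast
    qed
    obtain f where f: "f \<in> L2 M" "(\<lambda>i. l2_norm M (\<lambda>x. s i x - f x)) \<longlonglongrightarrow> 0"
      using L2_complete[OF fin s(1) cauchy] by blast
    have apf: "(\<lambda>i. l2_norm M (\<lambda>x. ap (s i) x - ap f x)) \<longlonglongrightarrow> 0"
    proof (rule Lim_null_comparison)
      show "eventually (\<lambda>i. norm (l2_norm M (\<lambda>x. ap (s i) x - ap f x)) \<le> W * l2_norm M (\<lambda>x. s i x - f x)) sequentially"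
        using norm_ap_diff[OF s(1) f(1)] norm_ap[OF L2_diff[OF s(1) f(1)]] by auto
      show "(\<lambda>i. W * l2_norm M (\<lambda>x. s i x - f x)) \<longlonglongrightarrow> 0"
        using tendsto_mult_left[OF f(2), of W] by simp
    qed
    have inner_lim: "(\<lambda>i. l2_inner M h (s i)) \<longlonglongrightarrow> l2_inner M h f" if "h \<in> L2 M" for h
      by (rule l2_inner_tendsto[OF that s(1) f])
    have fN: "l2_inner M e f = 0" if e: "e \<in> E" for e
    proof (rule LIMSEQ_unique[OF inner_lim])
      show "e \<in> L2 M" using e E by blast
      show "(\<lambda>i. l2_inner M e (s i)) \<longlonglongrightarrow> 0" using s(3) e by (simp add: N_def)
    qed
    have fnorm: "l2_norm M f = 1"
    proof -
      have "\<bar>1 - l2_norm M f\<bar> \<le> l2_norm M (\<lambda>x. s i x - f x)" for i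
      proof -
        have "l2_norm M (s i) \<le> l2_norm M (\<lambda>x. s i x - f x) + l2_norm M f"
          using l2_norm_triangle[OF L2_diff[OF s(1)[of i] f(1)] f(1)] by simp
        moreover have "l2_norm M f \<le> l2_norm M (s i) + l2_norm M (\<lambda>x. s i x - f x)"
          using l2_norm_triangle_diff[OF s(1)[of i] L2_diff[OF s(1)[of i] f(1)]] by simp
        ultimately show ?thesis by (simp add: s(2))
      qed
      then have "\<bar>1 - l2_norm M f\<bar> \<le> 0"
        by (intro LIMSEQ_le_const[OF f(2)]) auto
      then show ?thesis by simp
    qed
    have "l2_inner M (ap f) (ap h) = of_real (m\<^sup>2) * l2_inner M f h" if h: "h \<in> L2 M" for h
    proof -
      have "(\<lambda>i. l2_inner M (ap h) (ap (s i)) - of_real (m\<^sup>2) * l2_inner M h (s i)) \<longlonglongrightarrow> 0"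
      proof (rule Lim_null_comparison)
        have "cmod (l2_inner M (ap h) (ap (s i)) - of_real (m\<^sup>2) * l2_inner M h (s i)) \<le> l2_norm M h * D i" for i
        proof -
          have "l2_inner M (ap h) (ap (s i)) - of_real (m\<^sup>2) * l2_inner M h (s i)
              = l2_inner M h (\<lambda>x. S (s i) x - of_real (m\<^sup>2) * s i x)"
            by (subst l2_inner_diff_right[OF h SL[OF s(1)] L2_cmult[OF s(1)]])
               (simp add: Sin[OF s(1) h] l2_inner_cmult_right)
          then show ?thesis
            unfolding D_def using l2_cauchy_schwarz[OF h L2_diff[OF SL[OF s(1)] L2_cmult[OF s(1)]]] by simp
        qed
        then show "eventually (\<lambda>i. norm (l2_inner M (ap h) (ap (s i)) - of_real (m\<^sup>2) * l2_inner M h (s i)) \<le> l2_norm M h * D i) sequentially"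
          by simp
        show "(\<lambda>i. l2_norm M h * D i) \<longlonglongrightarrow> 0" using tendsto_mult_left[OF Dlim, of "l2_norm M h"] by simp
      qed
      moreover have "(\<lambda>i. l2_inner M (ap h) (ap (s i)) - of_real (m\<^sup>2) * l2_inner M h (s i))
          \<longlonglongrightarrow> l2_inner M (ap h) (ap f) - of_real (m\<^sup>2) * l2_inner M h f"
        by (intro tendsto_intros inner_lim h l2_inner_tendsto[OF ap_L2[OF h] ap_L2[OF s(1)] ap_L2[OF f(1)] apf])
      ultimately have "0 = l2_inner M (ap h) (ap f) - of_real (m\<^sup>2) * l2_inner M h f" by (rule LIMSEQ_unique)
      then have "cnj (l2_inner M (ap h) (ap f)) = cnj (of_real (m\<^sup>2) * l2_inner M h f)" by simp
      then show ?thesis by (simp add: l2_inner_commute[symmetric])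
    qed
    then have "eigen f" unfolding eigen_def by blast
    then show ?thesis using that[of f] f fnorm fN by blast
  qed
qed

text \<open>Zorn's lemma gives a maximal orthonormal set of eigenvectors. A non-null vector
  orthogonal to it would yield one more unit eigenvector in the complement.\<close>

lemma eigenbasis:
  obtains E where "orthonormal_basis M E" "\<And>e. e \<in> E \<Longrightarrow> eigen e"
proof -
  define \<S> where "\<S> = {E. orthonormal M E \<and> (\<forall>e\<in>E. eigen e)}"
  have "\<exists>E\<in>\<S>. \<forall>X\<in>\<S>. E \<subseteq> X \<longrightarrow> X = E"
  proof (rule subset_Zorn_nonempty)
    have "{} \<in> \<S>" by (simp add: \<S>_def orthonormal_def)
    then show "\<S> \<noteq> {}" by blast
    fix C assume C: "C \<noteq> {}" "subset.chain \<S> C"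
    have sub: "C \<subseteq> \<S>" using C(2) by (simp add: subset_chain_def)
    have "orthonormal M (\<Union>C)"
      unfolding orthonormal_def
    proof (intro conjI ballI)
      show "\<Union>C \<subseteq> L2 M" using sub by (auto simp: \<S>_def orthonormal_def)
      fix e e' assume "e \<in> \<Union>C" "e' \<in> \<Union>C"
      then obtain X Y where XY: "X \<in> C" "e \<in> X" "Y \<in> C" "e' \<in> Y" by blast
      then have "X \<subseteq> Y \<or> Y \<subseteq> X" using C(2) by (auto simp: subset_chain_def)
      then obtain Z where "Z \<in> C" "e \<in> Z" "e' \<in> Z" using XY by blast
      moreover from this have "orthonormal M Z" using sub by (auto simp: \<S>_def)
      ultimately show "l2_inner M e e' = (if e = e' then 1 else 0)" by (simp add: orthonormal_def)
    qed
    moreover have "\<forall>e\<in>\<Union>C. eigen e" using sub by (auto simp: \<S>_def)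
    ultimately show "\<Union>C \<in> \<S>" by (simp add: \<S>_def)
  qed
  then obtain E where E: "orthonormal M E" "\<forall>e\<in>E. eigen e" "\<And>X. X \<in> \<S> \<Longrightarrow> E \<subseteq> X \<Longrightarrow> X = E"
    unfolding \<S>_def by auto
  have "AE x in M. f x = 0" if f: "f \<in> L2 M" "\<forall>e\<in>E. l2_inner M e f = 0" for f
  proof (rule ccontr)
    assume "\<not> (AE x in M. f x = 0)"
    then have nz: "l2_norm M f \<noteq> 0" using l2_norm_eq_0_AE[OF f(1)] by blast
    obtain g where g: "g \<in> L2 M" "l2_norm M g = 1" "eigen g" "\<And>e. e \<in> E \<Longrightarrow> l2_inner M e g = 0"
      using exists_eigen[of E f] E(1,2) f nz unfolding orthonormal_def by blast
    have gg: "l2_inner M g g = 1" using g(2) by (simp add: l2_inner_self)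
    have ge: "l2_inner M g e = 0" if "e \<in> E" for e using g(4)[OF that] l2_inner_commute[of M g e] by simp
    have gE: "g \<notin> E" using g(4)[of g] gg by auto
    then have "insert g E \<in> \<S>"
      using E(1,2) g gg ge by (auto simp: \<S>_def orthonormal_def)
    from E(3)[OF this] gE show False by blast
  qed
  then have "orthonormal_basis M E" using E(1) by (auto simp: orthonormal_basis_def orthonormal_def)
  then show ?thesis using that E(2) by blast
qed

section \<open>Singular values and the modulus\<close>

text \<open>For unit eigenvectors of \<open>T* T\<close> this is a singular value: the eigenvalue is
  its square.\<close>

definition sv :: "('a \<Rightarrow> complex) \<Rightarrow> real" where "sv e = l2_norm M (ap e)"

text \<open>The modulus of \<open>T\<close>, as the diagonal operator with the singular values in
  the eigenbasis.\<close>

definition abs_graph :: "('a \<Rightarrow> complex) set \<Rightarrow> ('a \<Rightarrow> complex) rel" where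
  "abs_graph E = {(f, g). f \<in> L2 M \<and> g \<in> L2 M \<and> (\<forall>e\<in>E. l2_inner M e g = of_real (sv e) * l2_inner M e f)}"

context
  fixes E assumes E: "orthonormal_basis M E" and eig: "\<And>e. e \<in> E \<Longrightarrow> eigen e"
begin

lemma E_L2: "e \<in> E \<Longrightarrow> e \<in> L2 M"
  using E by (auto simp: orthonormal_basis_def)

lemma E_inner: "e \<in> E \<Longrightarrow> e' \<in> E \<Longrightarrow> l2_inner M e e' = (if e = e' then 1 else 0)"
  using E by (auto simp: orthonormal_basis_def)

lemma sv_nonneg: "0 \<le> sv e" by (simp add: sv_def)

lemma sv_le_W: "e \<in> E \<Longrightarrow> sv e \<le> W"
  using norm_ap[OF E_L2, of e] orthonormal_norm[OF orthonormal_basis_orthonormal[OF E], of e] by (simp add: sv_def)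

lemma eigen_sv:
  assumes e: "e \<in> E" and f: "f \<in> L2 M"
  shows "l2_inner M (ap e) (ap f) = of_real ((sv e)\<^sup>2) * l2_inner M e f"
proof -
  obtain \<mu> where \<mu>: "\<And>f. f \<in> L2 M \<Longrightarrow> l2_inner M (ap e) (ap f) = \<mu> * l2_inner M e f"
    using eig[OF e] by (auto simp: eigen_def)
  from \<mu>[OF E_L2[OF e]] have "\<mu> = of_real ((sv e)\<^sup>2)" using E_inner[OF e e] by (simp add: l2_inner_self sv_def)
  then show ?thesis using \<mu>[OF f] by simp
qed

lemma abs_graph_exists:
  assumes f: "f \<in> L2 M"
  shows "\<exists>g. (f, g) \<in> abs_graph E"
proof -
  note E' = orthonormal_basis_orthonormal[OF E]
  have "(\<lambda>e. norm ((cmod (of_real (sv e) * l2_inner M e f))\<^sup>2)) summable_on E"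
  proof (rule Infinite_Sum.abs_summable_on_comparison_test')
    show "(\<lambda>e. W\<^sup>2 * (cmod (l2_inner M e f))\<^sup>2) summable_on E"
      by (intro summable_on_cmult_right bessel_summable(1)[OF E' f])
    fix e assume "e \<in> E"
    then have "(sv e)\<^sup>2 \<le> W\<^sup>2" using sv_le_W sv_nonneg by (intro power_mono)
    then show "norm ((cmod (of_real (sv e) * l2_inner M e f))\<^sup>2) \<le> W\<^sup>2 * (cmod (l2_inner M e f))\<^sup>2"
      by (simp add: norm_mult power_mult_distrib mult_right_mono)
  qed
  then have "(\<lambda>e. (cmod (of_real (sv e) * l2_inner M e f))\<^sup>2) summable_on E" by simp
  then show ?thesis
  proof (rule riesz_fischer[OF fin E'])
    fix g assume "g \<in> L2 M" "\<And>e. e \<in> E \<Longrightarrow> l2_inner M e g = of_real (sv e) * l2_inner M e f"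
    then show ?thesis using f unfolding abs_graph_def by blast
  qed
qed

lemma bounded_operator_abs: "bounded_operator M (abs_graph E)"
  unfolding bounded_operator_def
proof (intro conjI allI impI ballI)
  show "abs_graph E \<subseteq> L2 M \<times> L2 M" by (auto simp: abs_graph_def)
  show "\<exists>g. (f, g) \<in> abs_graph E" if "f \<in> L2 M" for f by (rule abs_graph_exists[OF that])
  fix f g f' g'
  assume "(f, g) \<in> abs_graph E \<and> f' \<in> L2 M \<and> g' \<in> L2 M \<and> (AE x in M. f' x = f x) \<and> (AE x in M. g' x = g x)"
  then have *: "(f, g) \<in> abs_graph E" "f \<in> L2 M" "g \<in> L2 M" "f' \<in> L2 M" "g' \<in> L2 M" "AE x in M. f' x = f x" "AE x in M. g' x = g x"
    by (auto simp: abs_graph_def)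
  have "l2_inner M h f' = l2_inner M h f" "l2_inner M h g' = l2_inner M h g" if "h \<in> L2 M" for h
    using * that by (auto intro!: l2_inner_cong_AE)
  with * E_L2 show "(f', g') \<in> abs_graph E" unfolding abs_graph_def by auto
next
  fix f g f' g' assume "(f, g) \<in> abs_graph E \<and> (f', g') \<in> abs_graph E"
  then show "(\<lambda>x. f x + f' x, \<lambda>x. g x + g' x) \<in> abs_graph E"
    unfolding abs_graph_def using E_L2 by (auto intro: L2_add simp: l2_inner_add_right distrib_left)
next
  fix c f g assume "(f, g) \<in> abs_graph E"
  then show "(\<lambda>x. c * f x, \<lambda>x. c * g x) \<in> abs_graph E"
    unfolding abs_graph_def by (auto intro: L2_cmult simp: l2_inner_cmult_right)
next
  have "l2_norm M g \<le> W * l2_norm M f" if fg: "(f, g) \<in> abs_graph E" for f g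
  proof (rule power2_le_imp_le)
    have L: "f \<in> L2 M" "g \<in> L2 M" using fg by (auto simp: abs_graph_def)
    have "((\<lambda>e. W\<^sup>2 * (cmod (l2_inner M e f))\<^sup>2) has_sum (W\<^sup>2 * (l2_norm M f)\<^sup>2)) E"
      by (intro has_sum_cmult_right parseval_norm[OF fin E L(1)])
    with parseval_norm[OF fin E L(2)] have "(l2_norm M g)\<^sup>2 \<le> W\<^sup>2 * (l2_norm M f)\<^sup>2"
    proof (rule has_sum_mono)
      fix e assume e: "e \<in> E"
      then have "(sv e)\<^sup>2 \<le> W\<^sup>2" using sv_le_W sv_nonneg by (intro power_mono)
      then show "(cmod (l2_inner M e g))\<^sup>2 \<le> W\<^sup>2 * (cmod (l2_inner M e f))\<^sup>2"
        using fg e by (simp add: abs_graph_def norm_mult power_mult_distrib mult_right_mono)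
    qed
    then show "(l2_norm M g)\<^sup>2 \<le> (W * l2_norm M f)\<^sup>2" by (simp add: power_mult_distrib)
    show "0 \<le> W * l2_norm M f" using W_nonneg by simp
  qed
  then show "\<exists>C. \<forall>(f, g)\<in>abs_graph E. l2_norm M g \<le> C * l2_norm M f" by blast
qed

lemma positive_operator_abs: "positive_operator M (abs_graph E)"
  unfolding positive_operator_def
proof (intro conjI bounded_operator_abs ballI, clarify)
  fix f g assume fg: "(f, g) \<in> abs_graph E"
  then have L: "f \<in> L2 M" "g \<in> L2 M" by (auto simp: abs_graph_def)
  have "l2_inner M f e * l2_inner M e g = of_real (sv e * (cmod (l2_inner M e f))\<^sup>2)" if "e \<in> E" for e
    using fg that by (simp add: abs_graph_def l2_inner_commute[of M f e] of_real_cmod_power2)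
  then have s: "((\<lambda>e. complex_of_real (sv e * (cmod (l2_inner M e f))\<^sup>2)) has_sum l2_inner M f g) E"
    using parseval[OF fin E L] by (subst has_sum_cong[where g = "\<lambda>e. l2_inner M f e * l2_inner M e g"]) auto
  have "0 \<le> Re (l2_inner M f g)"
    by (rule has_sum_nonneg[OF has_sum_Re[OF s]]) (use sv_nonneg in auto)
  moreover have "((\<lambda>e. 0) has_sum Im (l2_inner M f g)) E" using has_sum_Im[OF s] by simp
  then have "Im (l2_inner M f g) = 0" by (metis has_sum_0 has_sum_unique)
  ultimately show "l2_inner M f g \<in> \<real>\<^sub>\<ge>\<^sub>0" by (simp add: complex_nonneg_Reals_iff)
qed

text \<open>The square of the diagonal operator and \<open>T* T\<close> are both the diagonal
  relation \<open>R\<close> with the squared singular values. Both are compared as graphs, so each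
  inclusion has to produce an intermediate vector.\<close>

lemma is_operator_abs_graph: "is_operator_abs M graph (abs_graph E)"
proof -
  define R where "R = {(f, h). f \<in> L2 M \<and> h \<in> L2 M \<and> (\<forall>e\<in>E. l2_inner M e h = of_real ((sv e)\<^sup>2) * l2_inner M e f)}"
  have "abs_graph E O abs_graph E = R"
  proof (intro equalityI subrelI)
    fix f h assume "(f, h) \<in> abs_graph E O abs_graph E"
    then show "(f, h) \<in> R" by (auto simp: abs_graph_def R_def power2_eq_square)
  next
    fix f h assume fh: "(f, h) \<in> R"
    then have "f \<in> L2 M" by (simp add: R_def)
    then obtain g where g: "(f, g) \<in> abs_graph E" using abs_graph_exists by blast
    moreover have "(g, h) \<in> abs_graph E" using fh g by (auto simp: abs_graph_def R_def power2_eq_square)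
    ultimately show "(f, h) \<in> abs_graph E O abs_graph E" by blast
  qed
  moreover have "graph O adjoint_operator M graph = R"
  proof (intro equalityI subrelI)
    fix f h assume "(f, h) \<in> graph O adjoint_operator M graph"
    then obtain g where g: "(f, g) \<in> graph" "(g, h) \<in> adjoint_operator M graph" by blast
    have L: "f \<in> L2 M" "g \<in> L2 M" "h \<in> L2 M" using g by (auto simp: graph_def adjoint_operator_def)
    have "l2_inner M e h = of_real ((sv e)\<^sup>2) * l2_inner M e f" if e: "e \<in> E" for e
    proof -
      have "l2_inner M e h = l2_inner M (ap e) g"
        using g(2) ap_graph[OF E_L2[OF e]] by (auto simp: adjoint_operator_def)
      also have "\<dots> = l2_inner M (ap e) (ap f)"
        by (rule l2_inner_cong_AE) (use graph_AE[OF g(1)] L ap_L2 E_L2[OF e] in auto)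
      finally show ?thesis using eigen_sv[OF e L(1)] by simp
    qed
    then show "(f, h) \<in> R" using L by (simp add: R_def)
  next
    fix f h assume fh: "(f, h) \<in> R"
    then have L: "f \<in> L2 M" "h \<in> L2 M" by (auto simp: R_def)
    have SL: "adj.ap (ap f) \<in> L2 M" by (intro adj.ap_L2 ap_L2 L)
    have hS: "AE x in M. h x = adj.ap (ap f) x"
    proof (rule orthonormal_basis_AE_eq[OF E L(2) SL])
      fix e assume e: "e \<in> E"
      then show "l2_inner M e h = l2_inner M e (adj.ap (ap f))"
        using fh eigen_sv[OF e L(1)] adj_inner[OF E_L2[OF e] ap_L2[OF L(1)]] by (simp add: R_def)
    qed
    have "l2_inner M k (ap f) = l2_inner M x h" if xk: "(x, k) \<in> graph" for x k
    proof -
      have xL: "x \<in> L2 M" "k \<in> L2 M" using xk by (auto simp: graph_def)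
      have "l2_inner M k (ap f) = l2_inner M (ap x) (ap f)"
        by (rule l2_inner_cong_AE) (use graph_AE[OF xk] xL L ap_L2 in auto)
      also have "\<dots> = l2_inner M x (adj.ap (ap f))" by (rule adj_inner[OF xL(1) ap_L2[OF L(1)]])
      also have "\<dots> = l2_inner M x h"
        by (rule l2_inner_cong_AE) (use hS xL L SL in \<open>auto elim: AE_mp\<close>)
      finally show ?thesis .
    qed
    then have "(ap f, h) \<in> adjoint_operator M graph"
      unfolding adjoint_operator_def using L ap_L2 by auto
    then show "(f, h) \<in> graph O adjoint_operator M graph" using ap_graph[OF L(1)] by blast
  qed
  ultimately show ?thesis unfolding is_operator_abs_def using positive_operator_abs by simp
qed

text \<open>With the orthonormal vectors \<phi> e = T e / sv e of the polar decomposition, sv e =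
  <\<phi> e, T e>. Inserting the nuclear series and applying Cauchy-Schwarz and Bessel for each
  \<open>j\<close> bounds the \<open>j\<close>-th term by |a j| |b j|.\<close>

lemma sum_sv_le: assumes F: "finite F" "F \<subseteq> E" shows "(\<Sum>e\<in>F. sv e) \<le> W"
proof -
  \<comment> \<open>Vanishing singular values are dropped because \<phi> divides by them.\<close>
  define F' where "F' = {e \<in> F. sv e \<noteq> 0}"
  define \<phi> where "\<phi> e = (\<lambda>x. of_real (inverse (sv e)) * ap e x)" for e
  have F': "finite F'" "F' \<subseteq> E" "\<And>e. e \<in> F' \<Longrightarrow> sv e \<noteq> 0" using F by (auto simp: F'_def)
  have \<phi>L: "\<phi> e \<in> L2 M" if "e \<in> F'" for e unfolding \<phi>_def using that F' E_L2 by (intro L2_cmult ap_L2) auto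
  have \<phi>\<phi>: "l2_inner M (\<phi> e) (\<phi> e') = (if e = e' then 1 else 0)" if "e \<in> F'" "e' \<in> F'" for e e'
  proof -
    have eE: "e \<in> E" "e' \<in> E" using that F' by auto
    have "l2_inner M (\<phi> e) (\<phi> e') = of_real (inverse (sv e)) * (of_real (inverse (sv e')) * l2_inner M (ap e) (ap e'))"
      unfolding \<phi>_def l2_inner_cmult_right l2_inner_cmult_left by simp
    also have "\<dots> = (if e = e' then 1 else 0)"
      unfolding eigen_sv[OF eE(1) E_L2[OF eE(2)]] E_inner[OF eE]
      using F'(3)[OF that(1)] by (auto simp: power2_eq_square field_simps)
    finally show ?thesis .
  qed
  have inj: "inj_on \<phi> F'"
  proof (rule inj_onI)
    fix e e' assume *: "e \<in> F'" "e' \<in> F'" "\<phi> e = \<phi> e'"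
    then have "l2_inner M (\<phi> e) (\<phi> e') = 1" using \<phi>\<phi>[of e e] by simp
    then show "e = e'" using \<phi>\<phi>[OF *(1,2)] by (metis zero_neq_one)
  qed
  have \<phi>E: "orthonormal M (\<phi> ` F')"
    using \<phi>\<phi> \<phi>L inj by (auto simp: orthonormal_def inj_on_eq_iff)
  have E': "orthonormal M E" by (rule orthonormal_basis_orthonormal[OF E])
  have sv\<phi>: "of_real (sv e) = l2_inner M (\<phi> e) (ap e)" if "e \<in> F'" for e
  proof -
    have "l2_inner M (\<phi> e) (ap e) = of_real (inverse (sv e)) * of_real ((sv e)\<^sup>2)"
      unfolding \<phi>_def l2_inner_cmult_left by (simp add: l2_inner_self sv_def)
    then show ?thesis using F'(3)[OF that] by (simp add: power2_eq_square)
  qed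
  have "(\<Sum>e\<in>F. sv e) = (\<Sum>e\<in>F'. sv e)" unfolding F'_def using F(1) by (intro sum.mono_neutral_right) auto
  also have "complex_of_real \<dots> = (\<Sum>e\<in>F'. l2_inner M (\<phi> e) (ap e))" using sv\<phi> by simp
  finally have 1: "complex_of_real (\<Sum>e\<in>F. sv e) = (\<Sum>e\<in>F'. l2_inner M (\<phi> e) (ap e))" .
  have "((\<lambda>j. \<Sum>e\<in>F'. l2_inner M (\<phi> e) (a j) * l2_inner M (b j) e) has_sum (\<Sum>e\<in>F'. l2_inner M (\<phi> e) (ap e))) UNIV"
    by (rule has_sum_finite_sum[OF F'(1)]) (use inner_ap \<phi>L F' E_L2 in auto)
  moreover have "((\<lambda>j. l2_norm M (a j) * l2_norm M (b j)) has_sum W) UNIV"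
    unfolding W_def by (rule has_sum_infsum[OF summable])
  moreover have "cmod (\<Sum>e\<in>F'. l2_inner M (\<phi> e) (a j) * l2_inner M (b j) e) \<le> l2_norm M (a j) * l2_norm M (b j)" for j
  proof -
    have "cmod (\<Sum>e\<in>F'. l2_inner M (\<phi> e) (a j) * l2_inner M (b j) e)
        \<le> (\<Sum>e\<in>F'. \<bar>cmod (l2_inner M (\<phi> e) (a j))\<bar> * \<bar>cmod (l2_inner M (b j) e)\<bar>)"
      by (rule order.trans[OF norm_sum]) (simp add: norm_mult)
    also have "\<dots> \<le> L2_set (\<lambda>e. cmod (l2_inner M (\<phi> e) (a j))) F' * L2_set (\<lambda>e. cmod (l2_inner M (b j) e)) F'"
      by (rule L2_set_mult_ineq)
    also have "\<dots> \<le> l2_norm M (a j) * l2_norm M (b j)"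
    proof (intro mult_mono)
      have "(\<Sum>e\<in>F'. (cmod (l2_inner M (\<phi> e) (a j)))\<^sup>2) = (\<Sum>e\<in>\<phi> ` F'. (cmod (l2_inner M e (a j)))\<^sup>2)"
        by (simp add: sum.reindex[OF inj])
      also have "\<dots> \<le> (l2_norm M (a j))\<^sup>2" by (rule bessel[OF \<phi>E _ _ a]) (use F' in auto)
      finally show "L2_set (\<lambda>e. cmod (l2_inner M (\<phi> e) (a j))) F' \<le> l2_norm M (a j)"
        unfolding L2_set_def by (intro real_le_lsqrt) (auto intro: sum_nonneg)
      have "(\<Sum>e\<in>F'. (cmod (l2_inner M (b j) e))\<^sup>2) = (\<Sum>e\<in>F'. (cmod (l2_inner M e (b j)))\<^sup>2)"
        by (intro sum.cong refl) (metis complex_mod_cnj l2_inner_commute)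
      also have "\<dots> \<le> (l2_norm M (b j))\<^sup>2" by (rule bessel[OF E' F'(1,2) b])
      finally show "L2_set (\<lambda>e. cmod (l2_inner M (b j) e)) F' \<le> l2_norm M (b j)"
        unfolding L2_set_def by (intro real_le_lsqrt) (auto intro: sum_nonneg)
    qed (auto simp: L2_set_nonneg)
    finally show ?thesis .
  qed
  ultimately have "cmod (\<Sum>e\<in>F'. l2_inner M (\<phi> e) (ap e)) \<le> W"
    by (rule norm_infsum_le)
  then have "\<bar>\<Sum>e\<in>F. sv e\<bar> \<le> W" unfolding 1[symmetric] norm_of_real .
  then show ?thesis by simp
qed

lemma abs_trace_summable: "(\<lambda>e. matrix_element M (abs_graph E) e e) summable_on E"
proof -
  have "sv summable_on E"
    by (rule nonneg_bdd_above_summable_on) (auto simp: sv_nonneg intro!: bdd_aboveI2[where M = W] sum_sv_le)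
  then have "(\<lambda>e. complex_of_real (sv e)) summable_on E" by (rule summable_on_of_real)
  moreover have "matrix_element M (abs_graph E) e e = of_real (sv e)" if e: "e \<in> E" for e
  proof -
    have "(e, SOME g. (e, g) \<in> abs_graph E) \<in> abs_graph E"
      using abs_graph_exists[OF E_L2[OF e]] by (rule someI_ex)
    then show ?thesis unfolding matrix_element_def using e E_inner[OF e e] by (auto simp: abs_graph_def)
  qed
  ultimately show ?thesis by (simp cong: summable_on_cong)
qed

end

section \<open>Trace class property and Fredholm determinant of a nuclear series\<close>

theorem trace_class_graph: "trace_class M graph"
proof -
  obtain E where E: "orthonormal_basis M E" "\<And>e. e \<in> E \<Longrightarrow> eigen e" using eigenbasis by blast
  show ?thesis unfolding trace_class_def
    using bounded_operator_graph is_operator_abs_graph[OF E] abs_trace_summable[OF E] E(1) by blast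
qed

lemma nuclear_matrices_basis:
  assumes E: "orthonormal_basis M E"
  shows "nuclear_matrices E UNIV (\<lambda>e j. l2_inner M e (a j)) (\<lambda>j e. l2_inner M (b j) e) (\<lambda>j. l2_norm M (a j)) (\<lambda>j. l2_norm M (b j))"
proof
  note E' = orthonormal_basis_orthonormal[OF E]
  have "(cmod (l2_inner M (b j) e))\<^sup>2 = (cmod (l2_inner M e (b j)))\<^sup>2" for j e
    by (metis complex_mod_cnj l2_inner_commute)
  then show "(\<lambda>e. (cmod (l2_inner M (b j) e))\<^sup>2) summable_on E"
    "infsum (\<lambda>e. (cmod (l2_inner M (b j) e))\<^sup>2) E \<le> (l2_norm M (b j))\<^sup>2" for j
    using bessel_summable[OF E' b] by simp_all
qed (use bessel_summable[OF orthonormal_basis_orthonormal[OF E] a] summable in auto)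

text \<open>The matrix \<open>BA\<close> of the factorisation; no basis enters.\<close>

definition kmat :: "'j \<Rightarrow> 'j \<Rightarrow> complex" where
  "kmat i j = l2_inner M (b i) (a j)"

text \<open>In any basis \<open>AB\<close> is the matrix of the operator, by the definition of the
  series, and \<open>BA\<close> is \<open>kmat\<close>, by Parseval. Cauchy--Binet equates their
  sums of principal minors, so the traces do not depend on the basis.\<close>

lemma wedge_trace_graph:
  assumes E: "orthonormal_basis M E"
  shows "wedge_trace M graph E k (infsum (perm_sum kmat) (subsets_of_card UNIV k))"
proof -
  interpret nm: nuclear_matrices E UNIV "\<lambda>e j. l2_inner M e (a j)" "\<lambda>j e. l2_inner M (b j) e" "\<lambda>j. l2_norm M (a j)" "\<lambda>j. l2_norm M (b j)"
    by (rule nuclear_matrices_basis[OF E])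
  have L: "e \<in> L2 M" if "e \<in> E" for e using E that by (auto simp: orthonormal_basis_def)
  have "nm.BA = kmat"
  proof (intro ext)
    fix i j
    show "nm.BA i j = kmat i j"
      unfolding nm.BA_def kmat_def by (rule infsumI[OF parseval[OF fin E b a]])
  qed
  then have "(perm_sum nm.AB has_sum infsum (perm_sum kmat) (subsets_of_card UNIV k)) (subsets_of_card E k)"
    using nm.cauchy_binet[of k] by simp
  then have "(wedge_matrix_element M graph has_sum infsum (perm_sum kmat) (subsets_of_card UNIV k)) (subsets_of_card E k)"
  proof (rule has_sum_cong[THEN iffD1, rotated])
    fix S assume S: "S \<in> subsets_of_card E k"
    have "perm_sum nm.AB S = perm_sum (matrix_element M graph) S"
    proof (rule perm_sum_cong)
      fix e e' assume "e \<in> S" "e' \<in> S"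
      then have e: "e \<in> L2 M" "e' \<in> L2 M" using S L by (auto simp: subsets_of_card_def)
      show "nm.AB e e' = matrix_element M graph e e'"
        unfolding nm.AB_def matrix_element_def ap_def[symmetric] by (rule infsumI[OF inner_ap[OF e(2,1)]])
    qed
    then show "perm_sum nm.AB S = wedge_matrix_element M graph S"
      by (simp add: wedge_matrix_element_def perm_sum_def)
  qed
  then show ?thesis unfolding wedge_trace_def subsets_of_card_def .
qed

text \<open>The eigenbasis serves here only as some orthonormal basis with which the matrix locale
  can be instantiated.\<close>

lemma fredholm_sums:
  "((\<lambda>U. (-1) ^ card U * perm_sum kmat U) has_sum infsum (\<lambda>U. (-1) ^ card U * perm_sum kmat U) {U. finite U}) {U. finite U}"
  "(\<lambda>k. (-1) ^ k * infsum (perm_sum kmat) (subsets_of_card UNIV k)) sums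
     infsum (\<lambda>U. (-1) ^ card U * perm_sum kmat U) {U. finite U}"
proof -
  obtain E where E: "orthonormal_basis M E" by (rule eigenbasis)
  interpret nm: nuclear_matrices E UNIV "\<lambda>e j. l2_inner M e (a j)" "\<lambda>j e. l2_inner M (b j) e" "\<lambda>j. l2_norm M (a j)" "\<lambda>j. l2_norm M (b j)"
    by (rule nuclear_matrices_basis[OF E])
  have k: "nm.BA = kmat"
  proof (intro ext)
    fix i j
    show "nm.BA i j = kmat i j"
      unfolding nm.BA_def kmat_def by (rule infsumI[OF parseval[OF fin E b a]])
  qed
  show "((\<lambda>U. (-1) ^ card U * perm_sum kmat U) has_sum infsum (\<lambda>U. (-1) ^ card U * perm_sum kmat U) {U. finite U}) {U. finite U}"
    "(\<lambda>k. (-1) ^ k * infsum (perm_sum kmat) (subsets_of_card UNIV k)) sums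
     infsum (\<lambda>U. (-1) ^ card U * perm_sum kmat U) {U. finite U}"
    using nm.fredholm_sum unfolding k by simp_all
qed

theorem fredholm_det_graph:
  "fredholm_det_id_minus M graph = infsum (\<lambda>U. (-1) ^ card U * perm_sum kmat U) {U. finite U}"
  unfolding fredholm_det_id_minus_def
proof (rule the_equality)
  show "\<forall>E. orthonormal_basis M E \<longrightarrow> (\<exists>t. (\<forall>k. wedge_trace M graph E k (t k)) \<and>
      (\<lambda>k. (-1) ^ k * t k) sums infsum (\<lambda>U. (-1) ^ card U * perm_sum kmat U) {U. finite U})"
    using wedge_trace_graph fredholm_sums(2) by (intro allI impI exI[of _ "\<lambda>k. infsum (perm_sum kmat) (subsets_of_card UNIV k)"]) simp
  fix d assume d: "\<forall>E. orthonormal_basis M E \<longrightarrow> (\<exists>t. (\<forall>k. wedge_trace M graph E k (t k)) \<and> (\<lambda>k. (-1) ^ k * t k) sums d)"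
  \<comment> \<open>At least one basis must exist, otherwise the defining condition would hold
    vacuously for every \<open>d\<close>.\<close>
  obtain E where E: "orthonormal_basis M E" by (rule eigenbasis)
  then obtain t where t: "\<And>k. wedge_trace M graph E k (t k)" "(\<lambda>k. (-1) ^ k * t k) sums d" using d by blast
  have "t k = infsum (perm_sum kmat) (subsets_of_card UNIV k)" for k
    using t(1)[of k] wedge_trace_graph[OF E, of k] unfolding wedge_trace_def by (rule has_sum_unique)
  then show "d = infsum (\<lambda>U. (-1) ^ card U * perm_sum kmat U) {U. finite U}"
    using t(2) sums_unique2[OF _ fredholm_sums(2)] by presburger
qed

end

section \<open>The resolvent of the free operator\<close>

lemma absolutely_integrable_Icc_iff_Ioo:
  fixes h :: "real \<Rightarrow> 'b :: euclidean_space"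
  shows "h absolutely_integrable_on {a..b} \<longleftrightarrow> h absolutely_integrable_on {a<..<b}"
proof (rule absolutely_integrable_spike_set_eq)
  show "negligible {x \<in> {a..b} - {a<..<b}. h x \<noteq> 0}"
    by (rule negligible_subset[of "{a, b}"]) auto
  show "negligible {x \<in> {a<..<b} - {a..b}. h x \<noteq> 0}"
    by (rule negligible_subset[of "{}"]) auto
qed

lemma integrable_interval_iff:
  fixes h :: "real \<Rightarrow> 'b :: euclidean_space"
  shows "integrable (interval_measure \<omega>) h \<longleftrightarrow> h absolutely_integrable_on {0..\<omega>}"
proof -
  have "integrable (interval_measure \<omega>) h \<longleftrightarrow> h absolutely_integrable_on {0<..<\<omega>}"
    unfolding set_integrable_def by (rule integrable_restrict_space) auto
  then show ?thesis by (simp only: absolutely_integrable_Icc_iff_Ioo)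
qed

lemma integral_interval_eq:
  fixes h :: "real \<Rightarrow> 'b :: euclidean_space"
  assumes "integrable (interval_measure \<omega>) h"
  shows "(LINT t|interval_measure \<omega>. h t) = integral {0..\<omega>} h"
  using lebesgue_integral_eq_integral[OF assms] by (simp add: integral_open_interval_real)

lemma AE_interval_in: "AE t in interval_measure \<omega>. t \<in> {0<..<\<omega>}"
  using AE_space[of "interval_measure \<omega>"] by simp

lemma finite_interval_measure: "finite_measure (interval_measure \<omega>)"
  by (rule finite_measureI, cases "0 \<le> \<omega>") (simp_all add: emeasure_restrict_space)

lemma interval_measurable_if_continuous:
  fixes q :: "real \<Rightarrow> complex"
  shows "continuous_on {0..\<omega>} q \<Longrightarrow> q \<in> borel_measurable (interval_measure \<omega>)"
  by (rule continuous_imp_measurable_on_sets_lebesgue) (auto intro: continuous_on_subset)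

lemma continuous_Icc_bounded:
  fixes q :: "real \<Rightarrow> complex"
  assumes "continuous_on {a..b} q"
  obtains B where "B > 0" "\<And>x. x \<in> {a..b} \<Longrightarrow> cmod (q x) \<le> B"
proof -
  have "bounded (q ` {a..b})" by (intro compact_imp_bounded compact_continuous_image assms) simp
  then show ?thesis using that unfolding bounded_pos by blast
qed

lemma L2_bounded_interval:
  assumes "f \<in> borel_measurable (interval_measure \<omega>)" "\<And>x. x \<in> {0<..<\<omega>} \<Longrightarrow> cmod (f x) \<le> B"
  shows "f \<in> L2 (interval_measure \<omega>)"
proof (rule L2I_bound[OF assms(1)])
  interpret finite_measure "interval_measure \<omega>" by (rule finite_interval_measure)
  show "integrable (interval_measure \<omega>) (\<lambda>_. B\<^sup>2)" by simp
  show "AE x in interval_measure \<omega>. (cmod (f x))\<^sup>2 \<le> B\<^sup>2"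
    using AE_interval_in by eventually_elim (intro power_mono assms(2), auto)
qed

lemma L2_integrable_interval:
  assumes "f \<in> L2 (interval_measure \<omega>)"
  shows "integrable (interval_measure \<omega>) f"
proof -
  have "(\<lambda>x. 1) \<in> L2 (interval_measure \<omega>)" by (rule L2_bounded_interval[where B = 1]) auto
  from L2_integrable_mult[OF this assms] show ?thesis by simp
qed

text \<open>Without \<open>Arg\<close> the measurability of \<open>u\<close> is immediate. At zeros
  of \<open>V\<close> both sides are 0 by the convention for division by 0.\<close>

lemma factor_u_altdef: "factor_u V x = V x / of_real (sqrt (cmod (V x)))"
proof (cases "V x = 0")
  case False
  have "V x = of_real (cmod (V x)) * exp (\<i> * of_real (Arg (V x)))"
    by (metis Arg_eq False)
  moreover have "complex_of_real (cmod (V x)) = of_real (sqrt (cmod (V x))) * of_real (sqrt (cmod (V x)))"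
    by (simp flip: of_real_mult)
  moreover have "complex_of_real (sqrt (cmod (V x))) \<noteq> 0" using False by simp
  ultimately show ?thesis unfolding factor_u_def by (metis mult.assoc nonzero_mult_div_cancel_left)
qed (simp add: factor_u_def)

lemma factor_uv: "factor_u V x * factor_v V x = V x"
  by (cases "V x = 0") (simp_all add: factor_u_altdef factor_v_def)

lemma cmod_factor_u: "cmod (factor_u V x) = sqrt (cmod (V x))"
  by (simp add: factor_u_def norm_mult)

lemma cmod_factor_v: "cmod (factor_v V x) = sqrt (cmod (V x))"
  by (simp add: factor_v_def)

lemma factor_L2:
  assumes "integrable M V"
  shows "factor_u V \<in> L2 M" "factor_v V \<in> L2 M"
proof -
  have [measurable]: "V \<in> borel_measurable M" using assms by simp
  have "factor_u V \<in> borel_measurable M" unfolding factor_u_altdef[abs_def] by measurable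
  then show "factor_u V \<in> L2 M" using assms by (simp add: L2_def cmod_factor_u)
  have "factor_v V \<in> borel_measurable M" unfolding factor_v_def[abs_def] by measurable
  then show "factor_v V \<in> L2 M" using assms by (simp add: L2_def cmod_factor_v)
qed

lemma minus_operatorI: "(f, g) \<in> A \<Longrightarrow> (f, \<lambda>x. - g x) \<in> minus_operator A"
  unfolding minus_operator_def by blast

lemma shift_operatorI: "(f, g) \<in> A \<Longrightarrow> (f, \<lambda>x. g x - z * f x) \<in> shift_operator A z"
  unfolding shift_operator_def by blast

section \<open>The Green's function of the quasi-periodic problem\<close>

locale floquet_problem =
  fixes \<omega> \<theta> :: real and V :: "real \<Rightarrow> complex" and z :: complex
  assumes \<omega>: "\<omega> > 0" and V: "integrable (interval_measure \<omega>) V"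
    and z: "z \<notin> spectrum (interval_measure \<omega>) (H0 \<omega> \<theta>)"
begin

abbreviation "M \<equiv> interval_measure \<omega>"
abbreviation "c \<equiv> free_cos z"
abbreviation "s \<equiv> free_sin z"
abbreviation "u \<equiv> factor_u V"
abbreviation "v \<equiv> factor_v V"

definition mult where "mult = exp (\<i> * of_real \<theta>)"

text \<open>The determinant of the free monodromy matrix minus \<open>mult\<close> times the
  identity; it vanishes exactly when a nonzero free solution satisfies the boundary
  conditions.\<close>

definition D where "D = 1 - 2 * mult * c \<omega> + mult\<^sup>2"

lemma mult_nz: "mult \<noteq> 0" by (simp add: mult_def)

lemma D_eq: "D = (c \<omega> - mult)\<^sup>2 + z * s \<omega> * s \<omega>"
  using free_wronskian[of z \<omega>] unfolding D_def by (simp add: power2_eq_square algebra_simps)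

lemma bounded_resolvent: "bounded_operator M (resolvent (H0 \<omega> \<theta>) z)"
  using z by (simp add: spectrum_def)

text \<open>By linearity the pair (0, f - g) lies in the relation, and the norm bound forces f - g
  to be null.\<close>

lemma resolvent_single_valued:
  assumes "(h, f) \<in> resolvent (H0 \<omega> \<theta>) z" "(h, g) \<in> resolvent (H0 \<omega> \<theta>) z"
  shows "AE x in M. f x = g x"
proof -
  note b = bounded_resolvent[unfolded bounded_operator_def]
  have sub: "resolvent (H0 \<omega> \<theta>) z \<subseteq> L2 M \<times> L2 M" using b by (elim conjE)
  have "(\<lambda>x. - 1 * h x, \<lambda>x. - 1 * g x) \<in> resolvent (H0 \<omega> \<theta>) z"
    using b assms(2) by (elim conjE) blast
  with b assms(1) have "(\<lambda>x. h x + - 1 * h x, \<lambda>x. f x + - 1 * g x) \<in> resolvent (H0 \<omega> \<theta>) z"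
    by (elim conjE) blast
  then have d: "((\<lambda>x. 0), \<lambda>x. f x - g x) \<in> resolvent (H0 \<omega> \<theta>) z" by simp
  obtain C where "\<forall>(f, g)\<in>resolvent (H0 \<omega> \<theta>) z. l2_norm M g \<le> C * l2_norm M f" using b by (elim conjE exE)
  with d have "l2_norm M (\<lambda>x. f x - g x) \<le> C * l2_norm M (\<lambda>x. 0)" by blast
  then have "l2_norm M (\<lambda>x. f x - g x) = 0" using l2_norm_nonneg[of M "\<lambda>x. f x - g x"] by simp
  moreover have "(\<lambda>x. f x - g x) \<in> L2 M" using d sub by blast
  ultimately have "AE x in M. f x - g x = 0" by (rule l2_norm_eq_0_AE[rotated])
  then show ?thesis by eventually_elim simp
qed

text \<open>The values \<open>f\<close> and the solution \<open>g\<close> are kept apart because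
  \<open>R h\<close> and the variation of parameters solution are only known to agree on the
  interval.\<close>

lemma resolventI:
  assumes h: "h \<in> L2 M" and g: "AC_derivs \<omega> g g1 (\<lambda>x. - z * g x - h x)"
    and bc: "g \<omega> = mult * g 0" "g1 \<omega> = mult * g1 0"
    and f: "f \<in> L2 M" "\<And>x. x \<in> {0<..<\<omega>} \<Longrightarrow> f x = g x"
  shows "(h, f) \<in> resolvent (H0 \<omega> \<theta>) z"
proof -
  have "AE x in M. (g1 has_vector_derivative - z * g x - h x) (at x)" using g by (simp add: AC_derivs_def)
  then have "AE x in M. (g1 has_vector_derivative - (h x + z * f x)) (at x)"
    using AE_interval_in
  proof eventually_elim
    case (elim x)
    have "- z * g x - h x = - (h x + z * f x)" by (simp add: f(2)[OF elim(2)])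
    with elim(1) show ?case by (simp only:)
  qed
  then have ACd: "AC_derivs \<omega> g g1 (\<lambda>x. - (h x + z * f x))" using g unfolding AC_derivs_def by simp
  have "AE x in M. f x = g x" using AE_interval_in by eventually_elim (rule f(2))
  with ACd bc have "\<exists>g g1. (AE x in M. f x = g x) \<and> AC_derivs \<omega> g g1 (\<lambda>x. - (h x + z * f x)) \<and>
      g \<omega> = exp (\<i> * of_real \<theta>) * g 0 \<and> g1 \<omega> = exp (\<i> * of_real \<theta>) * g1 0"
    unfolding mult_def by blast
  then have "(f, \<lambda>x. h x + z * f x) \<in> H0 \<omega> \<theta>"
    unfolding H0_def mem_Collect_eq case_prod_conv by (intro conjI f(1) L2_add L2_cmult h)
  then have "(f, \<lambda>x. (h x + z * f x) - z * f x) \<in> shift_operator (H0 \<omega> \<theta>) z"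
    by (rule shift_operatorI)
  then show ?thesis by (simp add: resolvent_def)
qed

text \<open>If \<open>D\<close> vanished, a kernel vector of the monodromy matrix minus
  \<open>mult\<close> would give a free solution with the right boundary values. The resolvent would
  relate 0 both to it and to 0, so it would vanish almost everywhere, then everywhere by continuity,
  and its initial data would be 0.\<close>

lemma D_nz: "D \<noteq> 0"
proof
  assume D0: "D = 0"
  define p q where "p = c \<omega> - mult" and "q = s \<omega>"
  have det: "p * p + z * q * q = 0" using D0 by (simp add: D_eq p_def q_def power2_eq_square)
  have "\<exists>a b. (a, b) \<noteq> (0, 0) \<and> p * a + q * b = 0 \<and> - (z * q) * a + p * b = 0"
  proof (cases "p = 0 \<and> q = 0")
    case True
    then show ?thesis by (intro exI[of _ 0] exI[of _ 1]) simp
  next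
    case False
    \<comment> \<open>The vector (q, -p) solves the first equation identically and the second
      because the determinant is 0.\<close>
    have "- (z * q) * q + p * - p = - (p * p + z * q * q)" by (simp add: algebra_simps)
    with False det show ?thesis by (intro exI[of _ q] exI[of _ "- p"]) auto
  qed
  then obtain a b where ab: "(a, b) \<noteq> (0, 0)" "p * a + q * b = 0" "- (z * q) * a + p * b = 0" by blast
  define g where "g x = c x * a + s x * b" for x
  define g1 where "g1 x = - (z * s x) * a + c x * b" for x
  have "(\<lambda>_. 0 :: complex) absolutely_integrable_on {0..\<omega>}" by simp
  from variation_of_parameters[OF this, of z a b]
  have ACg: "AC_derivs \<omega> g g1 (\<lambda>x. - z * g x - 0)" by (simp add: g_def[abs_def] g1_def[abs_def])
  have bc: "g \<omega> = mult * g 0" "g1 \<omega> = mult * g1 0"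
    using ab(2,3) by (simp_all add: g_def g1_def p_def q_def algebra_simps)
  have cg: "continuous_on {0..\<omega>} g" unfolding g_def by (intro continuous_intros)
  obtain B where B: "B > 0" "\<And>x. x \<in> {0..\<omega>} \<Longrightarrow> cmod (g x) \<le> B" using continuous_Icc_bounded[OF cg] by blast
  have gL: "g \<in> L2 M" by (rule L2_bounded_interval[OF interval_measurable_if_continuous[OF cg], of B]) (use B in auto)
  have "((\<lambda>x. 0), g) \<in> resolvent (H0 \<omega> \<theta>) z" by (rule resolventI[OF L2_zero ACg bc gL]) simp
  moreover have "((\<lambda>x. 0), (\<lambda>x. 0)) \<in> resolvent (H0 \<omega> \<theta>) z"
  proof (rule resolventI[OF L2_zero _ _ _ L2_zero])
    show "AC_derivs \<omega> (\<lambda>x. 0) (\<lambda>x. 0) (\<lambda>x. - z * 0 - 0)" by (simp add: AC_derivs_def AC_const)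
  qed simp_all
  ultimately have g0: "AE x in M. g x = 0" by (rule resolvent_single_valued)
  have "(LINT x|M. (cmod (g x))\<^sup>2) = (LINT x|M. 0)"
    by (rule integral_cong_AE) (use g0 L2D[OF gL] in auto)
  then have "integral {0..\<omega>} (\<lambda>x. (cmod (g x))\<^sup>2) = 0"
    using integral_interval_eq[OF L2D(2)[OF gL]] by simp
  moreover have "continuous_on (cbox 0 \<omega>) (\<lambda>x. (cmod (g x))\<^sup>2)"
    unfolding box_real by (intro continuous_intros cg)
  ultimately have "\<forall>x\<in>{0..\<omega>}. (cmod (g x))\<^sup>2 = 0"
    using integral_cbox_eq_0_iff[of 0 \<omega> "\<lambda>x. (cmod (g x))\<^sup>2"] \<omega> unfolding box_real by simp
  then have gz: "g x = 0" if "x \<in> {0..\<omega>}" for x using that by simp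
  \<comment> \<open>The second initial value is read off from the one-sided derivative at 0 of a
    function that vanishes on the whole interval.\<close>
  have "(g has_vector_derivative g1 0) (at 0 within {0..\<omega>})" using ACg \<omega> by (simp add: AC_derivs_def)
  moreover have "(g has_vector_derivative 0) (at 0 within {0..\<omega>})"
    by (rule has_vector_derivative_transform[where f = "\<lambda>x. 0"]) (use \<omega> gz in auto)
  ultimately have "g1 0 = 0"
    using \<omega> by (intro vector_derivative_unique_within[of 0 "{0..\<omega>}" g]) (auto simp: trivial_limit_within)
  then have "b = 0" by (simp add: g1_def)
  moreover have "a = 0" using gz[of 0] \<omega> by (simp add: g_def)
  ultimately show False using ab(1) by simp
qed

text \<open>With the free monodromy matrix M0, the matrix with rows (\<Gamma>1, -\<Gamma>2) and (z
  \<Gamma>2, \<Gamma>1) is the inverse of M0 - mult times M0, that is, the identity plus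
  \<open>mult\<close> times the inverse of M0 - mult. It solves the boundary conditions for the
  initial coefficients.\<close>

definition \<Gamma>1 where "\<Gamma>1 = 1 + mult * (c \<omega> - mult) / D"
definition \<Gamma>2 where "\<Gamma>2 = mult * s \<omega> / D"

definition green_a :: "real \<Rightarrow> complex" where "green_a t = - \<Gamma>1 * s t - \<Gamma>2 * c t"
definition green_b :: "real \<Rightarrow> complex" where "green_b t = - (z * \<Gamma>2) * s t + \<Gamma>1 * c t"

text \<open>The Green's function as a Volterra kernel, which solves the equation with zero initial
  data, plus a free solution in \<open>x\<close> that repairs the boundary values. This form also
  covers \<open>z = 0\<close> and exhibits a rank two kernel minus a triangular one.\<close>

definition green :: "real \<Rightarrow> real \<Rightarrow> complex" where
  "green x t = c x * green_a t + s x * green_b t - (if t < x then s (x - t) else 0)"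

definition R :: "(real \<Rightarrow> complex) \<Rightarrow> real \<Rightarrow> complex" where
  "R h x = (LINT t|M. green x t * h t)"

lemma continuous_green_ab: "continuous_on S green_a" "continuous_on S green_b"
  unfolding green_a_def green_b_def by (intro continuous_intros)+

lemma integrable_continuous_mult:
  fixes q h :: "real \<Rightarrow> complex"
  assumes "continuous_on {0..\<omega>} q" "integrable M h"
  shows "integrable M (\<lambda>t. q t * h t)"
  using assms unfolding integrable_interval_iff by (rule absolutely_integrable_continuous_mult)

lemma green_bound:
  obtains B where "B > 0" "\<And>x t. x \<in> {0..\<omega>} \<Longrightarrow> t \<in> {0..\<omega>} \<Longrightarrow> cmod (green x t) \<le> B"
proof -
  obtain Bc where Bc: "Bc > 0" "\<And>x. x \<in> {0..\<omega>} \<Longrightarrow> cmod (c x) \<le> Bc"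
    using continuous_Icc_bounded[OF continuous_on_free_cos] by blast
  obtain Bs where Bs: "Bs > 0" "\<And>x. x \<in> {0..\<omega>} \<Longrightarrow> cmod (s x) \<le> Bs"
    using continuous_Icc_bounded[OF continuous_on_free_sin] by blast
  obtain Ba where Ba: "Ba > 0" "\<And>x. x \<in> {0..\<omega>} \<Longrightarrow> cmod (green_a x) \<le> Ba"
    using continuous_Icc_bounded[OF continuous_green_ab(1)] by blast
  obtain Bb where Bb: "Bb > 0" "\<And>x. x \<in> {0..\<omega>} \<Longrightarrow> cmod (green_b x) \<le> Bb"
    using continuous_Icc_bounded[OF continuous_green_ab(2)] by blast
  show ?thesis
  proof (rule that[of "Bc * Ba + Bs * Bb + Bs"])
    show "Bc * Ba + Bs * Bb + Bs > 0" using Bc Bs Ba Bb by (simp add: add_pos_pos)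
    fix x t assume xt: "x \<in> {0..\<omega>}" "t \<in> {0..\<omega>}"
    have "cmod (green x t) \<le> cmod (c x * green_a t) + cmod (s x * green_b t) + cmod (if t < x then s (x - t) else 0)"
      unfolding green_def by (meson norm_triangle_ineq norm_triangle_ineq4 order.trans add_mono order.refl)
    also have "\<dots> \<le> Bc * Ba + Bs * Bb + Bs"
      unfolding norm_mult using Bc Bs Ba Bb xt by (intro add_mono mult_mono) auto
    finally show "cmod (green x t) \<le> Bc * Ba + Bs * Bb + Bs" .
  qed
qed

lemma id_measurable [measurable]: "(\<lambda>t :: real. t) \<in> borel_measurable (interval_measure \<omega>)"
  by (rule continuous_imp_measurable_on_sets_lebesgue) auto

lemma green_measurable: "green x \<in> borel_measurable M"
proof -
  have [measurable]: "(\<lambda>t. s (x - t)) \<in> borel_measurable M"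
    by (intro interval_measurable_if_continuous continuous_on_compose2[OF continuous_on_free_sin] continuous_intros) auto
  then show ?thesis
    unfolding green_def[abs_def] using interval_measurable_if_continuous[OF continuous_green_ab(1)]
      interval_measurable_if_continuous[OF continuous_green_ab(2)] id_measurable by measurable
qed

lemma green_integrable:
  assumes h: "integrable M h" and x: "x \<in> {0..\<omega>}"
  shows "integrable M (\<lambda>t. green x t * h t)"
proof -
  obtain B where B: "B > 0" "\<And>x t. x \<in> {0..\<omega>} \<Longrightarrow> t \<in> {0..\<omega>} \<Longrightarrow> cmod (green x t) \<le> B" using green_bound by blast
  have [measurable]: "green x \<in> borel_measurable M" "h \<in> borel_measurable M" using green_measurable h by auto
  show ?thesis
  proof (rule Bochner_Integration.integrable_bound[of _ "\<lambda>t. B * cmod (h t)"])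
    show "integrable M (\<lambda>t. B * cmod (h t))" using h by auto
    show "AE t in M. norm (green x t * h t) \<le> norm (B * cmod (h t))"
      using AE_interval_in
    proof eventually_elim
      case (elim t)
      then show ?case using B(1) B(2)[OF x, of t] by (simp add: norm_mult mult_right_mono)
    qed
  qed measurable
qed

lemma integral_initial_part:
  assumes h: "integrable M \<phi>" and x: "x \<in> {0..\<omega>}"
  shows "integrable M (\<lambda>t. if t < x then \<phi> t else 0)"
    "(LINT t|M. (if t < x then \<phi> t else (0 :: complex))) = integral {0..x} \<phi>"
proof -
  have [measurable]: "\<phi> \<in> borel_measurable M" "(\<lambda>t :: real. t) \<in> borel_measurable M" using h id_measurable by auto
  show i: "integrable M (\<lambda>t. if t < x then \<phi> t else 0)"
  proof (rule Bochner_Integration.integrable_bound[OF h])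
    show "(\<lambda>t. if t < x then \<phi> t else 0) \<in> borel_measurable M" using id_measurable by measurable
    show "AE t in M. cmod (if t < x then \<phi> t else 0) \<le> cmod (\<phi> t)" by (intro AE_I2) simp
  qed
  have "(LINT t|M. (if t < x then \<phi> t else 0)) = integral {0..\<omega>} (\<lambda>t. if t < x then \<phi> t else 0)"
    by (rule integral_interval_eq[OF i])
  also have "\<dots> = integral {0..\<omega>} (\<lambda>t. if t \<in> {0..x} then \<phi> t else 0)"
    by (rule integral_spike[of "{x}"]) auto
  also have "\<dots> = integral ({0..x} \<inter> {0..\<omega>}) \<phi>" by (rule Henstock_Kurzweil_Integration.integral_restrict_Int)
  also have "{0..x} \<inter> {0..\<omega>} = {0..x}" using x by auto
  finally show "(LINT t|M. (if t < x then \<phi> t else 0)) = integral {0..x} \<phi>" .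
qed

text \<open>Rewrites the kernel integral as a variation of parameters formula, from which the
  differential equation can be read off.\<close>

lemma R_eq:
  assumes h: "integrable M h" and x: "x \<in> {0..\<omega>}"
  shows "R h x = c x * ((LINT t|M. green_a t * h t) + integral {0..x} (\<lambda>t. s t * h t))
    + s x * ((LINT t|M. green_b t * h t) - integral {0..x} (\<lambda>t. c t * h t))"
proof -
  note ic = integrable_continuous_mult[OF _ h]
  have ia: "integrable M (\<lambda>t. green_a t * h t)" and ib: "integrable M (\<lambda>t. green_b t * h t)"
    and ish: "integrable M (\<lambda>t. s t * h t)" and ico: "integrable M (\<lambda>t. c t * h t)"
    by (intro ic continuous_green_ab continuous_intros)+
  note ps = integral_initial_part[OF ish x] and pc = integral_initial_part[OF ico x]
  have "R h x = (LINT t|M. c x * (green_a t * h t) + s x * (green_b t * h t)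
      - (s x * (if t < x then c t * h t else 0) - c x * (if t < x then s t * h t else 0)))"
    unfolding R_def by (rule Bochner_Integration.integral_cong) (auto simp: green_def free_sin_diff algebra_simps)
  also have "\<dots> = c x * (LINT t|M. green_a t * h t) + s x * (LINT t|M. green_b t * h t)
      - (s x * integral {0..x} (\<lambda>t. c t * h t) - c x * integral {0..x} (\<lambda>t. s t * h t))"
    using ia ib ps pc by simp
  finally show ?thesis by (simp add: algebra_simps)
qed

lemma continuous_R:
  assumes h: "integrable M h"
  shows "continuous_on {0..\<omega>} (R h)"
proof -
  have *: "(\<lambda>t. s t * h t) absolutely_integrable_on {0..\<omega>}" "(\<lambda>t. c t * h t) absolutely_integrable_on {0..\<omega>}"
    using h unfolding integrable_interval_iff by (intro absolutely_integrable_continuous_mult continuous_intros; assumption)+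
  have "continuous_on {0..\<omega>} (\<lambda>x. c x * ((LINT t|M. green_a t * h t) + integral {0..x} (\<lambda>t. s t * h t))
    + s x * ((LINT t|M. green_b t * h t) - integral {0..x} (\<lambda>t. c t * h t)))"
    by (intro continuous_intros AC_continuous_on[OF AC_integral] *)
  then show ?thesis by (rule continuous_on_eq) (simp add: R_eq[OF h])
qed

text \<open>After multiplication by \<open>D\<close> only the products (\<Gamma>1 - 1) D and
  \<Gamma>2 D occur, and these equal \<open>mult\<close> times entries of the free monodromy
  data.\<close>

lemma boundary_algebra:
  fixes \<alpha> \<beta> \<sigma> \<kappa> :: complex
  assumes \<alpha>: "\<alpha> = - \<Gamma>1 * \<sigma> - \<Gamma>2 * \<kappa>" and \<beta>: "\<beta> = - (z * \<Gamma>2) * \<sigma> + \<Gamma>1 * \<kappa>"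
  shows "c \<omega> * (\<alpha> + \<sigma>) + s \<omega> * (\<beta> - \<kappa>) = mult * \<alpha>"
    "- (z * s \<omega>) * (\<alpha> + \<sigma>) + c \<omega> * (\<beta> - \<kappa>) = mult * \<beta>"
proof -
  define p where "p = c \<omega> - mult"
  have g1: "(\<Gamma>1 - 1) * D = mult * p" and g2: "\<Gamma>2 * D = mult * s \<omega>"
    using D_nz by (simp_all add: \<Gamma>1_def \<Gamma>2_def p_def)
  have D: "D = p * p + z * s \<omega> * s \<omega>" by (simp add: D_eq p_def power2_eq_square)
  have "D * (c \<omega> * (\<alpha> + \<sigma>) + s \<omega> * (\<beta> - \<kappa>) - mult * \<alpha>)
     = - p * ((\<Gamma>1 - 1) * D) * \<sigma> - p * (\<Gamma>2 * D) * \<kappa> - z * s \<omega> * (\<Gamma>2 * D) * \<sigma> + s \<omega> * ((\<Gamma>1 - 1) * D) * \<kappa> + mult * D * \<sigma>"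
    unfolding \<alpha> \<beta> p_def by (simp add: algebra_simps)
  also have "\<dots> = 0" unfolding g1 g2 by (simp add: D algebra_simps)
  finally show "c \<omega> * (\<alpha> + \<sigma>) + s \<omega> * (\<beta> - \<kappa>) = mult * \<alpha>" using D_nz by simp
  have "D * (- (z * s \<omega>) * (\<alpha> + \<sigma>) + c \<omega> * (\<beta> - \<kappa>) - mult * \<beta>)
     = z * s \<omega> * ((\<Gamma>1 - 1) * D) * \<sigma> + z * s \<omega> * (\<Gamma>2 * D) * \<kappa> - p * z * (\<Gamma>2 * D) * \<sigma> + p * ((\<Gamma>1 - 1) * D) * \<kappa> - mult * D * \<kappa>"
    unfolding \<alpha> \<beta> p_def by (simp add: algebra_simps)
  also have "\<dots> = 0" unfolding g1 g2 by (simp add: D algebra_simps)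
  finally show "- (z * s \<omega>) * (\<alpha> + \<sigma>) + c \<omega> * (\<beta> - \<kappa>) = mult * \<beta>" using D_nz by simp
qed

lemma R_L2: "integrable M h \<Longrightarrow> R h \<in> L2 M"
proof -
  assume h: "integrable M h"
  obtain B where "B > 0" "\<And>x. x \<in> {0..\<omega>} \<Longrightarrow> cmod (R h x) \<le> B" using continuous_Icc_bounded[OF continuous_R[OF h]] by blast
  then show ?thesis by (intro L2_bounded_interval[OF interval_measurable_if_continuous[OF continuous_R[OF h]], of B]) auto
qed

lemma R_resolvent:
  assumes hL: "h \<in> L2 M"
  shows "(h, R h) \<in> resolvent (H0 \<omega> \<theta>) z"
proof -
  have h: "integrable M h" by (rule L2_integrable_interval[OF hL])
  have hA: "h absolutely_integrable_on {0..\<omega>}" using h by (simp add: integrable_interval_iff)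
  define \<sigma> \<kappa> where "\<sigma> = (LINT t|M. s t * h t)" and "\<kappa> = (LINT t|M. c t * h t)"
  have ish: "integrable M (\<lambda>t. s t * h t)" and ic: "integrable M (\<lambda>t. c t * h t)"
    by (intro integrable_continuous_mult h continuous_intros)+
  define \<alpha> \<beta> where "\<alpha> = (LINT t|M. green_a t * h t)" and "\<beta> = (LINT t|M. green_b t * h t)"
  have "\<alpha> = (LINT t|M. - \<Gamma>1 * (s t * h t) - \<Gamma>2 * (c t * h t))"
    unfolding \<alpha>_def green_a_def by (rule Bochner_Integration.integral_cong) (auto simp: algebra_simps)
  also have "\<dots> = - \<Gamma>1 * \<sigma> - \<Gamma>2 * \<kappa>" using ish ic by (simp add: \<sigma>_def \<kappa>_def)
  finally have \<alpha>: "\<alpha> = - \<Gamma>1 * \<sigma> - \<Gamma>2 * \<kappa>" .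
  have "\<beta> = (LINT t|M. - (z * \<Gamma>2) * (s t * h t) + \<Gamma>1 * (c t * h t))"
    unfolding \<beta>_def green_b_def by (rule Bochner_Integration.integral_cong) (auto simp: algebra_simps)
  also have "\<dots> = - (z * \<Gamma>2) * \<sigma> + \<Gamma>1 * \<kappa>" using ish ic by (simp add: \<sigma>_def \<kappa>_def)
  finally have \<beta>: "\<beta> = - (z * \<Gamma>2) * \<sigma> + \<Gamma>1 * \<kappa>" .
  have \<sigma>': "integral {0..\<omega>} (\<lambda>t. s t * h t) = \<sigma>" and \<kappa>': "integral {0..\<omega>} (\<lambda>t. c t * h t) = \<kappa>"
    unfolding \<sigma>_def \<kappa>_def by (rule integral_interval_eq[symmetric]; fact)+
  note b = boundary_algebra[OF \<alpha> \<beta>]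
  show ?thesis
  proof (rule resolventI[OF hL variation_of_parameters[OF hA, of z \<alpha> \<beta>] _ _ R_L2[OF h]])
    fix x assume "x \<in> {0<..<\<omega>}"
    then show "R h x = c x * (\<alpha> + integral {0..x} (\<lambda>t. s t * h t)) + s x * (\<beta> - integral {0..x} (\<lambda>t. c t * h t))"
      unfolding \<alpha>_def \<beta>_def by (intro R_eq[OF h]) auto
  qed (use b in \<open>simp_all add: \<sigma>' \<kappa>'\<close>)
qed

text \<open>A bound from the mean norm to the supremum norm: for square integrable \<open>f\<close>
  the product \<open>v * f\<close> is merely integrable, so the resolvent bound on square integrable
  functions does not reach it.\<close>

lemma R_norm:
  obtains C where "C \<ge> 0" "\<And>(h :: real \<Rightarrow> complex) x. integrable M h \<Longrightarrow> x \<in> {0..\<omega>} \<Longrightarrow> cmod (R h x) \<le> C * (LINT t|M. cmod (h t))"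
proof -
  obtain B where B: "B > 0" "\<And>x t. x \<in> {0..\<omega>} \<Longrightarrow> t \<in> {0..\<omega>} \<Longrightarrow> cmod (green x t) \<le> B" using green_bound by blast
  show ?thesis
  proof (rule that[of B])
    fix h :: "real \<Rightarrow> complex" and x assume h: "integrable M h" and x: "x \<in> {0..\<omega>}"
    have "cmod (R h x) \<le> (LINT t|M. cmod (green x t * h t))" unfolding R_def by (rule integral_norm_bound)
    also have "\<dots> \<le> (LINT t|M. B * cmod (h t))"
    proof (rule integral_mono_AE)
      show "AE t in M. cmod (green x t * h t) \<le> B * cmod (h t)"
        using AE_interval_in by eventually_elim (use B(2)[OF x] in \<open>simp add: norm_mult mult_right_mono\<close>)
    qed (use green_integrable[OF h x] h in auto)
    finally show "cmod (R h x) \<le> B * (LINT t|M. cmod (h t))" by simp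
  qed (use B in simp)
qed

section \<open>The operator as an integral operator on all square integrable functions\<close>

lemma u_L2: "u \<in> L2 M" and v_L2: "v \<in> L2 M"
  by (rule factor_L2[OF V])+

lemma vf_integrable: "f \<in> L2 M \<Longrightarrow> integrable M (\<lambda>t. v t * f t)"
  by (rule L2_integrable_mult[OF v_L2])

text \<open>The kernel form makes sense for every square integrable \<open>f\<close>, also when
  \<open>v * f\<close> is not square integrable and the operator product is undefined at
  \<open>f\<close>.\<close>

definition KR :: "(real \<Rightarrow> complex) \<Rightarrow> real \<Rightarrow> complex" where
  "KR f x = - (u x * R (\<lambda>t. v t * f t) x)"

lemma uR_L2:
  assumes h: "integrable M h"
  shows "(\<lambda>x. u x * R h x) \<in> L2 M"
proof -
  obtain B where B: "B > 0" "\<And>x. x \<in> {0..\<omega>} \<Longrightarrow> cmod (R h x) \<le> B" using continuous_Icc_bounded[OF continuous_R[OF h]] by blast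
  have m: "(\<lambda>x. u x * R h x) \<in> borel_measurable M"
    using L2D(1)[OF u_L2] L2D(1)[OF R_L2[OF h]] by measurable
  show ?thesis
  proof (rule L2I_bound[OF m, of "\<lambda>x. B\<^sup>2 * (cmod (u x))\<^sup>2"])
    show "integrable M (\<lambda>x. B\<^sup>2 * (cmod (u x))\<^sup>2)" using L2D(2)[OF u_L2] by simp
    show "AE x in M. (cmod (u x * R h x))\<^sup>2 \<le> B\<^sup>2 * (cmod (u x))\<^sup>2"
      using AE_interval_in
    proof eventually_elim
      case (elim x)
      then have "(cmod (R h x))\<^sup>2 \<le> B\<^sup>2" using B(2)[of x] by (intro power_mono) auto
      then show ?case by (simp add: norm_mult power_mult_distrib mult.commute[of "B\<^sup>2"] mult_left_mono)
    qed
  qed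
qed

lemma KR_L2: "f \<in> L2 M \<Longrightarrow> KR f \<in> L2 M"
  unfolding KR_def[abs_def] by (intro L2_uminus uR_L2 vf_integrable)

lemma norm_uR:
  assumes h: "integrable M h" and B: "\<And>x. x \<in> {0..\<omega>} \<Longrightarrow> cmod (R h x) \<le> B" "B \<ge> 0"
  shows "l2_norm M (\<lambda>x. u x * R h x) \<le> B * l2_norm M u"
proof (rule power2_le_imp_le)
  have "(l2_norm M (\<lambda>x. u x * R h x))\<^sup>2 \<le> (LINT x|M. B\<^sup>2 * (cmod (u x))\<^sup>2)"
    unfolding l2_norm_power2
  proof (rule integral_mono_AE)
    show "integrable M (\<lambda>x. (cmod (u x * R h x))\<^sup>2)" by (rule L2D(2)[OF uR_L2[OF h]])
    show "integrable M (\<lambda>x. B\<^sup>2 * (cmod (u x))\<^sup>2)" using L2D(2)[OF u_L2] by simp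
    show "AE x in M. (cmod (u x * R h x))\<^sup>2 \<le> B\<^sup>2 * (cmod (u x))\<^sup>2"
      using AE_interval_in
    proof eventually_elim
      case (elim x)
      then have "(cmod (R h x))\<^sup>2 \<le> B\<^sup>2" using B(1)[of x] by (intro power_mono) auto
      then show ?case by (simp add: norm_mult power_mult_distrib mult.commute[of "B\<^sup>2"] mult_left_mono)
    qed
  qed
  then show "(l2_norm M (\<lambda>x. u x * R h x))\<^sup>2 \<le> (B * l2_norm M u)\<^sup>2"
    by (simp add: power_mult_distrib l2_norm_power2)
qed (use B in simp)

lemma R_diff:
  assumes "integrable M h" "integrable M k" "x \<in> {0..\<omega>}"
  shows "R (\<lambda>t. h t - k t) x = R h x - R k x"
  unfolding R_def using green_integrable[OF assms(1,3)] green_integrable[OF assms(2,3)]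
  by (simp add: right_diff_distrib)

text \<open>Multiplication by \<open>v\<close> maps square integrable to integrable functions,
  \<open>R\<close> maps those to bounded functions, and multiplication by \<open>u\<close> returns
  to square integrable ones.\<close>

lemma KR_norm_diff:
  obtains C where "\<And>f f'. f \<in> L2 M \<Longrightarrow> f' \<in> L2 M \<Longrightarrow> l2_norm M (\<lambda>x. KR f x - KR f' x) \<le> C * l2_norm M (\<lambda>x. f x - f' x)"
proof -
  obtain C where C: "C \<ge> 0" "\<And>h x. integrable M h \<Longrightarrow> x \<in> {0..\<omega>} \<Longrightarrow> cmod (R h x) \<le> C * (LINT t|M. cmod (h t))"
    using R_norm by blast
  show ?thesis
  proof (rule that[of "C * l2_norm M v * l2_norm M u"])
    fix f f' assume f: "f \<in> L2 M" "f' \<in> L2 M"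
    define d where "d = (\<lambda>x. f x - f' x)"
    have d: "d \<in> L2 M" unfolding d_def by (rule L2_diff[OF f])
    have ac: "(LINT t|M. cmod (v t * d t)) \<le> l2_norm M v * l2_norm M d"
    proof -
      define v' d' where "v' t = complex_of_real (cmod (v t))" and "d' t = complex_of_real (cmod (d t))" for t
      have L: "v' \<in> L2 M" "d' \<in> L2 M" "l2_norm M v' = l2_norm M v" "l2_norm M d' = l2_norm M d"
        using v_L2 d by (auto simp: v'_def[abs_def] d'_def[abs_def] L2_def l2_norm_def)
      have "l2_inner M v' d' = of_real (LINT t|M. cmod (v t * d t))"
        unfolding l2_inner_def v'_def d'_def by (simp add: norm_mult flip: of_real_mult)
      then have "(LINT t|M. cmod (v t * d t)) \<le> cmod (l2_inner M v' d')" by simp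
      then show ?thesis using l2_cauchy_schwarz[OF L(1,2)] L(3,4) by simp
    qed
    have "l2_norm M (\<lambda>x. KR f x - KR f' x) = l2_norm M (\<lambda>x. u x * R (\<lambda>t. v t * d t) x)"
    proof -
      have "l2_norm M (\<lambda>x. KR f x - KR f' x) = l2_norm M (\<lambda>x. - (u x * R (\<lambda>t. v t * d t) x))"
      proof (rule l2_norm_cong_AE)
        show "AE x in M. KR f x - KR f' x = - (u x * R (\<lambda>t. v t * d t) x)"
          using AE_interval_in
        proof eventually_elim
          case (elim x)
          then have eq: "R (\<lambda>t. v t * d t) x = R (\<lambda>t. v t * f t) x - R (\<lambda>t. v t * f' t) x"
            using R_diff[OF vf_integrable[OF f(1)] vf_integrable[OF f(2)], of x] by (simp add: d_def right_diff_distrib)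
          show ?case unfolding KR_def eq by (simp add: algebra_simps)
        qed
      qed (intro L2_diff KR_L2 f L2_uminus uR_L2 vf_integrable d)+
      then show ?thesis by (simp add: l2_norm_uminus)
    qed
    also have "\<dots> \<le> (C * (l2_norm M v * l2_norm M d)) * l2_norm M u"
    proof (rule norm_uR[OF vf_integrable[OF d]])
      fix x assume "x \<in> {0..\<omega>}"
      from C(2)[OF vf_integrable[OF d] this] mult_left_mono[OF ac C(1)]
      show "cmod (R (\<lambda>t. v t * d t) x) \<le> C * (l2_norm M v * l2_norm M d)" by linarith
    qed (use C(1) in simp)
    finally show "l2_norm M (\<lambda>x. KR f x - KR f' x) \<le> C * l2_norm M v * l2_norm M u * l2_norm M (\<lambda>x. f x - f' x)"
      by (simp add: d_def mult_ac)
  qed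
qed

lemma pre_K:
  assumes "(f, g) \<in> minus_operator (mult_operator M v O resolvent (H0 \<omega> \<theta>) z O mult_operator M u)"
  shows "f \<in> L2 M" "g \<in> L2 M" "AE x in M. g x = KR f x"
proof -
  obtain g' where g': "g = (\<lambda>x. - g' x)" "(f, g') \<in> mult_operator M v O resolvent (H0 \<omega> \<theta>) z O mult_operator M u"
    using assms unfolding minus_operator_def by blast
  then obtain p r where pr: "(f, p) \<in> mult_operator M v" "(p, r) \<in> resolvent (H0 \<omega> \<theta>) z" "(r, g') \<in> mult_operator M u"
    by blast
  have L: "f \<in> L2 M" "p \<in> L2 M" "g' \<in> L2 M" and pv: "AE x in M. p x = v x * f x" and gu: "AE x in M. g' x = u x * r x"
    using pr by (auto simp: mult_operator_def)
  show "f \<in> L2 M" "g \<in> L2 M" using L g' by (auto intro: L2_uminus)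
  have "R p x = R (\<lambda>t. v t * f t) x" for x
    unfolding R_def
  proof (rule integral_cong_AE)
    show "AE t in M. green x t * p t = green x t * (v t * f t)" using pv by eventually_elim simp
  qed (use green_measurable[of x] L2D(1)[OF L(2)] L2D(1)[OF L(1)] L2D(1)[OF v_L2] in measurable)
  moreover have "AE x in M. r x = R p x"
    by (rule resolvent_single_valued[OF pr(2) R_resolvent[OF L(2)]])
  ultimately show "AE x in M. g x = KR f x"
    using gu by (auto simp: g' KR_def elim!: AE_mp)
qed

text \<open>Cutting \<open>f\<close> off where |V| exceeds \<open>n\<close> makes
  \<open>v * f\<close> square integrable, so the truncated function lies in the domain of the
  product; dominated convergence gives density.\<close>

lemma pre_K_dense:
  assumes f: "f \<in> L2 M" and e: "e > 0"
  obtains f' g' where "(f', g') \<in> minus_operator (mult_operator M v O resolvent (H0 \<omega> \<theta>) z O mult_operator M u)"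
    "l2_norm M (\<lambda>x. f x - f' x) < e" "g' = KR f'"
proof -
  define F where "F n x = (if cmod (V x) \<le> real n then f x else 0)" for n x
  have [measurable]: "f \<in> borel_measurable M" "V \<in> borel_measurable M" "v \<in> borel_measurable M"
    using L2D(1)[OF f] V L2D(1)[OF v_L2] by auto
  have Fm[measurable]: "F n \<in> borel_measurable M" for n unfolding F_def[abs_def] by measurable
  have FL: "F n \<in> L2 M" for n
    by (rule L2I_bound[OF Fm L2D(2)[OF f]]) (auto simp: F_def)
  have vF: "(\<lambda>x. v x * F n x) \<in> L2 M" for n
  proof (rule L2I_bound[of _ _ "\<lambda>x. real n * (cmod (f x))\<^sup>2"])
    show "integrable M (\<lambda>x. real n * (cmod (f x))\<^sup>2)" using L2D(2)[OF f] by simp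
    show "AE x in M. (cmod (v x * F n x))\<^sup>2 \<le> real n * (cmod (f x))\<^sup>2"
      by (intro AE_I2) (auto simp: F_def norm_mult power_mult_distrib cmod_factor_v mult_right_mono)
  qed measurable
  have lim: "(\<lambda>n. LINT x|M. (cmod (f x - F n x))\<^sup>2) \<longlonglongrightarrow> (LINT x|M. 0)"
  proof (rule Bochner_Integration.integral_dominated_convergence[where w = "\<lambda>x. (cmod (f x))\<^sup>2"])
    show "AE x in M. (\<lambda>n. (cmod (f x - F n x))\<^sup>2) \<longlonglongrightarrow> 0"
    proof (intro AE_I2 tendsto_eventually)
      fix x
      obtain N where "cmod (V x) \<le> real N" using real_arch_simple by blast
      then show "eventually (\<lambda>n. (cmod (f x - F n x))\<^sup>2 = 0) sequentially"
        unfolding eventually_sequentially by (intro exI[of _ N]) (auto simp: F_def)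
    qed
    show "AE x in M. norm ((cmod (f x - F n x))\<^sup>2) \<le> (cmod (f x))\<^sup>2" for n
      by (intro AE_I2) (simp add: F_def)
  qed (use L2D(2)[OF f] in auto)
  have "e\<^sup>2 > 0" using e by simp
  with lim have "eventually (\<lambda>n. (LINT x|M. (cmod (f x - F n x))\<^sup>2) < e\<^sup>2) sequentially"
    by (intro order_tendstoD(2)) auto
  then obtain n where n: "(LINT x|M. (cmod (f x - F n x))\<^sup>2) < e\<^sup>2" by (auto simp: eventually_sequentially)
  define f' where "f' = F n"
  have f'L: "f' \<in> L2 M" "(\<lambda>x. v x * f' x) \<in> L2 M" using FL vF by (auto simp: f'_def)
  have "(f', \<lambda>x. v x * f' x) \<in> mult_operator M v" using f'L by (simp add: mult_operator_def)
  moreover have "(\<lambda>x. v x * f' x, R (\<lambda>x. v x * f' x)) \<in> resolvent (H0 \<omega> \<theta>) z" by (rule R_resolvent[OF f'L(2)])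
  moreover have "(R (\<lambda>x. v x * f' x), \<lambda>x. u x * R (\<lambda>x. v x * f' x) x) \<in> mult_operator M u"
    using R_L2[OF vf_integrable[OF f'L(1)]] uR_L2[OF vf_integrable[OF f'L(1)]] by (simp add: mult_operator_def)
  ultimately have "(f', \<lambda>x. u x * R (\<lambda>x. v x * f' x) x) \<in> mult_operator M v O resolvent (H0 \<omega> \<theta>) z O mult_operator M u"
    by blast
  then have "(f', KR f') \<in> minus_operator (mult_operator M v O resolvent (H0 \<omega> \<theta>) z O mult_operator M u)"
    unfolding KR_def[abs_def] by (rule minus_operatorI)
  moreover have "l2_norm M (\<lambda>x. f x - f' x) < e"
    by (rule power2_less_imp_less) (use n e in \<open>simp_all add: l2_norm_power2 f'_def\<close>)
  ultimately show ?thesis using that by blast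
qed

text \<open>The product is the restriction of the Lipschitz map \<open>KR\<close> to a dense domain,
  so its closure is the graph of \<open>KR\<close>.\<close>

theorem K_eq: "K \<omega> V \<theta> z = {(f, g). f \<in> L2 M \<and> g \<in> L2 M \<and> (AE x in M. g x = KR f x)}"
proof (intro equalityI subrelI)
  obtain C0 where C0: "\<And>f f'. f \<in> L2 M \<Longrightarrow> f' \<in> L2 M \<Longrightarrow> l2_norm M (\<lambda>x. KR f x - KR f' x) \<le> C0 * l2_norm M (\<lambda>x. f x - f' x)"
    using KR_norm_diff by blast
  \<comment> \<open>Enlarged to be positive, since both inclusions divide by it.\<close>
  define C where "C = \<bar>C0\<bar> + 1"
  have Cpos: "C > 0" by (simp add: C_def)
  have C: "l2_norm M (\<lambda>x. KR f x - KR f' x) \<le> C * l2_norm M (\<lambda>x. f x - f' x)" if "f \<in> L2 M" "f' \<in> L2 M" for f f'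
  proof -
    have "C0 * l2_norm M (\<lambda>x. f x - f' x) \<le> C * l2_norm M (\<lambda>x. f x - f' x)"
      by (intro mult_right_mono) (auto simp: C_def)
    then show ?thesis using C0[OF that] by linarith
  qed
  {
    fix f g assume "(f, g) \<in> K \<omega> V \<theta> z"
    then have fg: "f \<in> L2 M" "g \<in> L2 M"
      "\<And>e. e > 0 \<Longrightarrow> \<exists>(f', g')\<in>minus_operator (mult_operator M v O resolvent (H0 \<omega> \<theta>) z O mult_operator M u).
         l2_norm M (\<lambda>x. f x - f' x) < e \<and> l2_norm M (\<lambda>x. g x - g' x) < e"
      by (auto simp: K_def operator_closure_def)
    have "l2_norm M (\<lambda>x. g x - KR f x) < e" if e: "e > 0" for e
    proof -
      define e' where "e' = e / (2 * C)"
      have e': "e' > 0" "C * e' = e / 2" using e Cpos by (simp_all add: e'_def)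
      have "min e' (e / 2) > 0" using e e' by simp
      from fg(3)[OF this] obtain f' g' where *: "(f', g') \<in> minus_operator (mult_operator M v O resolvent (H0 \<omega> \<theta>) z O mult_operator M u)"
        "l2_norm M (\<lambda>x. f x - f' x) < e'" "l2_norm M (\<lambda>x. g x - g' x) < e / 2" by auto
      note p = pre_K[OF *(1)]
      have "l2_norm M (\<lambda>x. g x - KR f x) \<le> l2_norm M (\<lambda>x. g x - g' x) + l2_norm M (\<lambda>x. g' x - KR f x)"
        by (rule l2_dist_triangle[OF fg(2) p(2) KR_L2[OF fg(1)]])
      also have "l2_norm M (\<lambda>x. g' x - KR f x) = l2_norm M (\<lambda>x. KR f' x - KR f x)"
        by (rule l2_norm_cong_AE) (use p KR_L2 fg in \<open>auto intro: L2_diff elim: AE_mp\<close>)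
      also have "\<dots> \<le> C * l2_norm M (\<lambda>x. f' x - f x)" by (rule C[OF p(1) fg(1)])
      also have "\<dots> \<le> C * e'" using *(2) Cpos by (intro mult_left_mono) (auto simp: l2_norm_minus_commute[of M f'])
      finally show ?thesis using *(3) e'(2) by simp
    qed
    then have "\<not> 0 < l2_norm M (\<lambda>x. g x - KR f x)" by blast
    then have "l2_norm M (\<lambda>x. g x - KR f x) = 0" using l2_norm_nonneg[of M "\<lambda>x. g x - KR f x"] by linarith
    then have "AE x in M. g x - KR f x = 0" by (intro l2_norm_eq_0_AE L2_diff fg KR_L2)
    then have "AE x in M. g x = KR f x" by eventually_elim simp
    then show "(f, g) \<in> {(f, g). f \<in> L2 M \<and> g \<in> L2 M \<and> (AE x in M. g x = KR f x)}" using fg by simp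
  next
    fix f g assume "(f, g) \<in> {(f, g). f \<in> L2 M \<and> g \<in> L2 M \<and> (AE x in M. g x = KR f x)}"
    then have fg: "f \<in> L2 M" "g \<in> L2 M" "AE x in M. g x = KR f x" by auto
    have "\<exists>(f', g')\<in>minus_operator (mult_operator M v O resolvent (H0 \<omega> \<theta>) z O mult_operator M u).
         l2_norm M (\<lambda>x. f x - f' x) < e \<and> l2_norm M (\<lambda>x. g x - g' x) < e" if e: "e > 0" for e
    proof -
      have "min e (e / C) > 0" using e Cpos by simp
      then obtain f' g' where *: "(f', g') \<in> minus_operator (mult_operator M v O resolvent (H0 \<omega> \<theta>) z O mult_operator M u)"
        "l2_norm M (\<lambda>x. f x - f' x) < min e (e / C)" "g' = KR f'" using pre_K_dense[OF fg(1)] by blast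
      note p = pre_K[OF *(1)]
      have "l2_norm M (\<lambda>x. g x - g' x) = l2_norm M (\<lambda>x. KR f x - KR f' x)"
        by (rule l2_norm_cong_AE) (use p KR_L2 fg *(3) in \<open>auto intro: L2_diff elim: AE_mp\<close>)
      also have "\<dots> \<le> C * l2_norm M (\<lambda>x. f x - f' x)" by (rule C[OF fg(1) p(1)])
      also have "\<dots> < C * (e / C)" using *(2) Cpos by (intro mult_strict_left_mono) auto
      also have "\<dots> = e" using Cpos by simp
      finally show ?thesis using *(1,2) by auto
    qed
    then show "(f, g) \<in> K \<omega> V \<theta> z" using fg by (auto simp: K_def operator_closure_def)
  }
qed

end

section \<open>Nuclear expansion of the operator\<close>

lemma perm_sum_zero_column:
  assumes "j \<in> U" "finite U" "\<And>i. F i j = 0"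
  shows "perm_sum F U = 0"
  unfolding perm_sum_def
proof (rule sum.neutral, rule ballI)
  fix p assume "p \<in> {p. p permutes U}"
  then have p: "p permutes U" by simp
  then obtain i where i: "i \<in> U" "p i = j"
    using permutes_image[OF p] assms(1) by (metis imageE)
  then have "(\<Prod>i\<in>U. F i (p i)) = 0" using assms(2,3) by (intro prod_zero) auto
  then show "of_int (sign p) * (\<Prod>i\<in>U. F i (p i)) = 0" by simp
qed

text \<open>It suffices that the \<open>F n\<close> cover the support: elements of the finite set
  \<open>X\<close> outside \<open>F n\<close> carry the value 0 and can be adjoined without changing
  the sum.\<close>

lemma has_sum_exhaustion:
  fixes f :: "'i \<Rightarrow> complex"
  assumes S: "(f has_sum S) A" and F: "\<And>n. finite (F n)" "\<And>n. F n \<subseteq> A" "incseq F"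
    and cover: "\<And>x. x \<in> A \<Longrightarrow> f x \<noteq> 0 \<Longrightarrow> \<exists>n. x \<in> F n"
  shows "(\<lambda>n. sum f (F n)) \<longlonglongrightarrow> S"
proof (rule LIMSEQ_I)
  fix e :: real assume e: "e > 0"
  have "eventually (\<lambda>X. dist (sum f X) S < e) (finite_subsets_at_top A)"
    using S unfolding has_sum_def by (rule tendstoD) (rule e)
  then obtain X where X: "finite X" "X \<subseteq> A" "\<And>Y. finite Y \<Longrightarrow> X \<subseteq> Y \<Longrightarrow> Y \<subseteq> A \<Longrightarrow> dist (sum f Y) S < e"
    unfolding eventually_finite_subsets_at_top by auto
  have "\<forall>x\<in>X. \<exists>n. f x \<noteq> 0 \<longrightarrow> x \<in> F n" using cover X(2) by blast
  then obtain m where m: "\<And>x. x \<in> X \<Longrightarrow> f x \<noteq> 0 \<Longrightarrow> x \<in> F (m x)" by metis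
  define N where "N = Max (insert 0 (m ` X))"
  show "\<exists>no. \<forall>n\<ge>no. norm (sum f (F n) - S) < e"
  proof (intro exI[of _ N] allI impI)
    fix n assume n: "n \<ge> N"
    have "x \<in> F n" if "x \<in> X" "f x \<noteq> 0" for x
    proof -
      have "m x \<le> N" unfolding N_def using X(1) that(1) by (intro Max_ge) auto
      then have "F (m x) \<subseteq> F n" using F(3) n by (auto simp: incseq_def)
      then show ?thesis using m[OF that] by blast
    qed
    then have "sum f (F n \<union> X) = sum f (F n)"
      using F(1) X(1) by (intro sum.mono_neutral_right) auto
    moreover have "dist (sum f (F n \<union> X)) S < e"
      using X F by (intro X(3)) auto
    ultimately show "norm (sum f (F n) - S) < e" by (simp add: dist_norm)
  qed
qed

section \<open>Determinants of finite expansions\<close>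

context nuclear_operator
begin

text \<open>A finite index set meeting no \<open>F n\<close> in one of its elements has a zero
  column in \<open>kmat\<close>, so its minor vanishes and the power sets of the \<open>F n\<close>
  exhaust the support of the sum.\<close>

lemma fredholm_det_exhaustion:
  assumes F: "\<And>n. finite (F n)" "incseq F" and zero: "\<And>j. (\<And>n. j \<notin> F n) \<Longrightarrow> a j = (\<lambda>_. 0)"
  shows "(\<lambda>n. \<Sum>U\<in>Pow (F n). (-1) ^ card U * perm_sum kmat U) \<longlonglongrightarrow> fredholm_det_id_minus M graph"
  unfolding fredholm_det_graph
proof (rule has_sum_exhaustion[OF fredholm_sums(1)])
  show "finite (Pow (F n))" "Pow (F n) \<subseteq> {U. finite U}" for n using F(1) by (auto intro: finite_subset)
  show "incseq (\<lambda>n. Pow (F n))" using F(2) by (auto simp: incseq_def)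
  fix U assume U: "U \<in> {U. finite U}" "(-1) ^ card U * perm_sum kmat U \<noteq> 0"
  have "\<exists>n. j \<in> F n" if "j \<in> U" for j
  proof (rule ccontr)
    assume "\<nexists>n. j \<in> F n"
    then have "a j = (\<lambda>_. 0)" using zero by blast
    then have "kmat i j = 0" for i by (simp add: kmat_def)
    then have "perm_sum kmat U = 0" using U that by (intro perm_sum_zero_column) auto
    then show False using U by simp
  qed
  then obtain m where m: "\<And>j. j \<in> U \<Longrightarrow> j \<in> F (m j)" by metis
  define N where "N = Max (insert 0 (m ` U))"
  have "j \<in> F N" if "j \<in> U" for j
  proof -
    have "m j \<le> N" unfolding N_def using U(1) that by (intro Max_ge) auto
    then show ?thesis using m[OF that] F(2) by (auto simp: incseq_def)
  qed
  then show "\<exists>n. U \<in> Pow (F n)" by blast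
qed

lemma fredholm_det_finite:
  assumes "finite F" "\<And>j. j \<notin> F \<Longrightarrow> a j = (\<lambda>_. 0)"
  shows "fredholm_det_id_minus M graph = (\<Sum>U\<in>Pow F. (-1) ^ card U * perm_sum kmat U)"
  using fredholm_det_exhaustion[of "\<lambda>_. F"] assms
  by (simp add: incseq_def LIMSEQ_const_iff)

lemma graph_finite:
  assumes F: "finite F" "\<And>j. j \<notin> F \<Longrightarrow> a j = (\<lambda>_. 0)"
  shows "graph = {(f, g). f \<in> L2 M \<and> g \<in> L2 M \<and>
    (\<forall>h\<in>L2 M. l2_inner M h (\<lambda>x. \<Sum>j\<in>F. l2_inner M (b j) f * a j x) = l2_inner M h g)}"
proof -
  have "((\<lambda>j. l2_inner M h (a j) * l2_inner M (b j) f) has_sum y) UNIV \<longleftrightarrow>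
      l2_inner M h (\<lambda>x. \<Sum>j\<in>F. l2_inner M (b j) f * a j x) = y" if "h \<in> L2 M" for h f y
  proof -
    have "((\<lambda>j. l2_inner M h (a j) * l2_inner M (b j) f) has_sum (\<Sum>j\<in>F. l2_inner M h (a j) * l2_inner M (b j) f)) UNIV"
      by (rule has_sum_finite_neutralI[where B = F]) (use F in auto)
    moreover have "(\<Sum>j\<in>F. l2_inner M h (a j) * l2_inner M (b j) f) = l2_inner M h (\<lambda>x. \<Sum>j\<in>F. l2_inner M (b j) f * a j x)"
      using that a by (subst l2_inner_sum_right) (auto simp: l2_inner_cmult_right intro!: L2_cmult sum.cong)
    ultimately show ?thesis using has_sum_unique by fastforce
  qed
  then show ?thesis unfolding graph_def by auto
qed

end

text \<open>The determinant depends on the graph alone. Two finite expansions of one operator, even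
  over different index types, thus have equal sums of minors.\<close>

lemma nuclear_operator_graph_cong:
  assumes 1: "nuclear_operator M a b" "finite F" "\<And>j. j \<notin> F \<Longrightarrow> a j = (\<lambda>_. 0)"
    and 2: "nuclear_operator M a' b'" "finite F'" "\<And>j. j \<notin> F' \<Longrightarrow> a' j = (\<lambda>_. 0)"
    and eq: "\<And>f. f \<in> L2 M \<Longrightarrow> AE x in M. (\<Sum>j\<in>F. l2_inner M (b j) f * a j x) = (\<Sum>j\<in>F'. l2_inner M (b' j) f * a' j x)"
  shows "nuclear_operator.graph M a b = nuclear_operator.graph M a' b'"
proof -
  have L: "(\<lambda>x. \<Sum>j\<in>F. l2_inner M (b j) f * a j x) \<in> L2 M" "(\<lambda>x. \<Sum>j\<in>F'. l2_inner M (b' j) f * a' j x) \<in> L2 M" for f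
    by (intro L2_sum L2_cmult nuclear_operator.a[OF 1(1)] nuclear_operator.a[OF 2(1)])+
  have "l2_inner M h (\<lambda>x. \<Sum>j\<in>F. l2_inner M (b j) f * a j x) = l2_inner M h (\<lambda>x. \<Sum>j\<in>F'. l2_inner M (b' j) f * a' j x)"
    if "f \<in> L2 M" "h \<in> L2 M" for f h
    by (rule l2_inner_cong_AE) (use that L eq in auto)
  moreover have "nuclear_operator.graph M a b = {(f, g). f \<in> L2 M \<and> g \<in> L2 M \<and>
    (\<forall>h\<in>L2 M. l2_inner M h (\<lambda>x. \<Sum>j\<in>F. l2_inner M (b j) f * a j x) = l2_inner M h g)}"
    by (rule nuclear_operator.graph_finite[OF 1(1,2)]) (rule 1(3))
  moreover have "nuclear_operator.graph M a' b' = {(f, g). f \<in> L2 M \<and> g \<in> L2 M \<and>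
    (\<forall>h\<in>L2 M. l2_inner M h (\<lambda>x. \<Sum>j\<in>F'. l2_inner M (b' j) f * a' j x) = l2_inner M h g)}"
    by (rule nuclear_operator.graph_finite[OF 2(1,2)]) (rule 2(3))
  ultimately show ?thesis by auto
qed

lemma C1_lipschitz:
  fixes f :: "real \<Rightarrow> complex"
  assumes "\<And>x. x \<in> {a..b} \<Longrightarrow> (f has_vector_derivative f' x) (at x within {a..b})"
    and "continuous_on {a..b} f'"
  obtains B where "B > 0" "\<And>x y. x \<in> {a..b} \<Longrightarrow> y \<in> {a..b} \<Longrightarrow> cmod (f x - f y) \<le> B * \<bar>x - y\<bar>"
proof -
  obtain B where B: "B > 0" "\<And>x. x \<in> {a..b} \<Longrightarrow> cmod (f' x) \<le> B"
    using continuous_Icc_bounded[OF assms(2)] by blast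
  show ?thesis
  proof (rule that[OF B(1)])
    fix x y assume "x \<in> {a..b}" "y \<in> {a..b}"
    then have "norm (f x - f y) \<le> B * norm (x - y)"
    proof (intro differentiable_bound[where S = "{a..b}" and f' = "\<lambda>x t. t *\<^sub>R f' x"])
      fix u assume u: "u \<in> {a..b}"
      show "onorm (\<lambda>t. t *\<^sub>R f' u) \<le> B"
        using B(2)[OF u] by (intro onorm_le) (simp add: mult.commute[of B] mult_left_mono)
    qed (use assms(1) in \<open>auto simp: has_vector_derivative_def\<close>)
    then show "cmod (f x - f y) \<le> B * \<bar>x - y\<bar>" by simp
  qed
qed

section \<open>The grid and the telescoping expansion\<close>

context floquet_problem
begin

text \<open>The cut-off term is continuous across t = x because \<open>s\<close> vanishes at 0, so
  it is Lipschitz in \<open>x\<close> with the constant of \<open>s\<close>.\<close>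

lemma green_lipschitz:
  obtains L where "L > 0" "\<And>x y t. x \<in> {0..\<omega>} \<Longrightarrow> y \<in> {0..\<omega>} \<Longrightarrow> t \<in> {0..\<omega>} \<Longrightarrow>
    cmod (green x t - green y t) \<le> L * \<bar>x - y\<bar>"
proof -
  obtain Lc where Lc: "Lc > 0" "\<And>x y. x \<in> {0..\<omega>} \<Longrightarrow> y \<in> {0..\<omega>} \<Longrightarrow> cmod (c x - c y) \<le> Lc * \<bar>x - y\<bar>"
  proof (rule C1_lipschitz[OF free_cos_deriv])
    show "continuous_on {0..\<omega>} (\<lambda>x. - (z * s x))" by (intro continuous_intros)
  qed blast
  obtain Ls where Ls: "Ls > 0" "\<And>x y. x \<in> {0..\<omega>} \<Longrightarrow> y \<in> {0..\<omega>} \<Longrightarrow> cmod (s x - s y) \<le> Ls * \<bar>x - y\<bar>"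
  proof (rule C1_lipschitz[OF free_sin_deriv])
    show "continuous_on {0..\<omega>} c" by (intro continuous_intros)
  qed blast
  obtain Ba where Ba: "Ba > 0" "\<And>x. x \<in> {0..\<omega>} \<Longrightarrow> cmod (green_a x) \<le> Ba"
    using continuous_Icc_bounded[OF continuous_green_ab(1)] by blast
  obtain Bb where Bb: "Bb > 0" "\<And>x. x \<in> {0..\<omega>} \<Longrightarrow> cmod (green_b x) \<le> Bb"
    using continuous_Icc_bounded[OF continuous_green_ab(2)] by blast
  have main: "cmod (green x t - green y t) \<le> (Lc * Ba + Ls * Bb + Ls) * \<bar>x - y\<bar>"
    if xyt: "x \<in> {0..\<omega>}" "y \<in> {0..\<omega>}" "t \<in> {0..\<omega>}" and le: "y \<le> x" for x y t
  proof -
    define r where "r x = (if t < x then s (x - t) else 0)" for x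
    have r: "cmod (r x - r y) \<le> Ls * \<bar>x - y\<bar>"
    proof (cases "t < x")
      case True
      \<comment> \<open>If \<open>t\<close> is not below \<open>y\<close>, the cut-off value 0 is
        s(0), so the argument is clipped at 0.\<close>
      define y' where "y' = (if t < y then y - t else 0)"
      have "r y = s y'" "r x = s (x - t)" using True by (auto simp: r_def y'_def)
      moreover have "cmod (s (x - t) - s y') \<le> Ls * \<bar>x - t - y'\<bar>"
        using xyt le True by (intro Ls(2)) (auto simp: y'_def)
      moreover have "Ls * \<bar>x - t - y'\<bar> \<le> Ls * \<bar>x - y\<bar>"
        using le True Ls(1) by (intro mult_left_mono) (auto simp: y'_def)
      ultimately show ?thesis by simp
    next
      case False
      then show ?thesis using le Ls(1) by (simp add: r_def)
    qed
    have "green x t - green y t = (c x - c y) * green_a t + (s x - s y) * green_b t - (r x - r y)"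
      by (simp add: green_def r_def algebra_simps)
    also have "cmod \<dots> \<le> cmod ((c x - c y) * green_a t) + cmod ((s x - s y) * green_b t) + cmod (r x - r y)"
      by (meson norm_triangle_ineq norm_triangle_ineq4 order.trans add_mono order.refl)
    also have "\<dots> \<le> (Lc * \<bar>x - y\<bar>) * Ba + (Ls * \<bar>x - y\<bar>) * Bb + Ls * \<bar>x - y\<bar>"
      unfolding norm_mult
      using Lc(1) Ls(1) Lc(2)[OF xyt(1,2)] Ls(2)[OF xyt(1,2)] Ba(2)[OF xyt(3)] Bb(2)[OF xyt(3)] r
      by (intro add_mono mult_mono) auto
    finally show ?thesis by (simp add: algebra_simps)
  qed
  show ?thesis
  proof (rule that[of "Lc * Ba + Ls * Bb + Ls"])
    show "Lc * Ba + Ls * Bb + Ls > 0" using Lc Ls Ba Bb by (simp add: add_pos_pos)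
    fix x y t assume "x \<in> {0..\<omega>}" "y \<in> {0..\<omega>}" "t \<in> {0..\<omega>}"
    then show "cmod (green x t - green y t) \<le> (Lc * Ba + Ls * Bb + Ls) * \<bar>x - y\<bar>"
      using main[of x y t] main[of y x t] by (cases "y \<le> x") (auto simp: norm_minus_commute abs_minus_commute)
  qed
qed

definition gp :: "nat \<Rightarrow> nat \<Rightarrow> real" where "gp n i = \<omega> * real i / 4 ^ n"
text \<open>Half-open, so that on each level every nonnegative point lies in exactly one cell,
  namely number \<open>idx n x\<close>.\<close>

definition cell :: "nat \<Rightarrow> nat \<Rightarrow> real set" where "cell n i = {gp n i..<gp n (Suc i)}"
definition idx :: "nat \<Rightarrow> real \<Rightarrow> nat" where "idx n x = nat \<lfloor>4 ^ n * x / \<omega>\<rfloor>"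

lemma gp_in: "i \<le> 4 ^ n \<Longrightarrow> gp n i \<in> {0..\<omega>}"
proof -
  assume "i \<le> 4 ^ n"
  then have "real i \<le> 4 ^ n" by (metis of_nat_le_iff of_nat_numeral of_nat_power)
  then show ?thesis using \<omega> by (simp add: gp_def field_simps)
qed

lemma cell_iff: "x \<ge> 0 \<Longrightarrow> x \<in> cell n i \<longleftrightarrow> i = idx n x"
proof -
  assume x: "x \<ge> 0"
  have "x \<in> cell n i \<longleftrightarrow> real i \<le> 4 ^ n * x / \<omega> \<and> 4 ^ n * x / \<omega> < real i + 1"
    using \<omega> by (simp add: cell_def gp_def field_simps)
  also have "\<dots> \<longleftrightarrow> \<lfloor>4 ^ n * x / \<omega>\<rfloor> = int i"
    by (simp add: floor_eq_iff)
  also have "\<dots> \<longleftrightarrow> i = idx n x" using x \<omega> by (auto simp: idx_def)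
  finally show ?thesis .
qed

lemma idx_less: "x \<in> {0<..<\<omega>} \<Longrightarrow> idx n x < 4 ^ n"
proof -
  assume x: "x \<in> {0<..<\<omega>}"
  then have "x \<in> cell n (idx n x)" by (simp add: cell_iff)
  then have "\<omega> * real (idx n x) / 4 ^ n < \<omega>" using x by (simp add: cell_def gp_def)
  then have "real (idx n x) < 4 ^ n" using \<omega> by (simp add: field_simps)
  then show ?thesis by (metis of_nat_less_iff of_nat_numeral of_nat_power)
qed

lemma gp_parent: "gp m (i div 4) \<le> gp (Suc m) i" "gp (Suc m) (Suc i) \<le> gp m (Suc (i div 4))"
proof -
  have "4 * real (i div 4) \<le> real i" by linarith
  then show "gp m (i div 4) \<le> gp (Suc m) i" using \<omega> by (simp add: gp_def field_simps)
  have "Suc i \<le> 4 * Suc (i div 4)" by presburger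
  then have "real (Suc i) \<le> real (4 * Suc (i div 4))" by (rule of_nat_mono)
  then have "real (Suc i) \<le> 4 * real (Suc (i div 4))" by simp
  then have "\<omega> * real (Suc i) \<le> \<omega> * (4 * real (Suc (i div 4)))" using \<omega> by (intro mult_left_mono) auto
  then have "\<omega> * real (Suc i) / 4 ^ Suc m \<le> \<omega> * (4 * real (Suc (i div 4))) / 4 ^ Suc m" by (rule divide_right_mono) simp
  also have "\<dots> = gp m (Suc (i div 4))" by (simp add: gp_def field_simps)
  finally show "gp (Suc m) (Suc i) \<le> gp m (Suc (i div 4))" by (simp only: gp_def)
qed

lemma idx_parent: "x \<ge> 0 \<Longrightarrow> idx (Suc m) x div 4 = idx m x"
proof -
  assume x: "x \<ge> 0"
  then have "x \<in> cell (Suc m) (idx (Suc m) x)" by (simp add: cell_iff)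
  then have "x \<in> cell m (idx (Suc m) x div 4)"
    using gp_parent[of m "idx (Suc m) x"] by (auto simp: cell_def)
  then show ?thesis using x by (simp add: cell_iff)
qed

lemma gp_idx_close: "x \<ge> 0 \<Longrightarrow> \<bar>gp n (idx n x) - x\<bar> \<le> \<omega> / 4 ^ n"
proof -
  assume "x \<ge> 0"
  then have "x \<in> cell n (idx n x)" by (simp add: cell_iff)
  moreover have "gp n (Suc (idx n x)) = gp n (idx n x) + \<omega> / 4 ^ n" by (simp add: gp_def field_simps)
  ultimately show ?thesis by (auto simp: cell_def)
qed

text \<open>Indices are pairs of a level and a cell number. Pairs beyond the 4^n cells of a level
  get the zero function, so that all pairs of naturals can serve as the index type.\<close>

definition ca :: "nat \<times> nat \<Rightarrow> real \<Rightarrow> complex" where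
  "ca j x = (if snd j < 4 ^ fst j \<and> x \<in> cell (fst j) (snd j) then - u x else 0)"

text \<open>The conjugate compensates for the one in the first argument of
  \<open>l2_inner\<close>.\<close>

definition gv :: "nat \<Rightarrow> nat \<Rightarrow> real \<Rightarrow> complex" where
  "gv n i t = cnj (green (gp n i) t * v t)"

text \<open>The kernel row at a cell minus the row at its parent cell one level up, of number
  \<open>i div 4\<close>; level 0 has no parent.\<close>

definition cb :: "nat \<times> nat \<Rightarrow> real \<Rightarrow> complex" where
  "cb j = (if snd j < 4 ^ fst j then
     (\<lambda>t. gv (fst j) (snd j) t - (if fst j = 0 then 0 else gv (fst j - 1) (snd j div 4) t)) else (\<lambda>_. 0))"

lemma u_measurable [measurable]: "u \<in> borel_measurable M" and v_measurable [measurable]: "v \<in> borel_measurable M"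
  using L2D(1)[OF u_L2] L2D(1)[OF v_L2] by auto

lemma ca_L2: "ca j \<in> L2 M"
proof (rule L2I_bound[OF _ L2D(2)[OF u_L2]])
  have "(\<lambda>x. if snd j < 4 ^ fst j \<and> gp (fst j) (snd j) \<le> x \<and> x < gp (fst j) (Suc (snd j)) then - u x else 0) \<in> borel_measurable M"
    using id_measurable u_measurable by measurable
  then show "ca j \<in> borel_measurable M" by (simp add: ca_def[abs_def] cell_def)
  show "AE x in M. (cmod (ca j x))\<^sup>2 \<le> (cmod (u x))\<^sup>2" by (intro AE_I2) (simp add: ca_def)
qed

lemma gv_L2: assumes "i \<le> 4 ^ n" shows "gv n i \<in> L2 M"
proof -
  obtain B where B: "B > 0" "\<And>x t. x \<in> {0..\<omega>} \<Longrightarrow> t \<in> {0..\<omega>} \<Longrightarrow> cmod (green x t) \<le> B" using green_bound by blast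
  have "(\<lambda>t. green (gp n i) t * v t) \<in> L2 M"
  proof (rule L2I_bound)
    show "(\<lambda>t. green (gp n i) t * v t) \<in> borel_measurable M" using green_measurable v_measurable by measurable
    show "integrable M (\<lambda>t. B\<^sup>2 * (cmod (v t))\<^sup>2)" using L2D(2)[OF v_L2] by simp
    show "AE t in M. (cmod (green (gp n i) t * v t))\<^sup>2 \<le> B\<^sup>2 * (cmod (v t))\<^sup>2"
      using AE_interval_in
    proof eventually_elim
      case (elim t)
      then have "(cmod (green (gp n i) t))\<^sup>2 \<le> B\<^sup>2" using B(2)[OF gp_in[OF assms], of t] by (intro power_mono) auto
      then show ?case by (simp add: norm_mult power_mult_distrib mult_right_mono)
    qed
  qed
  then show ?thesis unfolding gv_def[abs_def] by (rule L2_cnj)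
qed

lemma div4_le: "i < 4 ^ n \<Longrightarrow> n \<noteq> 0 \<Longrightarrow> (i :: nat) div 4 \<le> 4 ^ (n - 1)"
  by (cases n) (auto simp: less_imp_le less_mult_imp_div_less mult.commute)

lemma cb_L2: "cb j \<in> L2 M"
proof (cases "snd j < 4 ^ fst j")
  case True
  show ?thesis
  proof (cases "fst j = 0")
    case False
    then show ?thesis unfolding cb_def using True gv_L2[OF div4_le[OF True False]]
      by (auto intro!: L2_diff gv_L2)
  qed (use True in \<open>auto simp: cb_def intro!: gv_L2\<close>)
qed (simp add: cb_def L2_zero)

definition \<kappa> :: "(real \<Rightarrow> complex) \<Rightarrow> real \<Rightarrow> complex" where "\<kappa> f = R (\<lambda>t. v t * f t)"

lemma inner_gv: "l2_inner M (gv n i) f = \<kappa> f (gp n i)"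
  unfolding l2_inner_def \<kappa>_def R_def gv_def by (simp add: mult.assoc)

lemma inner_cb:
  assumes "i < 4 ^ n" "f \<in> L2 M"
  shows "l2_inner M (cb (n, i)) f = \<kappa> f (gp n i) - (if n = 0 then 0 else \<kappa> f (gp (n - 1) (i div 4)))"
proof (cases "n = 0")
  case True
  then show ?thesis using assms inner_gv[of n i f] by (simp add: cb_def)
next
  case False
  then have "l2_inner M (cb (n, i)) f = l2_inner M (\<lambda>t. gv n i t - gv (n - 1) (i div 4) t) f"
    using assms by (simp add: cb_def)
  also have "\<dots> = l2_inner M (gv n i) f - l2_inner M (gv (n - 1) (i div 4)) f"
    using assms div4_le[OF assms(1) False] by (intro l2_inner_diff_left gv_L2) auto
  finally show ?thesis using False by (simp add: inner_gv)
qed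

text \<open>The left endpoint of a cell and that of its parent are at most 4 \<omega> / 4^n apart,
  so the Lipschitz bound gives the decay.\<close>

lemma norm_cb:
  obtains C where "C > 0" "\<And>n i. l2_norm M (cb (n, i)) \<le> C / 4 ^ n"
proof -
  obtain B where B: "B > 0" "\<And>x t. x \<in> {0..\<omega>} \<Longrightarrow> t \<in> {0..\<omega>} \<Longrightarrow> cmod (green x t) \<le> B" using green_bound by blast
  obtain L where L: "L > 0" "\<And>x y t. x \<in> {0..\<omega>} \<Longrightarrow> y \<in> {0..\<omega>} \<Longrightarrow> t \<in> {0..\<omega>} \<Longrightarrow>
    cmod (green x t - green y t) \<le> L * \<bar>x - y\<bar>" using green_lipschitz by blast
  \<comment> \<open>\<open>B\<close> serves level 0, where the kernel itself appears, and
    \<open>4 * \<omega> * L\<close> all later levels.\<close>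
  define C0 where "C0 = B + 4 * \<omega> * L"
  have C0: "C0 > 0" using B L \<omega> by (simp add: C0_def add_pos_pos)
  have pt: "cmod (cb (n, i) t) \<le> (C0 / 4 ^ n) * cmod (v t)" if t: "t \<in> {0<..<\<omega>}" for n i t
  proof (cases "i < 4 ^ n")
    case True
    have t': "t \<in> {0..\<omega>}" using t by auto
    show ?thesis
    proof (cases n)
      case 0
      have "cmod (cb (n, i) t) = cmod (green (gp n i) t) * cmod (v t)"
        using True 0 by (simp add: cb_def gv_def norm_mult)
      also have "\<dots> \<le> C0 * cmod (v t)"
        using B(2)[OF gp_in[OF less_imp_le[OF True]] t'] L(1) \<omega> by (intro mult_right_mono) (auto simp: C0_def add_increasing2)
      finally show ?thesis using 0 by simp
    next
      case (Suc m)
      have g: "gp n i \<in> {0..\<omega>}" "gp m (i div 4) \<in> {0..\<omega>}"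
        using gp_in[of i n] gp_in[of "i div 4" m] True div4_le[OF True] Suc by auto
      have "\<bar>gp n i - gp m (i div 4)\<bar> \<le> 4 * \<omega> / 4 ^ n"
      proof -
        have "gp n i \<le> gp n (Suc i)" using \<omega> by (simp add: gp_def divide_right_mono)
        then have "gp n i \<le> gp m (Suc (i div 4))" using gp_parent(2)[of m i] Suc by simp
        moreover have "gp m (Suc (i div 4)) = gp m (i div 4) + 4 * \<omega> / 4 ^ n"
          using Suc by (simp add: gp_def field_simps)
        ultimately show ?thesis using gp_parent(1)[of m i] Suc by simp
      qed
      then have "L * \<bar>gp n i - gp m (i div 4)\<bar> \<le> L * (4 * \<omega> / 4 ^ n)" using L(1) by (intro mult_left_mono) auto
      with L(2)[OF g t'] have "cmod (green (gp n i) t - green (gp m (i div 4)) t) \<le> L * (4 * \<omega> / 4 ^ n)" by linarith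
      also have "\<dots> \<le> C0 / 4 ^ n" using B by (simp add: C0_def divide_right_mono)
      finally have 1: "cmod (green (gp n i) t - green (gp m (i div 4)) t) \<le> C0 / 4 ^ n" .
      have "cb (n, i) t = cnj ((green (gp n i) t - green (gp m (i div 4)) t) * v t)"
        using True Suc by (simp add: cb_def gv_def algebra_simps)
      then have "cmod (cb (n, i) t) = cmod (green (gp n i) t - green (gp m (i div 4)) t) * cmod (v t)"
        by (simp only: complex_mod_cnj norm_mult)
      then show ?thesis using mult_right_mono[OF 1, of "cmod (v t)"] by simp
    qed
  next
    case False
    then show ?thesis using C0 by (simp add: cb_def)
  qed
  show ?thesis
  proof (rule that[of "C0 * (l2_norm M v + 1)"])
    show "C0 * (l2_norm M v + 1) > 0" using C0 l2_norm_nonneg[of M v] by (intro mult_pos_pos) linarith+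
    fix n i
    have "l2_norm M (cb (n, i)) \<le> (C0 / 4 ^ n) * l2_norm M v"
    proof (rule power2_le_imp_le)
      have "(l2_norm M (cb (n, i)))\<^sup>2 \<le> (LINT t|M. (C0 / 4 ^ n)\<^sup>2 * (cmod (v t))\<^sup>2)"
        unfolding l2_norm_power2
      proof (rule integral_mono_AE[OF L2D(2)[OF cb_L2]])
        show "integrable M (\<lambda>t. (C0 / 4 ^ n)\<^sup>2 * (cmod (v t))\<^sup>2)" using L2D(2)[OF v_L2] by simp
        show "AE t in M. (cmod (cb (n, i) t))\<^sup>2 \<le> (C0 / 4 ^ n)\<^sup>2 * (cmod (v t))\<^sup>2"
          using AE_interval_in
        proof eventually_elim
          case (elim t)
          then show ?case unfolding power_mult_distrib[symmetric] by (intro power_mono pt) auto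
        qed
      qed
      then show "(l2_norm M (cb (n, i)))\<^sup>2 \<le> ((C0 / 4 ^ n) * l2_norm M v)\<^sup>2"
        by (simp add: power_mult_distrib power_divide l2_norm_power2)
    qed (use C0 in simp)
    also have "\<dots> \<le> (C0 / 4 ^ n) * (l2_norm M v + 1)" using C0 by (intro mult_left_mono) auto
    finally show "l2_norm M (cb (n, i)) \<le> C0 * (l2_norm M v + 1) / 4 ^ n" by simp
  qed
qed

lemma sum_cells:
  fixes h :: "nat \<Rightarrow> 'b :: comm_monoid_add"
  assumes "x \<in> {0<..<\<omega>}"
  shows "(\<Sum>i<4 ^ n. if x \<in> cell n i then h i else 0) = h (idx n x)"
proof -
  have "(\<Sum>i<4 ^ n. if x \<in> cell n i then h i else 0) = (\<Sum>i<4 ^ n. if i = idx n x then h i else 0)"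
    using assms by (intro sum.cong) (auto simp: cell_iff)
  also have "\<dots> = h (idx n x)" using idx_less[OF assms, of n] by simp
  finally show ?thesis .
qed

lemma sum_norm_ca: "(\<Sum>i<4 ^ n. (l2_norm M (ca (n, i)))\<^sup>2) = (l2_norm M u)\<^sup>2"
proof -
  have "(\<Sum>i<4 ^ n. (l2_norm M (ca (n, i)))\<^sup>2) = (LINT x|M. (\<Sum>i<4 ^ n. (cmod (ca (n, i) x))\<^sup>2))"
    unfolding l2_norm_power2 by (rule Bochner_Integration.integral_sum[symmetric]) (rule L2D(2)[OF ca_L2])
  also have "\<dots> = (LINT x|M. (cmod (u x))\<^sup>2)"
  proof (rule Bochner_Integration.integral_cong_AE)
    show "AE x in M. (\<Sum>i<4 ^ n. (cmod (ca (n, i) x))\<^sup>2) = (cmod (u x))\<^sup>2"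
      using AE_interval_in
    proof eventually_elim
      case (elim x)
      have "(\<Sum>i<4 ^ n. (cmod (ca (n, i) x))\<^sup>2) = (\<Sum>i<4 ^ n. if x \<in> cell n i then (cmod (u x))\<^sup>2 else 0)"
        by (rule sum.cong) (auto simp: ca_def)
      then show ?case using sum_cells[OF elim, of n "\<lambda>_. (cmod (u x))\<^sup>2"] by simp
    qed
  qed (use L2D(1)[OF ca_L2] in measurable)
  finally show ?thesis by (simp add: l2_norm_power2)
qed

text \<open>On level \<open>n\<close> the squared norms of the \<open>ca\<close> add up to |u|^2
  over 4^n cells while those of the \<open>cb\<close> are O(4^-n). The inequality of arithmetic and
  geometric means bounds the level by a multiple of 2^-n.\<close>

lemma nuclear_K: "nuclear_operator M ca cb"
proof (rule nuclear_operator.intro)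
  show "finite_measure M" by (rule finite_interval_measure)
  show "ca j \<in> L2 M" "cb j \<in> L2 M" for j by (rule ca_L2 cb_L2)+
  obtain C where C: "C > 0" "\<And>n i. l2_norm M (cb (n, i)) \<le> C / 4 ^ n" using norm_cb by blast
  define w where "w j = l2_norm M (ca j) * l2_norm M (cb j)" for j
  have w0: "w j \<ge> 0" for j by (simp add: w_def)
  have wz: "w (n, i) = 0" if "\<not> i < 4 ^ n" for n i using that by (simp add: w_def cb_def)
  have inner: "((\<lambda>i. w (n, i)) has_sum (\<Sum>i<4 ^ n. w (n, i))) UNIV" for n
    by (rule has_sum_finite_neutralI[where B = "{..<4 ^ n}"]) (auto simp: wz)
  define S where "S = C * ((l2_norm M u)\<^sup>2 + 1) / 2"
  have outer: "(\<Sum>i<4 ^ n. w (n, i)) \<le> S * (1 / 2) ^ n" for n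
  proof -
    have "w (n, i) \<le> C / 2 * ((1 / 2) ^ n * (l2_norm M (ca (n, i)))\<^sup>2 + (1 / 2) ^ n * (1 / 4) ^ n)" for i
    proof -
      define X Y where "X = l2_norm M (ca (n, i))" and "Y = (1 / 4 :: real) ^ n"
      \<comment> \<open>The balancing weight: expanding h (X - h)^2 bounds 2 X 4^-n by h X^2 + h
        4^-n, and summation over the 4^n cells gives h (|u|^2 + 1).\<close>
      define h where "h = (1 / 2 :: real) ^ n"
      have hh: "h * h = Y" "h > 0" "2 ^ n * h = 1" by (simp_all add: h_def Y_def flip: power_mult_distrib)
      have "0 \<le> h * (X - h)\<^sup>2" using hh by simp
      also have "\<dots> = h * X\<^sup>2 - 2 * (X * (h * h)) + h * (h * h)" by (simp add: power2_eq_square algebra_simps)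
      finally have "2 * (X * Y) \<le> h * X\<^sup>2 + h * Y" using hh by simp
      then have "C / 2 * (2 * (X * Y)) \<le> C / 2 * (h * X\<^sup>2 + h * Y)" using C by (intro mult_left_mono) auto
      moreover have "w (n, i) \<le> X * (C / 4 ^ n)" unfolding w_def X_def by (intro mult_left_mono C) auto
      moreover have "X * (C / 4 ^ n) = C / 2 * (2 * (X * Y))" by (simp add: Y_def power_divide)
      ultimately show ?thesis by (simp add: X_def Y_def h_def)
    qed
    then have "(\<Sum>i<4 ^ n. w (n, i)) \<le> (\<Sum>i<4 ^ n. C / 2 * ((1 / 2) ^ n * (l2_norm M (ca (n, i)))\<^sup>2 + (1 / 2) ^ n * (1 / 4) ^ n))"
      by (rule sum_mono)
    also have "\<dots> = C / 2 * ((1 / 2) ^ n * (\<Sum>i<4 ^ n. (l2_norm M (ca (n, i)))\<^sup>2) + (\<Sum>i<(4 :: nat) ^ n. (1 / 2) ^ n * (1 / 4) ^ n))"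
      by (simp only: sum_distrib_left[symmetric] sum.distrib)
    also have "(\<Sum>i<(4 :: nat) ^ n. (1 / 2 :: real) ^ n * (1 / 4) ^ n) = (1 / 2) ^ n"
      by (simp add: power_divide)
    finally show ?thesis unfolding sum_norm_ca S_def by (simp add: algebra_simps)
  qed
  have "(\<lambda>j. norm (w j)) summable_on (UNIV \<times> UNIV)"
  proof (subst Infinite_Sum.abs_summable_on_Sigma_iff, intro conjI ballI)
    show "(\<lambda>i. norm (w (n, i))) summable_on UNIV" for n
      using has_sum_imp_summable[OF inner] w0 by simp
    have eq: "infsum (\<lambda>i. norm (w (n, i))) UNIV = (\<Sum>i<4 ^ n. w (n, i))" for n
      using infsumI[OF inner] w0 by simp
    show "(\<lambda>n. norm (infsum (\<lambda>i. norm (w (n, i))) UNIV)) summable_on UNIV"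
    proof (rule Infinite_Sum.abs_summable_on_comparison_test')
      have "summable (\<lambda>n. S * (1 / 2) ^ n)" by (intro summable_mult summable_geometric) simp
      then show "(\<lambda>n. S * (1 / 2) ^ n) summable_on UNIV"
        using C by (subst summable_on_UNIV_nonneg_real_iff) (auto simp: S_def)
      show "norm (infsum (\<lambda>i. norm (w (n, i))) UNIV) \<le> S * (1 / 2) ^ n" for n
        unfolding eq using outer[of n] w0 by (simp add: sum_nonneg)
    qed
  qed
  then have "w summable_on UNIV" using w0 by simp
  then show "(\<lambda>j. l2_norm M (ca j) * l2_norm M (cb j)) summable_on UNIV" by (simp add: w_def[abs_def])
qed

sublocale N: nuclear_operator M ca cb by (rule nuclear_K)

definition FF :: "nat \<Rightarrow> (nat \<times> nat) set" where "FF n = Sigma {..n} (\<lambda>m. {..<4 ^ m})"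

lemma FF: "finite (FF n)" "incseq FF" "(\<And>n. j \<notin> FF n) \<Longrightarrow> ca j = (\<lambda>_. 0)"
proof -
  show "finite (FF n)" by (simp add: FF_def)
  show "incseq FF" by (auto simp: FF_def incseq_def)
  assume "\<And>n. j \<notin> FF n"
  then have "j \<notin> FF (fst j)" .
  then have "\<not> snd j < 4 ^ fst j" by (cases j) (simp add: FF_def)
  then show "ca j = (\<lambda>_. 0)" by (simp add: ca_def fun_eq_iff)
qed

lemma sum_level:
  assumes f: "f \<in> L2 M" and x: "x \<in> {0<..<\<omega>}"
  shows "(\<Sum>i<4 ^ n. l2_inner M (b i) f * ca (n, i) x) = - (u x * l2_inner M (b (idx n x)) f)"
proof -
  have "(\<Sum>i<4 ^ n. l2_inner M (b i) f * ca (n, i) x)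
      = (\<Sum>i<4 ^ n. if x \<in> cell n i then - (u x * l2_inner M (b i) f) else 0)"
    by (rule sum.cong) (auto simp: ca_def)
  then show ?thesis using sum_cells[OF x, of n "\<lambda>i. - (u x * l2_inner M (b i) f)"] by simp
qed

text \<open>At a fixed \<open>x\<close> one cell per level contributes, and the parent of the cell
  of \<open>x\<close> is the cell of \<open>x\<close> one level up, so the sum telescopes to the
  kernel frozen at the finest endpoint.\<close>

lemma sum_FF:
  assumes f: "f \<in> L2 M" and x: "x \<in> {0<..<\<omega>}"
  shows "(\<Sum>j\<in>FF n. l2_inner M (cb j) f * ca j x) = - (u x * \<kappa> f (gp n (idx n x)))"
proof (induction n)
  case 0
  have FF0: "FF 0 = {(0, 0)}" by (auto simp: FF_def)
  have "(\<Sum>j\<in>FF 0. l2_inner M (cb j) f * ca j x) = (\<Sum>i<4 ^ 0. l2_inner M (cb (0, i)) f * ca (0, i) x)"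
    by (simp add: FF0)
  also have "\<dots> = - (u x * l2_inner M (cb (0, idx 0 x)) f)" by (rule sum_level[OF f x])
  finally show ?case using inner_cb[OF idx_less[OF x] f, of 0] by simp
next
  case (Suc n)
  have "FF (Suc n) = FF n \<union> Pair (Suc n) ` {..<4 ^ Suc n}" by (auto simp: FF_def le_Suc_eq)
  moreover have "FF n \<inter> Pair (Suc n) ` {..<4 ^ Suc n} = {}" by (auto simp: FF_def)
  ultimately have "(\<Sum>j\<in>FF (Suc n). l2_inner M (cb j) f * ca j x)
      = (\<Sum>j\<in>FF n. l2_inner M (cb j) f * ca j x) + (\<Sum>j\<in>Pair (Suc n) ` {..<4 ^ Suc n}. l2_inner M (cb j) f * ca j x)"
    using FF(1) by (simp add: sum.union_disjoint)
  also have "(\<Sum>j\<in>Pair (Suc n) ` {..<4 ^ Suc n}. l2_inner M (cb j) f * ca j x)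
      = (\<Sum>i<4 ^ Suc n. l2_inner M (cb (Suc n, i)) f * ca (Suc n, i) x)"
    by (subst sum.reindex) (auto simp: inj_on_def)
  also have "\<dots> = - (u x * l2_inner M (cb (Suc n, idx (Suc n) x)) f)" by (rule sum_level[OF f x])
  also have "l2_inner M (cb (Suc n, idx (Suc n) x)) f = \<kappa> f (gp (Suc n) (idx (Suc n) x)) - \<kappa> f (gp n (idx n x))"
    using inner_cb[OF idx_less[OF x] f, of "Suc n"] idx_parent[of x n] x by simp
  finally show ?case unfolding Suc by (simp add: algebra_simps)
qed

lemma continuous_\<kappa>: "f \<in> L2 M \<Longrightarrow> continuous_on {0..\<omega>} (\<kappa> f)"
  unfolding \<kappa>_def by (rule continuous_R[OF vf_integrable])

lemma N_ap_eq:
  assumes f: "f \<in> L2 M" and h: "h \<in> L2 M"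
  shows "l2_inner M h (N.ap f) = l2_inner M h (KR f)"
proof (rule LIMSEQ_unique)
  show "(\<lambda>n. \<Sum>j\<in>FF n. l2_inner M h (ca j) * l2_inner M (cb j) f) \<longlonglongrightarrow> l2_inner M h (N.ap f)"
  proof (rule has_sum_exhaustion[OF N.inner_ap[OF f h] FF(1) _ FF(2)])
    fix j :: "nat \<times> nat" assume "l2_inner M h (ca j) * l2_inner M (cb j) f \<noteq> 0"
    then have "ca j \<noteq> (\<lambda>_. 0)" by auto
    then show "\<exists>n. j \<in> FF n" using FF(3) by blast
  qed simp
  obtain B where B: "B > 0" "\<And>x. x \<in> {0..\<omega>} \<Longrightarrow> cmod (\<kappa> f x) \<le> B"
    using continuous_Icc_bounded[OF continuous_\<kappa>[OF f]] by blast
  have SL: "(\<lambda>x. \<Sum>j\<in>FF n. l2_inner M (cb j) f * ca j x) \<in> L2 M" for n by (intro L2_sum L2_cmult ca_L2)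
  have eq: "(\<Sum>j\<in>FF n. l2_inner M h (ca j) * l2_inner M (cb j) f)
      = (LINT x|M. cnj (h x) * (\<Sum>j\<in>FF n. l2_inner M (cb j) f * ca j x))" for n
  proof -
    have "(\<Sum>j\<in>FF n. l2_inner M h (ca j) * l2_inner M (cb j) f) = l2_inner M h (\<lambda>x. \<Sum>j\<in>FF n. l2_inner M (cb j) f * ca j x)"
      by (subst l2_inner_sum_right[OF h]) (auto simp: l2_inner_cmult_right intro!: L2_cmult ca_L2 sum.cong)
    then show ?thesis by (simp add: l2_inner_def)
  qed
  have "(\<lambda>n. LINT x|M. cnj (h x) * (\<Sum>j\<in>FF n. l2_inner M (cb j) f * ca j x)) \<longlonglongrightarrow> (LINT x|M. cnj (h x) * KR f x)"
  proof (rule Bochner_Integration.integral_dominated_convergence[where w = "\<lambda>x. B * (cmod (h x) * cmod (u x))"])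
    show "(\<lambda>x. cnj (h x) * KR f x) \<in> borel_measurable M"
      using L2_integrable_inner[OF h KR_L2[OF f]] by auto
    show "(\<lambda>x. cnj (h x) * (\<Sum>j\<in>FF n. l2_inner M (cb j) f * ca j x)) \<in> borel_measurable M" for n
      using L2_integrable_inner[OF h SL] by auto
    show "integrable M (\<lambda>x. B * (cmod (h x) * cmod (u x)))"
      using L2_integrable_norm_mult[OF h u_L2] by simp
    show "AE x in M. (\<lambda>n. cnj (h x) * (\<Sum>j\<in>FF n. l2_inner M (cb j) f * ca j x)) \<longlonglongrightarrow> cnj (h x) * KR f x"
      using AE_interval_in
    proof eventually_elim
      case (elim x)
      have "(\<lambda>n. gp n (idx n x) - x) \<longlonglongrightarrow> 0"
      proof (rule Lim_null_comparison)
        show "eventually (\<lambda>n. norm (gp n (idx n x) - x) \<le> \<omega> * (1 / 4) ^ n) sequentially"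
          using gp_idx_close[of x] elim by (simp add: power_divide)
        show "(\<lambda>n. \<omega> * (1 / 4) ^ n) \<longlonglongrightarrow> 0"
          using tendsto_mult_left[OF LIMSEQ_realpow_zero[of "1 / 4"], of \<omega>] by simp
      qed
      then have "(\<lambda>n. gp n (idx n x)) \<longlonglongrightarrow> x" by (rule LIM_zero_cancel)
      then have "(\<lambda>n. \<kappa> f (gp n (idx n x))) \<longlonglongrightarrow> \<kappa> f x"
        by (rule continuous_on_tendsto_compose[OF continuous_\<kappa>[OF f]])
           (use elim gp_in[OF less_imp_le[OF idx_less[OF elim]]] in auto)
      then have "(\<lambda>n. cnj (h x) * - (u x * \<kappa> f (gp n (idx n x)))) \<longlonglongrightarrow> cnj (h x) * - (u x * \<kappa> f x)"
        by (intro tendsto_intros)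
      then show ?case unfolding sum_FF[OF f elim] KR_def \<kappa>_def .
    qed
    show "AE x in M. norm (cnj (h x) * (\<Sum>j\<in>FF n. l2_inner M (cb j) f * ca j x)) \<le> B * (cmod (h x) * cmod (u x))" for n
      using AE_interval_in
    proof eventually_elim
      case (elim x)
      have "cmod (\<kappa> f (gp n (idx n x))) \<le> B" using B(2) gp_in[OF less_imp_le[OF idx_less[OF elim]]] by blast
      then have "cmod (h x) * cmod (u x) * cmod (\<kappa> f (gp n (idx n x))) \<le> cmod (h x) * cmod (u x) * B"
        by (intro mult_left_mono) auto
      then show ?case unfolding sum_FF[OF f elim] by (simp add: norm_mult mult_ac)
    qed
  qed
  then show "(\<lambda>n. \<Sum>j\<in>FF n. l2_inner M h (ca j) * l2_inner M (cb j) f) \<longlonglongrightarrow> l2_inner M h (KR f)"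
    unfolding eq by (simp add: l2_inner_def)
qed

theorem K_graph: "K \<omega> V \<theta> z = N.graph"
  unfolding K_eq
proof (intro equalityI subrelI)
  fix f g assume "(f, g) \<in> {(f, g). f \<in> L2 M \<and> g \<in> L2 M \<and> (AE x in M. g x = KR f x)}"
  then have fg: "f \<in> L2 M" "g \<in> L2 M" "AE x in M. g x = KR f x" by auto
  have "l2_inner M h g = l2_inner M h (N.ap f)" if h: "h \<in> L2 M" for h
    unfolding N_ap_eq[OF fg(1) h] by (rule l2_inner_cong_AE) (use fg h KR_L2 in auto)
  then show "(f, g) \<in> N.graph" using N.inner_ap[OF fg(1)] fg by (simp add: N.graph_def)
next
  fix f g assume fg: "(f, g) \<in> N.graph"
  then have L: "f \<in> L2 M" "g \<in> L2 M" by (auto simp: N.graph_def)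
  have "AE x in M. N.ap f x = KR f x"
    by (rule l2_AE_eqI[OF N.ap_L2[OF L(1)] KR_L2[OF L(1)]]) (rule N_ap_eq[OF L(1)])
  with N.graph_AE[OF fg] have "AE x in M. g x = KR f x" by eventually_elim simp
  then show "(f, g) \<in> {(f, g). f \<in> L2 M \<and> g \<in> L2 M \<and> (AE x in M. g x = KR f x)}" using L by simp
qed

section \<open>Grid matrices\<close>

definition gmat :: "nat \<Rightarrow> nat \<Rightarrow> nat \<Rightarrow> complex" where
  "gmat n i k = - (LINT t|M. green (gp n i) t * (indicator (cell n k) t * V t))"

text \<open>The partial sum over \<open>FF n\<close> is also the grid operator with kernel \<open>green\<close> frozen at the left endpoints
  of the cells, so both finite expansions have the same Fredholm determinant.\<close>

lemma partial_det:
  "(\<Sum>U\<in>Pow (FF n). (-1) ^ card U * perm_sum N.kmat U) = (\<Sum>U\<in>Pow {..<4 ^ n}. (-1) ^ card U * perm_sum (gmat n) U)"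
proof -
  \<comment> \<open>Cutting the expansion off at level \<open>n\<close> by zeroing \<open>ca\<close>
    leaves the minors inside \<open>FF n\<close> untouched. \<open>a2\<close> and \<open>b2\<close>
    form the one-level expansion, indexed by cells.\<close>
  define a1 where "a1 j = (if j \<in> FF n then ca j else (\<lambda>_. 0))" for j
  define a2 where "a2 i = (if i < 4 ^ n then ca (n, i) else (\<lambda>_. 0))" for i
  define b2 where "b2 i = (if i < 4 ^ n then gv n i else (\<lambda>_. 0))" for i
  have "(\<lambda>j. l2_norm M (a1 j) * l2_norm M (cb j)) summable_on UNIV"
    by (rule has_sum_imp_summable[OF has_sum_finite_neutralI[where B = "FF n"]]) (use FF(1) in \<open>auto simp: a1_def\<close>)
  then have n1: "nuclear_operator M a1 cb"
    by (intro nuclear_operator.intro finite_interval_measure cb_L2) (auto simp: a1_def ca_L2 L2_zero)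
  have "(\<lambda>i. l2_norm M (a2 i) * l2_norm M (b2 i)) summable_on UNIV"
    by (rule has_sum_imp_summable[OF has_sum_finite_neutralI[where B = "{..<4 ^ n}"]]) (auto simp: a2_def)
  then have n2: "nuclear_operator M a2 b2"
    by (intro nuclear_operator.intro finite_interval_measure) (auto simp: a2_def b2_def ca_L2 L2_zero intro: gv_L2)
  have g: "nuclear_operator.graph M a1 cb = nuclear_operator.graph M a2 b2"
  proof (rule nuclear_operator_graph_cong[OF n1 FF(1)[of n] _ n2, of "{..<4 ^ n}"])
    fix f assume f: "f \<in> L2 M"
    show "AE x in M. (\<Sum>j\<in>FF n. l2_inner M (cb j) f * a1 j x) = (\<Sum>j<4 ^ n. l2_inner M (b2 j) f * a2 j x)"
      using AE_interval_in
    proof eventually_elim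
      case (elim x)
      have "(\<Sum>j\<in>FF n. l2_inner M (cb j) f * a1 j x) = (\<Sum>j\<in>FF n. l2_inner M (cb j) f * ca j x)"
        by (rule sum.cong) (auto simp: a1_def)
      also have "\<dots> = - (u x * l2_inner M (gv n (idx n x)) f)" by (simp add: sum_FF[OF f elim] inner_gv)
      also have "\<dots> = (\<Sum>i<4 ^ n. l2_inner M (gv n i) f * ca (n, i) x)" by (rule sum_level[OF f elim, symmetric])
      also have "\<dots> = (\<Sum>j<4 ^ n. l2_inner M (b2 j) f * a2 j x)" by (rule sum.cong) (auto simp: a2_def b2_def)
      finally show ?case .
    qed
  qed (auto simp: a1_def a2_def)
  have "(\<Sum>U\<in>Pow (FF n). (-1) ^ card U * perm_sum N.kmat U) = (\<Sum>U\<in>Pow (FF n). (-1) ^ card U * perm_sum (nuclear_operator.kmat M a1 cb) U)"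
  proof (rule sum.cong)
    fix U assume "U \<in> Pow (FF n)"
    then have "perm_sum N.kmat U = perm_sum (nuclear_operator.kmat M a1 cb) U"
      by (intro perm_sum_cong) (auto simp: N.kmat_def nuclear_operator.kmat_def[OF n1] a1_def)
    then show "(-1) ^ card U * perm_sum N.kmat U = (-1) ^ card U * perm_sum (nuclear_operator.kmat M a1 cb) U" by simp
  qed simp
  also have "\<dots> = fredholm_det_id_minus M (nuclear_operator.graph M a1 cb)"
    by (rule nuclear_operator.fredholm_det_finite[OF n1 FF(1), symmetric]) (auto simp: a1_def)
  also have "\<dots> = (\<Sum>U\<in>Pow {..<4 ^ n}. (-1) ^ card U * perm_sum (nuclear_operator.kmat M a2 b2) U)"
    unfolding g by (rule nuclear_operator.fredholm_det_finite[OF n2]) (auto simp: a2_def)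
  also have "\<dots> = (\<Sum>U\<in>Pow {..<4 ^ n}. (-1) ^ card U * perm_sum (gmat n) U)"
  proof (rule sum.cong)
    fix U :: "nat set" assume U: "U \<in> Pow {..<4 ^ n}"
    have "perm_sum (nuclear_operator.kmat M a2 b2) U = perm_sum (gmat n) U"
    proof (rule perm_sum_cong)
      fix i k assume "i \<in> U" "k \<in> U"
      then have ik: "i < 4 ^ n" "k < 4 ^ n" using U by auto
      have "nuclear_operator.kmat M a2 b2 i k = (LINT t|M. - (green (gp n i) t * (indicator (cell n k) t * V t)))"
        unfolding nuclear_operator.kmat_def[OF n2] l2_inner_def
      proof (rule Bochner_Integration.integral_cong)
        fix t
        have "v t * u t = V t" using factor_uv[of V t] by (simp add: mult.commute)
        then show "cnj (b2 i t) * a2 k t = - (green (gp n i) t * (indicator (cell n k) t * V t))"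
          using ik by (simp add: a2_def b2_def gv_def ca_def mult.assoc)
      qed simp
      then show "nuclear_operator.kmat M a2 b2 i k = gmat n i k" by (simp add: gmat_def)
    qed
    then show "(-1) ^ card U * perm_sum (nuclear_operator.kmat M a2 b2) U = (-1) ^ card U * perm_sum (gmat n) U" by simp
  qed simp
  finally show ?thesis .
qed

theorem fredholm_det_limit:
  "(\<lambda>n. \<Sum>U\<in>Pow {..<4 ^ n}. (-1) ^ card U * perm_sum (gmat n) U) \<longlonglongrightarrow> fredholm_det_id_minus M (K \<omega> V \<theta> z)"
  using N.fredholm_det_exhaustion[OF FF(1,2) FF(3)] unfolding partial_det K_graph .

theorem trace_class_K: "trace_class M (K \<omega> V \<theta> z)"
  unfolding K_graph by (rule N.trace_class_graph)

end

section \<open>Finite determinants\<close>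

text \<open>Expanding each product over the subset \<open>U\<close> of places where the entry of -F
  is taken, the remaining factors are identity entries; they vanish unless the permutation fixes
  everything outside \<open>U\<close>.\<close>

lemma sum_perm_sum_eq_det:
  "(\<Sum>U\<in>Pow {..<N}. (-1) ^ card U * perm_sum F U)
    = Determinant.det (Matrix.mat N N (\<lambda>(i, k). (if i = k then 1 else 0) - F i k))"
proof -
  let ?S = "{..<N}"
  define d :: "nat \<Rightarrow> nat \<Rightarrow> complex" where "d i k = (if i = k then 1 else 0)" for i k
  have "Determinant.det (Matrix.mat N N (\<lambda>(i, k). (if i = k then 1 else 0) - F i k))
      = (\<Sum>p | p permutes ?S. of_int (sign p) * (\<Prod>i\<in>?S. d i (p i) - F i (p i)))"
    unfolding Determinant.det_def atLeast0LessThan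
    by (auto intro!: sum.cong prod.cong simp: d_def permutes_in_image[of _ ?S, simplified])
  also have "\<dots> = (\<Sum>p | p permutes ?S. \<Sum>U\<in>Pow ?S. of_int (sign p) * ((\<Prod>i\<in>U. - F i (p i)) * (\<Prod>i\<in>?S - U. d i (p i))))"
  proof (rule sum.cong)
    fix p
    have "(\<Prod>i\<in>?S. d i (p i) - F i (p i)) = (\<Prod>i\<in>?S. - F i (p i) + d i (p i))" by simp
    also have "\<dots> = (\<Sum>U\<in>Pow ?S. (\<Prod>i\<in>U. - F i (p i)) * (\<Prod>i\<in>?S - U. d i (p i)))" by (rule prod_add) simp
    finally show "of_int (sign p) * (\<Prod>i\<in>?S. d i (p i) - F i (p i))
        = (\<Sum>U\<in>Pow ?S. of_int (sign p) * ((\<Prod>i\<in>U. - F i (p i)) * (\<Prod>i\<in>?S - U. d i (p i))))"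
      by (simp only: sum_distrib_left)
  qed simp
  also have "\<dots> = (\<Sum>U\<in>Pow ?S. \<Sum>p | p permutes ?S. of_int (sign p) * ((\<Prod>i\<in>U. - F i (p i)) * (\<Prod>i\<in>?S - U. d i (p i))))"
    by (rule sum.swap)
  also have "\<dots> = (\<Sum>U\<in>Pow ?S. (-1) ^ card U * perm_sum F U)"
  proof (rule sum.cong)
    fix U assume "U \<in> Pow ?S"
    then have U: "U \<subseteq> ?S" by simp
    have "(\<Sum>p | p permutes ?S. of_int (sign p) * ((\<Prod>i\<in>U. - F i (p i)) * (\<Prod>i\<in>?S - U. d i (p i))))
        = (\<Sum>p | p permutes U. of_int (sign p) * ((\<Prod>i\<in>U. - F i (p i)) * (\<Prod>i\<in>?S - U. d i (p i))))"
    proof (rule sum.mono_neutral_right)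
      show "finite {p. p permutes ?S}" by (simp add: finite_permutations)
      show "{p. p permutes U} \<subseteq> {p. p permutes ?S}" using permutes_subset[OF _ U] by blast
      show "\<forall>p\<in>{p. p permutes ?S} - {p. p permutes U}.
          of_int (sign p) * ((\<Prod>i\<in>U. - F i (p i)) * (\<Prod>i\<in>?S - U. d i (p i))) = 0"
      proof
        fix p assume "p \<in> {p. p permutes ?S} - {p. p permutes U}"
        then obtain i where i: "i \<in> ?S - U" "p i \<noteq> i" using permutes_superset[of p ?S U] by blast
        then have "(\<Prod>i\<in>?S - U. d i (p i)) = 0" by (intro prod_zero) (auto simp: d_def intro!: bexI[of _ i])
        then show "of_int (sign p) * ((\<Prod>i\<in>U. - F i (p i)) * (\<Prod>i\<in>?S - U. d i (p i))) = 0" by simp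
      qed
    qed
    also have "\<dots> = (\<Sum>p | p permutes U. (-1) ^ card U * (of_int (sign p) * (\<Prod>i\<in>U. F i (p i))))"
    proof (rule sum.cong)
      fix p assume "p \<in> {p. p permutes U}"
      then have "(\<Prod>i\<in>?S - U. d i (p i)) = 1" by (intro prod.neutral) (auto simp: d_def permutes_not_in)
      then show "of_int (sign p) * ((\<Prod>i\<in>U. - F i (p i)) * (\<Prod>i\<in>?S - U. d i (p i)))
          = (-1) ^ card U * (of_int (sign p) * (\<Prod>i\<in>U. F i (p i)))"
        by (simp add: prod_uminus)
    qed simp
    finally show "(\<Sum>p | p permutes ?S. of_int (sign p) * ((\<Prod>i\<in>U. - F i (p i)) * (\<Prod>i\<in>?S - U. d i (p i))))
        = (-1) ^ card U * perm_sum F U"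
      by (simp add: perm_sum_def sum_distrib_left)
  qed simp
  finally show ?thesis by simp
qed

lemma det_2x2:
  "Determinant.det (Matrix.mat 2 2 f) = f (0, 0) * f (1, 1) - f (0, 1) * (f (1, 0) :: 'a :: comm_ring_1)"
proof -
  have S: "{0..<2 :: nat} = {0, Suc 0}" by auto
  have P: "{p. p permutes {0, Suc 0}} = {id, Transposition.transpose 0 (Suc 0)}"
  proof -
    have "{(b, p). b \<in> {0, Suc 0} \<and> p permutes {Suc 0}} = {(0, id), (Suc 0, id)}" by (auto simp: permutes_sing)
    then show ?thesis by (simp add: permutes_insert)
  qed
  have "id \<noteq> Transposition.transpose 0 (Suc 0)" by (metis id_apply transpose_apply_first zero_neq_one One_nat_def)
  then show ?thesis
    unfolding Determinant.det_def by (simp add: S P sign_swap_id sign_id)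
qed

text \<open>Both sides are the determinant of the block matrix with blocks \<open>I - L\<close>, \<open>-P\<close>, \<open>B\<close>, \<open>I\<^sub>2\<close>, where
  \<open>L\<close> is the strictly lower triangular part of \<open>PQ\<close>; the rows \<open>(u i, v i)\<close> solve \<open>(I - L) Y = P\<close>.\<close>

lemma det_rank_two_minus_triangular:
  fixes p1 p2 q1 q2 b1 b2 u v :: "nat \<Rightarrow> 'a :: idom"
  assumes u: "\<And>i. i < N \<Longrightarrow> u i = p1 i + (\<Sum>k<i. (p1 i * q1 k + p2 i * q2 k) * u k)"
    and v: "\<And>i. i < N \<Longrightarrow> v i = p2 i + (\<Sum>k<i. (p1 i * q1 k + p2 i * q2 k) * v k)"
  shows "Determinant.det (Matrix.mat N N (\<lambda>(i, k). (if i = k then 1 else 0) + (p1 i * b1 k + p2 i * b2 k)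
      - (if k < i then p1 i * q1 k + p2 i * q2 k else 0)))
    = (1 + (\<Sum>k<N. b1 k * u k)) * (1 + (\<Sum>k<N. b2 k * v k)) - (\<Sum>k<N. b1 k * v k) * (\<Sum>k<N. b2 k * u k)"
proof -
  define L where "L i k = (if k < i then p1 i * q1 k + p2 i * q2 k else 0)" for i k
  define IL where "IL = Matrix.mat N N (\<lambda>(i, k). (if i = k then 1 else 0) - L i k)"
  define P where "P = Matrix.mat N 2 (\<lambda>(i, r). if r = 0 then p1 i else p2 i)"
  define Y where "Y = Matrix.mat N 2 (\<lambda>(i, r). if r = 0 then u i else v i)"
  define B where "B = Matrix.mat 2 N (\<lambda>(r, k). if r = 0 then b1 k else b2 k)"
  have c: "IL \<in> carrier_mat N N" "P \<in> carrier_mat N 2" "Y \<in> carrier_mat N 2" "B \<in> carrier_mat 2 N"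
    by (simp_all add: IL_def P_def Y_def B_def)
  define X where "X = four_block_mat IL (- P) B (1\<^sub>m 2)"
  have cX: "X \<in> carrier_mat (N + 2) (N + 2)" unfolding X_def using c by auto
  \<comment> \<open>This is the recursion for \<open>u\<close> and \<open>v\<close> in matrix form;
    I - L is unipotent, so \<open>Y\<close> may be viewed as its inverse applied to P.\<close>
  have solve: "IL * Y = P"
  proof (rule eq_matI)
    fix i r assume ir: "i < dim_row P" "r < dim_col P"
    define y where "y k = (if r = 0 then u k else v k)" for k
    have i: "i < N" and r: "r < 2" using ir by (auto simp: P_def)
    have "(IL * Y) $$ (i, r) = (\<Sum>k\<in>{0..<N}. ((if i = k then 1 else 0) - L i k) * y k)"
      using i r by (auto simp: IL_def Y_def y_def scalar_prod_def intro!: sum.cong)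
    also have "\<dots> = (\<Sum>k\<in>{0..<N}. (if i = k then y k else 0) - (if k < i then (p1 i * q1 k + p2 i * q2 k) * y k else 0))"
      by (rule sum.cong) (auto simp: L_def left_diff_distrib)
    also have "\<dots> = y i - (\<Sum>k\<in>{0..<N}. if k < i then (p1 i * q1 k + p2 i * q2 k) * y k else 0)"
      using i by (simp add: sum_subtractf)
    also have "(\<Sum>k\<in>{0..<N}. if k < i then (p1 i * q1 k + p2 i * q2 k) * y k else 0) = (\<Sum>k<i. (p1 i * q1 k + p2 i * q2 k) * y k)"
      using i by (intro sum.mono_neutral_cong_right) auto
    also have "y i - \<dots> = (if r = 0 then p1 i else p2 i)"
      using u[OF i] v[OF i] by (auto simp: y_def)
    finally show "(IL * Y) $$ (i, r) = P $$ (i, r)" using i r by (simp add: P_def)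
  qed (use c in auto)
  have detIL: "Determinant.det IL = 1"
  proof -
    have "Determinant.det IL = prod_list (diag_mat IL)"
      by (rule det_lower_triangular[OF _ c(1)]) (auto simp: IL_def L_def)
    also have "\<dots> = 1"
      unfolding prod_list_diag_prod by (rule prod.neutral) (auto simp: IL_def L_def)
    finally show ?thesis .
  qed
  \<comment> \<open>Clearing the lower left block by a unipotent column operation leaves the large
    determinant.\<close>
  have "X * four_block_mat (1\<^sub>m N) (0\<^sub>m N 2) (- B) (1\<^sub>m 2)
      = four_block_mat (IL * 1\<^sub>m N + (- P) * (- B)) (IL * 0\<^sub>m N 2 + (- P) * 1\<^sub>m 2) (B * 1\<^sub>m N + 1\<^sub>m 2 * (- B)) (B * 0\<^sub>m N 2 + 1\<^sub>m 2 * 1\<^sub>m 2)"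
    unfolding X_def by (rule mult_four_block_mat) (use c in auto)
  also have "\<dots> = four_block_mat (IL + P * B) (- P) (0\<^sub>m 2 N) (1\<^sub>m 2)"
  proof (intro cong_four_block_mat)
    have "B * 1\<^sub>m N = B" "1\<^sub>m 2 * (- B) = - B" using c by auto
    then show "B * 1\<^sub>m N + 1\<^sub>m 2 * (- B) = 0\<^sub>m 2 N" using c by (intro eq_matI) auto
    have "(- P) * (- B) = P * B" using c by simp
    then show "IL * 1\<^sub>m N + (- P) * (- B) = IL + P * B" using c by auto
  qed (use c in auto)
  also have "Determinant.det \<dots> = Determinant.det (IL + P * B)"
    using c by (subst det_four_block_mat_lower_left_zero[where n = N and m = 2]) auto
  finally have 1: "Determinant.det (X * four_block_mat (1\<^sub>m N) (0\<^sub>m N 2) (- B) (1\<^sub>m 2)) = Determinant.det (IL + P * B)"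
    by simp
  have "Determinant.det (X * four_block_mat (1\<^sub>m N) (0\<^sub>m N 2) (- B) (1\<^sub>m 2)) = Determinant.det X"
    using c cX by (subst det_mult[where n = "N + 2"]) (auto simp: det_four_block_mat_upper_right_zero[where n = N and m = 2])
  with 1 have a: "Determinant.det X = Determinant.det (IL + P * B)" by simp
  \<comment> \<open>Clearing the upper right block instead leaves the two by two determinant, since
    I - L has determinant 1.\<close>
  have "X * four_block_mat (1\<^sub>m N) Y (0\<^sub>m 2 N) (1\<^sub>m 2)
      = four_block_mat (IL * 1\<^sub>m N + (- P) * 0\<^sub>m 2 N) (IL * Y + (- P) * 1\<^sub>m 2) (B * 1\<^sub>m N + 1\<^sub>m 2 * 0\<^sub>m 2 N) (B * Y + 1\<^sub>m 2 * 1\<^sub>m 2)"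
    unfolding X_def by (rule mult_four_block_mat) (use c in auto)
  also have "\<dots> = four_block_mat IL (0\<^sub>m N 2) B (B * Y + 1\<^sub>m 2)"
    using c by (intro cong_four_block_mat) (auto simp: solve)
  also have "Determinant.det \<dots> = Determinant.det (B * Y + 1\<^sub>m 2)"
    using c detIL by (subst det_four_block_mat_upper_right_zero[where n = N and m = 2]) auto
  finally have 2: "Determinant.det (X * four_block_mat (1\<^sub>m N) Y (0\<^sub>m 2 N) (1\<^sub>m 2)) = Determinant.det (B * Y + 1\<^sub>m 2)"
    by simp
  have "Determinant.det (X * four_block_mat (1\<^sub>m N) Y (0\<^sub>m 2 N) (1\<^sub>m 2)) = Determinant.det X"
    using c cX by (subst det_mult[where n = "N + 2"]) (auto simp: det_four_block_mat_lower_left_zero[where n = N and m = 2])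
  with a 2 have b: "Determinant.det (IL + P * B) = Determinant.det (B * Y + 1\<^sub>m 2)" by simp
  have "IL + P * B = Matrix.mat N N (\<lambda>(i, k). (if i = k then 1 else 0) + (p1 i * b1 k + p2 i * b2 k)
      - (if k < i then p1 i * q1 k + p2 i * q2 k else 0))"
    by (rule eq_matI) (auto simp: IL_def P_def B_def L_def scalar_prod_def numeral_2_eq_2)
  moreover have "B * Y + 1\<^sub>m 2 = Matrix.mat 2 2 (\<lambda>(r, r'). (\<Sum>k<N. (if r = 0 then b1 k else b2 k) * (if r' = 0 then u k else v k))
      + (if r = r' then 1 else 0))"
    by (rule eq_matI) (auto simp: B_def Y_def scalar_prod_def atLeast0LessThan intro!: sum.cong)
  ultimately show ?thesis using b by (simp add: det_2x2 add.commute)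
qed

section \<open>Reduction of the grid determinant to two by two size\<close>

context floquet_problem
begin

text \<open>\<open>q1\<close> and \<open>q2\<close> are the integrals over a cell of the coefficient
  functions in A1' = -s V \<psi> and A2' = c V \<psi>.\<close>

definition q1 :: "nat \<Rightarrow> nat \<Rightarrow> complex" where
  "q1 n k = - (LINT t|M. indicator (cell n k) t * (s t * V t))"
definition q2 :: "nat \<Rightarrow> nat \<Rightarrow> complex" where
  "q2 n k = (LINT t|M. indicator (cell n k) t * (c t * V t))"

lemma integrable_continuous_mult_V:
  "continuous_on {0..\<omega>} h \<Longrightarrow> integrable M (\<lambda>t. h t * V t)"
  using V absolutely_integrable_continuous_mult unfolding integrable_interval_iff by blast

lemma integrable_cell:
  fixes h :: "real \<Rightarrow> 'b :: {banach, real_normed_field, second_countable_topology}"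
  assumes h: "integrable M h"
  shows "integrable M (\<lambda>t. indicator (cell n k) t * h t)"
proof (rule Bochner_Integration.integrable_bound[OF h])
  have "(\<lambda>t. (if gp n k \<le> t \<and> t < gp n (Suc k) then h t else 0)) \<in> borel_measurable M"
    using id_measurable borel_measurable_integrable[OF h] by measurable
  also have "(\<lambda>t. (if gp n k \<le> t \<and> t < gp n (Suc k) then h t else 0)) = (\<lambda>t. indicator (cell n k) t * h t)"
    by (auto simp: cell_def indicator_def fun_eq_iff)
  finally show "(\<lambda>t. indicator (cell n k) t * h t) \<in> borel_measurable M" .
  show "AE t in M. norm (indicator (cell n k) t * h t) \<le> norm (h t)"
    by (intro AE_I2) (simp add: indicator_def)
qed

text \<open>On cell \<open>k\<close> the condition t < gp n i is the same as k < i, so the Volterra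
  part of the kernel becomes strictly lower triangular; both parts have rank two after separating
  variables.\<close>

lemma gmat_eq:
  "- gmat n i k = (c (gp n i) * (\<Gamma>1 * q1 n k - \<Gamma>2 * q2 n k) + s (gp n i) * (z * \<Gamma>2 * q1 n k + \<Gamma>1 * q2 n k))
     - (if k < i then c (gp n i) * q1 n k + s (gp n i) * q2 n k else 0)"
proof -
  let ?x = "gp n i"
  define \<alpha> where "\<alpha> = - (c ?x * \<Gamma>1) - s ?x * (z * \<Gamma>2) + (if k < i then c ?x else 0)"
  define \<beta> where "\<beta> = - (c ?x * \<Gamma>2) + s ?x * \<Gamma>1 - (if k < i then s ?x else 0)"
  have "- gmat n i k = (LINT t|M. \<alpha> * (indicator (cell n k) t * (s t * V t)) + \<beta> * (indicator (cell n k) t * (c t * V t)))"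
    unfolding gmat_def minus_minus
  proof (rule Bochner_Integration.integral_cong)
    fix t
    show "green ?x t * (indicator (cell n k) t * V t)
        = \<alpha> * (indicator (cell n k) t * (s t * V t)) + \<beta> * (indicator (cell n k) t * (c t * V t))"
    proof (cases "t \<in> cell n k")
      case True
      have "t < ?x \<longleftrightarrow> k < i"
      proof
        assume "t < ?x"
        with True have "gp n k < gp n i" by (simp add: cell_def)
        then show "k < i" using \<omega> by (simp add: gp_def divide_less_cancel)
      next
        assume "k < i"
        then have "gp n (Suc k) \<le> gp n i" using \<omega> by (simp add: gp_def divide_right_mono)
        with True show "t < ?x" by (simp add: cell_def)
      qed
      then show ?thesis
        by (simp add: green_def green_a_def green_b_def \<alpha>_def \<beta>_def free_sin_diff algebra_simps)
    qed simp
  qed simp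
  also have "\<dots> = \<alpha> * - q1 n k + \<beta> * q2 n k"
    unfolding q1_def q2_def
    by (subst Bochner_Integration.integral_add) (auto intro!: integrable_cell integrable_continuous_mult_V continuous_intros)
  finally show ?thesis by (cases "k < i") (simp_all add: \<alpha>_def \<beta>_def algebra_simps)
qed

text \<open>\<open>x\<close> and \<open>y\<close> approximate the coefficients of a solution in the
  free system; \<open>t\<close> is the approximate solution at the left endpoint, used throughout
  the cell.\<close>

fun step :: "nat \<Rightarrow> complex \<times> complex \<Rightarrow> nat \<Rightarrow> complex \<times> complex" where
  "step n w 0 = w"
| "step n w (Suc j) = (let (x, y) = step n w j; t = c (gp n j) * x + s (gp n j) * y
     in (x + q1 n j * t, y + q2 n j * t))"

definition step_out :: "nat \<Rightarrow> complex \<times> complex \<Rightarrow> nat \<Rightarrow> complex" where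
  "step_out n w j = c (gp n j) * fst (step n w j) + s (gp n j) * snd (step n w j)"

lemma step_sum:
  "fst (step n w j) = fst w + (\<Sum>k<j. q1 n k * step_out n w k)"
  "snd (step n w j) = snd w + (\<Sum>k<j. q2 n k * step_out n w k)"
  by (induction j) (simp_all add: step_out_def Let_def split_beta)

text \<open>The outputs from the initial vectors (1, 0) and (0, 1) satisfy exactly the recursions
  required of \<open>u\<close> and \<open>v\<close> in
  \<open>det_rank_two_minus_triangular\<close>.\<close>

lemma step_out_sum:
  "step_out n w i = (c (gp n i) * fst w + s (gp n i) * snd w)
     + (\<Sum>k<i. (c (gp n i) * q1 n k + s (gp n i) * q2 n k) * step_out n w k)"
  unfolding step_out_def[of n w i] step_sum[of n w i]
  by (simp add: algebra_simps sum.distrib sum_distrib_left)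

text \<open>The sums of \<open>q1\<close> and \<open>q2\<close> against the outputs are the total
  increments of the scheme, so the two by two matrix is I + \<Gamma> (X - I), with \<open>X\<close>
  the final state matrix and \<Gamma> the matrix of \<Gamma>1 and \<Gamma>2.\<close>

lemma grid_det:
  fixes n
  defines "X1 \<equiv> fst (step n (1, 0) (4 ^ n))" and "Y1 \<equiv> snd (step n (1, 0) (4 ^ n))"
    and "X2 \<equiv> fst (step n (0, 1) (4 ^ n))" and "Y2 \<equiv> snd (step n (0, 1) (4 ^ n))"
  shows "(\<Sum>U\<in>Pow {..<4 ^ n}. (-1) ^ card U * perm_sum (gmat n) U)
    = (1 + (\<Gamma>1 * (X1 - 1) - \<Gamma>2 * Y1)) * (1 + (z * \<Gamma>2 * X2 + \<Gamma>1 * (Y2 - 1)))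
      - (\<Gamma>1 * X2 - \<Gamma>2 * (Y2 - 1)) * (z * \<Gamma>2 * (X1 - 1) + \<Gamma>1 * Y1)"
proof -
  let ?N = "4 ^ n :: nat"
  have e: "(if i = k then 1 else 0) - gmat n i k = (if i = k then 1 else 0)
      + (c (gp n i) * (\<Gamma>1 * q1 n k - \<Gamma>2 * q2 n k) + s (gp n i) * (z * \<Gamma>2 * q1 n k + \<Gamma>1 * q2 n k))
      - (if k < i then c (gp n i) * q1 n k + s (gp n i) * q2 n k else 0)" for i k
    using gmat_eq[of n i k] by (simp add: algebra_simps)
  have X: "(\<Sum>k<?N. q1 n k * step_out n (1, 0) k) = X1 - 1" "(\<Sum>k<?N. q2 n k * step_out n (1, 0) k) = Y1"
    "(\<Sum>k<?N. q1 n k * step_out n (0, 1) k) = X2" "(\<Sum>k<?N. q2 n k * step_out n (0, 1) k) = Y2 - 1"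
    unfolding X1_def Y1_def X2_def Y2_def by (simp_all add: step_sum)
  have S: "(\<Sum>k<?N. (\<Gamma>1 * q1 n k - \<Gamma>2 * q2 n k) * step_out n w k)
      = \<Gamma>1 * (\<Sum>k<?N. q1 n k * step_out n w k) - \<Gamma>2 * (\<Sum>k<?N. q2 n k * step_out n w k)"
    "(\<Sum>k<?N. (z * \<Gamma>2 * q1 n k + \<Gamma>1 * q2 n k) * step_out n w k)
      = z * \<Gamma>2 * (\<Sum>k<?N. q1 n k * step_out n w k) + \<Gamma>1 * (\<Sum>k<?N. q2 n k * step_out n w k)" for w
    by (simp_all add: left_diff_distrib distrib_right sum_subtractf sum.distrib sum_distrib_left mult.assoc)
  have "(\<Sum>U\<in>Pow {..<?N}. (-1) ^ card U * perm_sum (gmat n) U)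
      = (1 + (\<Sum>k<?N. (\<Gamma>1 * q1 n k - \<Gamma>2 * q2 n k) * step_out n (1, 0) k))
        * (1 + (\<Sum>k<?N. (z * \<Gamma>2 * q1 n k + \<Gamma>1 * q2 n k) * step_out n (0, 1) k))
      - (\<Sum>k<?N. (\<Gamma>1 * q1 n k - \<Gamma>2 * q2 n k) * step_out n (0, 1) k)
        * (\<Sum>k<?N. (z * \<Gamma>2 * q1 n k + \<Gamma>1 * q2 n k) * step_out n (1, 0) k)"
    unfolding sum_perm_sum_eq_det e
  proof (rule det_rank_two_minus_triangular)
    fix i
    show "step_out n (1, 0) i = c (gp n i) + (\<Sum>k<i. (c (gp n i) * q1 n k + s (gp n i) * q2 n k) * step_out n (1, 0) k)"
      using step_out_sum[of n "(1, 0)" i] by (simp only: fst_conv snd_conv mult_1_right mult_zero_right add_0_right)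
    show "step_out n (0, 1) i = s (gp n i) + (\<Sum>k<i. (c (gp n i) * q1 n k + s (gp n i) * q2 n k) * step_out n (0, 1) k)"
      using step_out_sum[of n "(0, 1)" i] by (simp only: fst_conv snd_conv mult_1_right mult_zero_right add_0)
  qed
  then show ?thesis by (simp only: S X)
qed

text \<open>With M0 the free monodromy matrix, \<Gamma> inverse is I - mult M0^-1, so the matrix is
  \<Gamma> (X - mult M0^-1). As \<Gamma> has determinant 1/D and both \<open>X\<close> and M0 have
  determinant 1, the value is 1 + mult^2 - mult tr(M0 X).\<close>

lemma grid_det_limit_value:
  assumes W: "X1 * Y2 - X2 * Y1 = 1"
  shows "D * ((1 + (\<Gamma>1 * (X1 - 1) - \<Gamma>2 * Y1)) * (1 + (z * \<Gamma>2 * X2 + \<Gamma>1 * (Y2 - 1)))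
      - (\<Gamma>1 * X2 - \<Gamma>2 * (Y2 - 1)) * (z * \<Gamma>2 * (X1 - 1) + \<Gamma>1 * Y1))
    = 1 + mult\<^sup>2 - mult * (c \<omega> * X1 + s \<omega> * Y1 - z * s \<omega> * X2 + c \<omega> * Y2)"
proof -
  have g1: "D * \<Gamma>1 = 1 - mult * c \<omega>" and g2: "D * \<Gamma>2 = mult * s \<omega>"
    using D_nz unfolding \<Gamma>1_def \<Gamma>2_def by (simp_all add: D_def field_simps power2_eq_square)
  have "(D * \<Gamma>1) * (D * \<Gamma>1) + z * ((D * \<Gamma>2) * (D * \<Gamma>2)) = 1 - 2 * mult * c \<omega> + mult\<^sup>2 * (c \<omega> * c \<omega> + z * s \<omega> * s \<omega>)"
    unfolding g1 g2 by (simp add: algebra_simps power2_eq_square)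
  also have "\<dots> = D" by (simp add: free_wronskian D_def)
  finally have "D * (D * (\<Gamma>1 * \<Gamma>1 + z * (\<Gamma>2 * \<Gamma>2))) = D * 1" by (simp add: algebra_simps)
  then have g3: "D * (\<Gamma>1 * \<Gamma>1 + z * (\<Gamma>2 * \<Gamma>2)) = 1" using D_nz by (simp only: mult_cancel_left) simp
  have "D * ((1 + (\<Gamma>1 * (X1 - 1) - \<Gamma>2 * Y1)) * (1 + (z * \<Gamma>2 * X2 + \<Gamma>1 * (Y2 - 1)))
      - (\<Gamma>1 * X2 - \<Gamma>2 * (Y2 - 1)) * (z * \<Gamma>2 * (X1 - 1) + \<Gamma>1 * Y1))
    = D + (D * \<Gamma>1) * (X1 + Y2 - 2) + (D * \<Gamma>2) * (z * X2 - Y1)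
      + (D * (\<Gamma>1 * \<Gamma>1 + z * (\<Gamma>2 * \<Gamma>2))) * ((X1 * Y2 - X2 * Y1) - X1 - Y2 + 1)"
    by (simp add: algebra_simps)
  also have "\<dots> = 1 + mult\<^sup>2 - mult * (c \<omega> * X1 + s \<omega> * Y1 - z * s \<omega> * X2 + c \<omega> * Y2)"
    unfolding g1 g2 g3 W by (simp add: D_def algebra_simps)
  finally show ?thesis .
qed

end

section \<open>Convergence of the Euler scheme and the limit of the determinants\<close>

context floquet_problem
begin

lemma integral_cell:
  fixes h :: "real \<Rightarrow> complex"
  assumes h: "integrable M h" and k: "k < 4 ^ n"
  shows "integral {0..gp n (Suc k)} h = integral {0..gp n k} h + (LINT t|M. indicator (cell n k) t * h t)"
proof -
  let ?I = "{gp n k..gp n (Suc k)}"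
  have x: "0 \<le> gp n k" "gp n k \<le> gp n (Suc k)" "gp n (Suc k) \<le> \<omega>"
    using gp_in[of k n] gp_in[of "Suc k" n] k \<omega> by (auto simp: gp_def divide_right_mono)
  have i: "h integrable_on {0..\<omega>}"
    using h unfolding integrable_interval_iff by (rule set_lebesgue_integral_eq_integral(1))
  have "(LINT t|M. indicator (cell n k) t * h t) = integral {0..\<omega>} (\<lambda>t. indicator (cell n k) t * h t)"
    by (rule integral_interval_eq[OF integrable_cell[OF h]])
  also have "\<dots> = integral {0..\<omega>} (\<lambda>t. if t \<in> ?I then h t else 0)"
    by (rule integral_spike[of "{gp n (Suc k)}"]) (auto simp: cell_def)
  also have "\<dots> = integral (?I \<inter> {0..\<omega>}) h" by (rule integral_restrict_Int)
  also have "?I \<inter> {0..\<omega>} = ?I" using x by auto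
  finally show ?thesis using integral_diff_subinterval[OF i x] by (simp add: algebra_simps)
qed

lemma sum_cell_integral_le:
  "(\<Sum>k<4 ^ n. LINT t|M. indicator (cell n k) t * cmod (V t)) \<le> (LINT t|M. cmod (V t))"
proof -
  have iV: "integrable M (\<lambda>t. cmod (V t))" using V by simp
  have "(\<Sum>k<4 ^ n. LINT t|M. indicator (cell n k) t * cmod (V t)) = (LINT t|M. (\<Sum>k<4 ^ n. indicator (cell n k) t * cmod (V t)))"
    by (rule Bochner_Integration.integral_sum[symmetric]) (rule integrable_cell[OF iV])
  also have "\<dots> \<le> (LINT t|M. cmod (V t))"
  proof (rule integral_mono_AE[OF _ iV])
    show "integrable M (\<lambda>t. \<Sum>k<4 ^ n. indicator (cell n k) t * cmod (V t))"
      by (intro Bochner_Integration.integrable_sum integrable_cell[OF iV])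
    show "AE t in M. (\<Sum>k<4 ^ n. indicator (cell n k) t * cmod (V t)) \<le> cmod (V t)"
      using AE_interval_in
    proof eventually_elim
      case (elim t)
      have *: "(\<Sum>k<4 ^ n. indicator (cell n k) t * cmod (V t)) = (\<Sum>k<4 ^ n. if t \<in> cell n k then cmod (V t) else 0)"
        by (rule sum.cong) (auto simp: indicator_def)
      show ?case by (simp only: * sum_cells[OF elim, of n "\<lambda>_. cmod (V t)"] order.refl)
    qed
  qed
  finally show ?thesis .
qed

text \<open>The recursion is the explicit Euler scheme for the integrated form of the Schroedinger equation;
  a discrete Gronwall estimate gives convergence.\<close>

lemma step_tendsto:
  fixes \<psi> A1 A2 :: "real \<Rightarrow> complex"
  assumes \<psi>: "continuous_on {0..\<omega>} \<psi>"
    and A1: "\<And>x. A1 x = fst w - integral {0..x} (\<lambda>t. s t * (V t * \<psi> t))"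
    and A2: "\<And>x. A2 x = snd w + integral {0..x} (\<lambda>t. c t * (V t * \<psi> t))"
    and eq: "\<And>x. x \<in> {0..\<omega>} \<Longrightarrow> \<psi> x = c x * A1 x + s x * A2 x"
  shows "(\<lambda>n. fst (step n w (4 ^ n))) \<longlonglongrightarrow> A1 \<omega>" and "(\<lambda>n. snd (step n w (4 ^ n))) \<longlonglongrightarrow> A2 \<omega>"
proof -
  \<comment> \<open>The error of both coefficients together at grid point \<open>j\<close>.\<close>
  define d where "d n j = cmod (fst (step n w j) - A1 (gp n j)) + cmod (snd (step n w j) - A2 (gp n j))" for n j
  define vv where "vv n k = (LINT t|M. indicator (cell n k) t * cmod (V t))" for n k
  obtain Bc where Bc: "Bc > 0" "\<And>x. x \<in> {0..\<omega>} \<Longrightarrow> cmod (c x) \<le> Bc"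
    using continuous_Icc_bounded[OF continuous_on_free_cos] by blast
  obtain Bs where Bs: "Bs > 0" "\<And>x. x \<in> {0..\<omega>} \<Longrightarrow> cmod (s x) \<le> Bs"
    using continuous_Icc_bounded[OF continuous_on_free_sin] by blast
  define B where "B = Bc + Bs"
  have B: "B > 0" "\<And>x. x \<in> {0..\<omega>} \<Longrightarrow> cmod (c x) \<le> B" "\<And>x. x \<in> {0..\<omega>} \<Longrightarrow> cmod (s x) \<le> B"
    using Bc Bs by (auto simp: B_def add_increasing add_increasing2)
  have vv0: "0 \<le> vv n k" for n k unfolding vv_def by (rule integral_nonneg_AE) (auto simp: indicator_def)
  have iV: "integrable M (\<lambda>t. cmod (V t))" using V by simp
  \<comment> \<open>Local error on a cell: replacing \<psi> by a constant \<tau> costs at most its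
    oscillation times the integral of |V| over the cell, so no bound on \<open>V\<close>
    enters.\<close>
  have increment: "cmod ((LINT t|M. indicator (cell n j) t * (h t * (V t * \<psi> t))) - (LINT t|M. indicator (cell n j) t * (h t * V t)) * \<tau>)
      \<le> B * \<rho> * vv n j"
    if h: "continuous_on {0..\<omega>} h" "\<And>x. x \<in> {0..\<omega>} \<Longrightarrow> cmod (h x) \<le> B"
      and \<rho>: "\<And>t. t \<in> {0<..<\<omega>} \<Longrightarrow> t \<in> cell n j \<Longrightarrow> cmod (\<psi> t - \<tau>) \<le> \<rho>" "\<rho> \<ge> 0"
    for h n j \<tau> \<rho>
  proof -
    have i1: "integrable M (\<lambda>t. indicator (cell n j) t * (h t * (V t * \<psi> t)))"
      using integrable_cell[OF integrable_continuous_mult_V[OF continuous_on_mult[OF h(1) \<psi>]]] by (simp add: mult_ac)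
    have i2: "integrable M (\<lambda>t. indicator (cell n j) t * (h t * V t))"
      by (rule integrable_cell[OF integrable_continuous_mult_V[OF h(1)]])
    have "(LINT t|M. indicator (cell n j) t * (h t * (V t * \<psi> t))) - (LINT t|M. indicator (cell n j) t * (h t * V t)) * \<tau>
        = (LINT t|M. indicator (cell n j) t * (h t * (V t * \<psi> t)) - indicator (cell n j) t * (h t * V t) * \<tau>)"
      using i1 i2 by simp
    also have "cmod \<dots> \<le> (LINT t|M. B * \<rho> * (indicator (cell n j) t * cmod (V t)))"
    proof (rule Bochner_Integration.integral_norm_bound_integral[rotated 2])
      show "integrable M (\<lambda>t. indicator (cell n j) t * (h t * (V t * \<psi> t)) - indicator (cell n j) t * (h t * V t) * \<tau>)"
        using i1 i2 by simp
      show "integrable M (\<lambda>t. B * \<rho> * (indicator (cell n j) t * cmod (V t)))"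
        using integrable_cell[OF iV] by simp
      fix t assume "t \<in> space M"
      then have t: "t \<in> {0<..<\<omega>}" by simp
      show "cmod (indicator (cell n j) t * (h t * (V t * \<psi> t)) - indicator (cell n j) t * (h t * V t) * \<tau>)
          \<le> B * \<rho> * (indicator (cell n j) t * cmod (V t))"
      proof (cases "t \<in> cell n j")
        case True
        have "cmod (h t * (V t * \<psi> t) - h t * V t * \<tau>) = cmod (h t) * cmod (\<psi> t - \<tau>) * cmod (V t)"
          by (simp add: norm_mult[symmetric] algebra_simps)
        also have "\<dots> \<le> B * \<rho> * cmod (V t)"
          using h(2)[of t] \<rho>(1)[OF t True] t B(1) by (intro mult_right_mono mult_mono) auto
        finally show ?thesis using True by simp
      qed simp
    qed
    also have "\<dots> = B * \<rho> * vv n j" by (simp add: vv_def)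
    finally show ?thesis .
  qed
  have one_step: "d n (Suc j) \<le> d n j + 2 * B * (B * d n j + e) * vv n j"
    if j: "j < 4 ^ n" and e: "e > 0" and osc: "\<And>t. t \<in> {0<..<\<omega>} \<Longrightarrow> t \<in> cell n j \<Longrightarrow> cmod (\<psi> t - \<psi> (gp n j)) \<le> e" for n j e
  proof -
    let ?x = "gp n j" and ?X = "fst (step n w j)" and ?Y = "snd (step n w j)"
    define \<tau> where "\<tau> = c ?x * ?X + s ?x * ?Y"
    define \<rho> where "\<rho> = B * d n j + e"
    have x: "?x \<in> {0..\<omega>}" using gp_in j by simp
    have d0: "d n j \<ge> 0" by (simp add: d_def)
    have \<tau>: "cmod (\<psi> t - \<tau>) \<le> \<rho>" if "t \<in> {0<..<\<omega>}" "t \<in> cell n j" for t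
    proof -
      have "\<psi> t - \<tau> = (\<psi> t - \<psi> ?x) - (c ?x * (?X - A1 ?x) + s ?x * (?Y - A2 ?x))"
        by (simp add: \<tau>_def eq[OF x] algebra_simps)
      also have "cmod \<dots> \<le> cmod (\<psi> t - \<psi> ?x) + (cmod (c ?x * (?X - A1 ?x)) + cmod (s ?x * (?Y - A2 ?x)))"
        by (meson add_left_mono norm_triangle_ineq norm_triangle_ineq4 order.trans)
      also have "\<dots> \<le> e + (B * cmod (?X - A1 ?x) + B * cmod (?Y - A2 ?x))"
        unfolding norm_mult using osc[OF that] B(2,3)[OF x] by (intro add_mono mult_right_mono) auto
      finally show ?thesis by (simp add: \<rho>_def d_def algebra_simps)
    qed
    have \<rho>0: "\<rho> \<ge> 0" using B(1) d0 e by (simp add: \<rho>_def)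
    have iA: "integrable M (\<lambda>t. h t * (V t * \<psi> t))" if "continuous_on {0..\<omega>} h" for h
      using integrable_continuous_mult_V[OF continuous_on_mult[OF that \<psi>]] by (simp add: mult_ac)
    have X: "fst (step n w (Suc j)) = ?X + q1 n j * \<tau>" and Y: "snd (step n w (Suc j)) = ?Y + q2 n j * \<tau>"
      by (simp_all add: Let_def split_beta \<tau>_def)
    define I1 where "I1 = (LINT t|M. indicator (cell n j) t * (s t * (V t * \<psi> t))) - (LINT t|M. indicator (cell n j) t * (s t * V t)) * \<tau>"
    define I2 where "I2 = (LINT t|M. indicator (cell n j) t * (c t * (V t * \<psi> t))) - (LINT t|M. indicator (cell n j) t * (c t * V t)) * \<tau>"
    have I: "cmod I1 \<le> B * \<rho> * vv n j" "cmod I2 \<le> B * \<rho> * vv n j"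
      unfolding I1_def I2_def
      by (rule increment[OF continuous_on_free_sin B(3) \<tau> \<rho>0] increment[OF continuous_on_free_cos B(2) \<tau> \<rho>0]; assumption)+
    have E1: "fst (step n w (Suc j)) - A1 (gp n (Suc j)) = (?X - A1 ?x) + I1"
      unfolding X A1 integral_cell[OF iA[OF continuous_on_free_sin] j] q1_def I1_def by (simp add: algebra_simps)
    have E2: "snd (step n w (Suc j)) - A2 (gp n (Suc j)) = (?Y - A2 ?x) - I2"
      unfolding Y A2 integral_cell[OF iA[OF continuous_on_free_cos] j] q2_def I2_def by (simp add: algebra_simps)
    have 1: "cmod (fst (step n w (Suc j)) - A1 (gp n (Suc j))) \<le> cmod (?X - A1 ?x) + B * \<rho> * vv n j"
      unfolding E1 using norm_triangle_ineq[of "?X - A1 ?x" I1] I(1) by linarith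
    have 2: "cmod (snd (step n w (Suc j)) - A2 (gp n (Suc j))) \<le> cmod (?Y - A2 ?x) + B * \<rho> * vv n j"
      unfolding E2 using norm_triangle_ineq4[of "?Y - A2 ?x" I2] I(2) by linarith
    have "d n (Suc j) \<le> d n j + 2 * (B * \<rho> * vv n j)" using 1 2 unfolding d_def by linarith
    then show ?thesis by (simp add: \<rho>_def algebra_simps)
  qed
  define C where "C = exp (2 * B\<^sup>2 * (LINT t|M. cmod (V t))) / B"
  have C: "C > 0" using B by (simp add: C_def)
  have gronwall: "d n (4 ^ n) \<le> C * e"
    if e: "e > 0" and osc: "\<And>j t. j < 4 ^ n \<Longrightarrow> t \<in> {0<..<\<omega>} \<Longrightarrow> t \<in> cell n j \<Longrightarrow> cmod (\<psi> t - \<psi> (gp n j)) \<le> e" for n e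
  proof -
    \<comment> \<open>Adding \<open>e / B\<close> makes the affine recursion homogeneous; its
      factors are then bounded by exponentials, whose exponents sum to at most the integral of |V|
      times 2 B^2.\<close>
    have "d n j + e / B \<le> e / B * exp (2 * B\<^sup>2 * (\<Sum>k<j. vv n k))" if "j \<le> 4 ^ n" for j
      using that
    proof (induction j)
      case 0
      show ?case by (simp add: d_def A1 A2 gp_def)
    next
      case (Suc j)
      have nn: "d n j + e / B \<ge> 0" using e B by (simp add: d_def)
      have "d n (Suc j) + e / B \<le> d n j + 2 * B * (B * d n j + e) * vv n j + e / B"
        using one_step[OF _ e osc] Suc.prems by simp
      also have "\<dots> = (1 + 2 * B\<^sup>2 * vv n j) * (d n j + e / B)"
        using B(1) by (simp add: field_simps power2_eq_square)
      also have "\<dots> \<le> exp (2 * B\<^sup>2 * vv n j) * (d n j + e / B)"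
        by (intro mult_right_mono nn exp_ge_add_one_self)
      also have "\<dots> \<le> exp (2 * B\<^sup>2 * vv n j) * (e / B * exp (2 * B\<^sup>2 * (\<Sum>k<j. vv n k)))"
        using Suc by (intro mult_left_mono) auto
      also have "\<dots> = e / B * exp (2 * B\<^sup>2 * (\<Sum>k<Suc j. vv n k))"
        by (simp add: distrib_left exp_add)
      finally show ?case .
    qed
    from this[of "4 ^ n"] have "d n (4 ^ n) + e / B \<le> e / B * exp (2 * B\<^sup>2 * (\<Sum>k<4 ^ n. vv n k))" by simp
    also have "\<dots> \<le> e / B * exp (2 * B\<^sup>2 * (LINT t|M. cmod (V t)))"
      using e B sum_cell_integral_le[of n] unfolding vv_def by (intro mult_left_mono) auto
    also have "\<dots> = C * e" by (simp add: C_def)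
    finally show ?thesis using divide_pos_pos[OF e B(1)] by linarith
  qed
  have lim: "(\<lambda>n. d n (4 ^ n)) \<longlonglongrightarrow> 0"
  proof (rule LIMSEQ_I)
    fix r :: real assume r: "r > 0"
    define e where "e = r / (2 * C)"
    have e: "e > 0" using r C by (simp add: e_def)
    \<comment> \<open>Uniform continuity makes the oscillation on all cells small as soon as the
      mesh is.\<close>
    have "uniformly_continuous_on {0..\<omega>} \<psi>" by (rule compact_uniformly_continuous[OF \<psi>]) simp
    then obtain \<delta> where \<delta>: "\<delta> > 0" "\<And>x y. x \<in> {0..\<omega>} \<Longrightarrow> y \<in> {0..\<omega>} \<Longrightarrow> dist y x < \<delta> \<Longrightarrow> dist (\<psi> y) (\<psi> x) < e"
      using e unfolding uniformly_continuous_on_def by blast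
    have "(\<lambda>n. \<omega> * (1 / 4) ^ n) \<longlonglongrightarrow> \<omega> * 0" by (intro tendsto_intros LIMSEQ_realpow_zero) auto
    then have "eventually (\<lambda>n. \<omega> * (1 / 4) ^ n < \<delta>) sequentially" using \<delta>(1) by (intro order_tendstoD) auto
    then obtain N where N: "\<And>n. n \<ge> N \<Longrightarrow> \<omega> * (1 / 4) ^ n < \<delta>" by (auto simp: eventually_sequentially)
    show "\<exists>no. \<forall>n\<ge>no. norm (d n (4 ^ n) - 0) < r"
    proof (intro exI[of _ N] allI impI)
      fix n assume n: "n \<ge> N"
      have "d n (4 ^ n) \<le> C * e"
      proof (rule gronwall[OF e])
        fix j t assume j: "j < 4 ^ n" and t: "t \<in> {0<..<\<omega>}" "t \<in> cell n j"
        then have "j = idx n t" by (simp add: cell_iff)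
        then have "\<bar>gp n j - t\<bar> \<le> \<omega> / 4 ^ n" using gp_idx_close[of t n] t by simp
        also have "\<dots> < \<delta>" using N[OF n] by (simp add: power_divide)
        finally have "dist (\<psi> t) (\<psi> (gp n j)) < e"
          using \<delta>(2)[of "gp n j" t] gp_in[of j n] j t by (simp add: dist_real_def abs_minus_commute)
        then show "cmod (\<psi> t - \<psi> (gp n j)) \<le> e" by (simp add: dist_norm)
      qed
      also have "\<dots> < r" using C r by (simp add: e_def)
      finally show "norm (d n (4 ^ n) - 0) < r" by (simp add: d_def)
    qed
  qed
  have gpN: "gp n (4 ^ n) = \<omega>" for n by (simp add: gp_def)
  have "(\<lambda>n. fst (step n w (4 ^ n)) - A1 \<omega>) \<longlonglongrightarrow> 0"
    by (rule Lim_null_comparison[OF _ lim]) (simp add: d_def gpN)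
  then show "(\<lambda>n. fst (step n w (4 ^ n))) \<longlonglongrightarrow> A1 \<omega>" by (rule LIM_zero_cancel)
  have "(\<lambda>n. snd (step n w (4 ^ n)) - A2 \<omega>) \<longlonglongrightarrow> 0"
    by (rule Lim_null_comparison[OF _ lim]) (simp add: d_def gpN)
  then show "(\<lambda>n. snd (step n w (4 ^ n))) \<longlonglongrightarrow> A2 \<omega>" by (rule LIM_zero_cancel)
qed

lemma fredholm_det_K:
  "D * fredholm_det_id_minus M (K \<omega> V \<theta> z) = 1 + mult\<^sup>2 - 2 * mult * floquet_discriminant \<omega> V z"
proof -
  have Vi: "V absolutely_integrable_on {0..\<omega>}" using V by (simp add: integrable_interval_iff)
  obtain f g C1 C2 S1 S2 where cont: "continuous_on {0..\<omega>} f" "continuous_on {0..\<omega>} g"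
    and C1: "\<And>x. C1 x = 1 - integral {0..x} (\<lambda>t. s t * (V t * f t))"
    and C2: "\<And>x. C2 x = integral {0..x} (\<lambda>t. c t * (V t * f t))"
    and S1: "\<And>x. S1 x = - integral {0..x} (\<lambda>t. s t * (V t * g t))"
    and S2: "\<And>x. S2 x = 1 + integral {0..x} (\<lambda>t. c t * (V t * g t))"
    and f: "\<And>x. x \<in> {0..\<omega>} \<Longrightarrow> f x = c x * C1 x + s x * C2 x"
    and g: "\<And>x. x \<in> {0..\<omega>} \<Longrightarrow> g x = c x * S1 x + s x * S2 x"
    and W: "C1 \<omega> * S2 \<omega> - S1 \<omega> * C2 \<omega> = 1"
    and disc: "floquet_discriminant \<omega> V z = (c \<omega> * C1 \<omega> + s \<omega> * C2 \<omega> - z * s \<omega> * S1 \<omega> + c \<omega> * S2 \<omega>) / 2"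
    by (rule floquet_discriminant_eq[OF \<omega> Vi, where z = z]) (rule that; assumption)
  have c_lim: "(\<lambda>n. fst (step n (1, 0) (4 ^ n))) \<longlonglongrightarrow> C1 \<omega>" "(\<lambda>n. snd (step n (1, 0) (4 ^ n))) \<longlonglongrightarrow> C2 \<omega>"
    by (rule step_tendsto[OF cont(1) _ _ f]; simp add: C1 C2)+
  have s_lim: "(\<lambda>n. fst (step n (0, 1) (4 ^ n))) \<longlonglongrightarrow> S1 \<omega>" "(\<lambda>n. snd (step n (0, 1) (4 ^ n))) \<longlonglongrightarrow> S2 \<omega>"
    by (rule step_tendsto[OF cont(2) _ _ g]; simp add: S1 S2)+
  have "(\<lambda>n. \<Sum>U\<in>Pow {..<4 ^ n}. (-1) ^ card U * perm_sum (gmat n) U) \<longlonglongrightarrow>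
      (1 + (\<Gamma>1 * (C1 \<omega> - 1) - \<Gamma>2 * C2 \<omega>)) * (1 + (z * \<Gamma>2 * S1 \<omega> + \<Gamma>1 * (S2 \<omega> - 1)))
      - (\<Gamma>1 * S1 \<omega> - \<Gamma>2 * (S2 \<omega> - 1)) * (z * \<Gamma>2 * (C1 \<omega> - 1) + \<Gamma>1 * C2 \<omega>)"
    unfolding grid_det by (intro tendsto_intros c_lim s_lim)
  then have "fredholm_det_id_minus M (K \<omega> V \<theta> z)
      = (1 + (\<Gamma>1 * (C1 \<omega> - 1) - \<Gamma>2 * C2 \<omega>)) * (1 + (z * \<Gamma>2 * S1 \<omega> + \<Gamma>1 * (S2 \<omega> - 1)))
      - (\<Gamma>1 * S1 \<omega> - \<Gamma>2 * (S2 \<omega> - 1)) * (z * \<Gamma>2 * (C1 \<omega> - 1) + \<Gamma>1 * C2 \<omega>)"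
    by (rule LIMSEQ_unique[OF fredholm_det_limit])
  then show ?thesis by (simp only: grid_det_limit_value[OF W] disc) simp
qed

end

theorem theorem4p9:
  fixes \<omega> \<theta> :: real and V :: "real \<Rightarrow> complex" and z :: complex
  assumes "\<omega> > 0"
    and "integrable (lebesgue_on {0<..<\<omega>}) V"
    and "0 \<le> \<theta>" and "\<theta> < 2 * pi"
    and "z \<notin> spectrum (lebesgue_on {0<..<\<omega>}) (H0 \<omega> \<theta>)"
  shows "trace_class (lebesgue_on {0<..<\<omega>}) (K \<omega> V \<theta> z) \<and>
    fredholm_det_id_minus (lebesgue_on {0<..<\<omega>}) (K \<omega> V \<theta> z) =
      (floquet_discriminant \<omega> V z - of_real (cos \<theta>)) /
      (cos (csqrt z * of_real \<omega>) - of_real (cos \<theta>))"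
proof -
  interpret floquet_problem \<omega> \<theta> V z by unfold_locales (use assms in auto)
  define m where "m = exp (- (\<i> * complex_of_real \<theta>))"
  have m: "mult * m = 1" unfolding mult_def m_def by (simp flip: exp_add)
  have "complex_of_real (cos \<theta>) = (mult + m) / 2"
    unfolding mult_def m_def cos_of_real[symmetric] cos_exp_eq ..
  \<comment> \<open>The cosine is the mean of \<open>mult\<close> and its inverse, so 1 + mult^2 = 2
    mult cos \<theta>.\<close>
  then have "2 * mult * of_real (cos \<theta>) = mult * mult + mult * m" by (simp add: algebra_simps)
  then have cos: "1 + mult\<^sup>2 = 2 * mult * of_real (cos \<theta>)" by (simp add: m power2_eq_square)
  have c: "c \<omega> = cos (csqrt z * of_real \<omega>)" by (simp add: free_cos_def)
  \<comment> \<open>Thus the denominator of the formula is \<open>D\<close> up to the nonzero factor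
    -2 \<open>mult\<close>, and it cannot vanish.\<close>
  have D: "D = - 2 * mult * (cos (csqrt z * of_real \<omega>) - of_real (cos \<theta>))"
    using cos unfolding D_def c by (simp add: algebra_simps)
  have "D * fredholm_det_id_minus M (K \<omega> V \<theta> z) = - 2 * mult * (floquet_discriminant \<omega> V z - of_real (cos \<theta>))"
    unfolding fredholm_det_K cos by (simp add: algebra_simps)
  then have "(cos (csqrt z * of_real \<omega>) - of_real (cos \<theta>)) * fredholm_det_id_minus M (K \<omega> V \<theta> z)
      = floquet_discriminant \<omega> V z - of_real (cos \<theta>)"
    unfolding D using mult_nz by simp
  moreover have "cos (csqrt z * of_real \<omega>) - of_real (cos \<theta>) \<noteq> 0" using D_nz unfolding D by auto
  ultimately show ?thesis using trace_class_K by (simp add: field_simps)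
qed

end
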